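(* Fix $n\ge4$ and let $m$ range over square-free integers with $X^n-m$ irreducible over $\mathbb{Q}$. Then the set of monogenic fields $K_m$ differs from the set of $\alpha$-monogenic fields $K_m$ by a density-zero subset of parameters $m$. Equivalently, monogenicity and $\alpha$-monogenicity have the same two-sided natural density in the pure family $\{K_m\}$.
   Context: For a square-free integer $m$ with $X^n-m$ irreducible over $\mathbb{Q}$, let $\alpha$ be a root of $X^n-m$, let $K_m=\mathbb{Q}(\alpha)$ (the pure family is the family of these fields, indexed by $m$), and let $\mathcal{O}_{K_m}$ be its ring of integers. $K_m$ is monogenic if $\mathcal{O}_{K_m}=\mathbb{Z}[\theta]$ for some $\theta\in\mathcal{O}_{K_m}$, and $\alpha$-monogenic if $[\mathcal{O}_{K_m}:\mathbb{Z}[\alpha]]=1$, i.e. $\mathcal{O}_{K_m}=\mathbb{Z}[\alpha]$. Density of a set of parameters means two-sided natural density: for $A\subseteq\mathbb{Z}$, $\delta(A)=\lim_{X\to\infty}\#\{m\in A:|m|\le X\}/(2X)$, if the limit exists. *)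

theory Defs
  imports Complex_Main "HOL-Computational_Algebra.Computational_Algebra" "HOL.Hull"
begin

definition pure_poly :: "nat \<Rightarrow> int \<Rightarrow> 'a :: comm_ring_1 poly" where
  "pure_poly n m = monom 1 n - [:of_int m:]"

definition pure_params :: "nat \<Rightarrow> int set" where
  "pure_params n = {m. squarefree m \<and> irreducible (pure_poly n m :: rat poly)}"

definition is_subfield :: "complex set \<Rightarrow> bool" where
  "is_subfield K \<longleftrightarrow> 0 \<in> K \<and> 1 \<in> K \<and>
     (\<forall>x\<in>K. \<forall>y\<in>K. x + y \<in> K \<and> x * y \<in> K) \<and>
     (\<forall>x\<in>K. - x \<in> K \<and> inverse x \<in> K)"

text \<open>Every subfield of the complex numbers contains the rationals, so the subfield generated
  by \<open>\<alpha>\<close> is \<open>\<rat>(\<alpha>)\<close>.\<close>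

definition rat_adjoin :: "complex \<Rightarrow> complex set" where
  "rat_adjoin \<alpha> = is_subfield hull {\<alpha>}"

definition int_adjoin :: "complex \<Rightarrow> complex set" where
  "int_adjoin \<theta> = range (\<lambda>p :: int poly. poly (map_poly of_int p) \<theta>)"

definition ring_of_integers :: "complex set \<Rightarrow> complex set" where
  "ring_of_integers K = {x \<in> K. algebraic_int x}"

definition monogenic :: "complex set \<Rightarrow> bool" where
  "monogenic K \<longleftrightarrow> (\<exists>\<theta>\<in>ring_of_integers K. ring_of_integers K = int_adjoin \<theta>)"

text \<open>The index \<open>[\<O>\<^sub>K : \<int>[\<alpha>]]\<close> for \<open>K = \<rat>(\<alpha>)\<close> is 1 iff the two rings coincide.\<close>

definition alpha_monogenic :: "complex \<Rightarrow> bool" where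
  "alpha_monogenic \<alpha> \<longleftrightarrow> ring_of_integers (rat_adjoin \<alpha>) = int_adjoin \<alpha>"

text \<open>Two-sided natural density; the relation includes the existence of the limit.\<close>

definition has_density :: "int set \<Rightarrow> real \<Rightarrow> bool" where
  "has_density A d \<longleftrightarrow>
     ((\<lambda>X :: real. real (card {m \<in> A. \<bar>real_of_int m\<bar> \<le> X}) / (2 * X)) \<longlongrightarrow> d) at_top"

end

theory Submission
  imports Defs "Jordan_Normal_Form.Char_Poly" "HOL-Number_Theory.Number_Theory"
    "HOL-Computational_Algebra.Field_as_Ring" "HOL-Analysis.Analysis"
begin

text \<open>Let \<open>a\<close> be a root of \<open>X\<^sup>n - m\<close> with conjugates \<open>a\<^sub>i = a\<zeta>\<^sup>i\<close>, and let \<open>\<theta> = b(a)\<close> generate the ring of integers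
  of \<open>\<rat>(a)\<close>, so that \<open>a = c(\<theta>)\<close> with an integral polynomial \<open>c\<close>. For a set \<open>D\<close> of differences of exponents that is
  stable under the units modulo \<open>n\<close>, let \<open>J(D)\<close> be the product of the quotients \<open>(a\<^sub>i - a\<^sub>j) / (\<theta>\<^sub>i - \<theta>\<^sub>j)\<close>
  over the pairs \<open>i < j\<close> with \<open>j - i\<close> in \<open>D\<close>. These quotients are integral because \<open>a = c(\<theta>)\<close>, and the product is
  rational by symmetry, so \<open>J(D)\<close> is an integer. For the set of all differences it is, up to sign, the index of
  \<open>\<int>[a]\<close>, so the field is \<open>\<alpha>\<close>-monogenic if it is \<open>\<plusminus>1\<close> (\<open>integral_coeffs_if_unit\<close>).

  Two facts restrict the integers \<open>J(D)\<close>. By a comparison of discriminants, and because \<open>J(D)\<close> is prime to \<open>m\<close>, its square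
  divides the \<open>n\<close>-th power of \<open>\<Prod>\<^sub>d (1 - \<zeta>\<^sup>d)\<close> (\<open>J_squared_dvd\<close>), which bounds it independently of \<open>m\<close>. Modulo \<open>a\<close> all the quotients
  are congruent to one and the same number, so that \<open>J(D) \<equiv> x\<^sup>N\<close> modulo \<open>m\<close>, where \<open>N\<close> is the number of pairs
  (\<open>J_congruence\<close>). Hence different \<open>J(D)\<close> have powers that are congruent modulo \<open>m\<close>, and for large \<open>m\<close> they are equal.
  If \<open>n\<close> is not a prime power, two coprime parts of \<open>n\<close> give coprime integers with a common power, and the index is \<open>\<plusminus>1\<close>.
  If \<open>n = q\<^sup>k\<close> and the index is not \<open>\<plusminus>1\<close>, the differences of order \<open>q\<close> give \<open>\<plusminus>q\<^sup>e\<close> with \<open>0 < e \<le> q/2\<close>, and the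
  congruence shows that \<open>q\<close> or \<open>-q\<close> is a \<open>q\<close>-th power modulo every prime divisor of \<open>m\<close>
  (\<open>monogenic_not_alpha_monogenic\<close>).

  The numbers with this last property have density zero, by the following substitute for the density theorem of Chebotarev. The
  pairs of a square-free \<open>k \<le> X\<close> and a residue \<open>x\<close> modulo \<open>k\<close> with \<open>x\<^sup>q \<equiv> c\<close> number \<open>O(X)\<close>: by the pigeonhole
  principle such a pair comes with a polynomial that has small coefficients and the root \<open>x\<close> modulo \<open>k\<close>, and its norm
  from \<open>\<rat>(c\<^sup>1\<^sup>/\<^sup>q)\<close> is a bounded multiple of \<open>k\<close> (\<open>card_root_pairs_bound\<close>). A number \<open>k\<close> modulo all of whose prime divisors \<open>c\<close> is a
  \<open>q\<close>-th power, and which has \<open>K\<close> prime divisors congruent to 1 modulo \<open>q\<close>, has at least \<open>2\<^sup>K\<close> such residues. So there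
  are only \<open>O(X / 2\<^sup>K)\<close> such \<open>k\<close>, whereas almost all integers have \<open>K\<close> prime divisors congruent to 1 modulo \<open>q\<close>,
  because by Dirichlet the sum of the reciprocals of these primes diverges (\<open>primes_cong_1_reciprocals_diverge\<close>).

  The density exists for the following reason. If the field is not \<open>\<alpha>\<close>-monogenic, then \<open>g(a)/p\<close> is integral for a prime \<open>p\<close>
  dividing \<open>n\<close> and an integral polynomial \<open>g\<close> that \<open>p\<close> does not divide, and whether \<open>g(a)/p\<close> is integral depends only
  on \<open>m\<close> modulo \<open>p\<^sup>n\<close>. Up to finitely many exceptions, the parameters of \<open>\<alpha>\<close>-monogenic fields are
  therefore the square-free numbers in a union of residue classes modulo \<open>n\<^sup>n\<close>, and these have a density.\<close>

hide_const (open) Finite_Cartesian_Product.mat Finite_Cartesian_Product.vec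
  UnivPoly.up_ring.coeff UnivPoly.up_ring.monom Module.module.smult

lemmas cong_iff_mod = unique_euclidean_semiring_class.cong_def

section \<open>Sums and products of algebraic integers\<close>

text \<open>The eigenvalue is a root of the characteristic polynomial, which is monic and integral.\<close>

lemma algebraic_int_eigenvalue:
  fixes M :: "int mat" and z :: complex
  assumes M: "M \<in> carrier_mat N N" and v: "v \<in> carrier_vec N" "v \<noteq> 0\<^sub>v N"
    and eig: "map_mat of_int M *\<^sub>v v = z \<cdot>\<^sub>v v"
  shows "algebraic_int z"
proof -
  have A: "(map_mat of_int M :: complex mat) \<in> carrier_mat N N" using M by simp
  have "eigenvector (map_mat of_int M) v z" unfolding eigenvector_def using A v eig by auto
  hence "eigenvalue (map_mat of_int M) z" unfolding eigenvalue_def by blast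
  hence "poly (char_poly (map_mat of_int M)) z = 0"
    using eigenvalue_root_char_poly[OF A] by simp
  hence r: "poly (map_poly of_int (char_poly M)) z = 0"
    using of_int_hom.char_poly_hom[OF M, where 'a=complex] by simp
  have "lead_coeff (char_poly M) = 1" using degree_monic_char_poly[OF M] by simp
  thus ?thesis using r algebraic_int_altdef_ipoly by blast
qed

definition int_span :: "complex set \<Rightarrow> complex set" where
  "int_span V = {y. \<exists>c::complex \<Rightarrow> int. y = (\<Sum>l\<in>V. of_int (c l) * l)}"

lemma int_span_add: "x \<in> int_span V \<Longrightarrow> y \<in> int_span V \<Longrightarrow> x + y \<in> int_span V"
proof -
  assume "x \<in> int_span V" "y \<in> int_span V"
  then obtain c d :: "complex \<Rightarrow> int" where "x = (\<Sum>l\<in>V. of_int (c l) * l)" "y = (\<Sum>l\<in>V. of_int (d l) * l)"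
    unfolding int_span_def by blast
  hence "x + y = (\<Sum>l\<in>V. of_int (c l + d l) * l)"
    by (simp add: sum.distrib algebra_simps)
  thus ?thesis unfolding int_span_def by (intro CollectI exI[of _ "\<lambda>l. c l + d l"]) simp
qed

lemma int_span_scale: "x \<in> int_span V \<Longrightarrow> of_int k * x \<in> int_span V"
proof -
  assume "x \<in> int_span V"
  then obtain c :: "complex \<Rightarrow> int" where "x = (\<Sum>l\<in>V. of_int (c l) * l)"
    unfolding int_span_def by blast
  hence "of_int k * x = (\<Sum>l\<in>V. of_int (k * c l) * l)"
    by (simp add: sum_distrib_left algebra_simps)
  thus ?thesis unfolding int_span_def by (intro CollectI exI[of _ "\<lambda>l. k * c l"]) simp
qed

lemma int_span_0: "0 \<in> int_span V"
  unfolding int_span_def by (intro CollectI exI[of _ "\<lambda>l. 0"]) simp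

lemma int_span_sum: "(\<And>i. i \<in> I \<Longrightarrow> f i \<in> int_span V) \<Longrightarrow> sum f I \<in> int_span V"
  by (induction I rule: infinite_finite_induct) (auto intro: int_span_add int_span_0)

lemma int_span_base: "finite V \<Longrightarrow> v \<in> V \<Longrightarrow> v \<in> int_span V"
proof -
  assume V: "finite V" "v \<in> V"
  have "(\<Sum>l\<in>V. of_int (if l = v then 1 else 0) * l) = (\<Sum>l\<in>V. if l = v then l else 0)"
    by (intro sum.cong) auto
  also have "\<dots> = v" using V by simp
  finally show ?thesis unfolding int_span_def
    by (intro CollectI exI[of _ "\<lambda>l. if l = v then 1 else 0"]) simp
qed

text \<open>The coordinates of the products \<open>z * v\<close> form an integer matrix that has the vector of the elements
  of \<open>V\<close> as an eigenvector. The elements need not be independent; the element \<open>v0\<close> makes the vector nonzero.\<close>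

lemma algebraic_int_if_stable_span:
  assumes V: "finite V" "v0 \<in> V" "v0 \<noteq> 0"
    and st: "\<And>v. v \<in> V \<Longrightarrow> z * v \<in> int_span V"
  shows "algebraic_int z"
proof -
  define N where "N = card V"
  obtain e where e: "bij_betw e {0..<N} V"
    using ex_bij_betw_nat_finite[OF V(1)] N_def by blast
  have "\<forall>v. \<exists>c::complex \<Rightarrow> int. v \<in> V \<longrightarrow> z * v = (\<Sum>l\<in>V. of_int (c l) * l)"
    using st unfolding int_span_def by blast
  then obtain c :: "complex \<Rightarrow> complex \<Rightarrow> int"
    where c: "\<And>v. v \<in> V \<Longrightarrow> z * v = (\<Sum>l\<in>V. of_int (c v l) * l)" by metis
  define M where "M = mat N N (\<lambda>(i,j). c (e i) (e j))"
  define w where "w = vec N e"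
  have eV: "e i \<in> V" if "i < N" for i using e that by (auto simp: bij_betw_def)
  show ?thesis
  proof (rule algebraic_int_eigenvalue[of M N w z])
    show "M \<in> carrier_mat N N" by (simp add: M_def)
    show "w \<in> carrier_vec N" by (simp add: w_def)
    obtain i where i: "i < N" "e i = v0" using e V(2) by (auto simp: bij_betw_def image_iff)
    show "w \<noteq> 0\<^sub>v N"
    proof
      assume "w = 0\<^sub>v N"
      hence "vec_index w i = 0" using i by simp
      thus False using i V(3) by (simp add: w_def)
    qed
    show "map_mat of_int M *\<^sub>v w = z \<cdot>\<^sub>v w"
    proof (rule eq_vecI)
      fix i assume "i < dim_vec (z \<cdot>\<^sub>v w)"
      hence i: "i < N" by (simp add: w_def)
      have "vec_index (map_mat of_int M *\<^sub>v w) i = (\<Sum>j\<in>{0..<N}. of_int (c (e i) (e j)) * e j)"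
        using i by (simp add: M_def w_def scalar_prod_def)
      also have "\<dots> = (\<Sum>l\<in>V. of_int (c (e i) l) * l)"
        by (rule sum.reindex_bij_betw[OF e])
      also have "\<dots> = z * e i" using c[OF eV[OF i]] by simp
      finally show "vec_index (map_mat of_int M *\<^sub>v w) i = vec_index (z \<cdot>\<^sub>v w) i"
        using i by (simp add: w_def)
    qed (simp add: M_def w_def)
  qed
qed

lemma int_span_mult_stable:
  assumes st: "\<And>v. v \<in> V \<Longrightarrow> z * v \<in> int_span V" and y: "y \<in> int_span V"
  shows "z * y \<in> int_span V"
proof -
  obtain c :: "complex \<Rightarrow> int" where "y = (\<Sum>l\<in>V. of_int (c l) * l)"
    using y unfolding int_span_def by blast
  hence "z * y = (\<Sum>l\<in>V. of_int (c l) * (z * l))" by (simp add: sum_distrib_left algebra_simps)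
  also have "\<dots> \<in> int_span V" by (intro int_span_sum int_span_scale st)
  finally show ?thesis .
qed

lemma algebraic_int_power_reduce:
  assumes "algebraic_int (x::complex)"
  obtains m c where "m > 0" "x ^ m = (\<Sum>k<m. of_int (c k :: int) * x ^ k)"
proof -
  obtain p where p: "poly (map_poly of_int p) x = 0" "lead_coeff p = 1"
    using assms algebraic_int_altdef_ipoly by blast
  have deg: "degree (map_poly of_int p :: complex poly) = degree p" by (rule degree_map_poly) auto
  have "(\<Sum>k\<le>degree p. of_int (coeff p k) * x ^ k) = 0"
    using p(1) by (simp add: poly_altdef deg coeff_map_poly)
  hence eq: "(\<Sum>k<degree p. of_int (coeff p k) * x ^ k) + x ^ degree p = 0"
    using p(2) by (simp add: lessThan_Suc_atMost[symmetric])
  have "degree p > 0"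
  proof (rule ccontr)
    assume "\<not> degree p > 0"
    thus False using eq by simp
  qed
  moreover have "x ^ degree p = (\<Sum>k<degree p. of_int (- coeff p k) * x ^ k)"
    using eq by (simp only: of_int_minus mult_minus_left sum_negf add_eq_0_iff)
  ultimately show ?thesis by (rule that)
qed

text \<open>Both \<open>x\<close> and \<open>y\<close> map the group spanned by the products of their small powers into itself, so \<open>x + y\<close> and
  \<open>x * y\<close> do so as well.\<close>

lemma algebraic_int_add_mult:
  assumes x: "algebraic_int (x::complex)" and y: "algebraic_int y"
  shows "algebraic_int (x + y)" "algebraic_int (x * y)"
proof -
  obtain m c where m: "m > 0" "x ^ m = (\<Sum>k<m. of_int (c k :: int) * x ^ k)"
    using algebraic_int_power_reduce[OF x] .
  obtain n d where n: "n > 0" "y ^ n = (\<Sum>k<n. of_int (d k :: int) * y ^ k)"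
    using algebraic_int_power_reduce[OF y] .
  define V where "V = (\<lambda>(i,j). x ^ i * y ^ j) ` ({..<m} \<times> {..<n})"
  have fin: "finite V" by (simp add: V_def)
  have mem: "x ^ i * y ^ j \<in> V" if "i < m" "j < n" for i j unfolding V_def using that by force
  have one: "1 \<in> V" using mem[of 0 0] m n by simp
  have X: "x * v \<in> int_span V" if v: "v \<in> V" for v
  proof -
    obtain i j where ij: "i < m" "j < n" "v = x ^ i * y ^ j" using v unfolding V_def by auto
    show ?thesis
    proof (cases "Suc i < m")
      case True
      thus ?thesis using mem[OF True ij(2)] int_span_base[OF fin] ij(3) by (simp add: mult.assoc)
    next
      case False
      hence "x * x ^ i = x ^ m" using ij(1) by (metis Suc_lessI power_Suc)
      hence "x * v = (\<Sum>k<m. of_int (c k) * (x ^ k * y ^ j))"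
        by (simp add: ij(3) mult.assoc[symmetric] m(2) sum_distrib_right)
      also have "\<dots> \<in> int_span V"
        by (intro int_span_sum int_span_scale int_span_base fin mem ij(2)) auto
      finally show ?thesis .
    qed
  qed
  have Y: "y * v \<in> int_span V" if v: "v \<in> V" for v
  proof -
    obtain i j where ij: "i < m" "j < n" "v = x ^ i * y ^ j" using v unfolding V_def by auto
    show ?thesis
    proof (cases "Suc j < n")
      case True
      thus ?thesis using mem[OF ij(1) True] int_span_base[OF fin] ij(3) by (simp add: mult_ac)
    next
      case False
      hence "y * y ^ j = y ^ n" using ij(2) by (metis Suc_lessI power_Suc)
      hence "y * v = x ^ i * y ^ n" by (simp add: ij(3) mult_ac)
      also have "\<dots> = (\<Sum>k<n. of_int (d k) * (x ^ i * y ^ k))"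
        by (simp add: n(2) sum_distrib_left mult_ac)
      also have "\<dots> \<in> int_span V"
        by (intro int_span_sum int_span_scale int_span_base fin mem ij(1)) auto
      finally show ?thesis .
    qed
  qed
  have s: "(x + y) * v \<in> int_span V" if "v \<in> V" for v
    using int_span_add[OF X[OF that] Y[OF that]] by (simp add: distrib_right)
  show "algebraic_int (x + y)"
    by (rule algebraic_int_if_stable_span[OF fin one _ s]) simp
  have t: "(x * y) * v \<in> int_span V" if "v \<in> V" for v
    using int_span_mult_stable[OF X Y[OF that]] by (simp add: mult.assoc)
  show "algebraic_int (x * y)"
    by (rule algebraic_int_if_stable_span[OF fin one _ t]) simp
qed

lemmas algebraic_int_add = algebraic_int_add_mult(1)
  and algebraic_int_mult = algebraic_int_add_mult(2)

lemma algebraic_int_diff: "algebraic_int (x::complex) \<Longrightarrow> algebraic_int y \<Longrightarrow> algebraic_int (x - y)"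
  using algebraic_int_add[of x "- y"] by (simp only: algebraic_int_minus_iff diff_conv_add_uminus)

lemma algebraic_int_power: "algebraic_int (x::complex) \<Longrightarrow> algebraic_int (x ^ k)"
  by (induction k) (simp_all add: algebraic_int_mult)

lemma algebraic_int_sum: "(\<And>i. i \<in> I \<Longrightarrow> algebraic_int (f i :: complex)) \<Longrightarrow> algebraic_int (sum f I)"
  by (induction I rule: infinite_finite_induct) (simp_all add: algebraic_int_add)

lemma algebraic_int_prod: "(\<And>i. i \<in> I \<Longrightarrow> algebraic_int (f i :: complex)) \<Longrightarrow> algebraic_int (prod f I)"
  by (induction I rule: infinite_finite_induct) (simp_all add: algebraic_int_mult)

lemma algebraic_int_poly:
  "(\<And>k. algebraic_int (coeff p k)) \<Longrightarrow> algebraic_int (x::complex) \<Longrightarrow> algebraic_int (poly p x)"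
  unfolding poly_altdef by (simp add: algebraic_int_sum algebraic_int_mult algebraic_int_power)

section \<open>Roots of unity and rational values\<close>

definition primitive_root_of_unity :: "nat \<Rightarrow> complex \<Rightarrow> bool" where
  "primitive_root_of_unity n z \<longleftrightarrow> (\<forall>k. z ^ k = 1 \<longleftrightarrow> n dvd k)"

lemma primitive_root_of_unity_exists:
  assumes "n > 0"
  shows "primitive_root_of_unity n (exp (2 * of_real pi * \<i> / of_nat n))"
  unfolding primitive_root_of_unity_def
proof
  fix k
  have "exp (2 * of_real pi * \<i> / of_nat n) ^ k = exp (2 * of_real pi * \<i> * of_nat k / of_nat n)"
    by (simp add: exp_of_nat_mult[symmetric] mult_ac)
  thus "(exp (2 * of_real pi * \<i> / of_nat n) ^ k = 1) = (n dvd k)"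
    using complex_root_unity_eq_1[of n k] assms by simp
qed

lemma primitive_root_of_unity_eq_iff:
  assumes "primitive_root_of_unity n z" "n > 0"
  shows "z ^ i = z ^ j \<longleftrightarrow> i mod n = j mod n"
proof -
  have z: "z \<noteq> 0" using assms unfolding primitive_root_of_unity_def
    by (metis dvd_refl power_0_left zero_neq_one not_gr_zero)
  have *: "z ^ i = z ^ j \<longleftrightarrow> i mod n = j mod n" if "i \<le> j" for i j
  proof -
    have "z ^ j = z ^ i * z ^ (j - i)" using that by (simp add: power_add[symmetric])
    hence "z ^ i = z ^ j \<longleftrightarrow> z ^ (j - i) = 1" using z by auto
    also have "\<dots> \<longleftrightarrow> n dvd (j - i)" using assms unfolding primitive_root_of_unity_def by blast
    also have "\<dots> \<longleftrightarrow> i mod n = j mod n" using that by (metis mod_eq_dvd_iff_nat)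
    finally show ?thesis .
  qed
  show ?thesis using *[of i j] *[of j i] by (cases "i \<le> j") auto
qed

lemma sum_powers_root_of_unity:
  assumes "(z::complex) ^ n = 1"
  shows "(\<Sum>s<n. z ^ s) = (if z = 1 then of_nat n else 0)"
  using assms by (simp add: sum_gp_strict)

text \<open>Ramanujan sums. Sorting all exponents by their greatest common divisor with \<open>n\<close> expresses the
  full geometric sum through sums of the same kind for the divisors of \<open>n\<close>.\<close>

lemma sum_totatives_root_of_unity_rational:
  assumes "n > 0" "(z::complex) ^ n = 1"
  shows "(\<Sum>t\<in>totatives n. z ^ t) \<in> \<rat>"
  using assms
proof (induction n arbitrary: z rule: less_induct)
  case (less n)
  define A where "A = (\<lambda>d. {k\<in>{0<..n}. gcd k n = d})"
  have A: "(\<Sum>k\<in>A d. z ^ k) = (\<Sum>t\<in>totatives (n div d). (z ^ d) ^ t)" if "d dvd n" for d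
    unfolding A_def
    by (subst sum.reindex_bij_betw[OF bij_betw_totatives_gcd_eq[OF that less.prems(1)], symmetric])
      (simp add: power_mult[symmetric] mult.commute)
  have fin: "finite {d. d dvd n}" using less.prems(1) by simp
  have "(\<Sum>k\<in>{0<..n}. z ^ k) = (\<Sum>k\<in>(\<Union>d\<in>{d. d dvd n}. A d). z ^ k)"
    by (intro sum.cong) (auto simp: A_def)
  also have "\<dots> = (\<Sum>d | d dvd n. \<Sum>k\<in>A d. z ^ k)"
    using fin by (intro sum.UNION_disjoint) (auto simp: A_def)
  also have "\<dots> = (\<Sum>d | d dvd n. \<Sum>t\<in>totatives (n div d). (z ^ d) ^ t)"
    by (intro sum.cong refl A) auto
  also have "\<dots> = (\<Sum>t\<in>totatives n. z ^ t) + (\<Sum>d\<in>{d. d dvd n} - {1}. \<Sum>t\<in>totatives (n div d). (z ^ d) ^ t)"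
    using fin by (subst sum.remove[of _ 1]) auto
  finally have eq: "(\<Sum>t\<in>totatives n. z ^ t) = (\<Sum>k\<in>{0<..n}. z ^ k)
     - (\<Sum>d\<in>{d. d dvd n} - {1}. \<Sum>t\<in>totatives (n div d). (z ^ d) ^ t)" by simp
  have "(\<Sum>k\<in>{0<..n}. z ^ k) = (\<Sum>k<n. z ^ Suc k)"
    by (rule sum.reindex_bij_witness[of _ Suc "\<lambda>k. k - 1"]) auto
  also have "\<dots> = z * (\<Sum>k<n. z ^ k)" by (simp add: sum_distrib_left)
  also have "\<dots> \<in> \<rat>" using sum_powers_root_of_unity[OF less.prems(2)] by simp
  finally have r1: "(\<Sum>k\<in>{0<..n}. z ^ k) \<in> \<rat>" .
  have "(\<Sum>t\<in>totatives (n div d). (z ^ d) ^ t) \<in> \<rat>" if "d dvd n" "d \<noteq> 1" for d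
  proof (rule less.IH)
    have d0: "d > 0" using that less.prems(1) by (metis dvd_0_left_iff gr0I)
    show "n div d < n" using that d0 less.prems(1) by (intro div_less_dividend) auto
    show "n div d > 0" using that less.prems(1) by (metis dvd_div_eq_0_iff gr0I less_numeral_extra(3))
    show "(z ^ d) ^ (n div d) = 1" using that less.prems(2) by (simp add: power_mult[symmetric])
  qed
  hence "(\<Sum>d\<in>{d. d dvd n} - {1}. \<Sum>t\<in>totatives (n div d). (z ^ d) ^ t) \<in> \<rat>"
    by (intro Rats_sum[of "{d. d dvd n} - {1}"]) auto
  with r1 eq show ?case by simp
qed

text \<open>The polynomial functions with rational coefficients. They are kept as functions, not as polynomials in
  two variables, because only their values and closure under sums and products matter.\<close>

inductive rat_poly_fun :: "(complex \<Rightarrow> complex \<Rightarrow> complex) \<Rightarrow> bool" where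
  monom: "q \<in> \<rat> \<Longrightarrow> rat_poly_fun (\<lambda>x z. q * x ^ i * z ^ j)"
| add: "rat_poly_fun f \<Longrightarrow> rat_poly_fun g \<Longrightarrow> rat_poly_fun (\<lambda>x z. f x z + g x z)"

lemma rat_poly_fun_const: "q \<in> \<rat> \<Longrightarrow> rat_poly_fun (\<lambda>x z. q)"
  using rat_poly_fun.monom[of q 0 0] by simp

lemma rat_poly_fun_var: "rat_poly_fun (\<lambda>x z. x * z ^ j)"
  using rat_poly_fun.monom[of 1 1 j] by simp

lemma rat_poly_fun_mult_monom:
  "rat_poly_fun f \<Longrightarrow> q \<in> \<rat> \<Longrightarrow> rat_poly_fun (\<lambda>x z. q * x ^ i * z ^ j * f x z)"
proof (induction rule: rat_poly_fun.induct)
  case (monom r k l)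
  have "(\<lambda>x z. q * x ^ i * z ^ j * (r * x ^ k * z ^ l)) = (\<lambda>x z. (q * r) * x ^ (i + k) * z ^ (j + l))"
    by (intro ext) (simp add: power_add mult_ac)
  thus ?case using rat_poly_fun.monom[of "q * r" "i + k" "j + l"] monom by simp
next
  case (add f g)
  thus ?case using rat_poly_fun.add[OF add.IH] by (simp add: distrib_left)
qed

lemma rat_poly_fun_mult: "rat_poly_fun f \<Longrightarrow> rat_poly_fun g \<Longrightarrow> rat_poly_fun (\<lambda>x z. f x z * g x z)"
proof (induction rule: rat_poly_fun.induct)
  case (monom q i j)
  thus ?case by (intro rat_poly_fun_mult_monom)
next
  case (add f h)
  thus ?case using rat_poly_fun.add[of "\<lambda>x z. f x z * g x z" "\<lambda>x z. h x z * g x z"]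
    by (simp add: distrib_right)
qed

lemma rat_poly_fun_sum: "(\<And>i. i \<in> I \<Longrightarrow> rat_poly_fun (f i)) \<Longrightarrow> rat_poly_fun (\<lambda>x z. \<Sum>i\<in>I. f i x z)"
  by (induction I rule: infinite_finite_induct) (auto intro: rat_poly_fun.add rat_poly_fun_const)

lemma rat_poly_fun_prod: "(\<And>i. i \<in> I \<Longrightarrow> rat_poly_fun (f i)) \<Longrightarrow> rat_poly_fun (\<lambda>x z. \<Prod>i\<in>I. f i x z)"
  by (induction I rule: infinite_finite_induct) (auto intro: rat_poly_fun_mult rat_poly_fun_const)

lemma rat_poly_fun_power: "rat_poly_fun f \<Longrightarrow> rat_poly_fun (\<lambda>x z. f x z ^ k)"
  by (induction k) (auto intro: rat_poly_fun_mult rat_poly_fun_const)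

lemma rat_poly_fun_poly:
  "rat_poly_fun f \<Longrightarrow> rat_poly_fun (\<lambda>x z. poly (map_poly of_rat p) (f x z))"
  unfolding poly_altdef
  by (intro rat_poly_fun_sum rat_poly_fun_mult rat_poly_fun_power rat_poly_fun_const) auto

text \<open>Averaging such a function over all substitutions \<open>a \<mapsto> a\<zeta>\<^sup>s\<close>, \<open>\<zeta> \<mapsto> \<zeta>\<^sup>t\<close> gives a rational
  number: the average over \<open>s\<close> removes all powers of \<open>a\<close> that are not powers of \<open>a\<^sup>n\<close>, and the
  sums over \<open>t\<close> are Ramanujan sums. A value that these substitutions do not change equals its
  average. This replaces Galois theory for the splitting field of \<open>X\<^sup>n - a\<^sup>n\<close>.\<close>

lemma rational_if_invariant:
  fixes a \<zeta> :: complex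
  assumes n: "n > 0" and \<zeta>: "primitive_root_of_unity n \<zeta>" and a: "a ^ n \<in> \<rat>" and f: "rat_poly_fun f"
    and inv: "\<And>s t. coprime t n \<Longrightarrow> f (a * \<zeta> ^ s) (\<zeta> ^ t) = f a \<zeta>"
  shows "f a \<zeta> \<in> \<rat>"
proof -
  have avg: "(\<Sum>t\<in>totatives n. \<Sum>s<n. f (a * \<zeta> ^ s) (\<zeta> ^ t)) \<in> \<rat>"
    using f
  proof (induction rule: rat_poly_fun.induct)
    case (monom q i j)
    have \<zeta>n: "\<zeta> ^ n = 1" using \<zeta> unfolding primitive_root_of_unity_def by simp
    have "(\<Sum>s<n. q * (a * \<zeta> ^ s) ^ i * w) = q * a ^ i * (\<Sum>s<n. (\<zeta> ^ i) ^ s) * w" for w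
      by (simp add: sum_distrib_left sum_distrib_right power_mult_distrib power_mult[symmetric] mult_ac)
    hence "(\<Sum>t\<in>totatives n. \<Sum>s<n. q * (a * \<zeta> ^ s) ^ i * (\<zeta> ^ t) ^ j)
        = (\<Sum>t\<in>totatives n. q * (a ^ i * (\<Sum>s<n. (\<zeta> ^ i) ^ s)) * (\<zeta> ^ t) ^ j)" by (simp add: mult.assoc)
    also have "\<dots> = q * (a ^ i * (\<Sum>s<n. (\<zeta> ^ i) ^ s)) * (\<Sum>t\<in>totatives n. (\<zeta> ^ j) ^ t)"
      by (subst sum_distrib_left, intro sum.cong refl) (metis power_mult mult.commute)
    finally have "(\<Sum>t\<in>totatives n. \<Sum>s<n. q * (a * \<zeta> ^ s) ^ i * (\<zeta> ^ t) ^ j)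
        = q * (a ^ i * (\<Sum>s<n. (\<zeta> ^ i) ^ s)) * (\<Sum>t\<in>totatives n. (\<zeta> ^ j) ^ t)" .
    moreover have "(\<Sum>t\<in>totatives n. (\<zeta> ^ j) ^ t) \<in> \<rat>"
      using n \<zeta>n by (intro sum_totatives_root_of_unity_rational) (simp, metis mult.commute power_mult power_one)
    moreover have "a ^ i * (\<Sum>s<n. (\<zeta> ^ i) ^ s) \<in> \<rat>"
    proof -
      have "(\<zeta> ^ i) ^ n = 1" using \<zeta>n by (metis mult.commute power_mult power_one)
      hence *: "(\<Sum>s<n. (\<zeta> ^ i) ^ s) = (if \<zeta> ^ i = 1 then of_nat n else 0)"
        by (rule sum_powers_root_of_unity)
      show ?thesis
      proof (cases "\<zeta> ^ i = 1")
        case True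
        then obtain k where "i = n * k" using \<zeta> unfolding primitive_root_of_unity_def by (auto elim: dvdE)
        hence "a ^ i \<in> \<rat>" using a by (simp add: power_mult)
        thus ?thesis using * by simp
      qed (use * in simp)
    qed
    ultimately show ?case using monom by simp
  next
    case (add f g)
    thus ?case by (simp add: sum.distrib)
  qed
  have "(\<Sum>t\<in>totatives n. \<Sum>s<n. f (a * \<zeta> ^ s) (\<zeta> ^ t)) = (\<Sum>t\<in>totatives n. \<Sum>s<n. f a \<zeta>)"
    using inv by (intro sum.cong refl) (auto simp: in_totatives_iff)
  also have "\<dots> = of_nat (totient n * n) * f a \<zeta>" by (simp add: totient_def)
  finally have "of_nat (totient n * n) * f a \<zeta> \<in> \<rat>" using avg by simp
  hence "of_nat (totient n * n) * f a \<zeta> / of_nat (totient n * n) \<in> \<rat>" by (intro Rats_divide) auto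
  thus ?thesis using n by simp
qed

section \<open>Pure fields, conjugates and denominators\<close>

abbreviation rat_eval :: "rat poly \<Rightarrow> complex \<Rightarrow> complex" where
  "rat_eval p x \<equiv> poly (map_poly of_rat p) x"

abbreviation int_eval :: "int poly \<Rightarrow> complex \<Rightarrow> complex" where
  "int_eval p x \<equiv> poly (map_poly of_int p) x"

lemma rat_eval_add: "rat_eval (p + q) x = rat_eval p x + rat_eval q x"
  by (simp add: of_rat_hom.map_poly_hom_add)
lemma rat_eval_mult: "rat_eval (p * q) x = rat_eval p x * rat_eval q x"
proof -
  have "map_poly of_rat (p * q) = (map_poly of_rat p * map_poly of_rat q :: complex poly)"
    by (rule poly_eqI) (simp add: coeff_mult coeff_map_poly of_rat_sum of_rat_mult)
  thus ?thesis by simp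
qed
lemma rat_eval_smult: "rat_eval (Polynomial.smult c p) x = of_rat c * rat_eval p x"
  by (simp add: hom_distribs)
lemma rat_eval_pcompose: "rat_eval (pcompose p q) x = rat_eval p (rat_eval q x)"
  by (simp add: hom_distribs poly_pcompose)
lemma rat_eval_of_int: "rat_eval (map_poly of_int p) x = int_eval p x"
  by (simp add: map_poly_map_poly o_def)
lemma rat_eval_altdef: "degree p < n \<Longrightarrow> rat_eval p x = (\<Sum>k<n. of_rat (coeff p k) * x ^ k)"
  unfolding poly_altdef by (rule sum.mono_neutral_cong_left) (auto simp: coeff_eq_0 not_le)
lemma int_eval_altdef: "degree p < n \<Longrightarrow> int_eval p x = (\<Sum>k<n. of_int (coeff p k) * x ^ k)"
  unfolding poly_altdef by (rule sum.mono_neutral_cong_left) (auto simp: coeff_eq_0 not_le)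
lemma int_eval_add: "int_eval (p + q) x = int_eval p x + int_eval q x"
  by (simp add: hom_distribs)
lemma int_eval_mult: "int_eval (p * q) x = int_eval p x * int_eval q x"
  by (simp add: hom_distribs)
lemma int_eval_pcompose: "int_eval (pcompose p q) x = int_eval p (int_eval q x)"
  by (simp add: hom_distribs poly_pcompose)
lemma algebraic_int_int_eval: "algebraic_int x \<Longrightarrow> algebraic_int (int_eval p x)"
  by (rule algebraic_int_poly) simp_all

lemma rat_eval_pure_poly: "rat_eval (pure_poly n m) x = x ^ n - of_int m"
proof -
  have "map_poly of_rat (pure_poly n m :: rat poly) = (monom 1 n - [:of_int m:] :: complex poly)"
    by (rule poly_eqI) (simp add: pure_poly_def coeff_map_poly of_rat_diff coeff_pCons split: nat.splits)
  thus ?thesis by (simp add: poly_monom)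
qed

lemma degree_pure_poly: "n > 0 \<Longrightarrow> degree (pure_poly n m :: 'a::{comm_ring_1} poly) = n"
  unfolding pure_poly_def
  by (subst diff_conv_add_uminus, subst degree_add_eq_left) (auto simp: degree_monom_eq)

lemma algebraic_int_power_root:
  assumes "n > 0" "x ^ n = (y::complex)" "algebraic_int y"
  shows "algebraic_int x"
proof (rule algebraic_int_root[OF assms(3)])
  show "poly (monom 1 n) x = y" using assms(2) by (simp add: poly_monom)
qed (use assms(1) in \<open>simp_all add: degree_monom_eq\<close>)

lemma algebraic_int_divide_imp_dvd:
  assumes "algebraic_int (of_int x / of_int y :: complex)" "y \<noteq> 0"
  shows "y dvd x"
proof -
  have "of_int x / of_int y \<in> (\<rat> :: complex set)" by simp
  with assms have "of_int x / of_int y \<in> (\<int> :: complex set)" using rational_algebraic_int_is_int by blast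
  then obtain k where "of_int x / of_int y = (of_int k :: complex)" by (auto elim: Ints_cases)
  hence "(of_int x :: complex) = of_int (k * y)" using assms(2) by (simp add: field_simps)
  hence "x = k * y" by (simp only: of_int_eq_iff)
  thus ?thesis by simp
qed

locale pure_field =
  fixes n :: nat and m :: int and a \<zeta> :: complex
  assumes n2: "n \<ge> 2" and root: "a ^ n = of_int m"
    and zeta: "primitive_root_of_unity n \<zeta>"
    and irred: "irreducible (pure_poly n m :: rat poly)"
    and sqfree: "squarefree m" and m2: "\<bar>m\<bar> \<ge> 2"
begin

lemma zeta_power_n: "\<zeta> ^ n = 1"
  using zeta unfolding primitive_root_of_unity_def by simp

lemma a_nonzero: "a \<noteq> 0" using root m2 n2 by (auto simp: power_0_left)

lemma conj_power_n: "(a * \<zeta> ^ i) ^ n = of_int m"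
proof -
  have "(\<zeta> ^ i) ^ n = 1" using zeta_power_n by (metis mult.commute power_mult power_one)
  thus ?thesis using root by (simp add: power_mult_distrib)
qed

lemma algebraic_int_zeta: "algebraic_int \<zeta>"
  using algebraic_int_power_root[OF _ zeta_power_n] n2 by simp

lemma algebraic_int_a: "algebraic_int a"
  using algebraic_int_power_root[OF _ root] n2 by simp

lemma algebraic_int_conj: "algebraic_int (a * \<zeta> ^ i)"
  by (intro algebraic_int_mult algebraic_int_power algebraic_int_a algebraic_int_zeta)

lemma root_pure_poly_dvd_iff:
  assumes x: "x ^ n = of_int m"
  shows "rat_eval p x = 0 \<longleftrightarrow> pure_poly n m dvd p"
proof
  assume r: "rat_eval p x = 0"
  show "pure_poly n m dvd p"
  proof (rule ccontr)
    assume nd: "\<not> pure_poly n m dvd p"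
    have "prime_elem (pure_poly n m :: rat poly)" using irred by (simp add: irreducible_imp_prime_elem)
    hence "coprime (pure_poly n m) p" using nd by (simp add: prime_elem_imp_coprime)
    hence "gcd (pure_poly n m) p = 1" by simp
    then obtain u v where "u * pure_poly n m + v * p = 1" using bezout_coefficients_fst_snd by metis
    hence "rat_eval (u * pure_poly n m + v * p) x = 1" by simp
    thus False using r x by (simp add: rat_eval_add rat_eval_mult rat_eval_pure_poly)
  qed
next
  assume "pure_poly n m dvd p"
  thus "rat_eval p x = 0" using x by (auto elim!: dvdE simp: rat_eval_mult rat_eval_pure_poly)
qed

lemmas pure_poly_dvd_iff = root_pure_poly_dvd_iff[OF root]

lemma rat_eval_conj_0: "rat_eval p a = 0 \<Longrightarrow> rat_eval p (a * \<zeta> ^ i) = 0"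
  using pure_poly_dvd_iff conj_power_n by (auto elim!: dvdE simp: rat_eval_mult rat_eval_pure_poly)

lemma rat_eval_reduce:
  obtains c where "degree c < n" "\<And>i. rat_eval b (a * \<zeta> ^ i) = rat_eval c (a * \<zeta> ^ i)"
proof
  have n0: "n > 0" using n2 by simp
  have nz: "pure_poly n m \<noteq> (0 :: rat poly)" using degree_pure_poly[OF n0, of m, where 'a=rat] n2 by auto
  show "degree (b mod pure_poly n m) < n"
    using degree_mod_less'[OF nz, of b] degree_pure_poly[OF n0, of m, where 'a=rat] n2
    by (cases "b mod pure_poly n m = 0") auto
  fix i
  have "rat_eval b (a * \<zeta> ^ i) = rat_eval (b div pure_poly n m * pure_poly n m + b mod pure_poly n m) (a * \<zeta> ^ i)"
    by (simp only: div_mult_mod_eq)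
  also have "\<dots> = rat_eval (b mod pure_poly n m) (a * \<zeta> ^ i)"
    using conj_power_n by (simp add: rat_eval_add rat_eval_mult rat_eval_pure_poly)
  finally show "rat_eval b (a * \<zeta> ^ i) = rat_eval (b mod pure_poly n m) (a * \<zeta> ^ i)" .
qed

text \<open>An integral equation for \<open>b(a)\<close> is a polynomial relation for \<open>a\<close> over the rationals, and the conjugates of
  \<open>a\<close> satisfy the same relations.\<close>

lemma algebraic_int_rat_eval_conj:
  assumes "algebraic_int (rat_eval b a)"
  shows "algebraic_int (rat_eval b (a * \<zeta> ^ i))"
proof -
  obtain P where P: "int_eval P (rat_eval b a) = 0" "lead_coeff P = 1"
    using assms algebraic_int_altdef_ipoly by blast
  have "rat_eval (pcompose (map_poly of_int P) b) a = 0"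
    using P(1) by (simp only: rat_eval_pcompose rat_eval_of_int)
  hence "rat_eval (pcompose (map_poly of_int P) b) (a * \<zeta> ^ i) = 0" by (rule rat_eval_conj_0)
  hence "int_eval P (rat_eval b (a * \<zeta> ^ i)) = 0"
    by (simp only: rat_eval_pcompose rat_eval_of_int)
  thus ?thesis using P(2) algebraic_int_altdef_ipoly by blast
qed

lemma sum_powers_conj:
  "(\<Sum>i<n. (a * \<zeta> ^ i) ^ j) = (if n dvd j then of_nat n * a ^ j else 0)"
proof -
  have "(\<zeta> ^ j) ^ n = 1" using zeta_power_n by (metis mult.commute power_mult power_one)
  moreover have "(\<Sum>i<n. (a * \<zeta> ^ i) ^ j) = a ^ j * (\<Sum>i<n. (\<zeta> ^ j) ^ i)"
    by (simp add: sum_distrib_left power_mult_distrib power_mult[symmetric] mult.commute)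
  ultimately show ?thesis using zeta
    by (simp add: sum_powers_root_of_unity primitive_root_of_unity_def)
qed

text \<open>Multiplying by \<open>a\<^sup>n\<^sup>-\<^sup>k\<close> and taking the trace singles out the coefficient of \<open>a\<^sup>k\<close>.\<close>

lemma trace_coeff:
  assumes "degree b < n" "k < n"
  shows "(\<Sum>i<n. rat_eval b (a * \<zeta> ^ i) * (a * \<zeta> ^ i) ^ (n - k)) = of_nat n * of_int m * of_rat (coeff b k)"
proof -
  have "(\<Sum>i<n. rat_eval b (a * \<zeta> ^ i) * (a * \<zeta> ^ i) ^ (n - k))
      = (\<Sum>i<n. \<Sum>l<n. of_rat (coeff b l) * (a * \<zeta> ^ i) ^ (l + (n - k)))"
    by (simp add: rat_eval_altdef[OF assms(1)] sum_distrib_left sum_distrib_right power_add mult_ac)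
  also have "\<dots> = (\<Sum>l<n. of_rat (coeff b l) * (\<Sum>i<n. (a * \<zeta> ^ i) ^ (l + (n - k))))"
    by (subst sum.swap) (simp add: sum_distrib_left)
  also have "\<dots> = (\<Sum>l<n. if l = k then of_nat n * of_int m * of_rat (coeff b k) else 0)"
  proof (rule sum.cong)
    fix l assume "l \<in> {..<n}"
    hence l: "l < n" by simp
    have "n dvd (l + (n - k)) \<longleftrightarrow> l = k"
    proof
      assume "n dvd (l + (n - k))"
      then obtain c where c: "l + (n - k) = n * c" by (auto elim: dvdE)
      have "n * c > 0" "n * c < n * 2" using l assms(2) c by linarith+
      hence "c = 1" by auto
      thus "l = k" using c assms(2) by simp
    qed (use assms(2) in auto)
    moreover have "a ^ (k + (n - k)) = of_int m" using root assms(2) by simp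
    ultimately show "of_rat (coeff b l) * (\<Sum>i<n. (a * \<zeta> ^ i) ^ (l + (n - k)))
        = (if l = k then of_nat n * of_int m * of_rat (coeff b k) else 0)"
      by (auto simp: sum_powers_conj)
  qed simp
  also have "\<dots> = of_nat n * of_int m * of_rat (coeff b k)" using assms(2) by simp
  finally show ?thesis .
qed

text \<open>The trace in the previous lemma is a rational algebraic integer.\<close>

lemma coeff_trace_bound:
  assumes "degree b < n" "algebraic_int (rat_eval b a)"
  shows "of_nat n * of_int m * coeff b k \<in> \<int>"
proof (cases "k < n")
  case True
  have "algebraic_int (\<Sum>i<n. rat_eval b (a * \<zeta> ^ i) * (a * \<zeta> ^ i) ^ (n - k))"
    by (intro algebraic_int_sum algebraic_int_mult algebraic_int_power[of "a * \<zeta> ^ _"]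
        algebraic_int_rat_eval_conj assms algebraic_int_conj)
  hence "algebraic_int (of_rat (of_nat n * of_int m * coeff b k) :: complex)"
    using trace_coeff[OF assms(1) True] by (simp add: of_rat_mult)
  hence "(of_rat (of_nat n * of_int m * coeff b k) :: complex) \<in> \<int>"
    by (intro rational_algebraic_int_is_int) auto
  then obtain j where "(of_rat (of_nat n * of_int m * coeff b k) :: complex) = of_int j"
    by (auto elim: Ints_cases)
  hence "(of_rat (of_nat n * of_int m * coeff b k) :: complex) = of_rat (of_int j)" by simp
  hence "of_nat n * of_int m * coeff b k = of_int j" by (simp only: of_rat_eq_iff)
  thus ?thesis by simp
next
  case False
  thus ?thesis using assms(1) by (simp add: coeff_eq_0)
qed

text \<open>\<open>X\<^sup>n - m\<close> is Eisenstein at the prime divisors of \<open>m\<close>: isolating the lowest coefficient that is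
  prime to \<open>p\<close> would make \<open>c a\<^sup>n\<^sup>-\<^sup>1 / p\<close> integral, whose \<open>n\<close>-th power has the factor \<open>1/p\<close>.\<close>

lemma eisenstein_coeff_dvd:
  assumes p: "prime p" "p dvd m" and deg: "degree g < n"
    and int: "algebraic_int (int_eval g a / of_int p)"
  shows "p dvd coeff g k"
proof (rule ccontr)
  assume "\<not> p dvd coeff g k"
  define j where "j = (LEAST k. \<not> p dvd coeff g k)"
  have j: "\<not> p dvd coeff g j" and less: "\<And>k. k < j \<Longrightarrow> p dvd coeff g k"
    unfolding j_def using \<open>\<not> p dvd coeff g k\<close> by (rule LeastI, metis not_less_Least)
  have jn: "j < n" using j deg by (metis coeff_eq_0 dvd_0_right less_trans not_less_iff_gr_or_eq)
  have p0: "p \<noteq> 0" using p(1) by auto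
  obtain m' where m': "m = p * m'" using p(2) by (auto elim: dvdE)
  define T where "T = (\<Sum>k<j. of_int (coeff g k div p) * a ^ k)"
  define U where "U = (\<Sum>k\<in>{j<..<n}. of_int (coeff g k * m') * a ^ (k - Suc j))"
  have split: "{..<n} = {..<j} \<union> {j} \<union> {j<..<n}" using jn by auto
  have "int_eval g a = (\<Sum>k<j. of_int (coeff g k) * a ^ k) + of_int (coeff g j) * a ^ j
      + (\<Sum>k\<in>{j<..<n}. of_int (coeff g k) * a ^ k)"
    unfolding int_eval_altdef[OF deg] split
    by (subst sum.union_disjoint, simp, simp, force, subst sum.union_disjoint) auto
  moreover have "(\<Sum>k<j. of_int (coeff g k) * a ^ k) = of_int p * T"
    unfolding T_def sum_distrib_left
  proof (rule sum.cong)
    fix k assume "k \<in> {..<j}"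
    hence "coeff g k = p * (coeff g k div p)" using less by simp
    thus "of_int (coeff g k) * a ^ k = of_int p * (of_int (coeff g k div p) * a ^ k)"
      by (metis mult.assoc of_int_mult)
  qed simp
  moreover have "(\<Sum>k\<in>{j<..<n}. of_int (coeff g k) * a ^ k) * a ^ (n - 1 - j) = of_int p * U"
    unfolding U_def sum_distrib_left sum_distrib_right
  proof (rule sum.cong)
    fix k assume "k \<in> {j<..<n}"
    hence "k + (n - 1 - j) = n + (k - Suc j)" using jn by auto
    hence "a ^ k * a ^ (n - 1 - j) = of_int m * a ^ (k - Suc j)"
      using root by (metis power_add)
    thus "of_int (coeff g k) * a ^ k * a ^ (n - 1 - j) = of_int p * (of_int (coeff g k * m') * a ^ (k - Suc j))"
      by (simp add: m' mult_ac)
  qed simp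
  moreover have "a ^ j * a ^ (n - 1 - j) = a ^ (n - 1)" using jn by (simp add: power_add[symmetric])
  ultimately have "int_eval g a * a ^ (n - 1 - j)
      = of_int p * T * a ^ (n - 1 - j) + of_int (coeff g j) * a ^ (n - 1) + of_int p * U"
    by (simp only: distrib_right mult.assoc)
  note split_eq = this
  have pc: "of_int p \<noteq> (0 :: complex)" using p0 by (simp only: of_int_eq_0_iff not_False_eq_True)
  have divide: "(e / P - t) * x - u = y / P" if "e * x = P * t * x + y + P * u" "P \<noteq> 0" for e P t x u y :: complex
  proof -
    have "((e / P - t) * x - u) * P = y" using that by (simp add: algebra_simps)
    thus ?thesis using that(2) by (metis nonzero_eq_divide_eq)
  qed
  note eq = divide[OF split_eq pc]
  have "algebraic_int ((int_eval g a / of_int p - T) * a ^ (n - 1 - j) - U)"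
  proof -
    have "algebraic_int T" unfolding T_def
      by (rule algebraic_int_sum, rule algebraic_int_mult[OF algebraic_int_of_int algebraic_int_power[OF algebraic_int_a]])
    moreover have "algebraic_int U" unfolding U_def
      by (rule algebraic_int_sum, rule algebraic_int_mult[OF algebraic_int_of_int algebraic_int_power[OF algebraic_int_a]])
    ultimately show ?thesis
      by (intro algebraic_int_diff[of _ U] algebraic_int_mult[of "_ - T"] algebraic_int_diff[of _ T]
          algebraic_int_power algebraic_int_a int)
  qed
  hence "algebraic_int (of_int (coeff g j) * a ^ (n - 1) / of_int p)" unfolding eq .
  hence "algebraic_int ((of_int (coeff g j) * a ^ (n - 1) / of_int p) ^ n)" by (rule algebraic_int_power)
  also have "(of_int (coeff g j) * a ^ (n - 1) / of_int p) ^ n = of_int (coeff g j ^ n * m ^ (n - 1)) / of_int (p ^ n)"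
    by (simp add: power_divide power_mult_distrib power_mult[symmetric] mult.commute[of _ n] root[symmetric])
  finally have "p ^ n dvd coeff g j ^ n * m ^ (n - 1)"
    using p0 by (intro algebraic_int_divide_imp_dvd) auto
  moreover have "coeff g j ^ n * m ^ (n - 1) = p ^ (n - 1) * (coeff g j ^ n * m' ^ (n - 1))"
    by (simp add: m' power_mult_distrib mult_ac)
  moreover have "p ^ n = p ^ (n - 1) * p" using n2 by (cases n) auto
  ultimately have "p ^ (n - 1) * p dvd p ^ (n - 1) * (coeff g j ^ n * m' ^ (n - 1))" by metis
  moreover have "p ^ (n - 1) \<noteq> 0" using p0 by simp
  ultimately have "p dvd coeff g j ^ n * m' ^ (n - 1)" by (metis dvd_times_left_cancel_iff)
  hence "p dvd coeff g j \<or> p dvd m'" using p(1) prime_dvd_mult_iff prime_dvd_power by blast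
  hence "p dvd m'" using j by simp
  hence "p ^ 2 dvd m" unfolding m' power2_eq_square by (intro mult_dvd_mono) simp_all
  hence "is_unit p" using sqfree unfolding squarefree_def by blast
  thus False using p(1) by (simp add: not_prime_unit)
qed

text \<open>Take the least common denominator \<open>s\<close> of \<open>b\<close>. For a prime \<open>p\<close> dividing it, \<open>g(a)/p = (s/p) b(a)\<close> is still integral. The
  prime does not divide \<open>m\<close>, because \<open>X\<^sup>n - m\<close> is Eisenstein there, and so it divides \<open>n\<close> by the
  bound \<open>nm\<close> for the denominators.\<close>

lemma integral_denominator:
  assumes deg: "degree b < n" and int: "algebraic_int (rat_eval b a)"
  obtains s g where "s > 0" "degree g < n" "Polynomial.smult (of_int s) b = map_poly of_int g"
    "\<And>p. prime p \<Longrightarrow> p dvd s \<Longrightarrow> \<not> p dvd m \<and> p dvd int n \<and> (\<exists>k. \<not> p dvd coeff g k)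
        \<and> algebraic_int (int_eval g a / of_int p)"
proof -
  define Q where "Q = (\<lambda>s::nat. s > 0 \<and> (\<forall>k. of_nat s * coeff b k \<in> \<int>))"
  have "Q (nat \<bar>int n * m\<bar>)"
  proof -
    have "of_nat (nat \<bar>int n * m\<bar>) * coeff b k \<in> \<int>" for k
    proof -
      have "of_nat (nat \<bar>int n * m\<bar>) * coeff b k = of_int \<bar>int n * m\<bar> * coeff b k" by simp
      also have "\<dots> = of_int (sgn m) * (of_nat n * of_int m * coeff b k)"
        by (cases "m \<ge> 0") (auto simp: abs_mult sgn_if)
      also have "\<dots> \<in> \<int>" by (intro Ints_mult Ints_of_int coeff_trace_bound deg int)
      finally show ?thesis .
    qed
    thus ?thesis unfolding Q_def using n2 m2 by simp
  qed
  define s where "s = (LEAST s. Q s)"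
  have Qs: "Q s" unfolding s_def by (rule LeastI) fact
  have s0: "s > 0" using Qs by (simp add: Q_def)
  have small: "\<not> Q t" if "t < s" for t using that not_less_Least unfolding s_def by blast
  have "\<forall>k. \<exists>c. of_nat s * coeff b k = of_int c" using Qs unfolding Q_def by (meson Ints_cases)
  then obtain c where c: "\<And>k. of_nat s * coeff b k = of_int (c k)" by metis
  define g where "g = (\<Sum>k<n. monom (c k) k)"
  have cg: "coeff g k = c k" for k
  proof (cases "k < n")
    case True
    thus ?thesis by (simp add: g_def coeff_sum)
  next
    case False
    hence "coeff b k = 0" using deg by (simp add: coeff_eq_0)
    hence "c k = 0" using c[of k] by simp
    thus ?thesis using False by (auto simp: g_def coeff_sum)
  qed
  have gdeg: "degree g < n"
    unfolding g_def using n2 by (intro degree_sum_less) (auto intro: le_less_trans[OF degree_monom_le])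
  have sb: "Polynomial.smult (of_int (int s)) b = map_poly of_int g"
    by (rule poly_eqI) (simp add: coeff_map_poly c cg)
  show ?thesis
  proof (rule that[of "int s" g])
    fix p :: int assume p: "prime p" "p dvd int s"
    have p0: "p > 0" using p(1) by (simp add: prime_gt_0_int)
    obtain t where t: "int s = p * int t"
    proof -
      obtain u where "int s = p * u" using p(2) by (auto elim: dvdE)
      moreover from this have "u \<ge> 0" using p0 s0 by (metis of_nat_0_le_iff zero_le_mult_iff not_less)
      ultimately show ?thesis using that[of "nat u"] by simp
    qed
    have ts: "t < s" "t > 0" using t s0 prime_ge_2_int[OF p(1)]
      by (auto simp: zero_less_mult_iff intro: Nat.gr0I)
        (smt (verit, best) mult_less_cancel_right1 of_nat_0_less_iff of_nat_less_iff mult_le_cancel_right of_nat_0_le_iff zero_less_mult_iff)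
    have st: "of_nat s = (of_int p * of_nat t :: rat)" by (metis of_int_mult of_int_of_nat_eq t)
    have stc: "of_nat s = (of_int p * of_nat t :: complex)" by (metis of_int_mult of_int_of_nat_eq t)
    have tb: "of_nat t * coeff b k = of_int (c k) / of_int p" for k
      using c[of k] p0 st by (simp add: field_simps)
    have ex: "\<exists>k. \<not> p dvd coeff g k"
    proof (rule ccontr)
      assume "\<not> (\<exists>k. \<not> p dvd coeff g k)"
      hence "\<And>k. p dvd c k" by (simp add: cg)
      hence "of_nat t * coeff b k \<in> \<int>" for k unfolding tb by (metis Ints_of_int dvd_def nonzero_mult_div_cancel_left of_int_mult p0 of_int_eq_0_iff less_irrefl)
      hence "Q t" unfolding Q_def using ts by simp
      thus False using small ts by blast
    qed
    have "of_int p * (of_nat t * rat_eval b a) = int_eval g a"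
      using arg_cong[OF sb, of "\<lambda>q. rat_eval q a"] stc
      by (simp add: rat_eval_of_int rat_eval_smult mult.assoc)
    hence eq: "int_eval g a / of_int p = rat_eval (Polynomial.smult (of_nat t) b) a"
      using p0 by (simp add: rat_eval_smult field_simps)
    have alg: "algebraic_int (int_eval g a / of_int p)"
      unfolding eq rat_eval_smult by (intro algebraic_int_mult int) simp
    have pm: "\<not> p dvd m" using eisenstein_coeff_dvd[OF p(1) _ gdeg alg] ex by blast
    have "p dvd int n"
    proof -
      obtain k where k: "\<not> p dvd c k" using ex cg by auto
      have "of_nat n * of_int m * coeff (Polynomial.smult (of_nat t) b) k \<in> \<int>"
        using deg alg eq by (intro coeff_trace_bound) auto
      hence "of_nat n * of_int m * (of_int (c k) / of_int p) \<in> (\<int> :: rat set)" by (simp add: tb)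
      then obtain z where "of_nat n * of_int m * (of_int (c k) / of_int p) = (of_int z :: rat)" by (auto elim: Ints_cases)
      hence "(of_int (int n * m * c k) :: rat) = of_int (p * z)" using p0 by (simp add: field_simps)
      hence "p dvd int n * m * c k" by (simp only: of_int_eq_iff) simp
      thus ?thesis using p(1) pm k by (simp add: prime_dvd_mult_iff)
    qed
    thus "\<not> p dvd m \<and> p dvd int n \<and> (\<exists>k. \<not> p dvd coeff g k) \<and> algebraic_int (int_eval g a / of_int p)"
      using pm ex alg by blast
  qed (use s0 gdeg sb in auto)
qed

end

section \<open>Products over differences of exponents\<close>

lemma squarefree_dvdI:
  fixes m x :: "'a :: factorial_semiring_multiplicative"
  assumes sq: "squarefree m" and p: "\<And>p. prime p \<Longrightarrow> p dvd m \<Longrightarrow> p dvd x"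
  shows "m dvd x"
proof (cases "x = 0")
  case False
  have m0: "m \<noteq> 0" using sq by auto
  show ?thesis
  proof (rule multiplicity_le_imp_dvd[OF m0])
    fix q :: 'a assume q: "prime q"
    have le: "multiplicity q m \<le> 1"
      using squarefree_factorial_semiring''[OF m0] sq q by auto
    show "multiplicity q m \<le> multiplicity q x"
    proof (cases "q dvd m")
      case True
      hence "multiplicity q x \<ge> 1" using p[OF q] False q
        by (metis One_nat_def Suc_leI multiplicity_gt_zero_iff not_prime_unit)
      thus ?thesis using le by linarith
    qed (simp add: not_dvd_imp_multiplicity_0)
  qed
qed simp

text \<open>The divided difference \<open>(p(x) - p(y)) / (x - y)\<close>, written without division so that it is visibly
  integral and makes sense for \<open>x = y\<close>.\<close>

definition divided_diff :: "complex poly \<Rightarrow> complex \<Rightarrow> complex \<Rightarrow> complex" where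
  "divided_diff p x y = (\<Sum>k\<le>degree p. coeff p k * (\<Sum>i<k. y ^ (k - Suc i) * x ^ i))"

lemma divided_diff_eq: "poly p x - poly p y = (x - y) * divided_diff p x y"
proof -
  have "poly p x - poly p y = (\<Sum>k\<le>degree p. coeff p k * (x ^ k - y ^ k))"
    by (simp add: poly_altdef sum_subtractf right_diff_distrib)
  also have "\<dots> = (\<Sum>k\<le>degree p. (x - y) * (coeff p k * (\<Sum>i<k. y ^ (k - Suc i) * x ^ i)))"
    by (simp add: power_diff_sumr2 mult_ac)
  finally show ?thesis by (simp add: divided_diff_def sum_distrib_left)
qed

lemma algebraic_int_divided_diff:
  assumes "\<And>k. algebraic_int (coeff p k)" "algebraic_int x" "algebraic_int y"
  shows "algebraic_int (divided_diff p x y)"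
  unfolding divided_diff_def
  by (rule algebraic_int_sum, rule algebraic_int_mult[OF assms(1)], rule algebraic_int_sum,
      rule algebraic_int_mult[OF algebraic_int_power[OF assms(3)] algebraic_int_power[OF assms(2)]])

text \<open>This is \<open>1 + X + \<dots> + X\<^sup>d\<^sup>-\<^sup>1\<close> at \<open>X = 1\<close>.\<close>

lemma prod_roots_of_unity_minus_one:
  assumes d: "d > 0" and w: "primitive_root_of_unity d w"
  shows "(\<Prod>l\<in>{1..<d}. 1 - w ^ l) = of_nat d"
proof -
  define p where "p = (\<Prod>l\<in>{1..<d}. [:- (w ^ l), 1:])"
  define q where "q = (\<Sum>i<d. monom (1::complex) i)"
  define A where "A = (\<lambda>l. w ^ l) ` {1..<d}"
  have w1: "w ^ d = 1" using w unfolding primitive_root_of_unity_def by simp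
  have inj: "inj_on (\<lambda>l. w ^ l) {1..<d}"
    by (rule inj_onI) (use primitive_root_of_unity_eq_iff[OF w d] in auto)
  have card: "card A = d - 1" unfolding A_def by (subst card_image[OF inj]) simp
  have deg_p: "degree p = d - 1" unfolding p_def by (subst degree_prod_sum_eq) auto
  have lc_p: "coeff p (d - 1) = 1"
    using deg_p lead_coeff_prod[of "\<lambda>l. [:- (w ^ l), 1:]" "{1..<d}"] by (simp add: p_def)
  have lc_q: "coeff q (d - 1) = 1" using d by (simp add: q_def coeff_sum)
  have deg_q: "degree q \<le> d - 1" unfolding q_def
    by (rule degree_sum_le) (auto intro: order_trans[OF degree_monom_le])
  have "p = q"
  proof (rule poly_eqI_degree_lead_coeff[of _ "d - 1" _ A])
    show "coeff p (d - 1) = coeff q (d - 1)" using lc_p lc_q by simp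
    show "d - 1 \<le> card A" using card by simp
    show "degree p \<le> d - 1" "degree q \<le> d - 1" using deg_p deg_q by auto
    fix z assume "z \<in> A"
    then obtain l where l: "l \<in> {1..<d}" "z = w ^ l" by (auto simp: A_def)
    have "poly p z = 0" unfolding p_def poly_prod using l by (intro prod_zero) auto
    moreover have "poly q z = 0"
    proof -
      have "z ^ d = 1" using w1 l(2) by (metis mult.commute power_mult power_one)
      moreover have "z \<noteq> 1" using primitive_root_of_unity_eq_iff[OF w d, of l 0] l by auto
      ultimately show ?thesis using sum_powers_root_of_unity[of z d] by (simp add: q_def poly_sum poly_monom)
    qed
    ultimately show "poly p z = poly q z" by simp
  qed
  moreover have "poly p 1 = (\<Prod>l\<in>{1..<d}. 1 - w ^ l)" by (simp add: p_def poly_prod)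
  moreover have "poly q 1 = of_nat d" by (simp add: q_def poly_sum poly_monom)
  ultimately show ?thesis by simp
qed

text \<open>A set of differences of exponents that all automorphisms \<open>\<zeta> \<mapsto> \<zeta>\<^sup>t\<close> preserve.\<close>

definition galois_stable :: "nat \<Rightarrow> nat set \<Rightarrow> bool" where
  "galois_stable n D \<longleftrightarrow> D \<subseteq> {1..<n} \<and> (\<forall>t d. coprime t n \<longrightarrow> d \<in> D \<longrightarrow> (t * d) mod n \<in> D)"

text \<open>The \<open>k\<close> with \<open>\<zeta>\<^sup>k\<close> of order dividing \<open>d\<close>, without \<open>k = 0\<close>.\<close>

definition order_dividing :: "nat \<Rightarrow> nat \<Rightarrow> nat set" where
  "order_dividing n d = {k\<in>{1..<n}. n dvd d * k}"

lemma galois_stable_order_dividing: "galois_stable n (order_dividing n d)"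
  unfolding galois_stable_def order_dividing_def
proof (intro conjI allI impI)
  fix t k assume t: "coprime t n" and k: "k \<in> {k\<in>{1..<n}. n dvd d * k}"
  have "\<not> n dvd k" using k by (auto dest: dvd_imp_le)
  hence "\<not> n dvd t * k" using t by (metis coprime_commute coprime_dvd_mult_right_iff)
  hence "(t * k) mod n \<in> {1..<n}" using k by (auto simp: dvd_eq_mod_eq_0)
  moreover have "n dvd d * ((t * k) mod n)"
  proof -
    have "n dvd t * (d * k)" using k by simp
    hence "d * (t * k) mod n = 0" by (simp add: mult_ac dvd_eq_mod_eq_0)
    thus ?thesis by (simp add: dvd_eq_mod_eq_0 mod_mult_right_eq)
  qed
  ultimately show "(t * k) mod n \<in> {k\<in>{1..<n}. n dvd d * k}" by simp
qed auto

lemma galois_stable_Diff: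
  assumes D: "galois_stable n D" and D': "galois_stable n D'"
  shows "galois_stable n (D - D')"
  unfolding galois_stable_def
proof (intro conjI allI impI)
  fix t k assume t: "coprime t n" and k: "k \<in> D - D'"
  have "(t * k) mod n \<in> D" using D t k unfolding galois_stable_def by blast
  moreover have "(t * k) mod n \<notin> D'"
  proof
    assume in': "(t * k) mod n \<in> D'"
    have kn: "k < n" using D k unfolding galois_stable_def by auto
    obtain u where u: "[t * u = 1] (mod n)" using cong_solve_coprime_nat[OF t] by auto
    hence "coprime u n" by (metis cong_imp_coprime coprime_1_left coprime_mult_left_iff cong_sym)
    hence "(u * ((t * k) mod n)) mod n \<in> D'" using D' in' unfolding galois_stable_def by blast
    moreover have "(u * ((t * k) mod n)) mod n = k"
    proof -
      have "[u * (t * k) = 1 * k] (mod n)" using cong_scalar_right[OF u, of k] by (simp add: mult_ac)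
      thus ?thesis using kn by (simp add: cong_iff_mod mod_mult_right_eq)
    qed
    ultimately show False using k by simp
  qed
  ultimately show "(t * k) mod n \<in> D - D'" by simp
qed (use D in \<open>auto simp: galois_stable_def\<close>)

lemma order_dividing_eq_image:
  assumes "n = d * e" "n > 0"
  shows "order_dividing n d = (\<lambda>l. e * l) ` {1..<d}"
proof (intro equalityI subsetI)
  fix k assume "k \<in> order_dividing n d"
  hence k: "k \<ge> 1" "k < d * e" "d * e dvd d * k" using assms by (auto simp: order_dividing_def)
  hence "e dvd k" using assms(2) assms(1) by auto
  then obtain l where "k = e * l" by (auto elim: dvdE)
  thus "k \<in> (\<lambda>l. e * l) ` {1..<d}" using k by (auto simp: mult.commute[of d])
next
  fix k assume "k \<in> (\<lambda>l. e * l) ` {1..<d}"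
  thus "k \<in> order_dividing n d" using assms by (auto simp: order_dividing_def mult.commute[of d])
qed

lemma card_order_dividing: "n = d * e \<Longrightarrow> n > 0 \<Longrightarrow> card (order_dividing n d) = d - 1"
  by (subst order_dividing_eq_image) (auto simp: card_image inj_on_def)

lemma prod_order_dividing:
  assumes z: "primitive_root_of_unity n z" and n: "n = d * e" "n > 0"
  shows "(\<Prod>k\<in>order_dividing n d. 1 - z ^ k) = of_nat d"
proof -
  have "primitive_root_of_unity d (z ^ e)"
    using z n unfolding primitive_root_of_unity_def by (auto simp: power_mult[symmetric] mult.commute[of e])
  hence "(\<Prod>l\<in>{1..<d}. 1 - (z ^ e) ^ l) = of_nat d" using n by (intro prod_roots_of_unity_minus_one) auto
  moreover have "(\<Prod>k\<in>order_dividing n d. 1 - z ^ k) = (\<Prod>l\<in>{1..<d}. 1 - z ^ (e * l))"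
    unfolding order_dividing_eq_image[OF n] using n by (subst prod.reindex) (auto intro!: inj_onI)
  ultimately show ?thesis by (simp add: power_mult)
qed

lemma order_dividing_self: "order_dividing n n = {1..<n}"
  by (auto simp: order_dividing_def)

definition diff_pairs :: "nat \<Rightarrow> nat set \<Rightarrow> (nat \<times> nat) set" where
  "diff_pairs n D = {(i,j). i < j \<and> j < n \<and> j - i \<in> D}"

lemma finite_diff_pairs [simp]: "finite (diff_pairs n D)"
  by (rule finite_subset[of _ "{..<n} \<times> {..<n}"]) (auto simp: diff_pairs_def)

lemma galois_stable_neg:
  assumes "galois_stable n D" "d \<in> D" shows "n - d \<in> D"
proof -
  have d: "1 \<le> d" "d < n" using assms by (auto simp: galois_stable_def)
  have "coprime (n - 1) n" using d by (metis coprime_diff_one_left_nat less_imp_le_nat le_trans order_less_le_trans not_less_iff_gr_or_eq zero_less_one gr0I not_less0)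
  hence "((n - 1) * d) mod n \<in> D" using assms unfolding galois_stable_def by blast
  moreover have "(n - 1) * d = (n - d) + n * (d - 1)"
  proof -
    obtain n' where "n = Suc n'" using d by (cases n) auto
    moreover obtain d' where "d = Suc d'" using d by (cases d) auto
    ultimately show ?thesis using d by (simp add: algebra_simps)
  qed
  ultimately have "(n - d + n * (d - 1)) mod n \<in> D" by (simp only:)
  thus ?thesis using d by (simp only: mod_mult_self2) simp
qed

text \<open>Each unordered pair with difference in \<open>D\<close> comes from two pairs \<open>(i, i + d)\<close> modulo \<open>n\<close>.\<close>

lemma prod_over_differences:
  fixes h :: "nat \<Rightarrow> nat \<Rightarrow> 'a :: comm_monoid_mult"
  assumes D: "galois_stable n D"
  shows "(\<Prod>i<n. \<Prod>d\<in>D. h i ((i + d) mod n)) = (\<Prod>(i,j)\<in>diff_pairs n D. h i j * h j i)"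
proof -
  let ?P = "diff_pairs n D" and ?Q = "prod.swap ` diff_pairs n D"
  have Dn: "D \<subseteq> {1..<n}" using D by (simp add: galois_stable_def)
  have "(\<Prod>i<n. \<Prod>d\<in>D. h i ((i + d) mod n)) = (\<Prod>(i,d)\<in>{..<n}\<times>D. h i ((i + d) mod n))"
    by (rule prod.cartesian_product)
  also have "\<dots> = (\<Prod>(i,j)\<in>?P \<union> ?Q. h i j)"
  proof (rule prod.reindex_bij_witness[of _ "\<lambda>(i,j). (i, (j + n - i) mod n)" "\<lambda>(i,d). (i, (i + d) mod n)"], goal_cases)
    case (1 x)
    then obtain i d where x: "x = (i, d)" "i < n" "d \<in> D" by auto
    have d: "1 \<le> d" "d < n" using x Dn by auto
    show ?case
    proof (cases "i + d < n")
      case True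
      thus ?thesis using x d by simp
    next
      case False
      hence "(i + d) mod n = i + d - n" using x d by (simp add: mod_if)
      thus ?thesis using x d False by simp
    qed
  next
    case (2 x)
    then obtain i d where x: "x = (i, d)" "i < n" "d \<in> D" by auto
    have d: "1 \<le> d" "d < n" using x Dn by auto
    show ?case
    proof (cases "i + d < n")
      case True
      thus ?thesis using x d by (auto simp: diff_pairs_def)
    next
      case False
      hence "(i + d) mod n = i + d - n" using x d by (simp add: mod_if)
      moreover have "(i + d - n, i) \<in> ?P" using x d False galois_stable_neg[OF D x(3)]
        by (auto simp: diff_pairs_def)
      moreover have "(i, i + d - n) = prod.swap (i + d - n, i)" by simp
      ultimately have "(i, (i + d) mod n) \<in> ?Q" by (metis imageI)
      thus ?thesis using x by simp
    qed
  next
    case (3 x)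
    then obtain i j where x: "x = (i, j)" "i < n" "j < n" by (auto simp: diff_pairs_def)
    show ?case
    proof (cases "i \<le> j")
      case True
      hence "(j + n - i) mod n = j - i" using x by (simp add: mod_if)
      thus ?thesis using x True by simp
    next
      case False
      hence "(j + n - i) mod n = j + n - i" using x by simp
      thus ?thesis using x False by simp
    qed
  next
    case (4 x)
    then obtain i j where x: "x = (i, j)" "i < n" "j < n" "i \<noteq> j" 
        "(i < j \<and> j - i \<in> D) \<or> (j < i \<and> i - j \<in> D)" by (auto simp: diff_pairs_def)
    show ?case
    proof (cases "i < j")
      case True
      hence "(j + n - i) mod n = j - i" using x by (simp add: mod_if)
      thus ?thesis using x True by auto
    next
      case False
      hence "(j + n - i) mod n = n - (i - j)" using x by simp
      moreover have "n - (i - j) \<in> D" using x False by (intro galois_stable_neg[OF D]) auto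
      ultimately show ?thesis using x by simp
    qed
  next
    case (5 x)
    thus ?case by auto
  qed
  also have "\<dots> = (\<Prod>(i,j)\<in>?P. h i j) * (\<Prod>(i,j)\<in>?Q. h i j)"
    by (rule prod.union_disjoint) (simp, simp, auto simp: diff_pairs_def)
  also have "(\<Prod>(i,j)\<in>?Q. h i j) = (\<Prod>(i,j)\<in>?P. h j i)"
    by (subst prod.reindex) (auto simp: inj_on_def case_prod_beta intro!: prod.cong)
  finally show ?thesis by (simp add: prod.distrib[symmetric] case_prod_beta)
qed

lemma card_diff_pairs:
  assumes "galois_stable n D" shows "2 * card (diff_pairs n D) = n * card D"
proof -
  have "(2::nat) ^ (n * card D) = (\<Prod>i<n. \<Prod>d\<in>D. 2)" by (simp add: power_mult[symmetric] mult.commute)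
  also have "\<dots> = (\<Prod>(i,j)\<in>diff_pairs n D. 2 * 2)" using prod_over_differences[OF assms, of "\<lambda>_ _. 2::nat"] by simp
  also have "\<dots> = 2 ^ (2 * card (diff_pairs n D))" by (simp add: case_prod_beta power_mult)
  finally show ?thesis by simp
qed

text \<open>The substitutions \<open>a \<mapsto> a\<zeta>\<^sup>s\<close>, \<open>\<zeta> \<mapsto> \<zeta>\<^sup>t\<close> act on the exponents of the conjugates by \<open>i \<mapsto> s + ti\<close>.\<close>

lemma diff_pairs_affine:
  fixes s t i j n :: nat
  assumes D: "galois_stable n D" and t: "coprime t n" and ij: "(i, j) \<in> diff_pairs n D"
  defines "u \<equiv> (s + t * i) mod n" and "v \<equiv> (s + t * j) mod n"
  shows "u \<noteq> v" "(min u v, max u v) \<in> diff_pairs n D"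
proof -
  have ij': "i < j" "j < n" "j - i \<in> D" using ij by (auto simp: diff_pairs_def)
  define d where "d = j - i"
  have n0: "n > 0" using ij' by simp
  have v: "[v = u + t * d] (mod n)"
  proof -
    have "s + t * j = (s + t * i) + t * d" using ij' by (simp add: d_def algebra_simps)
    thus ?thesis unfolding u_def v_def cong_iff_mod by (simp add: mod_add_left_eq add.assoc)
  qed
  have un: "u < n" "v < n" using n0 by (auto simp: u_def v_def)
  have td: "(t * d) mod n \<in> D" using D t ij' unfolding galois_stable_def d_def by blast
  have td0: "1 \<le> (t * d) mod n" "(t * d) mod n < n" using td D by (auto simp: galois_stable_def)
  have eqv: "v = (u + (t * d) mod n) mod n" using v un by (simp add: cong_iff_mod mod_add_right_eq)
  have "u \<noteq> v \<and> (min u v, max u v) \<in> diff_pairs n D"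
  proof (cases "u + (t * d) mod n < n")
    case True
    hence uv: "v = u + (t * d) mod n" using eqv by simp
    hence "u < v" "v - u = (t * d) mod n" using td0 by linarith+
    hence "(u, v) \<in> diff_pairs n D" using td un unfolding diff_pairs_def by simp
    thus ?thesis using \<open>u < v\<close> by (simp add: min_def max_def)
  next
    case False
    define r where "r = (t * d) mod n"
    have r: "1 \<le> r" "r < n" "n \<le> u + r" using False td0 by (auto simp: r_def)
    have "v = (u + r - n) mod n" using eqv le_mod_geq[OF r(3)] by (simp only: r_def)
    hence "v = u + r - n" using r un by simp
    hence uv: "u - v = n - (t * d) mod n" "v < u" using r un unfolding r_def[symmetric] by linarith+
    hence "(v, u) \<in> diff_pairs n D" using galois_stable_neg[OF D td] un unfolding diff_pairs_def by simp
    thus ?thesis using uv(2) by (simp add: min_def max_def)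
  qed
  thus "u \<noteq> v" "(min u v, max u v) \<in> diff_pairs n D" by auto
qed

text \<open>Affine substitutions of the exponents permute the unordered pairs with difference in \<open>D\<close>. This is what makes
  products over these pairs rational.\<close>

lemma prod_diff_pairs_affine:
  fixes h :: "nat \<Rightarrow> nat \<Rightarrow> 'a :: comm_monoid_mult"
  assumes D: "galois_stable n D" and t: "coprime t n" and sym: "\<And>i j. i \<noteq> j \<Longrightarrow> i < n \<Longrightarrow> j < n \<Longrightarrow> h i j = h j i"
  shows "(\<Prod>(i,j)\<in>diff_pairs n D. h ((s + t * i) mod n) ((s + t * j) mod n)) = (\<Prod>(i,j)\<in>diff_pairs n D. h i j)"
proof -
  define \<sigma> where "\<sigma> = (\<lambda>i. (s + t * i) mod n)"
  define \<tau> where "\<tau> = (\<lambda>(i,j). (min (\<sigma> i) (\<sigma> j), max (\<sigma> i) (\<sigma> j)))"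
  have into: "\<tau> ` diff_pairs n D \<subseteq> diff_pairs n D"
    using diff_pairs_affine(2)[OF D t] by (auto simp: \<tau>_def \<sigma>_def)
  have \<sigma>inj: "i = j" if "\<sigma> i = \<sigma> j" "i < n" "j < n" for i j
  proof -
    have "[s + t * i = s + t * j] (mod n)" using that by (simp add: \<sigma>_def cong_iff_mod)
    hence "[t * i = t * j] (mod n)" by (simp add: cong_add_lcancel_nat)
    hence "[i = j] (mod n)" using t cong_mult_lcancel_nat by blast
    thus ?thesis using that by (simp add: cong_iff_mod)
  qed
  have inj: "inj_on \<tau> (diff_pairs n D)"
  proof (rule inj_onI)
    fix x y assume x: "x \<in> diff_pairs n D" and y: "y \<in> diff_pairs n D" and eq: "\<tau> x = \<tau> y"
    obtain i j where ij: "x = (i,j)" "i < j" "j < n" using x by (auto simp: diff_pairs_def)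
    obtain k l where kl: "y = (k,l)" "k < l" "l < n" using y by (auto simp: diff_pairs_def)
    have "(\<sigma> i = \<sigma> k \<and> \<sigma> j = \<sigma> l) \<or> (\<sigma> i = \<sigma> l \<and> \<sigma> j = \<sigma> k)"
      using eq unfolding ij kl \<tau>_def by (auto simp: min_def max_def split: if_splits)
    hence "(i = k \<and> j = l) \<or> (i = l \<and> j = k)" using \<sigma>inj ij kl by (meson less_trans)
    thus "x = y" using ij kl by auto
  qed
  have "(\<Prod>(i,j)\<in>diff_pairs n D. h (\<sigma> i) (\<sigma> j)) = (\<Prod>x\<in>diff_pairs n D. (\<lambda>(i,j). h i j) (\<tau> x))"
  proof (rule prod.cong[OF refl])
    fix x assume x: "x \<in> diff_pairs n D"
    obtain i j where ij: "x = (i,j)" "i < j" "j < n" using x by (auto simp: diff_pairs_def)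
    have "\<sigma> i < n" "\<sigma> j < n" using ij by (auto simp: \<sigma>_def)
    moreover have "\<sigma> i \<noteq> \<sigma> j" using \<sigma>inj ij by fastforce
    ultimately show "(case x of (i,j) \<Rightarrow> h (\<sigma> i) (\<sigma> j)) = (\<lambda>(i,j). h i j) (\<tau> x)"
      using ij sym[of "\<sigma> i" "\<sigma> j"] by (auto simp: \<tau>_def min_def max_def)
  qed
  also have "\<dots> = (\<Prod>x\<in>\<tau> ` diff_pairs n D. (\<lambda>(i,j). h i j) x)"
    by (subst prod.reindex[OF inj]) simp
  also have "\<tau> ` diff_pairs n D = diff_pairs n D"
    using into inj by (intro endo_inj_surj) auto
  finally show ?thesis by (simp add: \<sigma>_def)
qed

lemma prod_add_multiple:
  fixes m :: complex
  assumes "finite P" "\<And>x. x \<in> P \<Longrightarrow> algebraic_int (t x)" "\<And>x. x \<in> P \<Longrightarrow> algebraic_int (u x)" "algebraic_int m"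
  shows "\<exists>T. algebraic_int T \<and> (\<Prod>x\<in>P. u x + m * t x) = (\<Prod>x\<in>P. u x) + m * T"
  using assms(1-3)
proof (induction P rule: finite_induct)
  case empty
  thus ?case by (intro exI[of _ 0]) simp
next
  case (insert x P)
  then obtain T where T: "algebraic_int T" "(\<Prod>x\<in>P. u x + m * t x) = (\<Prod>x\<in>P. u x) + m * T" by auto
  have U: "algebraic_int (\<Prod>x\<in>P. u x)" using insert.prems by (intro algebraic_int_prod) simp
  have "(\<Prod>x\<in>insert x P. u x + m * t x) = (u x + m * t x) * ((\<Prod>x\<in>P. u x) + m * T)"
    using insert T by simp
  also have "\<dots> = (\<Prod>x\<in>insert x P. u x) + m * (u x * T + t x * ((\<Prod>x\<in>P. u x) + m * T))"
    using insert(1,2) by (simp add: algebra_simps)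
  finally show ?case using insert.prems T U assms(4)
    by (intro exI[of _ "u x * T + t x * ((\<Prod>x\<in>P. u x) + m * T)"] conjI)
      (simp_all add: algebraic_int_add algebraic_int_mult)
qed

section \<open>The integers J for a generator of the ring of integers\<close>

text \<open>Here \<open>b(a)\<close> stands for a generator of the ring of integers; as this ring contains \<open>a\<close>, there is a polynomial \<open>c\<close>.\<close>

locale generated_pure_field = pure_field +
  fixes b :: "rat poly" and c :: "int poly"
  assumes deg_b: "degree b < n" and int_b: "algebraic_int (rat_eval b a)"
    and c: "int_eval c (rat_eval b a) = a"
begin

text \<open>Here \<open>A\<close> and \<open>B\<close> are the conjugates of \<open>a\<close> and of \<open>b(a)\<close>, and \<open>C i j\<close> is the quotient \<open>(A i - A j) / (B i - B j)\<close>. Up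
  to sign, \<open>J {1..<n}\<close> is the index of \<open>\<int>[a]\<close> in \<open>\<int>[b(a)]\<close>.\<close>

definition A :: "nat \<Rightarrow> complex" where "A i = a * \<zeta> ^ i"
definition B :: "nat \<Rightarrow> complex" where "B i = rat_eval b (A i)"
definition C :: "nat \<Rightarrow> nat \<Rightarrow> complex" where "C i j = divided_diff (map_poly of_int c) (B i) (B j)"
definition J :: "nat set \<Rightarrow> complex" where "J D = (\<Prod>(i,j)\<in>diff_pairs n D. C i j)"

lemma n_pos: "n > 0" using n2 by simp

lemma A_mod: "A (i mod n) = A i"
  using primitive_root_of_unity_eq_iff[OF zeta n_pos, of "i mod n" i] by (simp add: A_def)

lemma A_inj: "A i = A j \<longleftrightarrow> i mod n = j mod n"
  using primitive_root_of_unity_eq_iff[OF zeta n_pos] a_nonzero by (simp add: A_def)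

lemma algebraic_int_A: "algebraic_int (A i)"
  unfolding A_def by (rule algebraic_int_conj)

lemma algebraic_int_B: "algebraic_int (B i)"
  unfolding B_def A_def by (rule algebraic_int_rat_eval_conj[OF int_b])

lemma int_eval_B: "int_eval c (B i) = A i"
proof -
  have "rat_eval (pcompose (map_poly of_int c) b + Polynomial.smult (-1) (monom 1 1)) x
      = int_eval c (rat_eval b x) - x" for x
    by (simp only: rat_eval_add rat_eval_smult rat_eval_pcompose rat_eval_of_int) (simp add: poly_monom)
  note eq = this
  have "rat_eval (pcompose (map_poly of_int c) b + Polynomial.smult (-1) (monom 1 1)) a = 0"
    unfolding eq using c by simp
  hence "rat_eval (pcompose (map_poly of_int c) b + Polynomial.smult (-1) (monom 1 1)) (a * \<zeta> ^ i) = 0"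
    by (rule rat_eval_conj_0)
  thus ?thesis unfolding eq by (simp add: A_def B_def)
qed

lemma C_eq: "A i - A j = (B i - B j) * C i j"
  using divided_diff_eq[of "map_poly of_int c" "B i" "B j"] by (simp add: int_eval_B C_def)

lemma algebraic_int_C: "algebraic_int (C i j)"
  unfolding C_def by (rule algebraic_int_divided_diff) (simp_all add: algebraic_int_B)

lemma A_distinct: "i \<noteq> j \<Longrightarrow> i < n \<Longrightarrow> j < n \<Longrightarrow> A i \<noteq> A j"
  by (simp add: A_inj)

lemma B_distinct: "i \<noteq> j \<Longrightarrow> i < n \<Longrightarrow> j < n \<Longrightarrow> B i \<noteq> B j"
  using A_distinct[of i j] C_eq[of i j] by auto

lemma C_sym: "i \<noteq> j \<Longrightarrow> i < n \<Longrightarrow> j < n \<Longrightarrow> C i j = C j i"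
proof -
  assume ij: "i \<noteq> j" "i < n" "j < n"
  have "(B i - B j) * C i j = - (A j - A i)" by (simp add: C_eq[symmetric])
  also have "\<dots> = (B i - B j) * C j i" unfolding C_eq by (simp add: algebra_simps)
  finally have "(B i - B j) * C i j = (B i - B j) * C j i" .
  thus ?thesis using B_distinct[OF ij] by simp
qed

lemma C_nonzero: "i \<noteq> j \<Longrightarrow> i < n \<Longrightarrow> j < n \<Longrightarrow> C i j \<noteq> 0"
  using C_eq[of i j] A_distinct[of i j] by auto

lemma algebraic_int_J: "algebraic_int (J D)"
  unfolding J_def by (rule algebraic_int_prod) (auto simp: algebraic_int_C)

lemma rational_J:
  assumes D: "galois_stable n D"
  shows "J D \<in> \<rat>"
proof -
  define f where "f = (\<lambda>x z. \<Prod>(i,j)\<in>diff_pairs n D.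
    divided_diff (map_poly of_int c) (rat_eval b (x * z ^ i)) (rat_eval b (x * z ^ j)))"
  have "f a \<zeta> = J D" by (simp add: f_def J_def C_def A_def B_def)
  moreover have "f a \<zeta> \<in> \<rat>"
  proof (rule rational_if_invariant[OF n_pos zeta, of a f])
    show "a ^ n \<in> \<rat>" using root by simp
    show "rat_poly_fun f" unfolding f_def case_prod_beta divided_diff_def
      by (intro rat_poly_fun_prod rat_poly_fun_sum rat_poly_fun_mult rat_poly_fun_power
          rat_poly_fun_poly rat_poly_fun_var rat_poly_fun_const) auto
    fix s t assume t: "coprime t n"
    have "f (a * \<zeta> ^ s) (\<zeta> ^ t) = (\<Prod>(i,j)\<in>diff_pairs n D. C (s + t * i) (s + t * j))"
      unfolding f_def C_def B_def A_def by (simp add: power_add power_mult mult.assoc)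
    also have "\<dots> = (\<Prod>(i,j)\<in>diff_pairs n D. C ((s + t * i) mod n) ((s + t * j) mod n))"
      by (simp add: C_def B_def A_mod)
    also have "\<dots> = J D"
      unfolding J_def by (rule prod_diff_pairs_affine[OF D t C_sym])
    finally show "f (a * \<zeta> ^ s) (\<zeta> ^ t) = f a \<zeta>" by (simp add: \<open>f a \<zeta> = J D\<close>)
  qed
  ultimately show ?thesis by simp
qed

lemma integer_J:
  assumes "galois_stable n D" obtains j where "J D = of_int j"
proof -
  have "J D \<in> \<int>"
    using rational_algebraic_int_is_int[OF algebraic_int_J rational_J[OF assms]] .
  thus ?thesis using that by (auto elim: Ints_cases)
qed

lemma prod_A_squared: "(\<Prod>i<n. A i) ^ 2 = of_int (m ^ 2)"
proof -
  have "(\<Prod>i<n. A i) = a ^ n * \<zeta> ^ (\<Sum>i<n. i)"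
    by (simp add: A_def prod.distrib power_sum)
  moreover have "(\<zeta> ^ (\<Sum>i<n. i)) ^ 2 = 1"
  proof -
    have "2 * (\<Sum>i<k. i) + k = k * k" for k :: nat by (induction k) (simp_all add: algebra_simps)
    hence "\<zeta> ^ (2 * (\<Sum>i<n. i)) * \<zeta> ^ n = \<zeta> ^ (n * n)" by (metis power_add)
    also have "\<zeta> ^ (n * n) = 1" by (simp only: power_mult zeta_power_n power_one)
    finally show ?thesis by (simp add: zeta_power_n power_mult[symmetric] mult.commute)
  qed
  ultimately show ?thesis by (simp add: power_mult_distrib root)
qed

text \<open>The integer \<open>J D\<close> times the product of the differences \<open>B i - B j\<close> is the product of the differences
  \<open>A i - A j\<close>, whose square is, up to sign, the right-hand side.\<close>

lemma J_squared_dvd: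
  assumes D: "galois_stable n D" and j: "J D = of_int j" and E: "(\<Prod>d\<in>D. 1 - \<zeta> ^ d) = of_int E"
  shows "j ^ 2 dvd E ^ n * m ^ card D"
proof -
  define X where "X = (\<Prod>(i,j)\<in>diff_pairs n D. B i - B j)"
  have X: "algebraic_int X" unfolding X_def
    by (rule algebraic_int_prod) (auto intro: algebraic_int_diff algebraic_int_B)
  have "J D * X = (\<Prod>(i,j)\<in>diff_pairs n D. A i - A j)"
    unfolding J_def X_def C_eq by (simp add: prod.distrib[symmetric] case_prod_beta mult.commute)
  \<comment> \<open>Fourth powers avoid the sign: the product over ordered pairs is the square of the one over unordered
    pairs up to sign.\<close>
  hence "(J D * X) ^ 4 = (\<Prod>(i,j)\<in>diff_pairs n D. (A i - A j) ^ 4)"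
    by (simp add: prod_power_distrib case_prod_beta)
  also have "\<dots> = (\<Prod>(i,j)\<in>diff_pairs n D. (A i - A j) ^ 2 * (A j - A i) ^ 2)"
  proof -
    have "(u - v) ^ 4 = (u - v) ^ 2 * (v - u) ^ 2" for u v :: complex
      by (simp add: power4_eq_xxxx power2_eq_square algebra_simps)
    thus ?thesis by simp
  qed
  also have "\<dots> = (\<Prod>i<n. \<Prod>d\<in>D. (A i - A ((i + d) mod n)) ^ 2)"
    by (rule prod_over_differences[OF D, symmetric])
  also have "\<dots> = (\<Prod>i<n. \<Prod>d\<in>D. (A i * (1 - \<zeta> ^ d)) ^ 2)"
    unfolding A_mod by (simp add: A_def power_add algebra_simps)
  also have "\<dots> = ((\<Prod>i<n. A i) ^ 2) ^ card D * ((\<Prod>d\<in>D. 1 - \<zeta> ^ d) ^ 2) ^ n"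
    by (simp add: power_mult_distrib prod.distrib prod_power_distrib power_mult[symmetric] mult.commute)
  also have "\<dots> = of_int ((E ^ n * m ^ card D) ^ 2)"
    by (simp only: prod_A_squared E) (simp add: power_mult_distrib power_mult[symmetric] mult.commute)
  finally have eq: "of_int ((j ^ 2) ^ 2) * X ^ 4 = of_int ((E ^ n * m ^ card D) ^ 2)"
    by (simp add: j power_mult_distrib power_mult[symmetric])
  have j0: "j \<noteq> 0"
  proof
    assume "j = 0"
    hence "J D = 0" using j by simp
    then obtain p where p: "p \<in> diff_pairs n D" "(\<lambda>(i,j). C i j) p = 0"
      unfolding J_def using prod_zero_iff[OF finite_diff_pairs] by blast
    thus False using C_nonzero by (auto simp: diff_pairs_def)
  qed
  have "of_int ((E ^ n * m ^ card D) ^ 2) / of_int ((j ^ 2) ^ 2) = X ^ 4"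
    using j0 eq by (metis nonzero_mult_div_cancel_left of_int_eq_0_iff power_not_zero)
  hence "algebraic_int (of_int ((E ^ n * m ^ card D) ^ 2) / of_int ((j ^ 2) ^ 2) :: complex)"
    using algebraic_int_power[OF X] by metis
  hence "(j ^ 2) ^ 2 dvd (E ^ n * m ^ card D) ^ 2"
    by (rule algebraic_int_divide_imp_dvd) (use j0 in simp)
  thus ?thesis by (subst (asm) pow_divides_pow_iff) simp_all
qed

text \<open>Modulo \<open>a\<close> the quotient of \<open>B i - B j\<close> by \<open>A i - A j\<close> is the linear coefficient \<open>v/s\<close> of \<open>b\<close>, because the terms of higher
  degree carry a further factor \<open>a\<close>. So every \<open>C i j\<close> is \<open>s/v\<close> modulo \<open>a\<close>. The denominator \<open>s\<close> is prime to \<open>m\<close>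
  by \<open>integral_denominator\<close>, and an integer divisible by \<open>a\<close> is divisible by the square-free number \<open>m\<close>.\<close>

lemma J_congruence:
  obtains x where "\<And>D j. galois_stable n D \<Longrightarrow> J D = of_int j \<Longrightarrow>
    [j = x ^ card (diff_pairs n D)] (mod m) \<and> coprime j m"
proof -
  obtain s g where s: "s > 0" and deg_g: "degree g < n" and sb: "Polynomial.smult (of_int s) b = map_poly of_int g"
    and pr: "\<And>p. prime p \<Longrightarrow> p dvd s \<Longrightarrow> \<not> p dvd m"
    using integral_denominator[OF deg_b int_b] by metis
  have cop: "coprime s m"
  proof (rule ccontr)
    assume "\<not> coprime s m"
    hence "\<not> is_unit (gcd s m)" using is_unit_gcd_iff by (metis coprime_iff_gcd_eq_1 is_unit_gcd)
    then obtain p where "prime p" "p dvd gcd s m"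
      using prime_divisor_exists[of "gcd s m"] s by auto
    thus False using pr[of p] by simp
  qed
  define v where "v = coeff g 1"
  define t where "t = (\<lambda>(i,j). \<Sum>k\<in>{2..degree g}. of_int (coeff g k) *
      (\<Sum>l<k. \<zeta> ^ (j * (k - Suc l) + i * l)) * a ^ (k - 2))"
  have t_int: "algebraic_int (t p)" for p
    unfolding t_def case_prod_beta
    by (rule algebraic_int_sum, rule algebraic_int_mult[OF algebraic_int_mult algebraic_int_power],
        simp, rule algebraic_int_sum, rule algebraic_int_power) (rule algebraic_int_zeta algebraic_int_a)+
  have dd: "divided_diff (map_poly of_int g) (A i) (A j) = of_int v + a * t (i, j)" for i j
  proof -
    have "divided_diff (map_poly of_int g) (A i) (A j)
        = (\<Sum>k\<le>degree g. of_int (coeff g k) * (\<Sum>l<k. A j ^ (k - Suc l) * A i ^ l))"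
      by (simp add: divided_diff_def)
    also have "\<dots> = (\<Sum>k\<in>{1,0} \<union> {2..degree g}. of_int (coeff g k) * (\<Sum>l<k. A j ^ (k - Suc l) * A i ^ l))"
      by (rule sum.mono_neutral_left) (auto simp: coeff_eq_0)
    also have "\<dots> = of_int v + (\<Sum>k\<in>{2..degree g}. of_int (coeff g k) * (\<Sum>l<k. A j ^ (k - Suc l) * A i ^ l))"
      by (subst sum.union_disjoint) (auto simp: v_def)
    also have "(\<Sum>k\<in>{2..degree g}. of_int (coeff g k) * (\<Sum>l<k. A j ^ (k - Suc l) * A i ^ l)) = a * t (i, j)"
      unfolding t_def case_prod_conv
    proof (subst sum_distrib_left, rule sum.cong[OF refl])
      fix k assume k: "k \<in> {2..degree g}"
      have "(\<Sum>l<k. A j ^ (k - Suc l) * A i ^ l) = (\<Sum>l<k. \<zeta> ^ (j * (k - Suc l) + i * l)) * a ^ (k - 1)"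
        unfolding sum_distrib_right
      proof (rule sum.cong[OF refl])
        fix l assume "l \<in> {..<k}"
        hence "a ^ (k - Suc l) * a ^ l = a ^ (k - 1)" by (simp add: power_add[symmetric])
        thus "A j ^ (k - Suc l) * A i ^ l = \<zeta> ^ (j * (k - Suc l) + i * l) * a ^ (k - 1)"
          by (simp add: A_def power_mult_distrib power_mult power_add mult_ac)
      qed
      moreover have "a ^ (k - 1) = a * a ^ (k - 2)"
      proof -
        have "k - 1 = Suc (k - 2)" using k by auto
        thus ?thesis by (simp only: power_Suc)
      qed
      ultimately show "of_int (coeff g k) * (\<Sum>l<k. A j ^ (k - Suc l) * A i ^ l)
          = a * (of_int (coeff g k) * (\<Sum>l<k. \<zeta> ^ (j * (k - Suc l) + i * l)) * a ^ (k - 2))"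
        by (simp only: mult_ac)
    qed
    finally show ?thesis .
  qed
  have sB: "of_int s * B i = int_eval g (A i)" for i
    using arg_cong[OF sb, of "\<lambda>q. rat_eval q (A i)"]
    by (simp add: B_def rat_eval_smult rat_eval_of_int)
  have key: "of_int s = C i j * (of_int v + a * t (i, j))" if "i \<noteq> j" "i < n" "j < n" for i j
  proof -
    have "of_int s * (B i - B j) = (A i - A j) * (of_int v + a * t (i, j))"
      using divided_diff_eq[of "map_poly of_int g" "A i" "A j"] by (simp add: dd right_diff_distrib sB)
    also have "\<dots> = (C i j * (of_int v + a * t (i, j))) * (B i - B j)" by (simp add: C_eq mult_ac)
    finally show ?thesis using B_distinct[OF that] by simp
  qed
  have cong: "[s ^ card (diff_pairs n D) = j * v ^ card (diff_pairs n D)] (mod m)"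
    if D: "galois_stable n D" and j: "J D = of_int j" for D j
  proof -
    let ?N = "card (diff_pairs n D)"
    obtain T where T: "algebraic_int T"
      "(\<Prod>p\<in>diff_pairs n D. of_int v + a * t p) = of_int v ^ ?N + a * T"
      using prod_add_multiple[of "diff_pairs n D" t "\<lambda>_. of_int v" a] t_int algebraic_int_a by auto
    have "of_int s ^ ?N = (\<Prod>p\<in>diff_pairs n D. of_int s)" by simp
    also have "\<dots> = (\<Prod>p\<in>diff_pairs n D. (\<lambda>(i,j). C i j) p * (of_int v + a * t p))"
      by (rule prod.cong) (auto simp: key diff_pairs_def)
    also have "\<dots> = J D * (of_int v ^ ?N + a * T)"
      by (simp add: prod.distrib T(2) J_def)
    finally have "of_int (s ^ ?N - j * v ^ ?N) = a * (of_int j * T)"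
      by (simp add: j algebra_simps)
    hence "of_int ((s ^ ?N - j * v ^ ?N) ^ n) = of_int m * (of_int j * T) ^ n"
      by (simp only: of_int_power power_mult_distrib root)
    moreover have m0: "m \<noteq> 0" using m2 by auto
    ultimately have "of_int ((s ^ ?N - j * v ^ ?N) ^ n) / of_int m = (of_int j * T) ^ n" by simp
    moreover have "algebraic_int ((of_int j * T) ^ n)"
      by (rule algebraic_int_power, rule algebraic_int_mult) (simp_all add: T(1))
    ultimately have "m dvd (s ^ ?N - j * v ^ ?N) ^ n"
      using m0 by (intro algebraic_int_divide_imp_dvd) simp_all
    hence "m dvd s ^ ?N - j * v ^ ?N"
      by (intro squarefree_dvdI[OF sqfree]) (meson dvd_trans prime_dvd_power)
    thus ?thesis by (simp add: cong_iff_dvd_diff)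
  qed
  have gs: "galois_stable n {1..<n}"
    using galois_stable_order_dividing[of n n] by (simp add: order_dividing_self)
  obtain j0 where j0: "J {1..<n} = of_int j0" using integer_J[OF gs] .
  have vm: "coprime v m"
  proof -
    have "card (diff_pairs n {1..<n}) > 0"
      using card_diff_pairs[OF gs] n2 by (cases "card (diff_pairs n {1..<n})") auto
    moreover have "coprime (s ^ card (diff_pairs n {1..<n})) m" using cop by simp
    hence "coprime (j0 * v ^ card (diff_pairs n {1..<n})) m"
      using cong_imp_coprime[OF cong[OF gs j0]] by simp
    ultimately show ?thesis by (auto simp: coprime_power_left_iff)
  qed
  then obtain w where w: "[v * w = 1] (mod m)" using cong_solve_coprime_int by blast
  show ?thesis
  proof (rule that[of "s * w"])
    fix D j assume D: "galois_stable n D" and j: "J D = of_int j"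
    let ?N = "card (diff_pairs n D)"
    have "[(s * w) ^ ?N = j * v ^ ?N * w ^ ?N] (mod m)"
      unfolding power_mult_distrib by (intro cong_scalar_right cong[OF D j])
    also have "j * v ^ ?N * w ^ ?N = j * (v * w) ^ ?N" by (simp add: power_mult_distrib)
    also have "[j * (v * w) ^ ?N = j * 1 ^ ?N] (mod m)" by (intro cong_mult cong_refl cong_pow w)
    finally have "[j = (s * w) ^ ?N] (mod m)" by (simp add: cong_sym)
    moreover have "coprime j m"
    proof -
      have "coprime (s ^ ?N) m" using cop by simp
      hence "coprime (j * v ^ ?N) m" using cong_imp_coprime[OF cong[OF D j]] by simp
      thus ?thesis by simp
    qed
    ultimately show "[j = (s * w) ^ ?N] (mod m) \<and> coprime j m" by simp
  qed
qed

end

section \<open>An index of one gives integral coefficients\<close>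

definition alg_coeffs :: "complex poly \<Rightarrow> bool" where
  "alg_coeffs p \<longleftrightarrow> (\<forall>k. algebraic_int (coeff p k))"

lemma alg_coeffs_pCons: "alg_coeffs (pCons x p) \<longleftrightarrow> algebraic_int x \<and> alg_coeffs p"
proof
  assume h: "alg_coeffs (pCons x p)"
  have "algebraic_int (coeff (pCons x p) 0)" "\<And>k. algebraic_int (coeff (pCons x p) (Suc k))"
    using h unfolding alg_coeffs_def by blast+
  thus "algebraic_int x \<and> alg_coeffs p" by (simp add: alg_coeffs_def)
qed (simp add: alg_coeffs_def coeff_pCons split: nat.splits)

lemma alg_coeffs_0: "alg_coeffs 0" and alg_coeffs_1: "alg_coeffs 1"
  by (simp_all add: alg_coeffs_def)

lemma alg_coeffs_add: "alg_coeffs p \<Longrightarrow> alg_coeffs q \<Longrightarrow> alg_coeffs (p + q)"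
  by (simp add: alg_coeffs_def algebraic_int_add)

lemma alg_coeffs_mult: "alg_coeffs p \<Longrightarrow> alg_coeffs q \<Longrightarrow> alg_coeffs (p * q)"
  unfolding alg_coeffs_def coeff_mult by (simp add: algebraic_int_sum algebraic_int_mult)

lemma alg_coeffs_smult: "algebraic_int x \<Longrightarrow> alg_coeffs p \<Longrightarrow> alg_coeffs (Polynomial.smult x p)"
  by (simp add: alg_coeffs_def algebraic_int_mult)

lemma alg_coeffs_prod: "(\<And>i. i \<in> I \<Longrightarrow> alg_coeffs (f i)) \<Longrightarrow> alg_coeffs (prod f I)"
  by (induction I rule: infinite_finite_induct) (simp_all add: alg_coeffs_mult alg_coeffs_1)

lemma alg_coeffs_pcompose: "alg_coeffs p \<Longrightarrow> alg_coeffs q \<Longrightarrow> alg_coeffs (pcompose p q)"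
proof (induction p)
  case (pCons x p)
  thus ?case
    by (simp add: pcompose_pCons alg_coeffs_add alg_coeffs_mult alg_coeffs_pCons alg_coeffs_0)
qed (simp add: alg_coeffs_0)

lemma alg_coeffs_synthetic_div: "alg_coeffs p \<Longrightarrow> algebraic_int x \<Longrightarrow> alg_coeffs (synthetic_div p x)"
proof (induction p)
  case (pCons y p)
  hence p: "alg_coeffs p" by (simp add: alg_coeffs_pCons)
  have "algebraic_int (poly p x)"
    by (rule algebraic_int_poly) (use p pCons.prems in \<open>simp_all add: alg_coeffs_def\<close>)
  thus ?case using pCons p by (simp add: alg_coeffs_pCons)
qed (simp add: alg_coeffs_0)

lemma poly_synthetic_div: "poly p (x::complex) - poly p y = (x - y) * poly (synthetic_div p y) x"
proof -
  have "poly ([:- y, 1:] * synthetic_div p y + [:poly p y:]) x = poly p x"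
    by (simp only: synthetic_div_correct')
  thus ?thesis by (simp add: algebra_simps)
qed

text \<open>The values of \<open>g\<close> are the roots of a polynomial \<open>P = x + XQ\<close>, where \<open>x\<close> is up to sign their product and hence a unit,
  and \<open>-Q(y)/x\<close> is the inverse of every root \<open>y\<close>.\<close>

lemma inverse_values_poly:
  assumes I: "finite I" and g: "alg_coeffs g"
    and unit: "\<And>i. i \<in> I \<Longrightarrow> poly g (\<theta> i) \<noteq> 0 \<and> algebraic_int (poly g (\<theta> i)) \<and> algebraic_int (1 / poly g (\<theta> i))"
  shows "\<exists>h. alg_coeffs h \<and> (\<forall>i\<in>I. poly h (\<theta> i) = 1 / poly g (\<theta> i))"
proof -
  define P where "P = (\<Prod>i\<in>I. [:- poly g (\<theta> i), 1:])"
  have P: "alg_coeffs P" unfolding P_def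
    using unit by (intro alg_coeffs_prod) (simp add: alg_coeffs_pCons alg_coeffs_0)
  obtain x Q where PQ: "P = pCons x Q" by (cases P) auto
  have Q: "alg_coeffs Q" using P by (simp add: PQ alg_coeffs_pCons)
  have x: "x = (\<Prod>i\<in>I. - poly g (\<theta> i))"
    using arg_cong[OF PQ, of "\<lambda>p. poly p 0"] by (simp add: P_def poly_prod)
  have x0: "x \<noteq> 0" using unit I by (simp add: x)
  have "x * (\<Prod>i\<in>I. - (1 / poly g (\<theta> i))) = 1"
    unfolding x prod.distrib[symmetric] using unit by (intro prod.neutral) simp
  hence "1 / x = (\<Prod>i\<in>I. - (1 / poly g (\<theta> i)))"
    using x0 by (metis nonzero_mult_div_cancel_left)
  hence xi: "algebraic_int (1 / x)" using unit by (simp add: algebraic_int_prod)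
  define h where "h = Polynomial.smult (- (1 / x)) (pcompose Q g)"
  have "alg_coeffs h"
    unfolding h_def using xi Q g by (intro alg_coeffs_smult alg_coeffs_pcompose) simp_all
  moreover have "poly h (\<theta> i) = 1 / poly g (\<theta> i)" if i: "i \<in> I" for i
  proof -
    have "poly P (poly g (\<theta> i)) = 0"
      unfolding P_def poly_prod using I i by (intro prod_zero) auto
    hence "poly g (\<theta> i) * poly Q (poly g (\<theta> i)) = - x" by (simp add: PQ add_eq_0_iff2)
    hence "poly Q (poly g (\<theta> i)) = - x / poly g (\<theta> i)"
      using unit[OF i] by (metis nonzero_mult_div_cancel_left)
    thus ?thesis using x0 by (simp add: h_def poly_pcompose)
  qed
  ultimately show ?thesis by blast
qed

context generated_pure_field
begin

text \<open>Newton interpolation. A polynomial in \<open>b(a)\<close> has integral divided differences with respect to the \<open>B i\<close>. If all \<open>C i j\<close> are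
  units, passing to divided differences with respect to the \<open>A i\<close> multiplies by inverse values of a polynomial, so
  these are polynomial in \<open>B i\<close> and integral again, and the values are interpolated integrally at the \<open>A i\<close>.\<close>

lemma integral_interpolation:
  assumes unit: "\<And>i j. i \<noteq> j \<Longrightarrow> i < n \<Longrightarrow> j < n \<Longrightarrow> algebraic_int (1 / C i j)"
    and I: "finite I" "I \<subseteq> {..<n}" and g: "alg_coeffs g"
  shows "\<exists>p. alg_coeffs p \<and> degree p \<le> card I - 1 \<and> (\<forall>i\<in>I. poly p (A i) = poly g (B i))"
  using I g
proof (induction I arbitrary: g rule: finite_induct)
  case empty
  thus ?case by (intro exI[of _ 0]) (simp add: alg_coeffs_0)
next
  case (insert j I)
  have j: "j < n" and sub: "I \<subseteq> {..<n}" using insert.prems by auto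
  define d where "d = synthetic_div (map_poly of_int c) (B j)"
  have d: "alg_coeffs d" unfolding d_def
    by (rule alg_coeffs_synthetic_div) (simp_all add: alg_coeffs_def algebraic_int_B)
  have ij: "i \<noteq> j" "i < n" if "i \<in> I" for i using that insert.hyps sub by auto
  have dC: "poly d (B i) = C i j" if "i \<in> I" for i
  proof -
    have "(B i - B j) * poly d (B i) = A i - A j"
      using poly_synthetic_div[of "map_poly of_int c" "B i" "B j"] by (simp add: int_eval_B d_def)
    hence "(B i - B j) * poly d (B i) = (B i - B j) * C i j" unfolding C_eq .
    thus ?thesis using B_distinct[OF ij(1)[OF that] ij(2)[OF that] j] by simp
  qed
  have "\<exists>h. alg_coeffs h \<and> (\<forall>i\<in>I. poly h (B i) = 1 / poly d (B i))"
    by (rule inverse_values_poly[OF insert.hyps(1) d])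
      (use dC ij j C_nonzero algebraic_int_C unit in simp)
  then obtain h where h: "alg_coeffs h" "\<And>i. i \<in> I \<Longrightarrow> poly h (B i) = 1 / C i j" using dC by auto
  define g' where "g' = synthetic_div g (B j) * h"
  have g': "alg_coeffs g'" unfolding g'_def
    by (intro alg_coeffs_mult alg_coeffs_synthetic_div insert.prems h(1) algebraic_int_B)
  obtain p where p: "alg_coeffs p" "degree p \<le> card I - 1" "\<And>i. i \<in> I \<Longrightarrow> poly p (A i) = poly g' (B i)"
    using insert.IH[OF sub g'] by blast
  have gj: "algebraic_int (poly g (B j))"
    by (rule algebraic_int_poly) (use insert.prems algebraic_int_B in \<open>simp_all add: alg_coeffs_def\<close>)
  define r where "r = [:poly g (B j):] + (if I = {} then 0 else [:- A j, 1:] * p)"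
  have "alg_coeffs ([:- A j, 1:] * p)"
    by (rule alg_coeffs_mult[OF _ p(1)]) (simp add: alg_coeffs_pCons alg_coeffs_0 algebraic_int_A)
  moreover have "alg_coeffs [:poly g (B j):]" using gj by (simp add: alg_coeffs_pCons alg_coeffs_0)
  ultimately have "alg_coeffs r" unfolding r_def
    by (auto simp: alg_coeffs_add simp del: mult_pCons_left)
  moreover have "degree r \<le> card (insert j I) - 1"
  proof (cases "I = {}")
    case False
    hence c0: "card I > 0" using insert.hyps by auto
    have "degree ([:- A j, 1:] * p) \<le> 1 + degree p" by (rule order_trans[OF degree_mult_le]) simp
    hence "degree ([:- A j, 1:] * p) \<le> card I" using p(2) c0 by linarith
    thus ?thesis using False insert.hyps unfolding r_def by (intro degree_add_le) simp_all
  qed (simp add: r_def)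
  moreover have "poly r (A i) = poly g (B i)" if "i \<in> insert j I" for i
  proof (cases "i = j")
    case False
    hence i: "i \<in> I" using that by simp
    have "poly r (A i) = poly g (B j) + (A i - A j) * poly g' (B i)"
      using i p(3) by (auto simp: r_def left_diff_distrib)
    also have "(A i - A j) * poly g' (B i) = (B i - B j) * poly (synthetic_div g (B j)) (B i)"
      using C_nonzero[OF ij(1)[OF i] ij(2)[OF i] j] h(2)[OF i] by (simp add: g'_def C_eq)
    also have "\<dots> = poly g (B i) - poly g (B j)" by (simp only: poly_synthetic_div)
    finally show ?thesis by simp
  qed (simp add: r_def)
  ultimately show ?case by blast
qed

text \<open>A product of integral elements is a unit only if all factors are. Interpolating the values \<open>B i\<close> at
  the \<open>A i\<close> then recovers \<open>b\<close>, with integral coefficients.\<close>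

lemma integral_coeffs_if_unit:
  assumes "J {1..<n} = 1 \<or> J {1..<n} = -1"
  obtains g where "b = map_poly of_int g"
proof -
  have unit': "algebraic_int (1 / C i j)" if ij: "i < j" "j < n" for i j
  proof -
    define R where "R = (\<Prod>(i,j)\<in>diff_pairs n {1..<n} - {(i,j)}. C i j)"
    have mem: "(i, j) \<in> diff_pairs n {1..<n}" using ij by (auto simp: diff_pairs_def)
    have "J {1..<n} = C i j * R"
      unfolding J_def R_def by (subst prod.remove[OF finite_diff_pairs mem]) simp
    moreover have "J {1..<n} * J {1..<n} = 1" using assms by auto
    ultimately have "C i j * (R * J {1..<n}) = 1" by (metis mult.assoc)
    hence "1 / C i j = R * J {1..<n}" by (metis mult_zero_left nonzero_mult_div_cancel_left zero_neq_one)
    moreover have "algebraic_int R" unfolding R_def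
      by (rule algebraic_int_prod) (simp add: case_prod_beta algebraic_int_C)
    ultimately show ?thesis by (simp add: algebraic_int_mult algebraic_int_J)
  qed
  have unit: "algebraic_int (1 / C i j)" if ij: "i \<noteq> j" "i < n" "j < n" for i j
    using unit'[of i j] unit'[of j i] C_sym[OF ij] ij by (cases "i < j") auto
  have "\<exists>p. alg_coeffs p \<and> degree p \<le> card {..<n} - 1 \<and> (\<forall>i\<in>{..<n}. poly p (A i) = poly [:0,1:] (B i))"
    by (rule integral_interpolation[OF unit]) (simp_all add: alg_coeffs_pCons alg_coeffs_0)
  then obtain p where p: "alg_coeffs p" "degree p \<le> n - 1" "\<And>i. i < n \<Longrightarrow> poly p (A i) = B i" by auto
  have inj: "inj_on A {..<n}" using A_distinct by (auto simp: inj_on_def)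
  have eq: "map_poly of_rat b = p"
  proof (rule poly_eqI_degree[of "A ` {..<n}"])
    show "card (A ` {..<n}) > degree p" using p(2) n_pos by (simp add: card_image[OF inj])
    show "card (A ` {..<n}) > degree (map_poly of_rat b :: complex poly)"
      using deg_b by (simp add: card_image[OF inj])
    fix x assume "x \<in> A ` {..<n}"
    thus "rat_eval b x = poly p x" using p(3) by (auto simp: B_def)
  qed
  have "coeff b k \<in> \<int>" for k
  proof -
    have "algebraic_int (coeff p k)" using p(1) by (simp add: alg_coeffs_def)
    moreover have "coeff p k = of_rat (coeff b k)" unfolding eq[symmetric] by (simp add: coeff_map_poly)
    ultimately have "algebraic_int (of_rat (coeff b k) :: complex)" by simp
    hence "(of_rat (coeff b k) :: complex) \<in> \<int>" by (rule rational_algebraic_int_is_int) simp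
    then obtain z where "(of_rat (coeff b k) :: complex) = of_int z" by (auto elim: Ints_cases)
    hence "(of_rat (coeff b k) :: complex) = of_rat (of_int z)" by simp
    hence "coeff b k = of_int z" by (simp only: of_rat_eq_iff)
    thus ?thesis by simp
  qed
  hence "b = map_poly of_int (map_poly floor b)"
    by (intro poly_eqI) (metis coeff_map_poly floor_of_int floor_zero Ints_cases of_int_0)
  thus ?thesis by (rule that)
qed

end

section \<open>Monogenic fields that are not alpha-monogenic\<close>

lemma cong_imp_eq_int:
  fixes x y m :: int
  assumes "[x = y] (mod m)" "\<bar>x\<bar> \<le> K" "\<bar>y\<bar> \<le> K" "2 * K < \<bar>m\<bar>"
  shows "x = y"
proof (rule ccontr)
  assume "x \<noteq> y"
  hence "\<bar>m\<bar> \<le> \<bar>x - y\<bar>" using assms(1) by (intro dvd_imp_le_int) (auto simp: cong_iff_dvd_diff)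
  thus False using assms(2-4) by linarith
qed

lemma prime_power_or_coprime_product:
  assumes "n > (1::nat)"
  obtains q k where "prime q" "k > 0" "n = q ^ k"
  | u v where "coprime u v" "u > 1" "v > 1" "n = u * v"
proof -
  obtain q where q: "prime q" "q dvd n" using prime_factor_nat[of n] assms by auto
  define k where "k = multiplicity q n"
  have q1: "\<not> is_unit q" using q(1) not_prime_unit by blast
  obtain v where v: "n = q ^ k * v" "\<not> q dvd v"
    using assms q1 unfolding k_def by (metis multiplicity_decompose' not_one_less_zero)
  have k: "k > 0" using q q1 assms unfolding k_def by (simp add: multiplicity_gt_zero_iff)
  show ?thesis
  proof (cases "v = 1")
    case True
    thus ?thesis using that(1)[OF q(1) k] v by simp
  next
    case False
    have "v \<noteq> 0" using v(1) assms by (metis mult_0_right not_one_less_zero)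
    hence "v > 1" using False by simp
    moreover have "coprime (q ^ k) v" using prime_imp_coprime[OF q(1) v(2)] by simp
    moreover have "q ^ k > 1" by (rule one_less_power[OF prime_gt_1_nat[OF q(1)] k])
    ultimately show ?thesis using that(2) v by blast
  qed
qed

lemma int_unit_power_cases:
  fixes j :: int assumes "is_unit (j ^ k)" "k \<noteq> 0" shows "j = 1 \<or> j = -1"
proof -
  have "is_unit j" using assms is_unit_power_iff[of j k] by simp
  hence "\<bar>j\<bar> = 1" by simp
  thus ?thesis by linarith
qed

context generated_pure_field
begin

lemma J_integer_data:
  assumes D: "galois_stable n D" and j: "J D = of_int j" and E: "(\<Prod>d\<in>D. 1 - \<zeta> ^ d) = of_nat E"
  shows "j ^ 2 dvd int E ^ n"
proof -
  have "j ^ 2 dvd int E ^ n * m ^ card D"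
    by (rule J_squared_dvd[OF D j]) (simp add: E)
  moreover have "coprime j m" using J_congruence D j by metis
  hence "coprime (j ^ 2) (m ^ card D)" by simp
  ultimately show ?thesis by (simp add: coprime_dvd_mult_left_iff)
qed

lemma abs_le_if_square_dvd:
  fixes j :: int assumes "j ^ 2 dvd int E ^ k" "E > 0" shows "\<bar>j\<bar> \<le> int E ^ k"
proof -
  have "\<bar>j\<bar> \<le> j ^ 2"
  proof (cases "j = 0")
    case False
    hence "\<bar>j\<bar> * 1 \<le> \<bar>j\<bar> * \<bar>j\<bar>" by (intro mult_left_mono) auto
    thus ?thesis by (simp add: power2_eq_square)
  qed simp
  also have "\<bar>j ^ 2\<bar> \<le> \<bar>int E ^ k\<bar>" using assms by (intro dvd_imp_le_int) auto
  hence "j ^ 2 \<le> int E ^ k" by simp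
  finally show ?thesis .
qed

lemma abs_power_le:
  fixes j :: int assumes "j ^ 2 dvd int E ^ n" "0 < E" "E \<le> n" "k \<le> 2 * n"
  shows "\<bar>j ^ k\<bar> \<le> int n ^ (n * (2 * n))"
proof -
  have "\<bar>j\<bar> \<le> int n ^ n"
    using abs_le_if_square_dvd[OF assms(1,2)] power_mono[of "int E" "int n" n] assms(3) by simp
  hence "\<bar>j\<bar> ^ k \<le> (int n ^ n) ^ k" by (intro power_mono) auto
  also have "\<dots> \<le> (int n ^ n) ^ (2 * n)"
    using n_pos assms(4) by (intro power_increasing) auto
  finally show ?thesis by (simp add: power_abs power_mult)
qed

text \<open>The size bound \<open>n\<^sup>n\<close> for all the integers \<open>J D\<close> in question turns a congruence modulo a large \<open>m\<close>
  into an equality. The exponents that occur are at most \<open>2n\<close>.\<close>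

lemma powers_eq_if_cong:
  fixes i j :: int
  assumes c: "[i ^ k = j ^ l] (mod m)" and i: "i ^ 2 dvd int E ^ n" "0 < E" "E \<le> n"
    and j: "j ^ 2 dvd int F ^ n" "0 < F" "F \<le> n" and kl: "k \<le> 2 * n" "l \<le> 2 * n"
    and big: "2 * int n ^ (n * (2 * n)) < \<bar>m\<bar>"
  shows "i ^ k = j ^ l"
  by (rule cong_imp_eq_int[OF c abs_power_le[OF i kl(1)] abs_power_le[OF j kl(2)] big])

text \<open>The numbers of pairs for the differences of order dividing \<open>u\<close>, \<open>v\<close> and \<open>n\<close> are proportional to \<open>u - 1\<close>, \<open>v - 1\<close> and
  \<open>n - 1\<close>. Therefore the integers for \<open>u\<close> and \<open>v\<close> have a common power. They divide powers of \<open>u\<close> and of \<open>v\<close>, so they are coprime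
  and hence units, and the integer for \<open>n\<close> has a power in common with them.\<close>

lemma J_unit_if_coprime_product:
  assumes uv: "coprime u v" "u > 1" "v > 1" "n = u * v" and big: "2 * int n ^ (n * (2 * n)) < \<bar>m\<bar>"
  shows "J {1..<n} = 1 \<or> J {1..<n} = -1"
proof -
  obtain x where x: "\<And>D j. galois_stable n D \<Longrightarrow> J D = of_int j \<Longrightarrow>
    [j = x ^ card (diff_pairs n D)] (mod m) \<and> coprime j m" using J_congruence by blast
  define Du Dv Dn where "Du = order_dividing n u" and "Dv = order_dividing n v" and "Dn = order_dividing n n"
  have gs: "galois_stable n Du" "galois_stable n Dv" "galois_stable n Dn"
    by (simp_all add: Du_def Dv_def Dn_def galois_stable_order_dividing)
  obtain ju where ju: "J Du = of_int ju" using integer_J[OF gs(1)] .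
  obtain jv where jv: "J Dv = of_int jv" using integer_J[OF gs(2)] .
  obtain jn where jn: "J Dn = of_int jn" using integer_J[OF gs(3)] .
  have n': "n = v * u" "n = n * 1" using uv by auto
  have cu: "2 * card (diff_pairs n Du) = n * (u - 1)"
    using card_diff_pairs[OF gs(1)] card_order_dividing[OF uv(4) n_pos] by (simp add: Du_def)
  have cv: "2 * card (diff_pairs n Dv) = n * (v - 1)"
    using card_diff_pairs[OF gs(2)] card_order_dividing[OF n'(1) n_pos] by (simp add: Dv_def)
  have cn: "2 * card (diff_pairs n Dn) = n * (n - 1)"
    using card_diff_pairs[OF gs(3)] card_order_dividing[OF n'(2) n_pos] by (simp add: Dn_def)
  have du: "ju ^ 2 dvd int u ^ n" using J_integer_data[OF gs(1) ju] prod_order_dividing[OF zeta uv(4) n_pos] by (simp add: Du_def)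
  have dv: "jv ^ 2 dvd int v ^ n" using J_integer_data[OF gs(2) jv] prod_order_dividing[OF zeta n'(1) n_pos] by (simp add: Dv_def)
  have dn: "jn ^ 2 dvd int n ^ n" using J_integer_data[OF gs(3) jn] prod_order_dividing[OF zeta n'(2) n_pos] by (simp add: Dn_def)
  have un: "u \<le> n" "v \<le> n" using uv by auto
  have "[ju ^ (2 * (v - 1)) = (x ^ card (diff_pairs n Du)) ^ (2 * (v - 1))] (mod m)"
    using x[OF gs(1) ju] by (intro cong_pow) blast
  also have "(x ^ card (diff_pairs n Du)) ^ (2 * (v - 1)) = x ^ (2 * card (diff_pairs n Du) * (v - 1))"
    by (simp only: power_mult[symmetric] mult_ac)
  also have "2 * card (diff_pairs n Du) * (v - 1) = 2 * card (diff_pairs n Dv) * (u - 1)"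
    unfolding cu cv by simp
  also have "x ^ (2 * card (diff_pairs n Dv) * (u - 1)) = (x ^ card (diff_pairs n Dv)) ^ (2 * (u - 1))"
    by (simp only: power_mult[symmetric] mult_ac)
  also have "[\<dots> = jv ^ (2 * (u - 1))] (mod m)"
    using x[OF gs(2) jv] by (intro cong_pow) (blast intro: cong_sym)
  finally have "ju ^ (2 * (v - 1)) = jv ^ (2 * (u - 1))"
    by (rule powers_eq_if_cong[OF _ du _ un(1) dv _ un(2) _ _ big]) (use uv(2,3) un in linarith)+
  moreover have "coprime ju jv"
  proof -
    have "coprime (int u ^ n) (int v ^ n)" using uv(1) by simp
    hence "coprime (ju ^ 2) (jv ^ 2)" using du dv coprime_divisors by blast
    thus ?thesis by simp
  qed
  hence "coprime (ju ^ (2 * (v - 1))) (jv ^ (2 * (u - 1)))" by simp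
  ultimately have "is_unit (ju ^ (2 * (v - 1)))" by simp
  moreover have "2 * (v - 1) \<noteq> 0" using uv(3) by simp
  ultimately have "ju = 1 \<or> ju = -1" by (rule int_unit_power_cases)
  hence ju1: "ju ^ 2 = 1" by (elim disjE) simp_all
  have "[jn ^ (2 * (u - 1)) = (x ^ card (diff_pairs n Dn)) ^ (2 * (u - 1))] (mod m)"
    using x[OF gs(3) jn] by (intro cong_pow) blast
  also have "(x ^ card (diff_pairs n Dn)) ^ (2 * (u - 1)) = x ^ (2 * card (diff_pairs n Dn) * (u - 1))"
    by (simp only: power_mult[symmetric] mult_ac)
  also have "2 * card (diff_pairs n Dn) * (u - 1) = 2 * card (diff_pairs n Du) * (n - 1)"
    unfolding cu cn by simp
  also have "x ^ (2 * card (diff_pairs n Du) * (n - 1)) = (x ^ card (diff_pairs n Du)) ^ (2 * (n - 1))"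
    by (simp only: power_mult[symmetric] mult_ac)
  also have "[\<dots> = ju ^ (2 * (n - 1))] (mod m)"
    using x[OF gs(1) ju] by (intro cong_pow) (blast intro: cong_sym)
  finally have "jn ^ (2 * (u - 1)) = ju ^ (2 * (n - 1))"
    by (rule powers_eq_if_cong[OF _ dn n_pos le_refl du _ un(1) _ _ big]) (use uv(2,3) un in linarith)+
  also have "\<dots> = 1" using ju1 by (simp add: power_mult)
  finally have "jn ^ (2 * (u - 1)) = 1" .
  hence "is_unit (jn ^ (2 * (u - 1)))" by simp
  moreover have "2 * (u - 1) \<noteq> 0" using uv(2) by simp
  ultimately have "jn = 1 \<or> jn = -1" by (rule int_unit_power_cases)
  thus ?thesis using jn by (auto simp: Dn_def order_dividing_self)
qed

text \<open>The integer for the differences of order \<open>q\<close> is, up to sign, a power \<open>q\<^sup>e\<close>. It is not a unit, because it has a power in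
  common with the integer for all differences. The differences of order exactly \<open>n\<close> give a divisor of a power of
  \<open>q\<close> whose square is, again by size, a power of \<open>q\<^sup>e\<close>, and this bounds \<open>e\<close> by \<open>q/2\<close>. Modulo \<open>m\<close> the number \<open>\<plusminus>q\<^sup>e\<close> is an \<open>N\<close>-th
  power with \<open>N = n(q - 1)/2\<close> divisible by \<open>q\<close>.\<close>

lemma prime_power_residue:
  assumes q: "prime q" and k: "k > 0" and nq: "n = q ^ k" and n3: "n \<ge> 3"
    and big: "2 * int n ^ (n * (2 * n)) < \<bar>m\<bar>"
    and nonunit: "\<not> (J {1..<n} = 1 \<or> J {1..<n} = -1)"
  shows "\<exists>c\<in>{int q, - int q}. \<forall>p. prime p \<longrightarrow> p dvd m \<longrightarrow> (\<exists>x. [x ^ q = c] (mod p))"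
proof -
  obtain x where x: "\<And>D j. galois_stable n D \<Longrightarrow> J D = of_int j \<Longrightarrow>
    [j = x ^ card (diff_pairs n D)] (mod m) \<and> coprime j m" using J_congruence by blast
  define Q where "Q = q ^ (k - 1)"
  have q2: "q \<ge> 2" using prime_ge_2_nat[OF q] .
  have nQ: "n = q * Q" unfolding nq Q_def using k by (cases k) auto
  have nQ': "n = Q * q" using nQ by simp
  have Q0: "Q > 0" using nQ n_pos by (cases Q) auto
  define Dq DQ Dn DR where "Dq = order_dividing n q" and "DQ = order_dividing n Q"
    and "Dn = order_dividing n n" and "DR = Dn - DQ"
  have gs: "galois_stable n Dq" "galois_stable n DQ" "galois_stable n Dn"
    by (simp_all add: Dq_def DQ_def Dn_def galois_stable_order_dividing)
  have gsR: "galois_stable n DR" unfolding DR_def by (intro galois_stable_Diff gs)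
  have n': "n = n * 1" by simp
  have QS: "DQ \<subseteq> Dn" "finite Dn" "finite DQ" by (auto simp: DQ_def Dn_def order_dividing_def)
  obtain jq where jq: "J Dq = of_int jq" using integer_J[OF gs(1)] .
  obtain jR where jR: "J DR = of_int jR" using integer_J[OF gsR] .
  obtain jn where jn: "J Dn = of_int jn" using integer_J[OF gs(3)] .
  have cq: "2 * card (diff_pairs n Dq) = n * (q - 1)"
    using card_diff_pairs[OF gs(1)] card_order_dividing[OF nQ n_pos] by (simp add: Dq_def)
  have cn: "2 * card (diff_pairs n Dn) = n * (n - 1)"
    using card_diff_pairs[OF gs(3)] card_order_dividing[OF n' n_pos] by (simp add: Dn_def)
  have cR: "2 * card (diff_pairs n DR) = n * (q - 1) * Q"
  proof -
    have "card DR = (n - 1) - (Q - 1)"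
      unfolding DR_def using QS card_order_dividing[OF n' n_pos] card_order_dividing[OF nQ' n_pos]
      by (subst card_Diff_subset) (auto simp: DQ_def Dn_def)
    also have "\<dots> = n - Q" using Q0 by simp
    also have "\<dots> = (q - 1) * Q" by (simp add: nQ diff_mult_distrib)
    finally show ?thesis using card_diff_pairs[OF gsR] by simp
  qed
  have dq: "jq ^ 2 dvd int q ^ n" using J_integer_data[OF gs(1) jq] prod_order_dividing[OF zeta nQ n_pos] by (simp add: Dq_def)
  have dn: "jn ^ 2 dvd int n ^ n" using J_integer_data[OF gs(3) jn] prod_order_dividing[OF zeta n' n_pos] by (simp add: Dn_def)
  have dR: "jR ^ 2 dvd int q ^ n"
  proof (rule J_integer_data[OF gsR jR])
    have "of_nat n = (\<Prod>d\<in>Dn. 1 - \<zeta> ^ d)" using prod_order_dividing[OF zeta n' n_pos] by (simp add: Dn_def)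
    also have "\<dots> = (\<Prod>d\<in>DR. 1 - \<zeta> ^ d) * (\<Prod>d\<in>DQ. 1 - \<zeta> ^ d)"
      unfolding DR_def using QS by (intro prod.subset_diff) auto
    also have "(\<Prod>d\<in>DQ. 1 - \<zeta> ^ d) = of_nat Q" unfolding DQ_def by (rule prod_order_dividing[OF zeta nQ' n_pos])
    finally have "(\<Prod>d\<in>DR. 1 - \<zeta> ^ d) * of_nat Q = of_nat q * of_nat Q" using nQ by (metis of_nat_mult)
    moreover have "of_nat Q \<noteq> (0 :: complex)" using Q0 by simp
    ultimately show "(\<Prod>d\<in>DR. 1 - \<zeta> ^ d) = of_nat q" by (metis mult_right_cancel)
  qed
  have qn: "q \<le> n" "Q \<le> n" using nQ Q0 q2 by auto
  have "[jn ^ (2 * (q - 1)) = (x ^ card (diff_pairs n Dn)) ^ (2 * (q - 1))] (mod m)"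
    using x[OF gs(3) jn] by (intro cong_pow) blast
  also have "(x ^ card (diff_pairs n Dn)) ^ (2 * (q - 1)) = x ^ (2 * card (diff_pairs n Dn) * (q - 1))"
    by (simp only: power_mult[symmetric] mult_ac)
  also have "2 * card (diff_pairs n Dn) * (q - 1) = 2 * card (diff_pairs n Dq) * (n - 1)"
    unfolding cq cn by simp
  also have "x ^ (2 * card (diff_pairs n Dq) * (n - 1)) = (x ^ card (diff_pairs n Dq)) ^ (2 * (n - 1))"
    by (simp only: power_mult[symmetric] mult_ac)
  also have "[\<dots> = jq ^ (2 * (n - 1))] (mod m)"
    using x[OF gs(1) jq] by (intro cong_pow) (blast intro: cong_sym)
  finally have jnq: "jn ^ (2 * (q - 1)) = jq ^ (2 * (n - 1))"
    by (rule powers_eq_if_cong[OF _ dn n_pos le_refl dq _ qn(1) _ _ big]) (use q2 qn in linarith)+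
  have "[jR ^ 2 = (x ^ card (diff_pairs n DR)) ^ 2] (mod m)"
    using x[OF gsR jR] by (intro cong_pow) blast
  also have "(x ^ card (diff_pairs n DR)) ^ 2 = x ^ (2 * card (diff_pairs n DR))"
    by (simp only: power_mult[symmetric] mult_ac)
  also have "2 * card (diff_pairs n DR) = 2 * card (diff_pairs n Dq) * Q"
    unfolding cq cR by simp
  also have "x ^ (2 * card (diff_pairs n Dq) * Q) = (x ^ card (diff_pairs n Dq)) ^ (2 * Q)"
    by (simp only: power_mult[symmetric] mult_ac)
  also have "[\<dots> = jq ^ (2 * Q)] (mod m)"
    using x[OF gs(1) jq] by (intro cong_pow) (blast intro: cong_sym)
  finally have jRq: "jR ^ 2 = jq ^ (2 * Q)"
    by (rule powers_eq_if_cong[OF _ dR _ qn(1) dq _ qn(1) _ _ big]) (use q2 qn in linarith)+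
  have pq: "prime (int q)" using q by simp
  have "nat \<bar>jq\<bar> dvd q ^ n"
  proof -
    have "jq dvd int q ^ n" using dq by (metis dvd_trans dvd_triv_left power2_eq_square)
    thus ?thesis by (metis abs_dvd_iff nat_abs_dvd_iff of_nat_power int_dvd_int_iff nat_0_le abs_ge_zero)
  qed
  then obtain e where e: "nat \<bar>jq\<bar> = q ^ e" using divides_primepow_nat[OF q] by auto
  hence e': "\<bar>jq\<bar> = int q ^ e" by (metis abs_ge_zero nat_0_le of_nat_power)
  have e0: "e > 0"
  proof (rule ccontr)
    assume "\<not> e > 0"
    hence "jq ^ 2 = 1" using e' by (auto simp: abs_if split: if_splits)
    hence "jn ^ (2 * (q - 1)) = 1" using jnq by (simp add: power_mult)
    hence "is_unit (jn ^ (2 * (q - 1)))" by simp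
    moreover have "2 * (q - 1) \<noteq> 0" using q2 by simp
    ultimately have "jn = 1 \<or> jn = -1" by (rule int_unit_power_cases)
    thus False using jn nonunit by (auto simp: Dn_def order_dividing_self)
  qed
  have e_le: "2 * e \<le> q"
  proof -
    have "\<bar>jq\<bar> ^ (2 * Q) dvd int q ^ n" using dR unfolding jRq by (simp add: power_even_abs)
    hence "int q ^ (e * (2 * Q)) dvd int q ^ (q * Q)" unfolding e' nQ by (simp add: power_mult)
    hence "int q ^ (e * (2 * Q)) \<le> int q ^ (q * Q)" using q2 by (intro zdvd_imp_le) auto
    hence "e * (2 * Q) \<le> q * Q" using q2 by (subst (asm) power_increasing_iff) auto
    thus ?thesis using Q0 by (metis mult.assoc mult.commute mult_le_cancel2)
  qed
  define N where "N = card (diff_pairs n Dq)"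
  have jx: "[jq = x ^ N] (mod p)" if "p dvd m" for p
    using x[OF gs(1) jq] that unfolding N_def by (meson cong_dvd_modulus)
  show ?thesis
  proof (cases "q = 2")
    case True
    \<comment> \<open>Here \<open>N = n/2\<close>, which is even because \<open>n \<ge> 3\<close> is a power of two.\<close>
    have "e = 1" using e0 e_le True by linarith
    hence "jq \<in> {int q, - int q}" using e' by (auto simp: abs_if split: if_splits)
    moreover have "\<exists>y. [y ^ q = jq] (mod p)" if "p dvd m" for p
    proof -
      have "k \<noteq> 1" using n3 True unfolding nq by auto
      hence "2 ^ 2 dvd n" unfolding nq True using k by (intro le_imp_power_dvd) auto
      hence "4 dvd 2 * N" using cq True by (simp add: N_def)
      then obtain r where "2 * N = 4 * r" by (auto elim: dvdE)
      hence "N = r * 2" by simp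
      hence "x ^ N = (x ^ r) ^ q" using True by (simp add: power_mult)
      thus ?thesis using jx[OF that] by (metis cong_sym)
    qed
    ultimately show ?thesis by blast
  next
    case False
    hence oddq: "odd q" using q by (simp add: prime_odd_nat q2 less_le)
    \<comment> \<open>As \<open>e\<close> is prime to \<open>q\<close>, a power of \<open>q\<^sup>e\<close> is \<open>q\<close> times a \<open>q\<close>-th power. The sign of \<open>jq\<close> is a \<open>q\<close>-th power itself.\<close>
    have "e < q" using e_le e0 by linarith
    hence "coprime e q" using q e0 by (metis coprime_commute prime_imp_coprime nat_dvd_not_less)
    then obtain f where f: "[e * f = 1] (mod q)" using cong_solve_coprime_nat by auto
    have "e * f mod q = 1" using f q2 by (simp add: cong_iff_mod)
    then obtain h where h: "e * f = q * h + 1" by (metis mult_div_mod_eq)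
    have "q dvd n * (q - 1)" unfolding nQ by simp
    hence "q dvd 2 * N" unfolding N_def cq .
    hence "q dvd N" using oddq q by (metis coprime_dvd_mult_right_iff coprime_commute coprime_left_2_iff_odd)
    then obtain N' where N': "N = N' * q" by (metis dvd_def mult.commute)
    have "\<exists>y. [y ^ q = int q] (mod p)" if p: "prime p" "p dvd m" for p :: int
    proof -
      define z where "z = sgn jq * x ^ N'"
      have "sgn jq ^ q = sgn jq" using oddq q2 by (cases "jq = 0") (auto simp: sgn_if)
      hence "z ^ q = sgn jq * x ^ N" by (simp add: z_def N' power_mult_distrib power_mult)
      moreover have "[sgn jq * jq = sgn jq * x ^ N] (mod p)" by (intro cong_scalar_left jx p)
      moreover have "sgn jq * jq = int q ^ e" using e' by (metis abs_sgn mult.commute)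
      ultimately have "[int q ^ e = z ^ q] (mod p)" by simp
      hence "[(int q ^ e) ^ f = (z ^ q) ^ f] (mod p)" by (rule cong_pow)
      moreover have "(int q ^ e) ^ f = int q * (int q ^ h) ^ q"
        by (simp only: power_mult[symmetric] h) (simp add: power_add power_mult mult.commute)
      moreover have "(z ^ q) ^ f = (z ^ f) ^ q" by (simp only: power_mult[symmetric] mult.commute)
      ultimately have c1: "[int q * (int q ^ h) ^ q = (z ^ f) ^ q] (mod p)" by simp
      have "coprime jq p" using x[OF gs(1) jq] p(2) by (meson coprime_divisors dvd_refl)
      hence "coprime \<bar>jq\<bar> p" by simp
      hence "coprime (int q) p" unfolding e' using e0 by simp
      hence "coprime (int q ^ h) p" by simp
      then obtain r where r: "[int q ^ h * r = 1] (mod p)" using cong_solve_coprime_int by blast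
      have "[(z ^ f * r) ^ q = int q * (int q ^ h) ^ q * r ^ q] (mod p)"
        unfolding power_mult_distrib by (intro cong_scalar_right cong_sym[OF c1])
      also have "int q * (int q ^ h) ^ q * r ^ q = int q * (int q ^ h * r) ^ q" by (simp add: power_mult_distrib)
      also have "[\<dots> = int q * 1 ^ q] (mod p)" by (intro cong_scalar_left cong_pow r)
      finally show ?thesis by auto
    qed
    thus ?thesis by blast
  qed
qed

end

text \<open>Subfields contain all rational numbers.\<close>

lemma subfield_rat_eval:
  assumes S: "is_subfield S" and x: "x \<in> S"
  shows "rat_eval p x \<in> S"
proof -
  have add: "u + v \<in> S" and mult: "u * v \<in> S" and neg: "- u \<in> S" and inv: "inverse u \<in> S"
    if "u \<in> S" "v \<in> S" for u v using S that unfolding is_subfield_def by auto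
  have 01: "0 \<in> S" "1 \<in> S" using S unfolding is_subfield_def by auto
  have nat: "of_nat k \<in> S" for k by (induction k) (use add 01 in auto)
  have int: "of_int k \<in> S" for k
    using nat[of "nat k"] neg[OF nat[of "nat (- k)"] 01(1)] by (cases "k \<ge> 0") auto
  have rat: "of_rat r \<in> S" for r
  proof -
    obtain u v where "quotient_of r = (u, v)" by (cases "quotient_of r")
    hence "r = of_int u / of_int v" by (rule quotient_of_div)
    hence "of_rat r = (of_int u * inverse (of_int v) :: complex)" by (simp add: of_rat_divide field_simps)
    thus ?thesis using mult[OF int inv[OF int 01(1)]] by simp
  qed
  show ?thesis
  proof (induction p)
    case (pCons r p)
    have "rat_eval (pCons r p) x = of_rat r + x * rat_eval p x" by (simp add: hom_distribs)
    thus ?case using add[OF rat mult[OF x pCons.IH]] by simp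
  qed (use 01 in simp)
qed

context pure_field
begin

lemma rat_adjoin_eq: "rat_adjoin a = range (\<lambda>p. rat_eval p a)"
proof
  have sub: "is_subfield (range (\<lambda>p. rat_eval p a))"
    unfolding is_subfield_def
  proof (intro conjI ballI)
    show "0 \<in> range (\<lambda>p. rat_eval p a)" by (rule range_eqI[of _ _ 0]) simp
    show "1 \<in> range (\<lambda>p. rat_eval p a)" by (rule range_eqI[of _ _ 1]) simp
    fix x assume "x \<in> range (\<lambda>p. rat_eval p a)"
    then obtain p where p: "x = rat_eval p a" by auto
    show "- x \<in> range (\<lambda>p. rat_eval p a)"
      by (rule range_eqI[of _ _ "Polynomial.smult (-1) p"]) (simp only: p rat_eval_smult, simp)
    show "inverse x \<in> range (\<lambda>p. rat_eval p a)"
    proof (cases "x = 0")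
      case True
      thus ?thesis by (intro range_eqI[of _ _ 0]) simp
    next
      case False
      hence nd: "\<not> pure_poly n m dvd p" using pure_poly_dvd_iff p by blast
      have "prime_elem (pure_poly n m :: rat poly)" using irred by (simp add: irreducible_imp_prime_elem)
      hence "coprime (pure_poly n m) p" using nd by (simp add: prime_elem_imp_coprime)
      hence "gcd (pure_poly n m) p = 1" by simp
      then obtain u v where "u * pure_poly n m + v * p = 1" using bezout_coefficients_fst_snd by metis
      hence "rat_eval (u * pure_poly n m + v * p) a = 1" by simp
      hence "rat_eval v a * x = 1" using root by (simp add: p rat_eval_add rat_eval_mult rat_eval_pure_poly)
      hence "inverse x = rat_eval v a" by (metis inverse_unique mult.commute)
      thus ?thesis by simp
    qed
    fix y assume "y \<in> range (\<lambda>p. rat_eval p a)"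
    then obtain r where r: "y = rat_eval r a" by auto
    show "x + y \<in> range (\<lambda>p. rat_eval p a)" by (rule range_eqI[of _ _ "p + r"]) (simp only: p r rat_eval_add)
    show "x * y \<in> range (\<lambda>p. rat_eval p a)" by (rule range_eqI[of _ _ "p * r"]) (simp only: p r rat_eval_mult)
  qed
  have "rat_eval (monom 1 1) a = a" by (simp add: poly_monom)
  hence "a \<in> range (\<lambda>p. rat_eval p a)" by (metis rangeI)
  thus "rat_adjoin a \<subseteq> range (\<lambda>p. rat_eval p a)" unfolding rat_adjoin_def using sub
    by (intro hull_minimal) auto
  show "range (\<lambda>p. rat_eval p a) \<subseteq> rat_adjoin a"
    unfolding rat_adjoin_def hull_def using subfield_rat_eval by auto
qed

lemma int_adjoin_subset: "int_adjoin a \<subseteq> ring_of_integers (rat_adjoin a)"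
proof
  fix x assume "x \<in> int_adjoin a"
  then obtain p where p: "x = int_eval p a" unfolding int_adjoin_def by auto
  hence "x = rat_eval (map_poly of_int p) a" by (simp only: rat_eval_of_int)
  hence "x \<in> rat_adjoin a" unfolding rat_adjoin_eq by blast
  thus "x \<in> ring_of_integers (rat_adjoin a)"
    unfolding ring_of_integers_def using algebraic_int_int_eval[OF algebraic_int_a, of p] p by simp
qed

text \<open>If \<open>J {1..<n}\<close> were \<open>\<plusminus>1\<close>, the generator would be an integral polynomial in \<open>a\<close>, and \<open>a\<close> would itself generate the
  ring of integers.\<close>

theorem monogenic_not_alpha_monogenic:
  assumes n3: "n \<ge> 3" and mono: "monogenic (rat_adjoin a)" and nalpha: "\<not> alpha_monogenic a"
    and big: "2 * int n ^ (n * (2 * n)) < \<bar>m\<bar>"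
  shows "\<exists>q. prime q \<and> q dvd n \<and> (\<exists>c\<in>{int q, - int q}. \<forall>p. prime p \<longrightarrow> p dvd m \<longrightarrow> (\<exists>x. [x ^ q = c] (mod p)))"
proof -
  obtain \<theta> where \<theta>: "\<theta> \<in> ring_of_integers (rat_adjoin a)" "ring_of_integers (rat_adjoin a) = int_adjoin \<theta>"
    using mono unfolding monogenic_def by blast
  obtain b0 where b0: "\<theta> = rat_eval b0 a" using \<theta>(1) unfolding ring_of_integers_def rat_adjoin_eq by auto
  obtain b where b: "degree b < n" "\<And>i. rat_eval b0 (a * \<zeta> ^ i) = rat_eval b (a * \<zeta> ^ i)"
    using rat_eval_reduce[of b0] by blast
  have \<theta>b: "\<theta> = rat_eval b a" using b(2)[of 0] b0 by simp
  have \<theta>int: "algebraic_int \<theta>" using \<theta>(1) by (simp add: ring_of_integers_def)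
  have "int_eval (monom 1 1) a = a" by (simp add: poly_monom)
  hence "a \<in> int_adjoin a" unfolding int_adjoin_def by (metis rangeI)
  hence "a \<in> int_adjoin \<theta>" using int_adjoin_subset \<theta>(2) by blast
  then obtain c where c: "int_eval c \<theta> = a" unfolding int_adjoin_def by auto
  interpret generated_pure_field n m a \<zeta> b c
    using b(1) \<theta>b \<theta>int c by unfold_locales auto
  have nonunit: "\<not> (J {1..<n} = 1 \<or> J {1..<n} = -1)"
  proof
    assume "J {1..<n} = 1 \<or> J {1..<n} = -1"
    then obtain g where g: "b = map_poly of_int g" using integral_coeffs_if_unit by blast
    have "int_adjoin \<theta> \<subseteq> int_adjoin a"
    proof
      fix x assume "x \<in> int_adjoin \<theta>"
      then obtain p where "x = int_eval p \<theta>" unfolding int_adjoin_def by auto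
      hence "x = int_eval (pcompose p g) a" by (simp only: \<theta>b g rat_eval_of_int int_eval_pcompose)
      thus "x \<in> int_adjoin a" unfolding int_adjoin_def by blast
    qed
    hence "alpha_monogenic a" unfolding alpha_monogenic_def using \<theta>(2) int_adjoin_subset by blast
    thus False using nalpha by blast
  qed
  have "n > 1" using n2 by simp
  thus ?thesis
  proof (cases rule: prime_power_or_coprime_product)
    case (1 q k)
    have "q dvd n" using 1 by simp
    thus ?thesis using prime_power_residue[OF 1 n3 big nonunit] 1(1) by blast
  next
    case (2 u v)
    thus ?thesis using J_unit_if_coprime_product[OF 2 big] nonunit by blast
  qed
qed

end

section \<open>Irreducibility and norms\<close>

lemma prod_mset_power: "(\<Prod>x\<in>#R. f x) ^ n = (\<Prod>x\<in>#R. (f x :: 'a :: comm_monoid_mult) ^ n)"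
  by (induction R) (auto simp: power_mult_distrib)

text \<open>A proper factor of \<open>X\<^sup>n - m\<close> of degree \<open>d\<close> has a constant term whose \<open>n\<close>-th power is \<open>\<plusminus>m\<^sup>d\<close>. A prime divisor of \<open>m\<close>
  divides this number exactly \<open>d\<close> times, which is not a multiple of \<open>n\<close>.\<close>

lemma irreducible_pure_poly:
  assumes sq: "squarefree m" and m2: "\<bar>m\<bar> \<ge> 2" and n0: "n > 0"
  shows "irreducible (pure_poly n m :: rat poly)"
proof (rule irreducibleI)
  have deg: "degree (pure_poly n m :: rat poly) = n" by (rule degree_pure_poly[OF n0])
  show nz: "pure_poly n m \<noteq> (0 :: rat poly)" using deg n0 by auto
  show "\<not> pure_poly n m dvd (1 :: rat poly)" using deg n0 by (auto simp: poly_dvd_1)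
  fix f g :: "rat poly" assume fg: "pure_poly n m = f * g"
  have fg0: "f \<noteq> 0" "g \<noteq> 0" using nz fg by auto
  have df: "degree f + degree g = n" using deg fg degree_mult_eq[OF fg0] by simp
  have "degree f = 0 \<or> degree g = 0"
  proof (rule ccontr)
    assume "\<not> (degree f = 0 \<or> degree g = 0)"
    hence d: "0 < degree f" "degree f < n" using df by auto
    define F where "F = (map_poly of_rat f :: complex poly)"
    have F0: "F \<noteq> 0" and dF: "degree F = degree f" and lF: "lead_coeff F = of_rat (lead_coeff f)"
      using fg0(1) by (simp_all add: F_def)
    obtain R where R: "size R = degree f" "F = Polynomial.smult (lead_coeff F) (\<Prod>x\<in>#R. [:- x, 1:])"
      using alg_closed_imp_factorization[OF F0] dF by auto
    have root: "x ^ n = of_int m" if "x \<in># R" for x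
    proof -
      have "poly (\<Prod>y\<in>#R. [:- y, 1:]) x = 0" using that by (simp add: poly_prod_mset prod_mset_zero_iff image_iff)
      hence "rat_eval f x = 0" using R(2) unfolding F_def[symmetric] by (metis poly_smult mult_zero_right)
      hence "rat_eval (f * g) x = 0" by (simp add: rat_eval_mult)
      thus ?thesis unfolding fg[symmetric] by (simp add: rat_eval_pure_poly)
    qed
    define r where "r = coeff f 0 / lead_coeff f"
    have "poly F 0 = lead_coeff F * (\<Prod>x\<in>#R. - x)"
      by (subst R(2)) (simp add: poly_prod_mset image_mset.compositionality o_def)
    moreover have "poly F 0 = of_rat (coeff f 0)" by (simp add: F_def poly_0_coeff_0)
    ultimately have "of_rat r = (\<Prod>x\<in>#R. - x)"
      using F0 by (simp add: r_def of_rat_divide lF[symmetric] field_simps)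
    hence "of_rat (r ^ n) = (\<Prod>x\<in>#R. (- x) ^ n)"
      by (simp only: of_rat_power prod_mset_power)
    also have "image_mset (\<lambda>x. (- x) ^ n) R = image_mset (\<lambda>x. (-1) ^ n * of_int m) R"
    proof (rule image_mset_cong)
      fix x assume "x \<in># R"
      have "(- x) ^ n = (-1) ^ n * x ^ n" by (rule power_minus)
      thus "(- x) ^ n = (-1) ^ n * of_int m" by (simp only: root[OF \<open>x \<in># R\<close>])
    qed
    also have "(\<Prod>x\<in>#R. (-1) ^ n * of_int m) = ((-1) ^ n * of_int m :: complex) ^ degree f"
      by (simp only: image_mset_const_eq prod_mset_replicate_mset R(1))
    finally have rn: "of_rat (r ^ n) = (of_int (((-1) ^ n * m) ^ degree f) :: complex)" by simp
    hence "(of_rat r :: complex) ^ n = of_int (((-1) ^ n * m) ^ degree f)" by (simp add: of_rat_power)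
    hence "algebraic_int (of_rat r :: complex)" using algebraic_int_power_root[OF n0] by blast
    hence "(of_rat r :: complex) \<in> \<int>" by (rule rational_algebraic_int_is_int) simp
    then obtain z where "(of_rat r :: complex) = of_int z" by (auto elim: Ints_cases)
    hence "of_int (z ^ n) = (of_int (((-1) ^ n * m) ^ degree f) :: complex)" using rn by (simp add: of_rat_power)
    hence z: "z ^ n = ((-1) ^ n * m) ^ degree f" by (simp only: of_int_eq_iff)
    have m0: "m \<noteq> 0" using m2 by auto
    obtain p where p: "prime p" "p dvd m" using prime_divisor_exists[of m] m2 m0 by auto
    have mult1: "multiplicity p m = 1"
    proof -
      have "multiplicity p m \<le> 1" using squarefree_factorial_semiring''[OF m0] sq p(1) by auto
      moreover have "multiplicity p m > 0" using p m0 by (metis multiplicity_gt_zero_iff not_prime_unit)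
      ultimately show ?thesis by simp
    qed
    have e: "prime_elem p" by (rule prime_imp_prime_elem[OF p(1)])
    have z0: "z \<noteq> 0" using z m0 n0 by (auto simp: power_0_left)
    have "n * multiplicity p z = multiplicity p (z ^ n)" using prime_elem_multiplicity_power_distrib[OF e z0] by simp
    also have "\<dots> = degree f * multiplicity p ((-1) ^ n * m)"
      unfolding z using m0 by (intro prime_elem_multiplicity_power_distrib[OF e]) simp
    also have "multiplicity p ((-1) ^ n * m) = multiplicity p m" by (cases "even n") simp_all
    finally have "n dvd degree f" using mult1 by (metis dvd_triv_left mult.right_neutral)
    thus False using d by (auto dest: dvd_imp_le)
  qed
  thus "f dvd 1 \<or> g dvd 1" using fg0 by (auto simp: is_unit_iff_degree)
qed

lemma prod_add_multiple_second_order: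
  fixes m :: complex
  assumes "finite P" "\<And>x. x \<in> P \<Longrightarrow> algebraic_int (t x)" "\<And>x. x \<in> P \<Longrightarrow> algebraic_int (u x)" "algebraic_int m"
  shows "\<exists>T. algebraic_int T \<and> (\<Prod>x\<in>P. u x + m * t x) =
    (\<Prod>x\<in>P. u x) + m * (\<Sum>x\<in>P. t x * (\<Prod>y\<in>P-{x}. u y)) + m ^ 2 * T"
  using assms(1-3)
proof (induction P rule: finite_induct)
  case empty
  thus ?case by (intro exI[of _ 0]) simp
next
  case (insert x P)
  define S where "S = (\<Sum>y\<in>P. t y * (\<Prod>z\<in>P-{y}. u z))"
  obtain T where T: "algebraic_int T" "(\<Prod>x\<in>P. u x + m * t x) = (\<Prod>x\<in>P. u x) + m * S + m ^ 2 * T"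
    using insert unfolding S_def by auto
  have S: "algebraic_int S" unfolding S_def using insert.prems
    by (intro algebraic_int_sum algebraic_int_mult algebraic_int_prod) auto
  have "(\<Sum>y\<in>insert x P. t y * (\<Prod>z\<in>insert x P-{y}. u z)) = t x * (\<Prod>z\<in>P. u z) + u x * S"
  proof -
    have "(\<Prod>z\<in>insert x P-{y}. u z) = u x * (\<Prod>z\<in>P-{y}. u z)" if "y \<in> P" for y
    proof -
      have "insert x P - {y} = insert x (P - {y})" using that insert.hyps by auto
      thus ?thesis using insert.hyps by simp
    qed
    moreover have "insert x P - {x} = P" using insert.hyps by auto
    ultimately show ?thesis using insert.hyps by (simp add: S_def sum_distrib_left mult_ac)
  qed
  note S' = this
  have "(\<Prod>x\<in>insert x P. u x + m * t x) = (u x + m * t x) * ((\<Prod>x\<in>P. u x) + m * S + m ^ 2 * T)"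
    using insert T by simp
  also have "\<dots> = (\<Prod>x\<in>insert x P. u x) + m * (t x * (\<Prod>z\<in>P. u z) + u x * S)
      + m ^ 2 * (u x * T + t x * S + m * t x * T)"
    using insert(1,2) by (simp add: algebra_simps power2_eq_square)
  finally have "(\<Prod>x\<in>insert x P. u x + m * t x) = (\<Prod>x\<in>insert x P. u x)
      + m * (\<Sum>y\<in>insert x P. t y * (\<Prod>z\<in>insert x P-{y}. u z)) + m ^ 2 * (u x * T + t x * S + m * t x * T)"
    by (simp only: S')
  moreover have "algebraic_int (u x * T + t x * S + m * t x * T)"
    using insert.prems T S assms(4) by (simp add: algebraic_int_add algebraic_int_mult)
  ultimately show ?case by blast
qed

context pure_field
begin

text \<open>The index map \<open>i \<mapsto> s + ti\<close> permutes the residues modulo \<open>n\<close>.\<close>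

lemma prod_conj_invariant:
  fixes F :: "complex \<Rightarrow> 'b :: comm_monoid_mult"
  assumes t: "coprime t n"
  shows "(\<Prod>i<n. F ((a * \<zeta> ^ s) * (\<zeta> ^ t) ^ i)) = (\<Prod>i<n. F (a * \<zeta> ^ i))"
proof -
  have n0: "n > 0" using n2 by simp
  define \<sigma> where "\<sigma> = (\<lambda>i. (s + t * i) mod n)"
  have inj: "inj_on \<sigma> {..<n}"
  proof (rule inj_onI)
    fix i j assume ij: "i \<in> {..<n}" "j \<in> {..<n}" "\<sigma> i = \<sigma> j"
    hence "[s + t * i = s + t * j] (mod n)" by (simp add: \<sigma>_def cong_iff_mod)
    hence "[t * i = t * j] (mod n)" by (simp add: cong_add_lcancel_nat)
    hence "[i = j] (mod n)" using t cong_mult_lcancel_nat by blast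
    thus "i = j" using ij by (simp add: cong_iff_mod)
  qed
  have surj: "\<sigma> ` {..<n} = {..<n}"
    using inj n0 by (intro endo_inj_surj) (auto simp: \<sigma>_def)
  have pw: "\<zeta> ^ \<sigma> i = \<zeta> ^ (s + t * i)" for i
    using primitive_root_of_unity_eq_iff[OF zeta n0, of "\<sigma> i" "s + t * i"] by (simp add: \<sigma>_def)
  have "(\<Prod>i<n. F ((a * \<zeta> ^ s) * (\<zeta> ^ t) ^ i)) = (\<Prod>i<n. F (a * \<zeta> ^ \<sigma> i))"
    unfolding pw by (simp only: power_add power_mult mult.assoc)
  also have "\<dots> = (\<Prod>i\<in>\<sigma> ` {..<n}. F (a * \<zeta> ^ i))"
    by (subst prod.reindex[OF inj]) (simp add: o_def)
  finally show ?thesis unfolding surj .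
qed

abbreviation R :: "nat \<Rightarrow> complex" where "R i \<equiv> a * \<zeta> ^ i"

lemma R_inj: "i < n \<Longrightarrow> j < n \<Longrightarrow> R i = R j \<Longrightarrow> i = j"
  using primitive_root_of_unity_eq_iff[OF zeta, of i j] a_nonzero by auto

lemma prod_minus_roots: "(\<Prod>i<n. y - R i) = y ^ n - of_int m"
proof -
  define p where "p = (\<Prod>i<n. [:- R i, 1:])"
  have inj: "inj_on R {..<n}" using R_inj by (auto simp: inj_on_def)
  have deg_p: "degree p = n" unfolding p_def by (subst degree_prod_sum_eq) auto
  have lc: "coeff p n = 1"
    using deg_p lead_coeff_prod[of "\<lambda>i. [:- R i, 1:]" "{..<n}"] by (simp add: p_def)
  have n0: "n > 0" using n2 by simp
  have "p = pure_poly n m"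
  proof (rule poly_eqI_degree_lead_coeff[of _ n _ "R ` {..<n}"])
    show "coeff p n = coeff (pure_poly n m) n" using lc n0 by (simp add: pure_poly_def coeff_pCons split: nat.splits)
    show "degree (pure_poly n m :: complex poly) \<le> n" by (simp add: degree_pure_poly[OF n0])
    fix x assume "x \<in> R ` {..<n}"
    then obtain i where i: "i < n" "x = R i" by auto
    have "poly p x = 0" unfolding p_def poly_prod using i by (intro prod_zero) auto
    moreover have "poly (pure_poly n m) x = 0"
      unfolding i(2) by (simp add: pure_poly_def poly_monom conj_power_n)
    ultimately show "poly p x = poly (pure_poly n m) x" by simp
  qed (use deg_p in \<open>simp_all add: card_image[OF inj]\<close>)
  hence "poly p y = poly (pure_poly n m) y" by simp
  thus ?thesis by (simp add: p_def poly_prod pure_poly_def poly_monom)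
qed

text \<open>The norm of \<open>w(a)\<close>.\<close>

definition norm_form :: "int poly \<Rightarrow> complex" where
  "norm_form w = (\<Prod>i<n. int_eval w (R i))"

lemma norm_form_integer: obtains k where "norm_form w = of_int k"
proof -
  define f where "f = (\<lambda>x z. \<Prod>i<n. rat_eval (map_poly of_int w) (x * z ^ i))"
  have n0: "n > 0" using n2 by simp
  have f: "f a \<zeta> = norm_form w" unfolding f_def norm_form_def by (simp only: rat_eval_of_int)
  have "f a \<zeta> \<in> \<rat>"
  proof (rule rational_if_invariant[OF n0 zeta, of a f])
    show "a ^ n \<in> \<rat>" using root by simp
    show "rat_poly_fun f" unfolding f_def
      by (intro rat_poly_fun_prod rat_poly_fun_poly rat_poly_fun_var)
    show "f (a * \<zeta> ^ s) (\<zeta> ^ t) = f a \<zeta>" if "coprime t n" for s t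
      unfolding f_def using prod_conj_invariant[OF that, of "rat_eval (map_poly of_int w)" s] .
  qed
  hence rat: "norm_form w \<in> \<rat>" by (simp add: f)
  have "algebraic_int (norm_form w)" unfolding norm_form_def
    by (rule algebraic_int_prod, rule algebraic_int_int_eval, rule algebraic_int_conj)
  hence "norm_form w \<in> \<int>" using rational_algebraic_int_is_int rat by blast
  thus ?thesis using that by (auto elim: Ints_cases)
qed

lemma int_eval_conj_eq_0:
  assumes "degree w < n" "int_eval w (R i) = 0" shows "w = 0"
proof (rule ccontr)
  assume "w \<noteq> 0"
  have "rat_eval (map_poly of_int w) (R i) = 0" using assms(2) by (simp only: rat_eval_of_int)
  hence "pure_poly n m dvd (map_poly of_int w :: rat poly)" using root_pure_poly_dvd_iff[OF conj_power_n] by blast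
  moreover have "(map_poly of_int w :: rat poly) \<noteq> 0" using \<open>w \<noteq> 0\<close> by simp
  ultimately have "degree (pure_poly n m :: rat poly) \<le> degree (map_poly of_int w :: rat poly)" by (rule dvd_imp_degree_le)
  thus False using assms(1) degree_pure_poly[of n m, where 'a=rat] n2 by simp
qed

lemma norm_form_nonzero:
  assumes "w \<noteq> 0" "degree w < n" shows "norm_form w \<noteq> 0"
  using int_eval_conj_eq_0[OF assms(2)] assms(1) by (auto simp: norm_form_def prod_zero_iff)

text \<open>Only the exponent of \<open>H\<close> matters; the other factor depends on the field alone.\<close>

lemma norm_form_bound:
  assumes "degree w < n" "\<And>k. \<bar>coeff w k\<bar> \<le> H"
  shows "norm (norm_form w) \<le> (real n * real_of_int \<bar>m\<bar> ^ n) ^ n * real_of_int H ^ n"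
proof -
  have R1: "norm (R i) \<le> real_of_int \<bar>m\<bar>" for i
  proof (rule ccontr)
    assume "\<not> norm (R i) \<le> real_of_int \<bar>m\<bar>"
    hence l: "real_of_int \<bar>m\<bar> < norm (R i)" by simp
    have m1: "1 \<le> real_of_int \<bar>m\<bar>" using m2 by linarith
    have "norm (R i) ^ 1 \<le> norm (R i) ^ n" using l m1 n2 by (intro power_increasing) auto
    also have "\<dots> = norm (R i ^ n)" by (simp only: norm_power)
    also have "\<dots> = real_of_int \<bar>m\<bar>" by (simp only: conj_power_n norm_of_int)
    finally show False using l by simp
  qed
  have H0: "0 \<le> H" using assms(2)[of 0] by linarith
  have b: "norm (int_eval w (R i)) \<le> real n * real_of_int \<bar>m\<bar> ^ n * real_of_int H" for i
  proof -
    have "norm (int_eval w (R i)) \<le> (\<Sum>k<n. norm (of_int (coeff w k) * R i ^ k))"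
      unfolding int_eval_altdef[OF assms(1)] by (rule norm_sum)
    also have "\<dots> \<le> (\<Sum>k<n. real_of_int H * real_of_int \<bar>m\<bar> ^ n)"
    proof (rule sum_mono)
      fix k assume k: "k \<in> {..<n}"
      have "norm (R i ^ k) \<le> real_of_int \<bar>m\<bar> ^ k" unfolding norm_power by (intro power_mono R1) simp
      also have "\<dots> \<le> real_of_int \<bar>m\<bar> ^ n" using k m2 by (intro power_increasing) auto
      finally have "norm (R i ^ k) \<le> real_of_int \<bar>m\<bar> ^ n" .
      moreover have "norm (of_int (coeff w k) :: complex) \<le> real_of_int H"
        using assms(2)[of k] by (simp add: norm_of_int)
      ultimately show "norm (of_int (coeff w k) * R i ^ k) \<le> real_of_int H * real_of_int \<bar>m\<bar> ^ n"
        unfolding norm_mult using H0 by (intro mult_mono) auto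
    qed
    finally show ?thesis by (simp add: mult_ac)
  qed
  have "norm (norm_form w) = (\<Prod>i<n. norm (int_eval w (R i)))" unfolding norm_form_def by (rule prod_norm[symmetric])
  also have "\<dots> \<le> (\<Prod>i<n. real n * real_of_int \<bar>m\<bar> ^ n * real_of_int H)"
    by (intro prod_mono) (use b in auto)
  finally show ?thesis by (simp add: power_mult_distrib)
qed

text \<open>Modulo \<open>k\<close> the polynomial \<open>w\<close> is divisible by \<open>T - x\<close>, and the norm of \<open>x - a\<close> is \<open>x\<^sup>n - m\<close>.\<close>

lemma dvd_norm_form:
  assumes k: "k \<noteq> 0" and x: "k dvd x ^ n - m" "k dvd poly w x" and N: "norm_form w = of_int N"
  shows "k dvd N"
proof -
  obtain e where e: "poly w x = k * e" using x(2) by (auto elim: dvdE)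
  obtain g where g: "x ^ n - m = k * g" using x(1) by (auto elim: dvdE)
  define d where "d = (\<lambda>i. - divided_diff (map_poly of_int w) (of_int x) (R i))"
  have d: "algebraic_int (d i)" for i unfolding d_def
    by (simp, rule algebraic_int_divided_diff) (simp_all add: algebraic_int_conj)
  have w: "int_eval w (R i) = (of_int x - R i) * d i + of_int k * of_int e" for i
  proof -
    have "of_int k * of_int e = int_eval w (of_int x)" by (simp add: e)
    moreover have "int_eval w (of_int x) - int_eval w (R i) = (of_int x - R i) * (- d i)"
      unfolding d_def minus_minus by (rule divided_diff_eq)
    ultimately show ?thesis by (simp add: algebra_simps)
  qed
  have D: "algebraic_int (\<Prod>i<n. d i)" by (rule algebraic_int_prod) (rule d)
  obtain T where T: "algebraic_int T" "(\<Prod>i<n. (of_int x - R i) * d i + of_int k * of_int e)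
      = (\<Prod>i<n. (of_int x - R i) * d i) + of_int k * T"
    using prod_add_multiple[of "{..<n}" "\<lambda>i. of_int e" "\<lambda>i. (of_int x - R i) * d i" "of_int k"]
      algebraic_int_mult[OF algebraic_int_diff[OF algebraic_int_of_int algebraic_int_conj] d] by auto
  have "of_int N = (of_int x ^ n - of_int m) * (\<Prod>i<n. d i) + of_int k * T"
    unfolding N[symmetric] norm_form_def w T(2) prod.distrib prod_minus_roots ..
  also have "of_int x ^ n - of_int m = (of_int (x ^ n - m) :: complex)" by simp
  also have "(of_int (x ^ n - m) :: complex) = of_int k * of_int g" by (simp add: g)
  finally have "of_int N = of_int k * (of_int g * (\<Prod>i<n. d i) + T)" by (simp add: distrib_left mult.assoc)
  hence "of_int N / of_int k = of_int g * (\<Prod>i<n. d i) + T" using k by simp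
  moreover have "algebraic_int (of_int g * (\<Prod>i<n. d i) + T)"
    using D T by (simp add: algebraic_int_add algebraic_int_mult)
  ultimately show ?thesis using algebraic_int_divide_imp_dvd[OF _ k] by metis
qed

text \<open>Write \<open>w = (T - x)(T - y)v + ps\<close> and expand the norm in powers of \<open>p\<close>. The constant term contains the norms of \<open>x - a\<close> and
  \<open>y - a\<close>, each divisible by \<open>p\<close>. The linear terms contain the product of the values at \<open>x\<close> and at \<open>y\<close> of \<open>X\<^sup>n - m\<close> with one linear
  factor removed, and \<open>p\<close> divides this product because \<open>x\<close> and \<open>y\<close> differ modulo \<open>p\<close>.\<close>

lemma square_dvd_norm_form:
  assumes p: "prime p" and x: "p dvd x ^ n - m" "p dvd poly w x" and y: "p dvd y ^ n - m" "p dvd poly w y"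
    and xy: "\<not> p dvd x - y" and N: "norm_form w = of_int N"
  shows "p ^ 2 dvd N"
proof -
  define w1 where "w1 = synthetic_div w x"
  define v where "v = synthetic_div w1 y"
  have w: "w = [:- x, 1:] * w1 + [:poly w x:]" by (simp only: w1_def synthetic_div_correct')
  have w1: "w1 = [:- y, 1:] * v + [:poly w1 y:]" by (simp only: v_def synthetic_div_correct')
  have "poly w y = (y - x) * poly w1 y + poly w x" by (subst w) (simp add: algebra_simps)
  hence "p dvd (y - x) * poly w1 y" using x(2) y(2) by (metis dvd_add_left_iff)
  hence "p dvd poly w1 y" using p xy by (metis dvd_minus_iff minus_diff_eq prime_dvd_mult_iff)
  then obtain r1 where r1: "poly w1 y = p * r1" by (auto elim: dvdE)
  obtain r0 where r0: "poly w x = p * r0" using x(2) by (auto elim: dvdE)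
  obtain gx where gx: "x ^ n - m = p * gx" using x(1) by (auto elim: dvdE)
  obtain gy where gy: "y ^ n - m = p * gy" using y(1) by (auto elim: dvdE)
  have "coprime p (y - x)" using p xy by (metis dvd_minus_iff minus_diff_eq prime_imp_coprime)
  then obtain e where "[(y - x) * e = 1] (mod p)" using cong_solve_coprime_int[of "y - x" p] by (auto simp: coprime_commute)
  hence "p dvd (y - x) * e - 1" by (simp only: cong_iff_dvd_diff)
  then obtain f where "(y - x) * e - 1 = p * f" by (rule dvdE)
  hence f: "(y - x) * e = 1 + p * f" by linarith
  define P Q V s where "P = (\<lambda>i. of_int x - R i)" and "Q = (\<lambda>i. of_int y - R i)"
    and "V = (\<lambda>i. int_eval v (R i))" and "s = (\<lambda>i. of_int r0 - of_int r1 * P i)"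
  have P: "algebraic_int (P i)" and Q: "algebraic_int (Q i)" for i
    unfolding P_def Q_def by (rule algebraic_int_diff, simp, rule algebraic_int_conj)+
  have V: "algebraic_int (V i)" for i unfolding V_def by (rule algebraic_int_int_eval, rule algebraic_int_conj)
  have s: "algebraic_int (s i)" for i unfolding s_def
    by (rule algebraic_int_diff, simp, rule algebraic_int_mult[OF algebraic_int_of_int P])
  have const: "int_eval [:k:] z = of_int k" for k and z :: complex by (simp add: hom_distribs)
  have wR: "int_eval w (R i) = P i * Q i * V i + of_int p * s i" for i
  proof -
    have e1: "int_eval w z = (z - of_int x) * int_eval w1 z + of_int (poly w x)" for z :: complex
    proof -
      have "int_eval w z = int_eval ([:- x, 1:] * w1 + [:poly w x:]) z" using w by simp
      also have "\<dots> = int_eval [:- x, 1:] z * int_eval w1 z + int_eval [:poly w x:] z" by (simp only: int_eval_add int_eval_mult)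
      finally show ?thesis unfolding const by (simp add: algebra_simps)
    qed
    have e2: "int_eval w1 z = (z - of_int y) * int_eval v z + of_int (poly w1 y)" for z :: complex
    proof -
      have "int_eval w1 z = int_eval ([:- y, 1:] * v + [:poly w1 y:]) z" using w1 by simp
      also have "\<dots> = int_eval [:- y, 1:] z * int_eval v z + int_eval [:poly w1 y:] z" by (simp only: int_eval_add int_eval_mult)
      finally show ?thesis unfolding const by (simp add: algebra_simps)
    qed
    have "int_eval w (R i) = (R i - of_int x) * ((R i - of_int y) * V i + of_int p * of_int r1) + of_int p * of_int r0"
      unfolding e1[of "R i"] e2[of "R i"] V_def r1 r0 by simp
    also have "\<dots> = P i * Q i * V i + of_int p * s i"
      unfolding P_def Q_def s_def by (simp add: algebra_simps)
    finally show ?thesis .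
  qed
  have PQV: "algebraic_int (P i * Q i * V i)" for i by (intro algebraic_int_mult P Q V)
  obtain T where T: "algebraic_int T" "(\<Prod>i<n. P i * Q i * V i + of_int p * s i) =
    (\<Prod>i<n. P i * Q i * V i) + of_int p * (\<Sum>i<n. s i * (\<Prod>j\<in>{..<n}-{i}. P j * Q j * V j)) + of_int p ^ 2 * T"
    using prod_add_multiple_second_order[of "{..<n}" s "\<lambda>i. P i * Q i * V i" "of_int p"] s PQV by auto
  have prodP: "(\<Prod>i<n. P i) = of_int p * of_int gx"
    unfolding P_def prod_minus_roots using gx by (metis of_int_diff of_int_mult of_int_power)
  have prodQ: "(\<Prod>i<n. Q i) = of_int p * of_int gy"
    unfolding Q_def prod_minus_roots using gy by (metis of_int_diff of_int_mult of_int_power)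
  have main: "(\<Prod>i<n. P i * Q i * V i) = of_int p ^ 2 * (of_int gx * of_int gy * (\<Prod>i<n. V i))"
    unfolding prod.distrib prodP prodQ by (simp add: power2_eq_square mult_ac)
  have lin: "\<exists>U. algebraic_int U \<and> (\<Prod>j\<in>{..<n}-{i}. P j * Q j * V j) = of_int p * U" if i: "i < n" for i
  proof -
    define P' Q' V' where "P' = (\<Prod>j\<in>{..<n}-{i}. P j)" and "Q' = (\<Prod>j\<in>{..<n}-{i}. Q j)"
      and "V' = (\<Prod>j\<in>{..<n}-{i}. V j)"
    have alg: "algebraic_int P'" "algebraic_int Q'" "algebraic_int V'"
      unfolding P'_def Q'_def V'_def by (rule algebraic_int_prod, rule P Q V)+
    have PP: "P i * P' = of_int p * of_int gx"
      unfolding prodP[symmetric] P'_def using i by (subst prod.remove[of "{..<n}" i P]) auto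
    have QQ: "Q i * Q' = of_int p * of_int gy"
      unfolding prodQ[symmetric] Q'_def using i by (subst prod.remove[of "{..<n}" i Q]) auto
    have QP: "Q i - P i = of_int (y - x)" by (simp add: P_def Q_def)
    have "of_int (y - x) * (P' * Q') = P' * (Q i * Q') - Q' * (P i * P')"
      unfolding QP[symmetric] by (simp add: algebra_simps)
    hence c: "of_int (y - x) * (P' * Q') = of_int p * (of_int gy * P' - of_int gx * Q')"
      unfolding PP QQ by (simp add: algebra_simps)
    have "P' * Q' = of_int ((y - x) * e - p * f) * (P' * Q')" by (simp add: f)
    also have "\<dots> = of_int e * (of_int (y - x) * (P' * Q')) - of_int p * of_int f * (P' * Q')"
      by (simp only: of_int_diff of_int_mult) (simp add: algebra_simps)
    also have "\<dots> = of_int p * (of_int e * (of_int gy * P' - of_int gx * Q') - of_int f * (P' * Q'))"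
      unfolding c by (simp add: algebra_simps)
    finally have "(\<Prod>j\<in>{..<n}-{i}. P j * Q j * V j)
        = of_int p * ((of_int e * (of_int gy * P' - of_int gx * Q') - of_int f * (P' * Q')) * V')"
      unfolding prod.distrib P'_def[symmetric] Q'_def[symmetric] V'_def[symmetric] by (metis mult.assoc)
    moreover have "algebraic_int ((of_int e * (of_int gy * P' - of_int gx * Q') - of_int f * (P' * Q')) * V')"
      using alg by (simp add: algebraic_int_mult algebraic_int_diff)
    ultimately show ?thesis by blast
  qed
  then obtain U where U: "\<And>i. i < n \<Longrightarrow> algebraic_int (U i)"
    "\<And>i. i < n \<Longrightarrow> (\<Prod>j\<in>{..<n}-{i}. P j * Q j * V j) = of_int p * U i" by metis
  have sumU: "(\<Sum>i<n. s i * (\<Prod>j\<in>{..<n}-{i}. P j * Q j * V j)) = of_int p * (\<Sum>i<n. s i * U i)"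
    unfolding sum_distrib_left by (rule sum.cong) (simp, metis U(2) lessThan_iff mult.left_commute)
  define Z where "Z = of_int gx * of_int gy * (\<Prod>i<n. V i) + (\<Sum>i<n. s i * U i) + T"
  have "of_int N = of_int p ^ 2 * Z"
    unfolding N[symmetric] norm_form_def wR T(2) main sumU Z_def by (simp add: power2_eq_square algebra_simps)
  moreover have p0: "p \<noteq> 0" using p by auto
  ultimately have "of_int N / of_int (p ^ 2) = Z" by simp
  moreover have "algebraic_int Z" unfolding Z_def
    by (intro algebraic_int_add algebraic_int_mult algebraic_int_of_int algebraic_int_prod V
        algebraic_int_sum s U(1) T(1)) simp
  ultimately show ?thesis using algebraic_int_divide_imp_dvd[of N "p ^ 2"] p0 by simp
qed

end

section \<open>Counting roots modulo square-free numbers\<close>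

lemma squarefree_int_iff: "squarefree (int k) \<longleftrightarrow> squarefree k"
proof
  assume k: "squarefree (int k)"
  show "squarefree k"
  proof (rule squarefreeI)
    fix x assume "x ^ 2 dvd k"
    hence "int x ^ 2 dvd int k" by (metis int_dvd_int_iff of_nat_power)
    hence "is_unit (int x)" using k squarefreeD by blast
    thus "is_unit x" by simp
  qed
next
  assume k: "squarefree k"
  show "squarefree (int k)"
  proof (rule squarefreeI)
    fix x :: int assume "x ^ 2 dvd int k"
    hence "int (nat \<bar>x\<bar> ^ 2) dvd int k" by simp
    hence "nat \<bar>x\<bar> ^ 2 dvd k" by (simp only: int_dvd_int_iff)
    hence "is_unit (nat \<bar>x\<bar>)" using k squarefreeD by blast
    thus "is_unit x" by simp
  qed
qed

definition root_pairs :: "nat \<Rightarrow> int \<Rightarrow> nat \<Rightarrow> (nat \<times> nat) set" where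
  "root_pairs n c X = {(k, x). 1 \<le> k \<and> k \<le> X \<and> squarefree k \<and> x < k \<and> int k dvd int x ^ n - c}"

lemma int_nat_root:
  assumes "n > 0"
  obtains H :: nat where "H ^ n \<le> X" "X < (H + 1) ^ n"
proof -
  define H where "H = (LEAST h. X < (h + 1) ^ n)"
  have ex: "X < (X + 1) ^ n"
  proof -
    have "X < (X + 1) ^ 1" by simp
    also have "\<dots> \<le> (X + 1) ^ n" using assms by (intro power_increasing) auto
    finally show ?thesis .
  qed
  have 1: "X < (H + 1) ^ n" unfolding H_def by (rule LeastI[of _ X]) (rule ex)
  have "H ^ n \<le> X"
  proof (cases H)
    case 0
    thus ?thesis using assms by (simp add: power_0_left)
  next
    case (Suc h)
    hence "\<not> X < (h + 1) ^ n" using not_less_Least[of h "\<lambda>h. X < (h + 1) ^ n"] unfolding H_def by auto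
    thus ?thesis using Suc by simp
  qed
  thus ?thesis using 1 that by blast
qed

definition small_polys :: "nat \<Rightarrow> nat \<Rightarrow> int poly set" where
  "small_polys n H = {w. (\<forall>k\<ge>n. coeff w k = 0) \<and> (\<forall>k. \<bar>coeff w k\<bar> \<le> int H)}"

lemma small_polys_bound: "finite (small_polys n H)" "card (small_polys n H) \<le> (2 * H + 1) ^ n"
proof -
  have inj: "inj_on (\<lambda>w. restrict (coeff w) {..<n}) (small_polys n H)"
  proof (rule inj_onI)
    fix v w assume v: "v \<in> small_polys n H" and w: "w \<in> small_polys n H"
      and eq: "restrict (coeff v) {..<n} = restrict (coeff w) {..<n}"
    show "v = w"
    proof (rule poly_eqI)
      fix k show "coeff v k = coeff w k"
      proof (cases "k < n")
        case True
        thus ?thesis using fun_cong[OF eq, of k] by simp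
      qed (use v w in \<open>simp add: small_polys_def\<close>)
    qed
  qed
  have sub: "(\<lambda>w. restrict (coeff w) {..<n}) ` small_polys n H \<subseteq> {..<n} \<rightarrow>\<^sub>E {- int H..int H}"
  proof (rule image_subsetI)
    fix w assume "w \<in> small_polys n H"
    hence "coeff w k \<in> {- int H..int H}" for k by (simp add: small_polys_def abs_le_iff minus_le_iff)
    thus "restrict (coeff w) {..<n} \<in> {..<n} \<rightarrow>\<^sub>E {- int H..int H}" by (simp only: restrict_PiE_iff) blast
  qed
  have fin: "finite ({..<n} \<rightarrow>\<^sub>E {- int H..int H})" by (intro finite_PiE) auto
  show "finite (small_polys n H)" using inj sub fin by (metis finite_imageD finite_subset)
  have "card (small_polys n H) \<le> card ({..<n} \<rightarrow>\<^sub>E {- int H..int H})" by (rule card_inj_on_le[OF inj sub fin])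
  also have "\<dots> = (2 * H + 1) ^ n" by (simp add: card_PiE nat_add_distrib nat_mult_distrib)
  finally show "card (small_polys n H) \<le> (2 * H + 1) ^ n" .
qed

lemma coeff_sum_monom: "coeff (\<Sum>k<n. monom (f k :: int) k) j = (if j < n then f j else 0)"
  by (auto simp: coeff_sum)

text \<open>The \<open>(H + 1)\<^sup>n\<close> polynomials with coefficients between 0 and \<open>H\<close> take fewer than \<open>(H + 1)\<^sup>n\<close> values at \<open>x\<close> modulo
  \<open>k\<close>. The difference of two that agree has coefficients of size at most \<open>H\<close>.\<close>

lemma small_poly_root:
  assumes n: "n > 0" and k: "k < (H + 1) ^ n" "k \<ge> 1"
  obtains w where "w \<in> small_polys n H" "w \<noteq> 0" "int k dvd poly w (int x)"
proof -
  define F where "F = ({..<n} \<rightarrow>\<^sub>E {0..H})"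
  define P where "P = (\<lambda>f :: nat \<Rightarrow> nat. \<Sum>i<n. monom (int (f i)) i)"
  define g where "g = (\<lambda>f. nat (poly (P f) (int x) mod int k))"
  have cF: "card F = (H + 1) ^ n" by (simp add: F_def card_PiE)
  have "g ` F \<subseteq> {..<k}" using k(2) by (auto simp: g_def nat_less_iff)
  hence "card (g ` F) \<le> k" using card_mono[of "{..<k}"] by simp
  hence "\<not> inj_on g F" using cF k(1) card_image[of g F] by auto
  then obtain f h where fh: "f \<in> F" "h \<in> F" "f \<noteq> h" "g f = g h" by (auto simp: inj_on_def)
  have "poly (P f) (int x) mod int k = poly (P h) (int x) mod int k"
    using fh(4) k(2) unfolding g_def by (subst (asm) nat_eq_iff2) auto
  hence d: "int k dvd poly (P f - P h) (int x)" by (simp add: mod_eq_dvd_iff)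
  have c: "coeff (P f - P h) j = (if j < n then int (f j) - int (h j) else 0)" for j
    unfolding P_def by (simp add: coeff_sum_monom)
  have "\<bar>coeff (P f - P h) j\<bar> \<le> int H" for j
  proof (cases "j < n")
    case True
    hence "f j \<le> H" "h j \<le> H" using fh(1,2) by (auto simp: F_def PiE_iff)
    thus ?thesis unfolding c by auto
  qed (simp only: c, simp)
  moreover have "coeff (P f - P h) j = 0" if "j \<ge> n" for j using that unfolding c by simp
  ultimately have "P f - P h \<in> small_polys n H" unfolding small_polys_def by blast
  moreover have "P f - P h \<noteq> 0"
  proof
    assume eq: "P f - P h = 0"
    have "f = h"
    proof (rule PiE_ext[OF fh(1,2)[unfolded F_def]])
      fix j assume "j \<in> {..<n}"
      thus "f j = h j" using c[of j] eq by simp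
    qed
    thus False using fh(3) by simp
  qed
  ultimately show ?thesis using that d by blast
qed

context pure_field
begin

text \<open>By the pigeonhole principle every pair has a polynomial \<open>w\<close> with small coefficients and the root
  \<open>x\<close> modulo \<open>k\<close>. Its norm is a multiple of \<open>k\<close> of size \<open>O(k)\<close>, so that \<open>w\<close> and the
  bounded quotient determine \<open>k\<close>; and \<open>x\<close> is then determined modulo all primes but the bounded ones.\<close>

lemma card_root_pairs_bound:
  obtains C where "\<And>X. finite (root_pairs n m X) \<and> card (root_pairs n m X) \<le> C * X"
proof -
  have n0: "n > 0" using n2 by simp
  define K where "K = nat \<lceil>(real n * real_of_int \<bar>m\<bar> ^ n) ^ n\<rceil>"
  have K: "(real n * real_of_int \<bar>m\<bar> ^ n) ^ n \<le> real K" unfolding K_def by linarith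
  define L where "L = (fact K :: nat)"
  have L0: "L > 0" by (simp add: L_def)
  define good where "good = (\<lambda>k x w N. w \<noteq> 0 \<and> (\<forall>j\<ge>n. coeff w j = 0) \<and> int k dvd poly w (int x)
     \<and> norm_form w = of_int N \<and> int k dvd N \<and> N \<noteq> 0 \<and> \<bar>N div int k\<bar> \<le> int K)"
  have ex: "\<exists>w N. good k x w N \<and> w \<in> small_polys n H"
    if k: "1 \<le> k" "k \<le> X" "int k dvd int x ^ n - m" and H: "X < (H + 1) ^ n" for k x X H
  proof -
    obtain h where h: "h ^ n \<le> k" "k < (h + 1) ^ n" using int_nat_root[OF n0] .
    \<comment> \<open>The height \<open>h\<close> is adapted to \<open>k\<close>, not to \<open>X\<close>, so that the norm is bounded by a multiple of \<open>k\<close>.\<close>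
    obtain w where w: "w \<in> small_polys n h" "w \<noteq> 0" "int k dvd poly w (int x)"
      using small_poly_root[OF n0 h(2) k(1)] .
    have deg: "degree w < n"
    proof (rule ccontr)
      assume "\<not> degree w < n"
      hence "coeff w (degree w) = 0" using w(1) by (simp add: small_polys_def)
      thus False using w(2) by simp
    qed
    obtain N where N: "norm_form w = of_int N" using norm_form_integer .
    have N0: "N \<noteq> 0" using norm_form_nonzero[OF w(2) deg] N by auto
    have dvd: "int k dvd N" using k w(3) by (intro dvd_norm_form[OF _ _ _ N]) auto
    have "norm (norm_form w) \<le> (real n * real_of_int \<bar>m\<bar> ^ n) ^ n * real_of_int (int h) ^ n"
      by (rule norm_form_bound[OF deg]) (use w(1) in \<open>simp add: small_polys_def\<close>)
    also have "\<dots> \<le> real K * real k"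
      using K h(1) by (intro mult_mono) (auto simp flip: of_nat_power)
    finally have "real_of_int \<bar>N\<bar> \<le> real_of_int (int K * int k)" unfolding N by simp
    hence NK: "\<bar>N\<bar> \<le> int K * int k" by (simp only: of_int_le_iff)
    obtain r where r: "N = int k * r" using dvd by (auto elim: dvdE)
    have "int k * \<bar>r\<bar> \<le> int k * int K" using NK by (simp add: r abs_mult mult.commute)
    hence "\<bar>N div int k\<bar> \<le> int K" using k(1) by (simp add: r)
    moreover have "h \<le> H"
    proof -
      have "h ^ n < (H + 1) ^ n" using h(1) k(2) H by linarith
      hence "h < H + 1" by (rule power_less_imp_less_base) simp
      thus ?thesis by simp
    qed
    hence "w \<in> small_polys n H" using w(1) by (fastforce simp: small_polys_def intro: order_trans)
    ultimately show ?thesis unfolding good_def using w N N0 dvd by (auto simp: small_polys_def)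
  qed
  have main: "finite (root_pairs n m X) \<and> card (root_pairs n m X) \<le> (3 ^ n * ((2 * K + 1) * L)) * X" for X
  proof (cases "X = 0")
    case True
    hence "root_pairs n m X = {}" by (auto simp: root_pairs_def)
    thus ?thesis by simp
  next
    case False
    obtain H where H: "H ^ n \<le> X" "X < (H + 1) ^ n" using int_nat_root[OF n0] .
    have H1: "H \<ge> 1"
    proof (rule ccontr)
      assume "\<not> H \<ge> 1"
      hence "H = 0" by simp
      thus False using H(2) False by simp
    qed
    have "\<forall>p\<in>root_pairs n m X. \<exists>w N. good (fst p) (snd p) w N \<and> w \<in> small_polys n H"
      using ex[of _ X _ H] H(2) by (auto simp: root_pairs_def)
    then obtain W M where WM: "\<And>p. p \<in> root_pairs n m X \<Longrightarrow> good (fst p) (snd p) (W p) (M p) \<and> W p \<in> small_polys n H"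
      by metis
    \<comment> \<open>Polynomial, quotient of the norm by \<open>k\<close>, and \<open>x\<close> modulo the primes up to \<open>K\<close>. These data determine the pair:
      a larger prime divisor \<open>l\<close> of \<open>k\<close> with two different roots would have its square dividing \<open>N\<close>, hence it would divide \<open>k\<close> twice or
      divide the quotient, which is nonzero and at most \<open>K\<close>.\<close>
    define \<Phi> where "\<Phi> = (\<lambda>p. (W p, M p div int (fst p), snd p mod L))"
    define T where "T = small_polys n H \<times> {- int K..int K} \<times> {..<L}"
    have finT: "finite T" unfolding T_def using small_polys_bound(1) by auto
    have into: "\<Phi> ` root_pairs n m X \<subseteq> T"
    proof (rule image_subsetI)
      fix p assume p: "p \<in> root_pairs n m X"
      show "\<Phi> p \<in> T" using WM[OF p] L0 unfolding \<Phi>_def T_def good_def by (auto simp: abs_le_iff)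
    qed
    have inj: "inj_on \<Phi> (root_pairs n m X)"
    proof (rule inj_onI)
      fix p p' assume p: "p \<in> root_pairs n m X" and p': "p' \<in> root_pairs n m X" and eq: "\<Phi> p = \<Phi> p'"
      obtain k x where kx: "p = (k, x)" by (cases p)
      obtain k' x' where kx': "p' = (k', x')" by (cases p')
      have k: "1 \<le> k" "squarefree k" "x < k" "int k dvd int x ^ n - m" using p by (auto simp: root_pairs_def kx)
      have k': "1 \<le> k'" "x' < k'" "int k' dvd int x' ^ n - m" using p' by (auto simp: root_pairs_def kx')
      define w where "w = W p"
      have w': "W p' = w" using eq by (simp add: \<Phi>_def w_def)
      have g: "good k x w (M p)" and g': "good k' x' w (M p')"
        using WM[OF p] WM[OF p'] w' by (simp_all add: w_def kx kx')
      have "of_int (M p) = (of_int (M p') :: complex)" using g g' unfolding good_def by metis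
      hence MM: "M p' = M p" by simp
      define N where "N = M p"
      obtain r where r: "N = int k * r" using g unfolding good_def N_def by (auto elim: dvdE)
      obtain r' where r': "N = int k' * r'" using g' unfolding good_def N_def MM by (auto elim: dvdE)
      have N0: "N \<noteq> 0" using g by (simp add: good_def N_def)
      have rr: "N div int k = r" using r k(1) by simp
      have rr': "N div int k' = r'" using r' k'(1) by simp
      have "M p div int k = M p' div int k'" using eq by (simp add: \<Phi>_def kx kx')
      hence "r = r'" using rr rr' by (simp only: MM N_def)
      hence kk: "k' = k" using r r' N0 by auto
      have rK: "\<bar>r\<bar> \<le> int K" using g rr by (simp add: good_def N_def)
      have r0: "r \<noteq> 0" using N0 r by auto
      have xL: "[int x = int x'] (mod int L)" using eq by (simp add: \<Phi>_def kx kx' cong_iff_mod flip: of_nat_mod)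
      have "int k dvd int x - int x'"
      proof (rule squarefree_dvdI)
        show "squarefree (int k)" using k(2) by (simp add: squarefree_int_iff)
        fix l :: int assume l: "prime l" "l dvd int k"
        have l0: "l > 0" using l(1) by (simp add: prime_gt_0_int)
        show "l dvd int x - int x'"
        proof (cases "l \<le> int K")
          case True
          hence "nat l dvd L" unfolding L_def using l0 by (intro dvd_fact) auto
          hence "l dvd int L" using l0 by (metis int_dvd_int_iff nat_0_le less_imp_le)
          thus ?thesis using xL by (meson cong_iff_dvd_diff dvd_trans)
        next
          case False
          show ?thesis
          proof (rule ccontr)
            assume nd: "\<not> l dvd int x - int x'"
            have "l ^ 2 dvd N"
            proof (rule square_dvd_norm_form[OF l(1) _ _ _ _ nd])
              show "l dvd int x ^ n - m" "l dvd int x' ^ n - m" using k(4) k'(3) l(2) kk by (auto intro: dvd_trans)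
              show "l dvd poly w (int x)" "l dvd poly w (int x')"
                using g g' l(2) kk unfolding good_def by (auto intro: dvd_trans)
              show "norm_form w = of_int N" using g by (simp add: good_def N_def)
            qed
            obtain k1 where k1: "int k = l * k1" using l(2) by (auto elim: dvdE)
            have "l * l dvd l * (k1 * r)" using \<open>l ^ 2 dvd N\<close> r k1 by (simp add: power2_eq_square mult.assoc)
            hence "l dvd k1 * r" using l0 by simp
            moreover have "\<not> l dvd r"
            proof
              assume "l dvd r"
              hence "\<bar>l\<bar> \<le> \<bar>r\<bar>" using r0 by (intro dvd_imp_le_int)
              thus False using rK False l0 by linarith
            qed
            ultimately have "l dvd k1" using l(1) by (simp add: prime_dvd_mult_iff)
            hence "l ^ 2 dvd int k" using k1 by (auto simp: power2_eq_square)
            moreover have "squarefree (int k)" using k(2) by (simp add: squarefree_int_iff)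
            ultimately have "is_unit l" using squarefreeD by blast
            thus False using l(1) by (simp add: not_prime_unit)
          qed
        qed
      qed
      moreover have "\<bar>int x - int x'\<bar> < int k" using k(3) k'(2) kk by linarith
      ultimately have "int x - int x' = 0" by (meson dvd_imp_le_int abs_of_nat not_less le_less_trans abs_ge_self)
      thus "p = p'" using kx kx' kk by simp
    qed
    have fin: "finite (root_pairs n m X)" using inj into finT by (metis finite_imageD finite_subset)
    have "card (root_pairs n m X) \<le> card T" by (rule card_inj_on_le[OF inj into finT])
    also have "\<dots> = card (small_polys n H) * ((2 * K + 1) * L)" by (simp add: T_def card_cartesian_product nat_add_distrib nat_mult_distrib)
    also have "\<dots> \<le> (3 * H) ^ n * ((2 * K + 1) * L)"
    proof (rule mult_le_mono1)
      have "(2 * H + 1) ^ n \<le> (3 * H) ^ n" using H1 by (intro power_mono) auto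
      thus "card (small_polys n H) \<le> (3 * H) ^ n" using small_polys_bound(2)[of n H] by linarith
    qed
    also have "\<dots> = (3 ^ n * ((2 * K + 1) * L)) * H ^ n" by (simp add: power_mult_distrib)
    also have "\<dots> \<le> (3 ^ n * ((2 * K + 1) * L)) * X" using H(1) by (rule mult_le_mono2)
    finally show ?thesis using fin by blast
  qed
  show ?thesis using that[of "3 ^ n * ((2 * K + 1) * L)"] main by blast
qed

end

text \<open>Multiply by a root of unity of order \<open>q\<close> modulo \<open>p\<close>, which exists because \<open>q\<close> divides \<open>p - 1\<close>.\<close>

lemma two_roots_mod_prime:
  assumes q: "prime (q::nat)" and p: "prime (p::nat)" "[p = 1] (mod q)" and x: "[x ^ q = c] (mod int p)" and c: "\<not> int p dvd c"
  obtains y where "[y ^ q = c] (mod int p)" "\<not> [x = y] (mod int p)"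
proof -
  obtain g where g: "residue_primroot p g" using prime_primitive_root_exists[of p] p(1) prime_gt_1_nat by blast
  have o: "ord p g = p - 1" using g p(1) by (simp add: residue_primroot_def totient_prime)
  have "q dvd p - 1" using p(2) prime_gt_1_nat[OF p(1)] by (metis cong_altdef_nat cong_sym less_imp_le cong_to_1_nat)
  then obtain e where e: "p - 1 = q * e" by (auto elim: dvdE)
  have e0: "e > 0" "e < p - 1"
  proof -
    have "p - 1 > 0" using prime_gt_1_nat[OF p(1)] by simp
    thus "e > 0" using e by (cases e) auto
    thus "e < p - 1" using e prime_gt_1_nat[OF q] by simp
  qed
  have "[(g ^ e) ^ q = 1] (mod p)" using ord_divides[of g "p - 1" p] o e by (simp add: power_mult[symmetric] mult.commute)
  hence g1: "[int (g ^ e) ^ q = 1] (mod int p)" by (metis cong_int_iff of_nat_1 of_nat_power)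
  have "\<not> [g ^ e = 1] (mod p)"
    using ord_divides[of g e p] o e0 by (auto dest: dvd_imp_le)
  hence g2: "\<not> [int (g ^ e) = 1] (mod int p)" by (metis cong_int_iff of_nat_1)
  show ?thesis
  proof (rule that[of "x * int (g ^ e)"])
    have "[(x * int (g ^ e)) ^ q = c * 1] (mod int p)"
      unfolding power_mult_distrib by (intro cong_mult x g1)
    thus "[(x * int (g ^ e)) ^ q = c] (mod int p)" by simp
    show "\<not> [x = x * int (g ^ e)] (mod int p)"
    proof
      assume "[x = x * int (g ^ e)] (mod int p)"
      hence "[x * int (g ^ e) = x * 1] (mod int p)" by (simp add: cong_sym)
      moreover have "coprime x (int p)"
      proof -
        have "\<not> int p dvd x"
        proof
          assume "int p dvd x"
          hence "int p dvd x ^ q" using prime_gt_0_nat[OF q] by (meson dvd_power dvd_trans)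
          thus False using x c by (meson cong_dvd_iff)
        qed
        thus ?thesis using p(1) by (metis coprime_commute prime_imp_coprime prime_int_nat_transfer prime_nat_int_transfer)
      qed
      ultimately have "[int (g ^ e) = 1] (mod int p)" using cong_mult_lcancel by blast
      thus False using g2 by blast
    qed
  qed
qed

definition power_residue_numbers :: "nat \<Rightarrow> int \<Rightarrow> nat set" where
  "power_residue_numbers q c = {k. squarefree k \<and> (\<forall>p. prime p \<longrightarrow> p dvd k \<longrightarrow> (\<exists>x. [x ^ q = c] (mod int p)))}"

lemma squarefree_pos: "squarefree (k::nat) \<Longrightarrow> k > 0"
  by (cases k) auto

text \<open>There is a root modulo each prime divisor, and there are two for the primes in \<open>S\<close>. The Chinese remainder theorem
  combines the choices.\<close>

lemma many_roots:
  assumes q: "prime (q::nat)" and k: "k \<in> power_residue_numbers q c"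
    and S: "S \<subseteq> {p. prime p \<and> p dvd k \<and> [p = 1] (mod q) \<and> \<not> int p dvd c}"
  shows "2 ^ card S \<le> card {x. x < k \<and> int k dvd int x ^ q - c}"
proof -
  have sq: "squarefree k" and sol: "\<And>p. prime p \<Longrightarrow> p dvd k \<Longrightarrow> \<exists>x. [x ^ q = c] (mod int p)"
    using k by (auto simp: power_residue_numbers_def)
  have k0: "k > 0" using squarefree_pos[OF sq] .
  define P where "P = {p. prime p \<and> p dvd k}"
  have finP: "finite P" unfolding P_def by (rule finite_subset[of _ "{..k}"]) (use k0 in \<open>auto dest: dvd_imp_le\<close>)
  have SP: "S \<subseteq> P" using S by (auto simp: P_def)
  have finS: "finite S" using SP finP finite_subset by blast
  have natify: "\<exists>u::nat. [int u = x] (mod int p)" if "p > 0" for x p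
    by (rule exI[of _ "nat (x mod int p)"]) (use that in \<open>simp add: cong_iff_mod\<close>)
  have "\<forall>p. \<exists>u v :: nat. p \<in> P \<longrightarrow> [int u ^ q = c] (mod int p) \<and> [int v ^ q = c] (mod int p) \<and> (p \<in> S \<longrightarrow> \<not> [int u = int v] (mod int p))"
  proof
    fix p
    show "\<exists>u v :: nat. p \<in> P \<longrightarrow> [int u ^ q = c] (mod int p) \<and> [int v ^ q = c] (mod int p) \<and> (p \<in> S \<longrightarrow> \<not> [int u = int v] (mod int p))"
    proof (cases "p \<in> P")
      case True
      hence p: "prime p" "p dvd k" "p > 0" by (auto simp: P_def prime_gt_0_nat)
      obtain x where x: "[x ^ q = c] (mod int p)" using sol p by blast
      obtain u where u: "[int u = x] (mod int p)" using natify[OF p(3)] by blast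
      have uq: "[int u ^ q = c] (mod int p)" using cong_pow[OF u, of q] x cong_trans by blast
      show ?thesis
      proof (cases "p \<in> S")
        case True
        then obtain y where y: "[y ^ q = c] (mod int p)" "\<not> [x = y] (mod int p)"
          using two_roots_mod_prime[OF q p(1) _ x] S by blast
        obtain v where v: "[int v = y] (mod int p)" using natify[OF p(3)] by blast
        have "[int v ^ q = c] (mod int p)" using cong_pow[OF v, of q] y(1) cong_trans by blast
        moreover have "\<not> [int u = int v] (mod int p)" using u v y(2) by (meson cong_sym cong_trans)
        ultimately show ?thesis using uq by blast
      qed (use uq in blast)
    qed simp
  qed
  then obtain u v :: "nat \<Rightarrow> nat" where uv: "\<And>p. p \<in> P \<Longrightarrow> [int (u p) ^ q = c] (mod int p)"
    "\<And>p. p \<in> P \<Longrightarrow> [int (v p) ^ q = c] (mod int p)" "\<And>p. p \<in> P \<Longrightarrow> p \<in> S \<Longrightarrow> \<not> [int (u p) = int (v p)] (mod int p)"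
    by metis
  have cop: "\<forall>i\<in>P. \<forall>j\<in>P. i \<noteq> j \<longrightarrow> coprime i j" by (auto simp: P_def primes_coprime)
  have "\<forall>T. \<exists>x. \<forall>p\<in>P. [x = (if p \<in> T then v p else u p)] (mod p)"
  proof
    fix T
    show "\<exists>x. \<forall>p\<in>P. [x = (if p \<in> T then v p else u p)] (mod p)"
      by (rule chinese_remainder_nat[OF finP cop])
  qed
  hence "\<exists>X. \<forall>T. \<forall>p\<in>P. [X T = (if p \<in> T then v p else u p)] (mod p)" by (rule choice)
  then obtain X where X: "\<And>T p. p \<in> P \<Longrightarrow> [X T = (if p \<in> T then v p else u p)] (mod p)" by blast
  define f where "f = (\<lambda>T. X T mod k)"
  have fX: "[f T = X T] (mod p)" if "p \<in> P" for T p
  proof -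
    have "[f T = X T] (mod k)" by (simp add: f_def cong_iff_mod)
    thus ?thesis using that by (auto simp: P_def intro: cong_dvd_modulus_nat)
  qed
  have inj: "inj_on f (Pow S)"
  proof (rule inj_onI)
    fix T T' assume T: "T \<in> Pow S" "T' \<in> Pow S" "f T = f T'"
    have "p \<in> T \<longleftrightarrow> p \<in> T'" if p: "p \<in> S" for p
    proof -
      have pP: "p \<in> P" using p SP by auto
      have "[(if p \<in> T then v p else u p) = (if p \<in> T' then v p else u p)] (mod p)"
        using X[OF pP, of T] X[OF pP, of T'] fX[OF pP, of T] fX[OF pP, of T'] T(3) by (metis cong_sym cong_trans)
      hence "[int (if p \<in> T then v p else u p) = int (if p \<in> T' then v p else u p)] (mod int p)" by (simp add: cong_int_iff)
      thus ?thesis using uv(3)[OF pP p] by (auto split: if_splits dest: cong_sym)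
    qed
    thus "T = T'" using T by blast
  qed
  have into: "f ` Pow S \<subseteq> {x. x < k \<and> int k dvd int x ^ q - c}"
  proof (rule image_subsetI)
    fix T
    have "int k dvd int (f T) ^ q - c"
    proof (rule squarefree_dvdI)
      show "squarefree (int k)" using sq by (simp add: squarefree_int_iff)
      fix l :: int assume l: "prime l" "l dvd int k"
      define p where "p = nat l"
      have lp: "l = int p" using l(1) by (simp add: p_def prime_ge_0_int)
      have pP: "p \<in> P" using l by (simp add: P_def lp)
      have "[f T = (if p \<in> T then v p else u p)] (mod p)" using fX[OF pP] X[OF pP] cong_trans by blast
      hence "[int (f T) = int (if p \<in> T then v p else u p)] (mod int p)" by (simp only: cong_int_iff)
      hence "[int (f T) ^ q = int (if p \<in> T then v p else u p) ^ q] (mod int p)" by (rule cong_pow)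
      hence "[int (f T) ^ q = c] (mod int p)" using uv(1,2)[OF pP] by (auto split: if_splits intro: cong_trans)
      thus "l dvd int (f T) ^ q - c" by (simp add: lp cong_iff_dvd_diff)
    qed
    thus "f T \<in> {x. x < k \<and> int k dvd int x ^ q - c}" using k0 by (simp add: f_def)
  qed
  have "2 ^ card S = card (Pow S)" using finS by (simp add: card_Pow)
  also have "\<dots> \<le> card {x. x < k \<and> int k dvd int x ^ q - c}" by (rule card_inj_on_le[OF inj into]) simp
  finally show ?thesis .
qed

text \<open>The numbers counted here have at least \<open>2\<^sup>K\<close> roots of \<open>x\<^sup>q \<equiv> c\<close> each, while there are \<open>O(X)\<close> roots in total. The prime \<open>q\<close>, the
  only one that divides \<open>c\<close>, is not congruent to 1 modulo \<open>q\<close>.\<close>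

lemma card_many_prime_factors_bound:
  assumes q: "prime (q::nat)" and c: "c = int q \<or> c = - int q"
  obtains C where "\<And>X K. card {k\<in>power_residue_numbers q c. k \<le> X \<and>
      K \<le> card {p. prime p \<and> p dvd k \<and> [p = 1] (mod q)}} * 2 ^ K \<le> C * X"
proof -
  have q2: "q \<ge> 2" using prime_ge_2_nat[OF q] .
  have pq: "prime (int q)" using q by simp
  have sqc: "squarefree c" using c squarefree_prime[OF pq] by auto
  have c2: "\<bar>c\<bar> \<ge> 2" using c q2 by auto
  have irr: "irreducible (pure_poly q c :: rat poly)" using q2 by (intro irreducible_pure_poly sqc c2) auto
  obtain a where a: "of_int c = (a::complex) ^ q" using exists_complex_root[of q "of_int c"] q2 by auto
  interpret pure_field q c a "exp (2 * of_real pi * \<i> / of_nat q)"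
    using q2 a irr sqc c2 primitive_root_of_unity_exists[of q] by unfold_locales auto
  obtain C where C: "\<And>X. finite (root_pairs q c X) \<and> card (root_pairs q c X) \<le> C * X"
    using card_root_pairs_bound by metis
  show ?thesis
  proof (rule that[of C])
    fix X K
    define A where "A = {k\<in>power_residue_numbers q c. k \<le> X \<and> K \<le> card {p. prime p \<and> p dvd k \<and> [p = 1] (mod q)}}"
    define r where "r = (\<lambda>k. {x. x < k \<and> int k dvd int x ^ q - c})"
    have finA: "finite A" by (rule finite_subset[of _ "{..X}"]) (auto simp: A_def)
    have "card A * 2 ^ K = (\<Sum>k\<in>A. 2 ^ K)" by simp
    also have "\<dots> \<le> (\<Sum>k\<in>A. card (r k))"
    proof (rule sum_mono)
      fix k assume k: "k \<in> A"
      let ?S = "{p. prime p \<and> p dvd k \<and> [p = 1] (mod q)}"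
      have "\<not> int p dvd c" if p: "p \<in> ?S" for p
      proof
        assume "int p dvd c"
        hence "p dvd q" using c by auto
        hence "p = q" using p q by (auto simp: primes_dvd_imp_eq)
        hence "[q = 1] (mod q)" using p by simp
        thus False using q2 by (simp add: cong_iff_mod)
      qed
      hence "2 ^ card ?S \<le> card (r k)"
        unfolding r_def using k by (intro many_roots[OF q]) (auto simp: A_def)
      moreover have "(2::nat) ^ K \<le> 2 ^ card ?S" using k by (intro power_increasing) (auto simp: A_def)
      ultimately show "2 ^ K \<le> card (r k)" by linarith
    qed
    also have "\<dots> = card (SIGMA k:A. r k)" using finA by (subst card_SigmaI) (auto simp: r_def)
    also have "\<dots> \<le> card (root_pairs q c X)"
    proof (rule card_mono)
      show "finite (root_pairs q c X)" using C by blast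
      show "(SIGMA k:A. r k) \<subseteq> root_pairs q c X"
        using squarefree_pos by (fastforce simp: root_pairs_def A_def r_def power_residue_numbers_def)
    qed
    also have "\<dots> \<le> C * X" using C by blast
    finally show "card {k\<in>power_residue_numbers q c. k \<le> X \<and> K \<le> card {p. prime p \<and> p dvd k \<and> [p = 1] (mod q)}} * 2 ^ K \<le> C * X"
      by (simp add: A_def)
  qed
qed

section \<open>Euler products\<close>

lemma norm_one_minus_le: "norm (1 - z) \<le> exp (- Re z + norm z ^ 2)"
proof -
  have "norm (1 - z) ^ 2 = 1 + (- 2 * Re z + norm z ^ 2)"
    unfolding cmod_power2 by (simp add: power2_eq_square algebra_simps)
  also have "\<dots> \<le> exp (- 2 * Re z + norm z ^ 2)" by (rule exp_ge_add_one_self)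
  also have "\<dots> \<le> exp (- 2 * Re z + 2 * norm z ^ 2)" by simp
  also have "\<dots> = exp (- Re z + norm z ^ 2) ^ 2" by (simp add: exp_of_nat_mult[symmetric] algebra_simps)
  finally show ?thesis by (rule power2_le_imp_le) simp
qed

text \<open>The lower bound is the upper bound for \<open>-z\<close>, because \<open>(1 - z)(1 + z) = 1 - z\<^sup>2\<close>.\<close>

lemma norm_one_minus_ge:
  assumes "norm z \<le> 1 / 2"
  shows "norm (1 - z) \<ge> exp (- Re z - 3 * norm z ^ 2)"
proof -
  define y where "y = norm z ^ 2"
  have "norm z ^ 2 \<le> (1 / 2) ^ 2" using assms by (intro power_mono) auto
  hence y: "0 \<le> y" "y \<le> 1 / 2" by (simp_all add: y_def power2_eq_square)
  have "exp (- y - 2 * y ^ 2) \<le> exp (ln (1 - y))"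
    using ln_one_minus_pos_lower_bound[OF y] by simp
  hence "exp (- y - 2 * y ^ 2) \<le> 1 - y" using y by simp
  moreover have "y ^ 2 \<le> y * (1 / 2)" unfolding power2_eq_square using y by (intro mult_left_mono) auto
  hence "exp (- 2 * y) \<le> exp (- y - 2 * y ^ 2)" by simp
  ultimately have 1: "exp (- 2 * y) \<le> 1 - y" by linarith
  have "norm (1::complex) - norm (z ^ 2) \<le> norm (1 - z ^ 2)" by (rule norm_triangle_ineq2)
  hence 2: "1 - y \<le> norm (1 - z ^ 2)" by (simp add: y_def norm_power)
  have "norm (1 - z ^ 2) = norm (1 - z) * norm (1 + z)"
    by (simp add: norm_mult[symmetric] power2_eq_square algebra_simps)
  also have "\<dots> \<le> norm (1 - z) * exp (Re z + y)"
    using norm_one_minus_le[of "- z"] by (intro mult_left_mono) (simp_all add: y_def)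
  finally have "exp (- 2 * y) \<le> norm (1 - z) * exp (Re z + y)" using 1 2 by linarith
  hence "exp (- 2 * y) * exp (- (Re z + y)) \<le> norm (1 - z) * exp (Re z + y) * exp (- (Re z + y))"
    by (intro mult_right_mono) auto
  also have "norm (1 - z) * exp (Re z + y) * exp (- (Re z + y)) = norm (1 - z)"
    by (simp add: mult.assoc exp_add[symmetric])
  also have "exp (- 2 * y) * exp (- (Re z + y)) = exp (- Re z - 3 * y)"
    by (simp add: exp_add[symmetric])
  finally show ?thesis by (simp add: y_def)
qed

text \<open>The Dirichlet series are functions of a real variable \<open>s > 1\<close>, because the divergence of the sum over the primes is decided by
  the behaviour as \<open>s\<close> tends to 1 from the right.\<close>

locale bounded_multiplicative =
  fixes \<psi> :: "nat \<Rightarrow> complex"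
  assumes psi_1: "\<psi> 1 = 1" and psi_mult: "\<psi> (m * n) = \<psi> m * \<psi> n" and psi_bound: "norm (\<psi> n) \<le> 1"
begin

definition dterm :: "real \<Rightarrow> nat \<Rightarrow> complex" where
  "dterm s n = \<psi> n * of_real (real n powr (- s))"

definition L :: "real \<Rightarrow> complex" where "L s = (\<Sum>n. dterm s n)"

definition prime_sum :: "real \<Rightarrow> real" where
  "prime_sum s = (\<Sum>p. if prime p then Re (dterm s p) else 0)"

lemma dterm_0: "dterm s 0 = 0" by (simp add: dterm_def)

lemma dterm_1: "dterm s 1 = 1" using psi_1 by (simp add: dterm_def)

lemma dterm_mult: "dterm s (m * n) = dterm s m * dterm s n"
  by (simp add: dterm_def psi_mult powr_mult)

lemma norm_dterm_le: "norm (dterm s n) \<le> real n powr (- s)"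
proof -
  have "norm (dterm s n) = norm (\<psi> n) * real n powr (- s)" by (simp add: dterm_def norm_mult)
  also have "\<dots> \<le> 1 * real n powr (- s)" by (intro mult_right_mono psi_bound) simp
  finally show ?thesis by simp
qed

lemma summable_powr: "s > 1 \<Longrightarrow> summable (\<lambda>n. real n powr (- s))"
  by (simp add: summable_real_powr_iff)

lemma summable_dterm: "s > 1 \<Longrightarrow> summable (\<lambda>n. norm (dterm s n))"
  by (rule summable_comparison_test'[OF summable_powr, of s 0]) (simp_all add: norm_dterm_le)

lemma summable_if_dterm: "s > 1 \<Longrightarrow> summable (\<lambda>n. if P n then dterm s n else 0)"
  by (rule summable_norm_cancel, rule summable_comparison_test'[OF summable_dterm, of s 0]) auto

text \<open>Multiplying by \<open>1 - \<psi>(p)p\<^sup>-\<^sup>s\<close> removes the multiples of \<open>p\<close> from the series.\<close>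

lemma euler_step:
  assumes s: "s > 1" and F: "finite F" "\<And>p. p \<in> F \<Longrightarrow> prime p"
  shows "L s * (\<Prod>p\<in>F. 1 - dterm s p) = (\<Sum>n. if \<exists>p\<in>F. p dvd n then 0 else dterm s n)"
  using F
proof (induction F rule: finite_induct)
  case empty
  thus ?case by (simp add: L_def)
next
  case (insert p F)
  define f where "f = (\<lambda>n. if \<exists>p\<in>F. p dvd n then 0 else dterm s n)"
  define h where "h = (\<lambda>n. if p dvd n then f n else 0)"
  have p: "prime p" using insert.prems by simp
  have sf: "summable f" unfolding f_def using summable_if_dterm[OF s, of "\<lambda>n. \<not> (\<exists>p\<in>F. p dvd n)"]
    by (rule back_subst[of summable]) auto
  have sh: "summable h" unfolding h_def f_def
    using summable_if_dterm[OF s, of "\<lambda>n. p dvd n \<and> \<not> (\<exists>p\<in>F. p dvd n)"]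
    by (rule back_subst[of summable]) auto
  have mono: "strict_mono (\<lambda>k. p * k)" using prime_gt_0_nat[OF p] by (simp add: strict_mono_def)
  have "(\<Sum>n. h n) = (\<Sum>k. h (p * k))"
    by (rule suminf_mono_reindex[OF mono, symmetric]) (auto simp: h_def)
  also have "\<dots> = (\<Sum>k. dterm s p * f k)"
  proof (rule suminf_cong)
    fix k
    have "(\<exists>r\<in>F. r dvd p * k) \<longleftrightarrow> (\<exists>r\<in>F. r dvd k)"
    proof -
      have "r dvd p * k \<longleftrightarrow> r dvd k" if "r \<in> F" for r
      proof -
        have "r \<noteq> p" "prime r" using that insert by auto
        thus ?thesis using p by (metis dvd_mult prime_dvd_mult_iff primes_dvd_imp_eq)
      qed
      thus ?thesis by blast
    qed
    thus "h (p * k) = dterm s p * f k" by (simp add: h_def f_def dterm_mult)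
  qed
  also have "\<dots> = dterm s p * (\<Sum>k. f k)" by (rule suminf_mult[OF sf])
  finally have hp: "(\<Sum>n. h n) = dterm s p * (\<Sum>k. f k)" .
  have "(\<Sum>n. if \<exists>p\<in>insert p F. p dvd n then 0 else dterm s n) = (\<Sum>n. f n - h n)"
    by (rule suminf_cong) (auto simp: f_def h_def)
  also have "\<dots> = (\<Sum>n. f n) - (\<Sum>n. h n)" by (rule suminf_diff[OF sf sh, symmetric])
  also have "\<dots> = (1 - dterm s p) * (\<Sum>n. f n)" by (simp add: hp algebra_simps)
  also have "(\<Sum>n. f n) = L s * (\<Prod>p\<in>F. 1 - dterm s p)" using insert by (simp add: f_def)
  finally show ?case using insert.hyps by (simp add: mult_ac)
qed

text \<open>After all primes up to \<open>N\<close> have been removed, only the term 1 and terms beyond \<open>N\<close> remain.\<close>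

lemma euler_product:
  assumes s: "s > 1"
  shows "(\<lambda>N. L s * (\<Prod>p\<in>{p. prime p \<and> p \<le> N}. 1 - dterm s p)) \<longlonglongrightarrow> 1"
proof -
  define f where "f = (\<lambda>N n. if \<exists>p\<in>{p. prime p \<and> p \<le> N}. p dvd n then 0 else dterm s n)"
  have st: "summable (\<lambda>n. norm (dterm s n))" by (rule summable_dterm[OF s])
  have eq: "L s * (\<Prod>p\<in>{p. prime p \<and> p \<le> N}. 1 - dterm s p) = (\<Sum>n. f N n)" for N
    unfolding f_def by (rule euler_step[OF s]) auto
  have sf: "summable (f N)" for N
    unfolding f_def using summable_if_dterm[OF s, of "\<lambda>n. \<not> (\<exists>p\<in>{p. prime p \<and> p \<le> N}. p dvd n)"]
    by (rule back_subst[of summable]) (intro ext, auto)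
  have bnd: "norm ((\<Sum>n. f N n) - 1) \<le> (\<Sum>n. norm (dterm s (n + Suc N)))" if "N \<ge> 1" for N
  proof -
    have "(\<Sum>n<Suc N. f N n) = (\<Sum>n<Suc N. if n = 1 then 1 else 0)"
    proof (rule sum.cong[OF refl])
      fix n assume n: "n \<in> {..<Suc N}"
      show "f N n = (if n = 1 then 1 else 0)"
      proof (cases "n \<le> 1")
        case True
        hence "n = 0 \<or> n = 1" by auto
        thus ?thesis
        proof
          assume "n = 1"
          moreover have "\<not> (\<exists>p\<in>{p. prime p \<and> p \<le> N}. p dvd 1)" by (auto dest: not_prime_unit)
          ultimately show ?thesis using dterm_1 by (simp add: f_def)
        qed (simp add: f_def dterm_0)
      next
        case False
        then obtain p where "prime p" "p dvd n" using prime_factor_nat[of n] by auto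
        moreover from this have "p \<le> N" using n False by (auto dest!: dvd_imp_le)
        ultimately show ?thesis using False by (auto simp: f_def)
      qed
    qed
    also have "\<dots> = 1" using that by (simp add: sum.delta)
    finally have "(\<Sum>n. f N n) - 1 = (\<Sum>n. f N (n + Suc N))"
      using suminf_split_initial_segment[OF sf[of N], of "Suc N"] by simp
    moreover have "norm (\<Sum>n. f N (n + Suc N)) \<le> (\<Sum>n. norm (dterm s (n + Suc N)))"
      by (rule norm_suminf_le) (use summable_ignore_initial_segment[OF st, of "Suc N"] in \<open>auto simp: f_def\<close>)
    ultimately show ?thesis by simp
  qed
  have tail: "(\<lambda>N. \<Sum>n. norm (dterm s (n + Suc N))) \<longlonglongrightarrow> 0"
    using LIMSEQ_Suc[OF suminf_exist_split2[OF st]] by simp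
  have "(\<lambda>N. (\<Sum>n. f N n) - 1) \<longlonglongrightarrow> 0"
    by (rule Lim_null_comparison[OF _ tail]) (use bnd in \<open>auto intro!: eventually_sequentiallyI[of 1]\<close>)
  hence "(\<lambda>N. (\<Sum>n. f N n)) \<longlonglongrightarrow> 1" by (simp add: LIM_zero_iff)
  thus ?thesis by (simp only: eq)
qed

definition square_sum :: real where "square_sum = (\<Sum>n. real n powr (- 2))"

text \<open>Take absolute values in the Euler product and compare each factor \<open>norm (1 - z)\<close> with \<open>exp (- Re z)\<close>. The error
  terms are squares and sum to a constant that depends on neither \<open>s\<close> nor \<open>\<psi>\<close>.\<close>

lemma log_L_prime_sum:
  assumes s: "s > 1"
  shows "norm (L s) > 0" "\<bar>prime_sum s - ln (norm (L s))\<bar> \<le> 3 * square_sum"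
proof -
  define Q where "Q = (\<lambda>N. {p. prime p \<and> p \<le> (N::nat)})"
  have finQ: "finite (Q N)" for N by (simp add: Q_def)
  have lim: "(\<lambda>N. norm (L s) * (\<Prod>p\<in>Q N. norm (1 - dterm s p))) \<longlonglongrightarrow> 1"
    using tendsto_norm[OF euler_product[OF s]] by (simp add: norm_mult prod_norm Q_def)
  have sp: "summable (\<lambda>p. if prime p then Re (dterm s p) else 0)"
    by (rule summable_norm_cancel, rule summable_comparison_test'[OF summable_dterm[OF s], of 0])
      (auto simp: abs_Re_le_cmod)
  have sumQ: "(\<Sum>p\<in>Q N. Re (dterm s p)) = (\<Sum>p<Suc N. if prime p then Re (dterm s p) else 0)" for N
    by (rule sum.mono_neutral_cong_left) (auto simp: Q_def)
  have "(\<lambda>N. \<Sum>p<N. if prime p then Re (dterm s p) else 0) \<longlonglongrightarrow> prime_sum s"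
    unfolding prime_sum_def by (rule summable_LIMSEQ[OF sp])
  hence limQ: "(\<lambda>N. \<Sum>p\<in>Q N. Re (dterm s p)) \<longlonglongrightarrow> prime_sum s"
    unfolding sumQ by (rule LIMSEQ_Suc)
  have sq: "(\<Sum>p\<in>Q N. norm (dterm s p) ^ 2) \<le> square_sum" for N
  proof -
    have le: "norm (dterm s p) ^ 2 \<le> real p powr (- 2)" for p
    proof (cases "p = 0")
      case False
      have "norm (dterm s p) ^ 2 \<le> (real p powr (- s)) ^ 2" by (intro power_mono norm_dterm_le) simp
      also have "\<dots> = real p powr (- s * 2)" using False by (simp add: powr_power mult.commute)
      also have "\<dots> \<le> real p powr (- 2)" using False s by (intro powr_mono) auto
      finally show ?thesis .
    qed (simp add: dterm_0)
    have "(\<Sum>p\<in>Q N. norm (dterm s p) ^ 2) \<le> (\<Sum>p\<in>Q N. real p powr (- 2))" by (intro sum_mono le)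
    also have "\<dots> \<le> square_sum" unfolding square_sum_def
      by (rule sum_le_suminf[OF summable_powr finQ]) simp_all
    finally show ?thesis .
  qed
  have half: "norm (dterm s p) \<le> 1 / 2" if "prime p" for p
  proof -
    have p: "real p \<ge> 2" using prime_ge_2_nat[OF that] by simp
    have "norm (dterm s p) \<le> real p powr (- s)" by (rule norm_dterm_le)
    also have "\<dots> \<le> real p powr (- 1)" using p s by (intro powr_mono) auto
    also have "\<dots> = 1 / real p" using p by (simp add: powr_minus_divide)
    also have "\<dots> \<le> 1 / 2" using p by (intro divide_left_mono) auto
    finally show ?thesis .
  qed
  have up: "norm (L s) * (\<Prod>p\<in>Q N. norm (1 - dterm s p)) \<le> norm (L s) * exp (- (\<Sum>p\<in>Q N. Re (dterm s p)) + 3 * square_sum)" for N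
  proof (rule mult_left_mono)
    have "(\<Prod>p\<in>Q N. norm (1 - dterm s p)) \<le> (\<Prod>p\<in>Q N. exp (- Re (dterm s p) + norm (dterm s p) ^ 2))"
      by (intro prod_mono conjI norm_ge_zero norm_one_minus_le)
    also have "\<dots> = exp (\<Sum>p\<in>Q N. - Re (dterm s p) + norm (dterm s p) ^ 2)" by (rule exp_sum[OF finQ, symmetric])
    also have "\<dots> \<le> exp (- (\<Sum>p\<in>Q N. Re (dterm s p)) + 3 * square_sum)"
    proof -
      have "0 \<le> (\<Sum>p\<in>Q N. norm (dterm s p) ^ 2)" by (intro sum_nonneg) simp
      thus ?thesis using sq[of N] by (simp add: sum.distrib sum_negf sum_subtractf)
    qed
    finally show "(\<Prod>p\<in>Q N. norm (1 - dterm s p)) \<le> exp (- (\<Sum>p\<in>Q N. Re (dterm s p)) + 3 * square_sum)" .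
  qed simp
  have lo: "norm (L s) * exp (- (\<Sum>p\<in>Q N. Re (dterm s p)) - 3 * square_sum) \<le> norm (L s) * (\<Prod>p\<in>Q N. norm (1 - dterm s p))" for N
  proof (rule mult_left_mono)
    have "exp (- (\<Sum>p\<in>Q N. Re (dterm s p)) - 3 * square_sum) \<le> exp (\<Sum>p\<in>Q N. - Re (dterm s p) - 3 * norm (dterm s p) ^ 2)"
      using sq[of N] by (simp add: sum_subtractf sum_negf sum_distrib_left[symmetric])
    also have "\<dots> = (\<Prod>p\<in>Q N. exp (- Re (dterm s p) - 3 * norm (dterm s p) ^ 2))" by (rule exp_sum[OF finQ])
    also have "\<dots> \<le> (\<Prod>p\<in>Q N. norm (1 - dterm s p))"
      by (intro prod_mono) (auto simp: Q_def intro: norm_one_minus_ge half)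
    finally show "exp (- (\<Sum>p\<in>Q N. Re (dterm s p)) - 3 * square_sum) \<le> (\<Prod>p\<in>Q N. norm (1 - dterm s p))" .
  qed simp
  have "(\<lambda>N. norm (L s) * exp (- (\<Sum>p\<in>Q N. Re (dterm s p)) + 3 * square_sum))
      \<longlonglongrightarrow> norm (L s) * exp (- prime_sum s + 3 * square_sum)" by (intro tendsto_intros limQ)
  from LIMSEQ_le[OF lim this] have "1 \<le> norm (L s) * exp (- prime_sum s + 3 * square_sum)"
    using up by blast
  moreover have "(\<lambda>N. norm (L s) * exp (- (\<Sum>p\<in>Q N. Re (dterm s p)) - 3 * square_sum))
      \<longlonglongrightarrow> norm (L s) * exp (- prime_sum s - 3 * square_sum)" by (intro tendsto_intros limQ)
  from LIMSEQ_le[OF this lim] have "norm (L s) * exp (- prime_sum s - 3 * square_sum) \<le> 1"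
    using lo by blast
  ultimately have b: "1 \<le> norm (L s) * exp (- prime_sum s + 3 * square_sum)"
    "norm (L s) * exp (- prime_sum s - 3 * square_sum) \<le> 1" by blast+
  show pos: "norm (L s) > 0" using b(1) by (cases "L s = 0") auto
  have "ln 1 \<le> ln (norm (L s) * exp (- prime_sum s + 3 * square_sum))" using b(1) by (intro ln_mono) auto
  hence 1: "prime_sum s - ln (norm (L s)) \<le> 3 * square_sum" using pos by (simp add: ln_mult)
  have "ln (norm (L s) * exp (- prime_sum s - 3 * square_sum)) \<le> ln 1" using b(2) pos by (intro ln_mono) auto
  hence 2: "ln (norm (L s)) - prime_sum s \<le> 3 * square_sum" using pos by (simp add: ln_mult)
  show "\<bar>prime_sum s - ln (norm (L s))\<bar> \<le> 3 * square_sum" using 1 2 by linarith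
qed

end

section \<open>Series with bounded partial sums\<close>

lemma abel_summation:
  fixes c :: "nat \<Rightarrow> complex" and b :: "nat \<Rightarrow> real"
  shows "(\<Sum>n<N. c n * of_real (b n)) = (\<Sum>n<N. c n) * of_real (b N) + (\<Sum>n<N. (\<Sum>k<Suc n. c k) * of_real (b n - b (Suc n)))"
  by (induction N) (simp_all add: algebra_simps)

text \<open>Comparison with the integral of \<open>t\<^sup>-\<^sup>s\<close> over \<open>[x, x + 1]\<close>, as an application of the mean value theorem.\<close>

lemma powr_diff_bounds:
  fixes s x :: real
  assumes "s > 1" "x > 0"
  shows "(s - 1) * (x + 1) powr (- s) \<le> x powr (1 - s) - (x + 1) powr (1 - s)"
    and "x powr (1 - s) - (x + 1) powr (1 - s) \<le> (s - 1) * x powr (- s)"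
proof -
  have "\<exists>z>x. z < x + 1 \<and> (x + 1) powr (1 - s) - x powr (1 - s) = (x + 1 - x) * ((1 - s) * z powr (1 - s - 1))"
    by (rule MVT2[of x "x + 1" "\<lambda>z. z powr (1 - s)" "\<lambda>z. (1 - s) * z powr (1 - s - 1)"], simp)
      (rule has_real_derivative_powr, use assms in linarith)
  then obtain z where z: "x < z" "z < x + 1" "(x + 1) powr (1 - s) - x powr (1 - s) = (1 - s) * z powr (- s)" by auto
  have e: "x powr (1 - s) - (x + 1) powr (1 - s) = (s - 1) * z powr (- s)" using z(3) by (simp add: algebra_simps)
  have "(x + 1) powr (- s) \<le> z powr (- s)" "z powr (- s) \<le> x powr (- s)"
    using z assms by (auto intro!: powr_mono2')
  thus "(s - 1) * (x + 1) powr (- s) \<le> x powr (1 - s) - (x + 1) powr (1 - s)"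
    "x powr (1 - s) - (x + 1) powr (1 - s) \<le> (s - 1) * x powr (- s)"
    unfolding e using assms by (auto intro: mult_left_mono)
qed

text \<open>The zeta function behaves like \<open>1/(s - 1)\<close> as \<open>s\<close> tends to 1.\<close>

lemma zeta_bounds:
  assumes s: "s > 1"
  shows "1 \<le> (s - 1) * (\<Sum>n. real n powr (- s))" "(s - 1) * (\<Sum>n. real n powr (- s)) \<le> s"
proof -
  have sm: "summable (\<lambda>n. real n powr (- s))" using s by (simp add: summable_real_powr_iff)
  have sm1: "summable (\<lambda>n. real (Suc n) powr (- s))" using sm by (subst summable_Suc_iff)
  have sm2: "summable (\<lambda>n. real (Suc (Suc n)) powr (- s))" using sm1 by (subst summable_Suc_iff[of "\<lambda>n. real (Suc n) powr (- s)"])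
  have "(\<lambda>n. real (Suc n) powr (1 - s)) \<longlonglongrightarrow> 0"
  proof -
    have "((\<lambda>x::real. x powr (1 - s)) \<longlongrightarrow> 0) at_top" using s by (intro tendsto_neg_powr) (auto simp: filterlim_ident)
    from filterlim_compose[OF this filterlim_compose[OF filterlim_real_sequentially filterlim_Suc]]
    show ?thesis .
  qed
  from telescope_sums'[OF this]
  have tel: "(\<lambda>n. real (Suc n) powr (1 - s) - real (Suc (Suc n)) powr (1 - s)) sums 1" by simp
  have z1: "(\<Sum>n. real n powr (- s)) = (\<Sum>n. real (Suc n) powr (- s))"
    using suminf_split_head[OF sm] by simp
  have z2: "(\<Sum>n. real (Suc n) powr (- s)) = (\<Sum>n. real (Suc (Suc n)) powr (- s)) + 1"
    using suminf_split_head[OF sm1] by simp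
  define T where "T = (\<lambda>n. real (Suc n) powr (1 - s) - real (Suc (Suc n)) powr (1 - s))"
  have T: "summable T" "suminf T = 1" using tel by (simp_all add: T_def sums_iff)
  have "suminf T \<le> (\<Sum>n. (s - 1) * real (Suc n) powr (- s))"
  proof (rule suminf_le)
    fix n show "T n \<le> (s - 1) * real (Suc n) powr (- s)"
      using powr_diff_bounds(2)[OF s, of "real (Suc n)"] by (simp add: T_def add_ac)
  qed (use T sm1 in \<open>auto intro: summable_mult\<close>)
  thus "1 \<le> (s - 1) * (\<Sum>n. real n powr (- s))" unfolding z1 using suminf_mult[OF sm1, of "s - 1"] T(2) by simp
  have "(\<Sum>n. (s - 1) * real (Suc (Suc n)) powr (- s)) \<le> suminf T"
  proof (rule suminf_le)
    fix n show "(s - 1) * real (Suc (Suc n)) powr (- s) \<le> T n"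
      using powr_diff_bounds(1)[OF s, of "real (Suc n)"] by (simp add: T_def add_ac)
  qed (use T sm2 in \<open>auto intro: summable_mult\<close>)
  hence "(s - 1) * (\<Sum>n. real (Suc (Suc n)) powr (- s)) \<le> 1" using suminf_mult[OF sm2, of "s - 1"] T(2) by simp
  thus "(s - 1) * (\<Sum>n. real n powr (- s)) \<le> s" unfolding z1 z2 by (simp add: algebra_simps)
qed

text \<open>The bound \<open>q\<close> on the partial sums is the property that distinguishes the nonprincipal characters modulo \<open>q\<close>.\<close>

locale nonprincipal = bounded_multiplicative +
  fixes q :: nat
  assumes partial_sums_bounded: "norm (\<Sum>k<N. \<psi> (Suc k)) \<le> real q"
begin

definition b :: "real \<Rightarrow> nat \<Rightarrow> real" where "b s n = real (Suc n) powr (- s)"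

definition S :: "nat \<Rightarrow> complex" where "S N = (\<Sum>k<N. \<psi> (Suc k))"

text \<open>The series \<open>L\<close> after summation by parts. It converges for \<open>s \<ge> 1\<close> and so continues \<open>L\<close> to \<open>s = 1\<close>.\<close>

definition L' :: "real \<Rightarrow> complex" where "L' s = (\<Sum>n. S (Suc n) * of_real (b s n - b s (Suc n)))"

lemma norm_S: "norm (S N) \<le> real q" unfolding S_def by (rule partial_sums_bounded)

lemma b_antimono: "s \<ge> 1 \<Longrightarrow> b s (Suc n) \<le> b s n"
  unfolding b_def by (intro powr_mono2') auto

lemma b_tendsto: "s \<ge> 1 \<Longrightarrow> b s \<longlonglongrightarrow> 0"
proof -
  assume s: "s \<ge> 1"
  have "((\<lambda>x::real. x powr (- s)) \<longlongrightarrow> 0) at_top" using s by (intro tendsto_neg_powr) (auto simp: filterlim_ident)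
  from filterlim_compose[OF this filterlim_compose[OF filterlim_real_sequentially filterlim_Suc]]
  show ?thesis unfolding b_def .
qed

lemma diff_b_sums: "s \<ge> 1 \<Longrightarrow> (\<lambda>n. b s n - b s (Suc n)) sums 1"
  using telescope_sums'[OF b_tendsto] by (simp add: b_def)

lemma summable_L': "s \<ge> 1 \<Longrightarrow> summable (\<lambda>n. S (Suc n) * of_real (b s n - b s (Suc n)))"
proof (rule summable_comparison_test'[of "\<lambda>n. real q * (b s n - b s (Suc n))" 0])
  assume s: "s \<ge> 1"
  show "summable (\<lambda>n. real q * (b s n - b s (Suc n)))"
    using diff_b_sums[OF s] by (intro summable_mult) (simp add: sums_iff)
  fix n
  show "norm (S (Suc n) * of_real (b s n - b s (Suc n))) \<le> real q * (b s n - b s (Suc n))"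
    unfolding norm_mult norm_of_real using b_antimono[OF s, of n] norm_S[of "Suc n"] by (intro mult_mono) auto
qed

lemma partial_sums_tendsto_L':
  assumes s: "s \<ge> 1"
  shows "(\<lambda>N. \<Sum>n<N. \<psi> (Suc n) * of_real (b s n)) \<longlonglongrightarrow> L' s"
proof -
  have "(\<lambda>N. S N * of_real (b s N)) \<longlonglongrightarrow> 0"
  proof (rule Lim_null_comparison)
    show "\<forall>\<^sub>F N in sequentially. norm (S N * of_real (b s N)) \<le> real q * b s N"
      by (rule always_eventually) (auto simp: norm_mult b_def intro!: mult_right_mono norm_S)
    show "(\<lambda>N. real q * b s N) \<longlonglongrightarrow> 0" using tendsto_mult_left[OF b_tendsto[OF s], of "real q"] by simp
  qed
  moreover have "(\<lambda>N. \<Sum>n<N. S (Suc n) * of_real (b s n - b s (Suc n))) \<longlonglongrightarrow> L' s"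
    unfolding L'_def by (rule summable_LIMSEQ[OF summable_L'[OF s]])
  ultimately have "(\<lambda>N. S N * of_real (b s N) + (\<Sum>n<N. S (Suc n) * of_real (b s n - b s (Suc n)))) \<longlonglongrightarrow> 0 + L' s"
    by (rule tendsto_add)
  moreover have "(\<lambda>N. \<Sum>n<N. \<psi> (Suc n) * of_real (b s n))
      = (\<lambda>N. S N * of_real (b s N) + (\<Sum>n<N. S (Suc n) * of_real (b s n - b s (Suc n))))"
    unfolding S_def by (intro ext abel_summation)
  ultimately show ?thesis by simp
qed

lemma L_eq_L': "s > 1 \<Longrightarrow> L s = L' s"
proof -
  assume s: "s > 1"
  have sm: "summable (dterm s)" using summable_dterm[OF s] by (rule summable_norm_cancel)
  have "L s = (\<Sum>n. dterm s (Suc n))" unfolding L_def using suminf_split_head[OF sm] by (simp add: dterm_0)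
  moreover have "(\<lambda>N. \<Sum>n<N. dterm s (Suc n)) \<longlonglongrightarrow> (\<Sum>n. dterm s (Suc n))"
    using sm by (intro summable_LIMSEQ) (simp add: summable_Suc_iff)
  moreover have "(\<lambda>N. \<Sum>n<N. dterm s (Suc n)) \<longlonglongrightarrow> L' s"
    using partial_sums_tendsto_L'[of s] s by (simp add: dterm_def b_def)
  ultimately show ?thesis using LIMSEQ_unique by metis
qed

lemma norm_L'_le: "s \<ge> 1 \<Longrightarrow> norm (L' s) \<le> real q"
proof -
  assume s: "s \<ge> 1"
  have "norm (L' s) \<le> (\<Sum>n. real q * (b s n - b s (Suc n)))"
    unfolding L'_def
  proof (rule norm_suminf_le)
    show "summable (\<lambda>n. real q * (b s n - b s (Suc n)))"
      using diff_b_sums[OF s] by (intro summable_mult) (simp add: sums_iff)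
    fix n
    show "norm (S (Suc n) * of_real (b s n - b s (Suc n))) \<le> real q * (b s n - b s (Suc n))"
      unfolding norm_mult norm_of_real using b_antimono[OF s, of n] norm_S[of "Suc n"] by (intro mult_mono) auto
  qed
  also have "\<dots> = real q" using sums_mult[OF diff_b_sums[OF s], of "real q"] by (simp add: sums_iff)
  finally show ?thesis .
qed

definition lip :: real where "lip = (\<Sum>n. real q * (3 * real (Suc n) powr (- 3 / 2)))"

lemma summable_lip: "summable (\<lambda>n. real (Suc n) powr (- 3 / 2))"
proof -
  have "summable (\<lambda>n. real n powr (- 3 / 2))" by (simp add: summable_real_powr_iff)
  thus ?thesis by (subst summable_Suc_iff)
qed

text \<open>The terms of the series have derivatives in \<open>s\<close> of size \<open>O(n\<^sup>-\<^sup>3\<^sup>/\<^sup>2)\<close>. By the mean value theorem the difference between the terms at \<open>s\<close> and at 1 is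
  a value of the derivative of \<open>x\<^sup>-\<^sup>1 - x\<^sup>-\<^sup>s\<close>.\<close>

lemma L'_lipschitz:
  assumes s: "s \<ge> 1"
  shows "norm (L' s - L' 1) \<le> lip * (s - 1)"
proof -
  define D where "D = (\<lambda>n. S (Suc n) * of_real (b s n - b s (Suc n)) - S (Suc n) * of_real (b 1 n - b 1 (Suc n)))"
  have bound: "norm (D n) \<le> real q * (3 * real (Suc n) powr (- 3 / 2)) * (s - 1)" for n
  proof -
    define x where "x = real (Suc n)"
    have x1: "x \<ge> 1" by (simp add: x_def)
    have "\<exists>z>x. z < x + 1 \<and> ((x + 1) powr (-1) - (x + 1) powr (- s)) - (x powr (-1) - x powr (- s))
        = (x + 1 - x) * ((-1) * z powr (-1 - 1) - (- s) * z powr (- s - 1))"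
      by (rule MVT2[of x "x + 1" "\<lambda>z. z powr (-1) - z powr (- s)" "\<lambda>z. (-1) * z powr (-1 - 1) - (- s) * z powr (- s - 1)"], simp)
        (rule DERIV_diff; rule has_real_derivative_powr; use x1 in linarith)
    then obtain z where z: "x < z" "z < x + 1" and eq: "((x + 1) powr (-1) - (x + 1) powr (- s)) - (x powr (-1) - x powr (- s))
        = s * z powr (- s - 1) - z powr (- 2)" by auto
    have z1: "z > 1" using z x1 by linarith
    have bb: "(b s n - b s (Suc n)) - (b 1 n - b 1 (Suc n)) = s * z powr (- s - 1) - z powr (- 2)"
      unfolding b_def eq[symmetric] x_def by (simp add: add_ac)
    have split: "z powr (- s - 1) = z powr (- 2) * exp (- ((s - 1) * ln z))"
      using z1 by (simp add: powr_def exp_add[symmetric] algebra_simps)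
    have e1: "1 - (s - 1) * ln z \<le> exp (- ((s - 1) * ln z))" using exp_ge_add_one_self[of "- ((s - 1) * ln z)"] by simp
    have e2: "exp (- ((s - 1) * ln z)) \<le> 1" using s z1 by simp
    have lnz: "ln z \<le> 2 * z powr (1 / 2)"
    proof -
      have "ln z = 2 * ln (z powr (1 / 2))" using z1 by (simp add: ln_powr)
      also have "\<dots> \<le> 2 * z powr (1 / 2)" using z1 ln_bound[of "z powr (1 / 2)"] by simp
      finally show ?thesis .
    qed
    have zh: "1 \<le> z powr (1 / 2)" using z1 by (intro ge_one_powr_ge_zero) auto
    define e where "e = exp (- ((s - 1) * ln z))"
    have "\<bar>s * z powr (- s - 1) - z powr (- 2)\<bar> = z powr (- 2) * \<bar>s * e - 1\<bar>"
    proof -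
      have "s * z powr (- s - 1) - z powr (- 2) = z powr (- 2) * (s * e - 1)"
        unfolding split e_def[symmetric] by (simp add: algebra_simps)
      thus ?thesis by (simp add: abs_mult)
    qed
    also have "\<dots> \<le> z powr (- 2) * ((s - 1) * (3 * z powr (1 / 2)))"
    proof (rule mult_left_mono)
      have "s * e - 1 = (s - 1) * e - (1 - e)" by (simp add: algebra_simps)
      moreover have "e \<le> 1" "0 \<le> e" using e2 by (simp_all only: e_def exp_ge_zero)
      hence "(s - 1) * e \<le> (s - 1) * 1" "0 \<le> (s - 1) * e" using s by (intro mult_left_mono mult_nonneg_nonneg; linarith)+
      moreover have "1 - e \<le> (s - 1) * ln z" "0 \<le> 1 - e" using e1 e2 by (simp_all add: e_def)
      moreover have "(s - 1) * ln z \<le> (s - 1) * (2 * z powr (1 / 2))" using s lnz by (intro mult_left_mono) auto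
      moreover have "(s - 1) * 1 \<le> (s - 1) * z powr (1 / 2)" using s zh by (intro mult_left_mono) auto
      ultimately show "\<bar>s * e - 1\<bar> \<le> (s - 1) * (3 * z powr (1 / 2))" by (simp add: abs_le_iff algebra_simps)
    qed simp
    also have "\<dots> = 3 * z powr (- 3 / 2) * (s - 1)"
      using z1 powr_add[of z "- 2" "1 / 2"] by (simp add: algebra_simps)
    also have "\<dots> \<le> 3 * x powr (- 3 / 2) * (s - 1)"
      using s z x1 by (intro mult_right_mono mult_left_mono powr_mono2') auto
    finally have "\<bar>(b s n - b s (Suc n)) - (b 1 n - b 1 (Suc n))\<bar> \<le> 3 * x powr (- 3 / 2) * (s - 1)" unfolding bb .
    moreover have "D n = S (Suc n) * of_real ((b s n - b s (Suc n)) - (b 1 n - b 1 (Suc n)))"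
      unfolding D_def by (simp add: algebra_simps)
    hence "norm (D n) = norm (S (Suc n)) * \<bar>(b s n - b s (Suc n)) - (b 1 n - b 1 (Suc n))\<bar>"
      by (simp only: norm_mult norm_of_real)
    moreover have "norm (S (Suc n)) * \<bar>(b s n - b s (Suc n)) - (b 1 n - b 1 (Suc n))\<bar> \<le> real q * (3 * x powr (- 3 / 2) * (s - 1))"
      using calculation(1) by (intro mult_mono norm_S) auto
    ultimately show ?thesis by (simp add: x_def mult.assoc)
  qed
  have "L' s - L' 1 = (\<Sum>n. D n)"
    unfolding L'_def D_def by (rule suminf_diff[OF summable_L'[OF s] summable_L']) simp
  moreover have "norm (\<Sum>n. D n) \<le> (\<Sum>n. real q * (3 * real (Suc n) powr (- 3 / 2)) * (s - 1))"
    by (rule norm_suminf_le[OF bound]) (intro summable_mult summable_mult2 summable_lip)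
  moreover have "\<dots> = lip * (s - 1)"
    unfolding lip_def by (rule suminf_mult2[symmetric]) (intro summable_mult summable_lip)
  ultimately show ?thesis by simp
qed

lemma prime_sum_upper: "s > 1 \<Longrightarrow> prime_sum s \<le> ln (real q) + 3 * square_sum"
  using log_L_prime_sum[of s] norm_L'_le[of s] L_eq_L'[of s] ln_mono[of "norm (L s)" "real q"] by fastforce

text \<open>A zero at 1 makes \<open>L(s)\<close> at most linear in \<open>s - 1\<close>, so the sum over the primes tends to \<open>-\<infinity>\<close> like \<open>ln (s - 1)\<close>.\<close>

lemma prime_sum_upper_if_zero:
  assumes "s > 1" "L' 1 = 0"
  shows "lip > 0" "prime_sum s \<le> ln (lip * (s - 1)) + 3 * square_sum"
proof -
  have le: "norm (L s) \<le> lip * (s - 1)" using L'_lipschitz[of s] assms L_eq_L'[of s] by simp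
  have pos: "norm (L s) > 0" by (rule log_L_prime_sum(1)[OF assms(1)])
  show "lip > 0" using le pos assms(1) by (metis less_le_trans zero_less_mult_pos2 diff_gt_0_iff_gt)
  have "ln (norm (L s)) \<le> ln (lip * (s - 1))" using le pos by (intro ln_mono) auto
  thus "prime_sum s \<le> ln (lip * (s - 1)) + 3 * square_sum" using log_L_prime_sum(2)[OF assms(1)] by linarith
qed

lemma prime_sum_lower_if_nonzero:
  assumes "L' 1 \<noteq> 0"
  obtains \<delta> K where "\<delta> > 0" "\<And>s. s > 1 \<Longrightarrow> s < 1 + \<delta> \<Longrightarrow> prime_sum s \<ge> K"
proof -
  define \<delta> where "\<delta> = norm (L' 1) / (2 * (\<bar>lip\<bar> + 1))"
  have d: "\<delta> > 0" using assms by (simp add: \<delta>_def)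
  show ?thesis
  proof (rule that[OF d, of "ln (norm (L' 1) / 2) - 3 * square_sum"])
    fix s :: real assume s: "s > 1" "s < 1 + \<delta>"
    have "lip * (s - 1) \<le> (\<bar>lip\<bar> + 1) * (s - 1)" using s by (intro mult_right_mono) auto
    also have "\<dots> \<le> (\<bar>lip\<bar> + 1) * \<delta>" using s by (intro mult_left_mono) auto
    also have "\<dots> = norm (L' 1) / 2" by (simp add: \<delta>_def field_simps)
    finally have "norm (L' s - L' 1) \<le> norm (L' 1) / 2" using L'_lipschitz[of s] s by linarith
    moreover have "norm (L' 1) \<le> norm (L' s) + norm (L' s - L' 1)" by (metis add.commute norm_triangle_sub norm_minus_commute)
    ultimately have "norm (L' 1) / 2 \<le> norm (L s)" using L_eq_L'[OF s(1)] by simp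
    hence "ln (norm (L' 1) / 2) \<le> ln (norm (L s))" using assms by (intro ln_mono) auto
    thus "ln (norm (L' 1) / 2) - 3 * square_sum \<le> prime_sum s" using log_L_prime_sum(2)[OF s(1)] by linarith
  qed
qed

text \<open>Summation by parts with bounded partial sums.\<close>

lemma decreasing_weights_bound:
  assumes dec: "\<And>n. w (Suc n) \<le> w n" and pos: "\<And>n. (0::real) \<le> w n"
  shows "norm (\<Sum>n<N. \<psi> (Suc n) * of_real (w n)) \<le> real q * w 0"
proof -
  have "norm (\<Sum>n<N. \<psi> (Suc n) * of_real (w n)) \<le> norm (S N * of_real (w N)) + norm (\<Sum>n<N. S (Suc n) * of_real (w n - w (Suc n)))"
    unfolding S_def by (subst abel_summation) (rule norm_triangle_ineq)
  also have "norm (S N * of_real (w N)) \<le> real q * w N"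
    using pos[of N] norm_S[of N] by (simp add: norm_mult mult_right_mono)
  also have "norm (\<Sum>n<N. S (Suc n) * of_real (w n - w (Suc n))) \<le> (\<Sum>n<N. real q * (w n - w (Suc n)))"
  proof (rule sum_norm_le)
    fix n
    have "norm (S (Suc n) * of_real (w n - w (Suc n))) = norm (S (Suc n)) * (w n - w (Suc n))"
      using dec[of n] by (simp only: norm_mult norm_of_real)
    also have "\<dots> \<le> real q * (w n - w (Suc n))" using dec[of n] norm_S[of "Suc n"] by (intro mult_right_mono) auto
    finally show "norm (S (Suc n) * of_real (w n - w (Suc n))) \<le> real q * (w n - w (Suc n))" .
  qed
  also have "(\<Sum>n<N. real q * (w n - w (Suc n))) = real q * (w 0 - w N)"
    by (simp add: sum_distrib_left[symmetric] sum_lessThan_telescope')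
  finally show ?thesis by (simp add: algebra_simps)
qed

end

section \<open>Real characters do not vanish at 1\<close>

text \<open>The inequality of the arithmetic and the geometric mean for \<open>1, r\<^sup>2, \<dots>, r\<^sup>2\<^sup>n\<close>.\<close>

lemma geometric_sum_ge:
  fixes r :: real
  assumes "0 < r"
  shows "(\<Sum>i<Suc n. (r ^ 2) ^ i) \<ge> real (Suc n) * r ^ n"
proof -
  have "2 * (\<Sum>i<Suc n. (r ^ 2) ^ i) = (\<Sum>i<Suc n. (r ^ 2) ^ i) + (\<Sum>i<Suc n. (r ^ 2) ^ (n - i))"
    using sum.nat_diff_reindex[of "\<lambda>i. (r ^ 2) ^ i" "Suc n"] by simp
  also have "\<dots> = (\<Sum>i<Suc n. (r ^ i) ^ 2 + (r ^ (n - i)) ^ 2)"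
    by (simp add: sum.distrib power_mult[symmetric] mult.commute)
  also have "\<dots> \<ge> (\<Sum>i<Suc n. 2 * r ^ n)"
  proof (rule sum_mono)
    fix i assume "i \<in> {..<Suc n}"
    hence e: "r ^ i * r ^ (n - i) = r ^ n" by (simp add: power_add[symmetric])
    have "0 \<le> (r ^ i - r ^ (n - i)) ^ 2" by simp
    hence "2 * (r ^ i * r ^ (n - i)) \<le> (r ^ i) ^ 2 + (r ^ (n - i)) ^ 2" by (simp add: power2_diff)
    thus "2 * r ^ n \<le> (r ^ i) ^ 2 + (r ^ (n - i)) ^ 2" unfolding e .
  qed
  finally show ?thesis by simp
qed

lemma sum_powers_sign_nonneg:
  fixes x :: real assumes "x \<in> {0, 1, -1}"
  shows "0 \<le> (\<Sum>i\<le>k. x ^ i)" "1 \<le> (\<Sum>i\<le>2 * k. x ^ i)"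
proof -
  have a: "(\<Sum>i\<le>2 * j. x ^ i) = (if x = 1 then 2 * real j + 1 else 1) \<and> (\<Sum>i\<le>Suc (2 * j). x ^ i) = (if x = 1 then 2 * real j + 2 else if x = 0 then 1 else 0)" for j
    using assms by (induction j) auto
  show "1 \<le> (\<Sum>i\<le>2 * k. x ^ i)" using a[of k] by auto
  show "0 \<le> (\<Sum>i\<le>k. x ^ i)"
  proof (cases "even k")
    case True
    then obtain j where "k = 2 * j" by (auto elim: evenE)
    thus ?thesis using a[of j] by auto
  next
    case False
    then obtain j where "k = Suc (2 * j)" by (auto elim: oddE)
    thus ?thesis using a[of j] by auto
  qed
qed

locale real_nonprincipal = nonprincipal +
  assumes psi_values: "\<psi> n \<in> {0, 1, -1}"
begin

definition f :: "nat \<Rightarrow> real" where "f n = Re (\<psi> n)"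

definition c :: "nat \<Rightarrow> real" where "c n = (\<Sum>d | d dvd n. f d)"

lemma psi_eq: "\<psi> n = of_real (f n)"
  using psi_values[of n] by (auto simp: f_def)

lemma f_values: "f n \<in> {0, 1, -1}"
  using psi_values[of n] by (auto simp: f_def)

lemma f_mult: "f (m * n) = f m * f n"
proof -
  have "of_real (f (m * n)) = (of_real (f m * f n) :: complex)" using psi_mult[of m n] by (simp add: psi_eq)
  thus ?thesis by (simp only: of_real_eq_iff)
qed

lemma f_1: "f 1 = 1" using psi_1 by (simp add: f_def)

lemma f_power: "f (p ^ i) = f p ^ i"
  by (induction i) (use f_1 in \<open>simp_all add: f_mult\<close>)

lemma c_prime_power_mult:
  assumes p: "prime p" and m: "\<not> p dvd m" "m > 0"
  shows "c (p ^ k * m) = (\<Sum>i\<le>k. f p ^ i) * c m"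
proof -
  have p0: "p > 0" using p prime_gt_0_nat by blast
  have inj: "inj_on (\<lambda>(i,d). p ^ i * d) ({..k} \<times> {d. d dvd m})"
  proof -
    have le: "i = j \<and> d = e" if "i \<le> j" "p ^ i * d = p ^ j * e" "d dvd m" for i j d e
    proof -
      have "p ^ j = p ^ i * p ^ (j - i)" using that(1) by (simp add: power_add[symmetric])
      hence "d = p ^ (j - i) * e" using that(2) p0 by simp
      moreover have "j - i = 0"
      proof (rule ccontr)
        assume "j - i \<noteq> 0"
        hence "p dvd d" using \<open>d = p ^ (j - i) * e\<close> by (simp add: dvd_mult2)
        thus False using that(3) m(1) dvd_trans by blast
      qed
      ultimately show ?thesis using that(1) by simp
    qed
    show ?thesis
    proof (rule inj_onI, clarify)
      fix i d j e assume "d dvd m" "e dvd m" "p ^ i * d = p ^ j * e"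
      thus "i = j \<and> d = e" using le[of i j d e] le[of j i e d] by (cases "i \<le> j") auto
    qed
  qed
  have img: "(\<lambda>(i,d). p ^ i * d) ` ({..k} \<times> {d. d dvd m}) = {d. d dvd p ^ k * m}"
  proof (intro equalityI subsetI)
    fix x assume "x \<in> (\<lambda>(i,d). p ^ i * d) ` ({..k} \<times> {d. d dvd m})"
    thus "x \<in> {d. d dvd p ^ k * m}" by (auto intro!: mult_dvd_mono le_imp_power_dvd)
  next
    fix x assume "x \<in> {d. d dvd p ^ k * m}"
    then obtain u v where uv: "x = u * v" "u dvd p ^ k" "v dvd m" using division_decomp by blast
    obtain i where "i \<le> k" "u = p ^ i" using uv(2) divides_primepow_nat[OF p] by blast
    thus "x \<in> (\<lambda>(i,d). p ^ i * d) ` ({..k} \<times> {d. d dvd m})" using uv by force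
  qed
  have "c (p ^ k * m) = (\<Sum>(i,d)\<in>{..k} \<times> {d. d dvd m}. f (p ^ i * d))"
    unfolding c_def img[symmetric] by (subst sum.reindex[OF inj]) (simp add: case_prod_beta o_def)
  also have "\<dots> = (\<Sum>(i,d)\<in>{..k} \<times> {d. d dvd m}. f p ^ i * f d)" by (simp add: f_mult f_power)
  also have "\<dots> = (\<Sum>i\<le>k. f p ^ i) * c m"
    unfolding c_def by (simp add: sum_product sum.cartesian_product)
  finally show ?thesis .
qed

text \<open>By multiplicativity this reduces to prime powers, where \<open>c\<close> is a sum of powers of \<open>f(p)\<close>, which is 0, 1 or -1.\<close>

lemma c_nonneg: "n > 0 \<Longrightarrow> 0 \<le> c n \<and> 1 \<le> c (n ^ 2)"
proof (induction n rule: less_induct)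
  case (less n)
  show ?case
  proof (cases "n = 1")
    case True
    thus ?thesis by (simp add: c_def f_1[unfolded One_nat_def])
  next
    case False
    then obtain p where p: "prime p" "p dvd n" using prime_factor_nat by blast
    define k where "k = multiplicity p n"
    have "\<not> is_unit p" using p(1) not_prime_unit by blast
    then obtain m where m: "n = p ^ k * m" "\<not> p dvd m"
      using less.prems unfolding k_def by (metis multiplicity_decompose' not_gr0)
    have k: "k > 0" using p m by (cases k) auto
    have m0: "m > 0" using m less.prems by (cases m) auto
    have "p ^ k > 1" using one_less_power[OF prime_gt_1_nat[OF p(1)] k] .
    hence mn: "m < n" using m(1) m0 by simp
    have n2: "n ^ 2 = p ^ (2 * k) * m ^ 2" by (simp add: m(1) power_mult_distrib power_mult[symmetric] mult.commute)
    have m2: "\<not> p dvd m ^ 2" using m(2) p(1) prime_dvd_power by blast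
    have "c n = (\<Sum>i\<le>k. f p ^ i) * c m" unfolding m(1) by (rule c_prime_power_mult[OF p(1) m(2) m0])
    moreover have "c (n ^ 2) = (\<Sum>i\<le>2 * k. f p ^ i) * c (m ^ 2)"
      unfolding n2 by (rule c_prime_power_mult[OF p(1) m2]) (use m0 in simp)
    moreover have "1 * 1 \<le> (\<Sum>i\<le>2 * k. f p ^ i) * c (m ^ 2)"
      using sum_powers_sign_nonneg(2)[OF f_values, of p k] less.IH[OF mn m0] by (intro mult_mono) auto
    ultimately show ?thesis using sum_powers_sign_nonneg(1)[OF f_values, of p k] less.IH[OF mn m0] by simp
  qed
qed

text \<open>When \<open>t\<close> is close to 1, the coefficient \<open>t\<^sup>n/(1 - t\<^sup>n)\<close> of a Lambert series is close to \<open>1/(n(1 - t))\<close>, and the weights are the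
  differences. The sum \<open>A n = 1 + t + \<dots> + t\<^sup>n\<close> is at least \<open>n + 1\<close> times the geometric mean \<open>r\<^sup>n\<close> of its terms, which is
  why \<open>t\<close> is written as a square.\<close>

lemma lambert_weights:
  fixes r :: real
  assumes r: "0 < r" "r < 1"
  defines "t \<equiv> r ^ 2"
  defines "w \<equiv> \<lambda>n. 1 / (real (Suc n) * (1 - t)) - t ^ Suc n / (1 - t ^ Suc n)"
  shows "w (Suc n) \<le> w n" "0 \<le> w n" "w 0 = 1"
proof -
  have t: "0 < t" "t < 1" using r by (auto simp: t_def power_less_one_iff)
  define A where "A = (\<lambda>n. \<Sum>i<Suc n. t ^ i)"
  have A: "1 - t ^ Suc n = (1 - t) * A n" for n
  proof -
    have "1 - t ^ Suc n = - (t ^ Suc n - 1)" by simp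
    also have "\<dots> = - ((t - 1) * A n)" by (simp only: power_diff_1_eq A_def)
    also have "\<dots> = (1 - t) * A n" by (simp add: algebra_simps)
    finally show ?thesis .
  qed
  have A_ge: "real (Suc n) * r ^ n \<le> A n" for n unfolding A_def t_def by (rule geometric_sum_ge[OF r(1)])
  have A_pos: "A n > 0" for n
    by (rule less_le_trans[OF _ A_ge]) (use r in simp)
  have w: "w n = (1 / real (Suc n) - t ^ Suc n / A n) / (1 - t)" for n
    unfolding w_def A using t by (simp add: diff_divide_distrib mult.commute)
  have AS: "A (Suc n) = 1 + t * A n" for n
    unfolding A_def sum_distrib_left by (subst sum.lessThan_Suc_shift) simp
  have rt: "r ^ n * r ^ Suc n \<ge> t ^ Suc n" for n
  proof -
    have "t ^ Suc n = r ^ Suc n * r ^ Suc n" by (simp add: t_def power2_eq_square power_mult_distrib)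
    moreover have "r ^ Suc n \<le> r ^ n" using r by (simp add: mult_left_le_one_le)
    ultimately show ?thesis using r by (simp add: mult_right_mono)
  qed
  show "w 0 = 1" using t by (simp add: w_def diff_divide_distrib[symmetric])
  show "0 \<le> w n"
  proof -
    have "t ^ Suc n * real (Suc n) \<le> A n"
    proof -
      have "t ^ Suc n \<le> r ^ n * r ^ Suc n" by (rule rt)
      also have "\<dots> \<le> r ^ n * 1" using r by (intro mult_left_mono power_le_one) auto
      finally have "t ^ Suc n * real (Suc n) \<le> r ^ n * real (Suc n)" by (intro mult_right_mono) auto
      also have "\<dots> = real (Suc n) * r ^ n" by (rule mult.commute)
      also have "\<dots> \<le> A n" by (rule A_ge)
      finally show ?thesis .
    qed
    hence "t ^ Suc n / A n \<le> 1 / real (Suc n)" using A_pos[of n] by (simp add: divide_simps mult.commute)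
    thus ?thesis unfolding w using t by simp
  qed
  show "w (Suc n) \<le> w n"
  proof -
    have "t ^ Suc n / A n - t ^ Suc (Suc n) / A (Suc n) = t ^ Suc n * (A (Suc n) - t * A n) / (A n * A (Suc n))"
      using A_pos[of n] A_pos[of "Suc n"] by (simp add: diff_divide_distrib right_diff_distrib)
    also have "\<dots> = t ^ Suc n / (A n * A (Suc n))" by (simp add: AS)
    also have "\<dots> \<le> 1 / (real (Suc n) * real (Suc (Suc n)))"
    proof -
      have "real (Suc n) * real (Suc (Suc n)) * t ^ Suc n \<le> real (Suc n) * real (Suc (Suc n)) * (r ^ n * r ^ Suc n)"
        by (intro mult_left_mono rt) auto
      also have "\<dots> = (real (Suc n) * r ^ n) * (real (Suc (Suc n)) * r ^ Suc n)" by (simp only: mult_ac)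
      also have "\<dots> \<le> A n * A (Suc n)"
        using r A_pos[of n] by (intro mult_mono A_ge) (auto intro: less_imp_le)
      finally show ?thesis using A_pos[of n] A_pos[of "Suc n"] by (simp add: divide_simps mult_ac)
    qed
    also have "\<dots> = 1 / real (Suc n) - 1 / real (Suc (Suc n))" by (simp add: divide_simps)
    finally have "1 / real (Suc (Suc n)) - t ^ Suc (Suc n) / A (Suc n) \<le> 1 / real (Suc n) - t ^ Suc n / A n" by linarith
    thus ?thesis unfolding w using t by (intro divide_right_mono) auto
  qed
qed

text \<open>Expand the geometric series \<open>t\<^sup>d/(1 - t\<^sup>d)\<close> and collect equal powers of \<open>t\<close>. The finite sums differ by the tails of these series,
  each of which is at most \<open>t\<^sup>N/(1 - t)\<close>.\<close>

lemma lambert_power_series: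
  assumes t: "0 < t" "t < 1"
  shows "(\<Sum>n\<in>{1..N}. c n * t ^ n) \<le> (\<Sum>d\<in>{1..N}. f d * (t ^ d / (1 - t ^ d))) + real N * t ^ N / (1 - t)"
proof -
  have geo: "(\<Sum>k\<in>{1..M}. (t ^ d) ^ k) = t ^ d / (1 - t ^ d) - (t ^ d) ^ Suc M / (1 - t ^ d)" if "d \<ge> 1" for d M
  proof -
    have td: "t ^ d < 1" using t that by (simp add: power_less_one_iff)
    have "(\<Sum>k\<in>{1..M}. u ^ k) * (1 - u) = u - u ^ Suc M" for u :: real
    proof (induction M)
      case (Suc M)
      have "(\<Sum>k\<in>{1..Suc M}. u ^ k) * (1 - u) = (\<Sum>k\<in>{1..M}. u ^ k) * (1 - u) + u ^ Suc M * (1 - u)"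
        by (simp add: distrib_right)
      also have "\<dots> = u - u ^ Suc M + u ^ Suc M * (1 - u)" by (simp only: Suc.IH)
      also have "\<dots> = u - u ^ Suc (Suc M)" by (simp add: algebra_simps)
      finally show ?case .
    qed simp
    from this[of "t ^ d"] have "(\<Sum>k\<in>{1..M}. (t ^ d) ^ k) * (1 - t ^ d) = t ^ d - (t ^ d) ^ Suc M" .
    moreover have "1 - t ^ d \<noteq> 0" using td by simp
    moreover have "x = a / y - b / y" if "x * y = a - b" "y \<noteq> 0" for x y a b :: real
      using that by (simp add: diff_divide_distrib[symmetric] nonzero_eq_divide_eq)
    ultimately show ?thesis by blast
  qed
  have "(\<Sum>n\<in>{1..N}. c n * t ^ n) = (\<Sum>n\<in>{1..N}. \<Sum>d\<in>{1..N}. if d dvd n then f d * t ^ n else 0)"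
  proof (rule sum.cong[OF refl])
    fix n assume n: "n \<in> {1..N}"
    have "c n * t ^ n = (\<Sum>d | d dvd n. f d * t ^ n)" by (simp add: c_def sum_distrib_right)
    also have "\<dots> = (\<Sum>d\<in>{1..N}. if d dvd n then f d * t ^ n else 0)"
    proof (rule sum.mono_neutral_cong_left)
      show "{d. d dvd n} \<subseteq> {1..N}"
      proof
        fix d assume "d \<in> {d. d dvd n}"
        hence "d dvd n" by simp
        hence "d \<le> n" "d > 0" using n by (auto dest: dvd_imp_le intro!: Nat.gr0I)
        thus "d \<in> {1..N}" using n by auto
      qed
    qed auto
    finally show "c n * t ^ n = (\<Sum>d\<in>{1..N}. if d dvd n then f d * t ^ n else 0)" .
  qed
  also have "\<dots> = (\<Sum>d\<in>{1..N}. \<Sum>n\<in>{1..N}. if d dvd n then f d * t ^ n else 0)" by (rule sum.swap)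
  also have "\<dots> = (\<Sum>d\<in>{1..N}. f d * (\<Sum>k\<in>{1..N div d}. (t ^ d) ^ k))"
  proof (rule sum.cong[OF refl])
    fix d assume d: "d \<in> {1..N}"
    have "(\<Sum>n\<in>{1..N}. if d dvd n then f d * t ^ n else 0) = (\<Sum>n\<in>{n\<in>{1..N}. d dvd n}. f d * t ^ n)"
      by (rule sum.inter_filter[symmetric]) simp
    also have "\<dots> = (\<Sum>k\<in>{1..N div d}. f d * t ^ (d * k))"
    proof (rule sum.reindex_bij_witness[of _ "\<lambda>k. d * k" "\<lambda>n. n div d"])
      fix k assume "k \<in> {1..N div d}"
      thus "d * k \<in> {n\<in>{1..N}. d dvd n}" using d
        by (auto simp: less_eq_div_iff_mult_less_eq mult.commute)
    next
      fix n assume "n \<in> {n\<in>{1..N}. d dvd n}"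
      thus "n div d \<in> {1..N div d}" using d by (auto simp: div_le_mono elim!: dvdE)
    qed (use d in auto)
    finally show "(\<Sum>n\<in>{1..N}. if d dvd n then f d * t ^ n else 0) = f d * (\<Sum>k\<in>{1..N div d}. (t ^ d) ^ k)"
      by (simp add: sum_distrib_left power_mult)
  qed
  also have "\<dots> \<le> (\<Sum>d\<in>{1..N}. f d * (t ^ d / (1 - t ^ d)) + t ^ N / (1 - t))"
  proof (rule sum_mono)
    fix d assume d: "d \<in> {1..N}"
    define e where "e = (t ^ d) ^ Suc (N div d) / (1 - t ^ d)"
    have td: "t ^ d \<le> t ^ 1" using t d by (intro power_decreasing) auto
    have "N \<le> d * Suc (N div d)" using d
      by (metis dividend_less_times_div less_imp_le mult.commute mult_Suc_right atLeastAtMost_iff not_one_le_zero gr0I add.commute)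
    hence "(t ^ d) ^ Suc (N div d) \<le> t ^ N" unfolding power_mult[symmetric] using t by (intro power_decreasing) auto
    hence e: "0 \<le> e" "e \<le> t ^ N / (1 - t)" unfolding e_def using t td by (auto intro!: frac_le divide_nonneg_nonneg)
    have "\<bar>f d * e\<bar> \<le> 1 * e" unfolding abs_mult using f_values[of d] e(1) by (intro mult_mono) auto
    hence "- (f d * e) \<le> t ^ N / (1 - t)" using e(2) by linarith
    moreover have "f d * (\<Sum>k\<in>{1..N div d}. (t ^ d) ^ k) = f d * (t ^ d / (1 - t ^ d)) - f d * e"
      using geo[of d "N div d"] d by (simp add: e_def right_diff_distrib)
    ultimately show "f d * (\<Sum>k\<in>{1..N div d}. (t ^ d) ^ k) \<le> f d * (t ^ d / (1 - t ^ d)) + t ^ N / (1 - t)" by linarith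
  qed
  also have "\<dots> = (\<Sum>d\<in>{1..N}. f d * (t ^ d / (1 - t ^ d))) + real N * t ^ N / (1 - t)"
    by (simp add: sum.distrib)
  finally show ?thesis .
qed

text \<open>An argument of Monsky. The Lambert series of \<open>f\<close> is the power series of \<open>c\<close>, which is unbounded near 1 because \<open>c\<close> is
  at least 1 at the squares. If \<open>\<Sum>f(n)/n\<close> were 0, the Lambert series would equal \<open>-\<Sum>f(n)w(n)\<close> with decreasing nonnegative
  weights that start at 1, and this is bounded by \<open>q\<close>.\<close>

lemma L'_1_nonzero: "L' 1 \<noteq> 0"
proof
  assume zero: "L' 1 = 0"
  \<comment> \<open>With \<open>t\<close> defined by \<open>t ^ (M ^ 2) = 1/2\<close>, the first \<open>M\<close> squares contribute at least \<open>M/2 = q + 2\<close> to the power series of \<open>c\<close>.\<close>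
  define M where "M = 2 * (q + 2)"
  have M0: "M > 0" by (simp add: M_def)
  define r where "r = (1 / 2 :: real) powr (1 / real (2 * M ^ 2))"
  have r0: "0 < r" by (simp add: r_def)
  have rM: "r ^ (2 * M ^ 2) = 1 / 2"
  proof -
    have "r ^ (2 * M ^ 2) = r powr (real (2 * M ^ 2))" using r0 by (simp only: powr_realpow)
    also have "\<dots> = (1 / 2) powr 1" unfolding r_def powr_powr using M0 by simp
    finally show ?thesis by simp
  qed
  have r1: "r < 1"
  proof (rule ccontr)
    assume "\<not> r < 1"
    hence "1 \<le> r ^ (2 * M ^ 2)" by (intro one_le_power) simp
    thus False using rM by simp
  qed
  define t where "t = r ^ 2"
  have t: "0 < t" "t < 1" using r0 r1 by (auto simp: t_def power_less_one_iff)
  have tM: "t ^ (M ^ 2) = 1 / 2" using rM by (simp add: t_def power_mult)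
  define w where "w = (\<lambda>n. 1 / (real (Suc n) * (1 - t)) - t ^ Suc n / (1 - t ^ Suc n))"
  have w: "\<And>n. w (Suc n) \<le> w n" "\<And>n. 0 \<le> w n" "w 0 = 1"
    using lambert_weights[OF r0 r1] unfolding w_def t_def by blast+
  define s1 where "s1 = (\<lambda>N. \<Sum>n<N. f (Suc n) * (1 / real (Suc n)))"
  have "(\<lambda>N. \<Sum>n<N. \<psi> (Suc n) * of_real (b 1 n)) \<longlonglongrightarrow> 0"
    using partial_sums_tendsto_L'[of 1] zero by simp
  hence "(\<lambda>N. Re (\<Sum>n<N. \<psi> (Suc n) * of_real (b 1 n))) \<longlonglongrightarrow> Re 0" by (rule tendsto_Re)
  moreover have "Re (\<Sum>n<N. \<psi> (Suc n) * of_real (b 1 n)) = s1 N" for N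
    unfolding s1_def b_def by (simp add: psi_eq powr_minus_divide)
  ultimately have s1: "s1 \<longlonglongrightarrow> 0" by simp
  have "(\<lambda>N. real N * t ^ N) \<longlonglongrightarrow> 0" using t by (intro powser_times_n_limit_0) auto
  hence lim: "(\<lambda>N. s1 N / (1 - t) + real N * t ^ N / (1 - t)) \<longlonglongrightarrow> 0 / (1 - t) + 0 / (1 - t)"
    using t by (intro tendsto_intros s1) auto
  hence "eventually (\<lambda>N. s1 N / (1 - t) + real N * t ^ N / (1 - t) < 1) sequentially"
    by (intro order_tendstoD(2)[OF lim]) simp
  then obtain N0 where N0: "\<And>N. N \<ge> N0 \<Longrightarrow> s1 N / (1 - t) + real N * t ^ N / (1 - t) < 1"
    by (auto simp: eventually_sequentially)
  define N where "N = max N0 (M ^ 2)"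
  have small: "s1 N / (1 - t) + real N * t ^ N / (1 - t) < 1" by (rule N0) (simp add: N_def)
  have "(\<Sum>d\<in>{1..N}. f d * (t ^ d / (1 - t ^ d))) = (\<Sum>n<N. f (Suc n) * (t ^ Suc n / (1 - t ^ Suc n)))"
    by (rule sum.reindex_bij_witness[of _ Suc "\<lambda>n. n - 1"]) auto
  also have "\<dots> = s1 N / (1 - t) - (\<Sum>n<N. f (Suc n) * w n)"
    unfolding s1_def w_def by (simp add: sum_divide_distrib sum_subtractf[symmetric] right_diff_distrib)
  finally have H: "(\<Sum>d\<in>{1..N}. f d * (t ^ d / (1 - t ^ d))) = s1 N / (1 - t) - (\<Sum>n<N. f (Suc n) * w n)" .
  have "norm (\<Sum>n<N. \<psi> (Suc n) * of_real (w n)) \<le> real q * w 0"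
    by (rule decreasing_weights_bound) (use w in auto)
  moreover have "(\<Sum>n<N. \<psi> (Suc n) * of_real (w n)) = of_real (\<Sum>n<N. f (Suc n) * w n)" by (simp add: psi_eq)
  ultimately have "\<bar>\<Sum>n<N. f (Suc n) * w n\<bar> \<le> real q" using w(3) by (simp only: norm_of_real mult_1_right)
  hence up: "(\<Sum>n\<in>{1..N}. c n * t ^ n) < real q + 1"
    using lambert_power_series[OF t, of N] small unfolding H by linarith
  have "real q + 2 = (\<Sum>k\<in>{1..M}. t ^ (M ^ 2))" unfolding tM by (simp add: M_def)
  also have "\<dots> \<le> (\<Sum>k\<in>{1..M}. c (k ^ 2) * t ^ (k ^ 2))"
  proof (rule sum_mono)
    fix k assume k: "k \<in> {1..M}"
    have "1 * t ^ (M ^ 2) \<le> c (k ^ 2) * t ^ (k ^ 2)"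
      using k t c_nonneg[of k] by (intro mult_mono power_decreasing power_mono) auto
    thus "t ^ (M ^ 2) \<le> c (k ^ 2) * t ^ (k ^ 2)" by simp
  qed
  also have "\<dots> = (\<Sum>n\<in>(\<lambda>k. k ^ 2) ` {1..M}. c n * t ^ n)"
    by (subst sum.reindex) (auto intro!: inj_onI simp: power2_eq_iff_nonneg)
  also have "\<dots> \<le> (\<Sum>n\<in>{1..N}. c n * t ^ n)"
  proof (rule sum_mono2)
    show "(\<lambda>k. k ^ 2) ` {1..M} \<subseteq> {1..N}"
    proof (rule image_subsetI)
      fix k assume k: "k \<in> {1..M}"
      hence "k ^ 2 \<le> M ^ 2" by (intro power_mono) auto
      thus "k ^ 2 \<in> {1..N}" using k by (simp add: N_def le_max_iff_disj)
    qed
  qed (use c_nonneg t in auto)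
  finally show False using up by linarith
qed

end

section \<open>Primes congruent to 1 modulo a prime\<close>

locale prime_modulus =
  fixes q g :: nat
  assumes q: "prime q" and g: "residue_primroot q g"
begin

text \<open>The characters modulo \<open>q\<close> are \<open>dchar j\<close> for \<open>j < d\<close>: they send the primitive root \<open>g\<close> to \<open>\<omega>\<^sup>j\<close>.\<close>

definition d :: nat where "d = q - 1"
definition \<omega> :: complex where "\<omega> = exp (2 * of_real pi * \<i> / of_nat d)"
definition ind :: "nat \<Rightarrow> nat" where "ind k = (SOME i. i < d \<and> [g ^ i = k] (mod q))"
definition dchar :: "nat \<Rightarrow> nat \<Rightarrow> complex" where "dchar j k = (if q dvd k then 0 else \<omega> ^ (j * ind k))"

lemma q2: "q \<ge> 2" by (rule prime_ge_2_nat[OF q])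

lemma d_pos: "d > 0" using q2 by (simp add: d_def)

lemma omega: "primitive_root_of_unity d \<omega>"
  unfolding \<omega>_def by (rule primitive_root_of_unity_exists[OF d_pos])

lemma g_coprime: "coprime q g" and g_ord: "ord q g = d"
  using g q by (auto simp: residue_primroot_def totient_prime d_def)

lemma generator: "bij_betw (\<lambda>i. g ^ i mod q) {..<d} {0<..<q}"
  using residue_primroot_is_generator[of q g] g q prime_gt_1_nat[OF q]
  by (simp add: totient_prime totatives_prime d_def)

lemma g_power_cong: "[g ^ i = g ^ j] (mod q) \<longleftrightarrow> [i = j] (mod d)"
  using order_divides_expdiff[OF g_coprime, of i j] g_ord by simp

lemma ind: assumes "\<not> q dvd k" shows "ind k < d" "[g ^ ind k = k] (mod q)"
proof -
  have "k mod q \<in> {0<..<q}" using assms q2 by (auto simp: mod_greater_zero_iff_not_dvd)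
  hence "k mod q \<in> (\<lambda>i. g ^ i mod q) ` {..<d}" using generator by (simp add: bij_betw_def)
  then obtain i where i: "i < d" "k mod q = g ^ i mod q" by blast
  have "[g ^ i = k] (mod q)" using i(2) unfolding cong_iff_mod by (rule sym)
  hence "ind k < d \<and> [g ^ ind k = k] (mod q)" unfolding ind_def using i(1) by (intro someI[of "\<lambda>i. i < d \<and> [g ^ i = k] (mod q)" i]) blast
  thus "ind k < d" "[g ^ ind k = k] (mod q)" by blast+
qed

lemma g_not_dvd: "\<not> q dvd g ^ i"
proof
  assume "q dvd g ^ i"
  hence "q dvd g" using q prime_dvd_power by blast
  thus False using g_coprime q by (metis coprime_absorb_left not_prime_unit)
qed

lemma dchar_g: "dchar j (g ^ i) = \<omega> ^ (j * i)"
proof -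
  have "[ind (g ^ i) = i] (mod d)" using ind(2)[OF g_not_dvd] g_power_cong by blast
  hence "[j * ind (g ^ i) = j * i] (mod d)" by (rule cong_scalar_left)
  hence "\<omega> ^ (j * ind (g ^ i)) = \<omega> ^ (j * i)"
    using primitive_root_of_unity_eq_iff[OF omega d_pos] by (simp add: cong_iff_mod)
  thus ?thesis using g_not_dvd by (simp add: dchar_def)
qed

lemma dchar_cong: "[k = l] (mod q) \<Longrightarrow> dchar j k = dchar j l"
proof -
  assume kl: "[k = l] (mod q)"
  have dv: "q dvd k \<longleftrightarrow> q dvd l" using kl by (rule cong_dvd_iff)
  show ?thesis
  proof (cases "q dvd k")
    case False
    have "[g ^ ind k = g ^ ind l] (mod q)" using ind(2)[of k] ind(2)[of l] dv kl False by (meson cong_sym cong_trans)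
    hence "[ind k = ind l] (mod d)" by (simp add: g_power_cong)
    hence "ind k = ind l" using ind(1)[of k] ind(1)[of l] dv False by (simp add: cong_iff_mod)
    thus ?thesis using dv by (simp add: dchar_def)
  qed (use dv in \<open>simp add: dchar_def\<close>)
qed

lemma norm_omega: "norm \<omega> = 1"
  unfolding \<omega>_def by (simp add: norm_exp_eq_Re)

lemma dchar_bounded_multiplicative: "bounded_multiplicative (dchar j)"
proof
  show "dchar j 1 = 1" using dchar_g[of j 0] by simp
  show "dchar j (m * n) = dchar j m * dchar j n" for m n
  proof (cases "q dvd m \<or> q dvd n")
    case True
    thus ?thesis by (auto simp: dchar_def)
  next
    case False
    hence mn: "\<not> q dvd m" "\<not> q dvd n" by auto
    have "[m * n = g ^ ind m * g ^ ind n] (mod q)"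
      using ind(2)[OF mn(1)] ind(2)[OF mn(2)] by (metis cong_mult cong_sym)
    hence "dchar j (m * n) = dchar j (g ^ (ind m + ind n))" unfolding power_add by (rule dchar_cong)
    also have "\<dots> = \<omega> ^ (j * (ind m + ind n))" by (rule dchar_g)
    also have "\<dots> = \<omega> ^ (j * ind m) * \<omega> ^ (j * ind n)" by (simp only: distrib_left power_add)
    finally show ?thesis using mn by (simp add: dchar_def)
  qed
  show "norm (dchar j n) \<le> 1" for n by (simp add: dchar_def norm_power norm_omega)
qed

lemma sum_dchar_full: "(\<Sum>k<q. dchar j (Suc k)) = (\<Sum>i<d. (\<omega> ^ j) ^ i)"
proof -
  have "(\<Sum>k<q. dchar j (Suc k)) = (\<Sum>k\<in>{0<..q}. dchar j k)"
    by (rule sum.reindex_bij_witness[of _ "\<lambda>k. k - 1" Suc]) auto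
  also have "\<dots> = (\<Sum>k\<in>{0<..<q}. dchar j k)"
    by (rule sum.mono_neutral_right) (auto simp: dchar_def)
  also have "\<dots> = (\<Sum>i<d. dchar j (g ^ i mod q))"
    by (rule sum.reindex_bij_betw[OF generator, symmetric])
  also have "\<dots> = (\<Sum>i<d. (\<omega> ^ j) ^ i)"
  proof (rule sum.cong[OF refl])
    fix i
    have "dchar j (g ^ i mod q) = dchar j (g ^ i)" by (rule dchar_cong) (simp add: cong_iff_mod)
    thus "dchar j (g ^ i mod q) = (\<omega> ^ j) ^ i" by (simp add: dchar_g power_mult)
  qed
  finally show ?thesis .
qed

text \<open>A complete period of a nonprincipal character has sum zero.\<close>

lemma dchar_nonprincipal:
  assumes j: "0 < j" "j < d"
  shows "nonprincipal (dchar j) q"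
proof -
  have "(\<omega> ^ j) ^ d = 1" using omega unfolding primitive_root_of_unity_def by (simp add: power_mult[symmetric])
  moreover have "\<omega> ^ j \<noteq> 1" using omega j unfolding primitive_root_of_unity_def by (auto dest: dvd_imp_le)
  ultimately have full: "(\<Sum>k<q. dchar j (Suc k)) = 0"
    unfolding sum_dchar_full by (simp add: sum_powers_root_of_unity)
  have bm: "norm (dchar j k) \<le> 1" for k
    using bounded_multiplicative.psi_bound[OF dchar_bounded_multiplicative] .
  have "norm (\<Sum>k<N. dchar j (Suc k)) \<le> real q" for N
  proof (induction N rule: less_induct)
    case (less N)
    show ?case
    proof (cases "N < q")
      case True
      have "norm (\<Sum>k<N. dchar j (Suc k)) \<le> (\<Sum>k<N. 1)" by (rule sum_norm_le) (rule bm)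
      thus ?thesis using True by simp
    next
      case False
      have "(\<Sum>k<N. dchar j (Suc k)) = (\<Sum>k<q. dchar j (Suc k)) + (\<Sum>k\<in>{q..<N}. dchar j (Suc k))"
        using False by (subst sum.union_disjoint[symmetric]) (auto intro!: sum.cong)
      also have "(\<Sum>k\<in>{q..<N}. dchar j (Suc k)) = (\<Sum>k<N - q. dchar j (Suc k))"
      proof (rule sum.reindex_bij_witness[of _ "\<lambda>k. k + q" "\<lambda>k. k - q"])
        fix k assume "k \<in> {q..<N}"
        thus "dchar j (Suc (k - q)) = dchar j (Suc k)"
          by (intro dchar_cong) (auto simp: cong_iff_mod Suc_diff_le[symmetric] le_mod_geq[of q "Suc k"])
      qed auto
      finally show ?thesis using less.IH[of "N - q"] full False q2 by simp
    qed
  qed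
  thus ?thesis using dchar_bounded_multiplicative by (simp add: nonprincipal_def nonprincipal_axioms_def)
qed

lemma dchar_orthogonality:
  "(\<Sum>j<d. dchar j k) = (if [k = 1] (mod q) then of_nat d else 0)"
proof (cases "q dvd k")
  case True
  hence "\<not> [k = 1] (mod q)" using q2 by (auto simp: cong_iff_mod)
  thus ?thesis using True by (simp add: dchar_def)
next
  case False
  have "(\<Sum>j<d. dchar j k) = (\<Sum>j<d. (\<omega> ^ ind k) ^ j)"
    using False by (simp add: dchar_def power_mult[symmetric] mult.commute)
  also have "\<dots> = (if \<omega> ^ ind k = 1 then of_nat d else 0)"
  proof (rule sum_powers_root_of_unity)
    show "(\<omega> ^ ind k) ^ d = 1" using omega unfolding primitive_root_of_unity_def by (simp add: power_mult[symmetric])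
  qed
  also have "\<omega> ^ ind k = 1 \<longleftrightarrow> [ind k = 0] (mod d)"
    using omega unfolding primitive_root_of_unity_def by (simp add: cong_0_iff)
  also have "\<dots> \<longleftrightarrow> [g ^ ind k = g ^ 0] (mod q)" by (rule g_power_cong[symmetric])
  also have "\<dots> \<longleftrightarrow> [k = 1] (mod q)" using ind(2)[OF False] by (metis cong_sym cong_trans power_0)
  finally show ?thesis .
qed

lemma dchar_conjugate:
  assumes "j < d" shows "dchar (d - j) k = cnj (dchar j k)"
proof (cases "q dvd k")
  case False
  have "\<omega> ^ ((d - j) * ind k) * \<omega> ^ (j * ind k) = \<omega> ^ (d * ind k)"
    using assms by (simp add: power_add[symmetric] add_mult_distrib[symmetric])
  also have "\<dots> = 1" using omega unfolding primitive_root_of_unity_def by simp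
  finally have 1: "\<omega> ^ ((d - j) * ind k) * \<omega> ^ (j * ind k) = 1" .
  have 2: "cnj (\<omega> ^ (j * ind k)) * \<omega> ^ (j * ind k) = 1"
    using complex_norm_square[of "\<omega> ^ (j * ind k)"] by (simp add: norm_power norm_omega mult.commute)
  have "\<omega> ^ (j * ind k) \<noteq> 0" using norm_omega by auto
  hence "\<omega> ^ ((d - j) * ind k) = cnj (\<omega> ^ (j * ind k))" using 1 2 by (metis mult_right_cancel)
  thus ?thesis using False by (simp add: dchar_def)
qed (simp add: dchar_def)

abbreviation psum :: "nat \<Rightarrow> real \<Rightarrow> real" where "psum j s \<equiv> bounded_multiplicative.prime_sum (dchar j) s"
abbreviation Lv :: "nat \<Rightarrow> complex" where "Lv j \<equiv> nonprincipal.L' (dchar j) 1"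

lemma Lv_conjugate:
  assumes j: "0 < j" "j < d" shows "Lv (d - j) = cnj (Lv j)"
proof -
  interpret a: nonprincipal "dchar j" q by (rule dchar_nonprincipal[OF j])
  interpret b: nonprincipal "dchar (d - j)" q by (rule dchar_nonprincipal) (use j in auto)
  have "(\<lambda>N. \<Sum>n<N. dchar (d - j) (Suc n) * of_real (b.b 1 n)) \<longlonglongrightarrow> Lv (d - j)"
    by (rule b.partial_sums_tendsto_L') simp
  moreover have "(\<lambda>N. cnj (\<Sum>n<N. dchar j (Suc n) * of_real (a.b 1 n))) \<longlonglongrightarrow> cnj (Lv j)"
    by (rule tendsto_cnj, rule a.partial_sums_tendsto_L') simp
  moreover have "(\<Sum>n<N. dchar (d - j) (Suc n) * of_real (b.b 1 n)) = cnj (\<Sum>n<N. dchar j (Suc n) * of_real (a.b 1 n))" for N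
    by (simp add: dchar_conjugate[OF j(2)] a.b_def b.b_def)
  ultimately show ?thesis using LIMSEQ_unique by simp
qed

text \<open>For \<open>2j = d\<close> the character is the quadratic one.\<close>

lemma Lv_nonzero_real:
  assumes j: "0 < j" "j < d" "2 * j = d" shows "Lv j \<noteq> 0"
proof -
  interpret a: nonprincipal "dchar j" q by (rule dchar_nonprincipal[OF j(1,2)])
  have "(\<omega> ^ j) ^ 2 = 1" using omega j(3) unfolding primitive_root_of_unity_def
    by (simp add: power_mult[symmetric] mult.commute)
  hence "\<omega> ^ j = 1 \<or> \<omega> ^ j = -1" by (simp add: power2_eq_1_iff)
  hence "(\<omega> ^ j) ^ i = 1 \<or> (\<omega> ^ j) ^ i = -1" for i by (induction i) auto
  hence "dchar j k \<in> {0, 1, -1}" for k by (simp add: dchar_def power_mult)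
  then interpret r: real_nonprincipal "dchar j" q by unfold_locales
  show ?thesis by (rule r.L'_1_nonzero)
qed

lemma psum_total:
  assumes s: "s > 1"
  shows "(\<Sum>j<d. psum j s) = real d * (\<Sum>p. if prime p \<and> [p = 1] (mod q) then real p powr (- s) else 0)"
    "summable (\<lambda>p. if prime p \<and> [p = 1] (mod q) then real p powr (- s) else 0)"
proof -
  have bm: "bounded_multiplicative (dchar j)" for j by (rule dchar_bounded_multiplicative)
  define h where "h = (\<lambda>j p. if prime p then Re (bounded_multiplicative.dterm (dchar j) s p) else 0)"
  have sm: "summable (h j)" for j unfolding h_def
    by (rule summable_norm_cancel, rule summable_comparison_test'[OF bounded_multiplicative.summable_dterm[OF bm s], of 0 _ j])
      (auto simp: abs_Re_le_cmod)
  have "(\<Sum>j<d. h j p) = real d * (if prime p \<and> [p = 1] (mod q) then real p powr (- s) else 0)" for p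
  proof (cases "prime p")
    case True
    have "(\<Sum>j<d. h j p) = Re (\<Sum>j<d. dchar j p * of_real (real p powr (- s)))"
      using True by (simp add: h_def bounded_multiplicative.dterm_def[OF bm])
    also have "\<dots> = Re ((\<Sum>j<d. dchar j p) * of_real (real p powr (- s)))" by (simp only: sum_distrib_right)
    also have "\<dots> = real d * (if prime p \<and> [p = 1] (mod q) then real p powr (- s) else 0)"
      unfolding dchar_orthogonality using True by simp
    finally show ?thesis .
  qed (simp add: h_def)
  note eq = this
  have s1: "summable (\<lambda>p. \<Sum>j<d. h j p)" by (rule summable_sum) (rule sm)
  show sm': "summable (\<lambda>p. if prime p \<and> [p = 1] (mod q) then real p powr (- s) else 0)"
    using s1 d_pos unfolding eq by (simp only: summable_cmult_iff) simp
  have "(\<Sum>j<d. psum j s) = (\<Sum>j<d. \<Sum>p. h j p)"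
    by (simp add: bounded_multiplicative.prime_sum_def[OF bm] h_def)
  also have "\<dots> = (\<Sum>p. \<Sum>j<d. h j p)" by (rule suminf_sum[symmetric]) (rule sm)
  also have "\<dots> = real d * (\<Sum>p. if prime p \<and> [p = 1] (mod q) then real p powr (- s) else 0)"
    unfolding eq by (rule suminf_mult[OF sm'])
  finally show "(\<Sum>j<d. psum j s) = real d * (\<Sum>p. if prime p \<and> [p = 1] (mod q) then real p powr (- s) else 0)" .
qed

text \<open>The L-series of the principal character is the zeta function without the Euler factor at \<open>q\<close>.\<close>

lemma principal_bounds:
  assumes s: "1 < s" "s < 2"
  shows "- ln (2 * (s - 1)) - 3 * bounded_multiplicative.square_sum \<le> psum 0 s"
    "psum 0 s \<le> ln 2 - ln (s - 1) + 3 * bounded_multiplicative.square_sum"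
proof -
  interpret z: bounded_multiplicative "\<lambda>_. 1" by unfold_locales simp_all
  interpret p: bounded_multiplicative "dchar 0" by (rule dchar_bounded_multiplicative)
  define Z where "Z = (\<Sum>n. real n powr (- s))"
  have smZ: "summable (\<lambda>n. real n powr (- s))" using s by (simp add: summable_real_powr_iff)
  have zL: "z.L s = of_real Z"
    unfolding z.L_def z.dterm_def Z_def using suminf_of_real[OF smZ, where 'a=complex] by simp
  have "p.L s = (\<Sum>n. if \<exists>r\<in>{q}. r dvd n then 0 else z.dterm s n)"
    unfolding p.L_def by (rule suminf_cong) (simp add: p.dterm_def z.dterm_def dchar_def)
  also have "\<dots> = z.L s * (\<Prod>r\<in>{q}. 1 - z.dterm s r)"
    by (rule z.euler_step[symmetric]) (use s q in auto)
  also have "\<dots> = of_real (Z * (1 - real q powr (- s)))" by (simp add: zL z.dterm_def)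
  finally have pL: "p.L s = of_real (Z * (1 - real q powr (- s)))" .
  have qs: "0 \<le> real q powr (- s)" "real q powr (- s) \<le> 1 / 2"
  proof -
    have "real q powr (- s) \<le> real q powr (- 1)" using q2 s by (intro powr_mono) auto
    also have "\<dots> = 1 / real q" using q2 by (simp add: powr_minus_divide)
    also have "\<dots> \<le> 1 / 2" using q2 by (intro divide_left_mono) auto
    finally show "real q powr (- s) \<le> 1 / 2" .
  qed simp
  have Z: "1 \<le> (s - 1) * Z" "(s - 1) * Z \<le> s" unfolding Z_def by (rule zeta_bounds[OF s(1)])+
  have "0 < (s - 1) * Z" using Z(1) by linarith
  hence Z0: "Z > 0" using s by (simp add: zero_less_mult_iff)
  have nL: "norm (p.L s) = Z * (1 - real q powr (- s))" unfolding pL norm_of_real using Z0 qs by simp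
  have "1 / (s - 1) \<le> Z" using Z(1) s by (simp add: pos_divide_le_eq mult.commute)
  hence "1 / (s - 1) * (1 / 2) \<le> norm (p.L s)" unfolding nL using Z0 qs s by (intro mult_mono) auto
  hence "1 / (2 * (s - 1)) \<le> norm (p.L s)" by (simp add: algebra_simps)
  hence "ln (1 / (2 * (s - 1))) \<le> ln (norm (p.L s))" using s by (intro ln_mono) auto
  hence lo: "- ln (2 * (s - 1)) \<le> ln (norm (p.L s))" using s by (simp add: ln_div)
  have "Z \<le> s / (s - 1)" using Z(2) s by (simp add: pos_le_divide_eq mult.commute)
  also have "\<dots> \<le> 2 / (s - 1)" using s by (intro divide_right_mono) auto
  finally have "Z * (1 - real q powr (- s)) \<le> 2 / (s - 1) * 1" using qs Z0 s by (intro mult_mono) auto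
  hence "norm (p.L s) \<le> 2 / (s - 1)" unfolding nL by simp
  hence "ln (norm (p.L s)) \<le> ln (2 / (s - 1))" using p.log_L_prime_sum(1)[OF s(1)] by (intro ln_mono) auto
  hence up: "ln (norm (p.L s)) \<le> ln 2 - ln (s - 1)" using s by (simp add: ln_div)
  show "- ln (2 * (s - 1)) - 3 * p.square_sum \<le> psum 0 s" "psum 0 s \<le> ln 2 - ln (s - 1) + 3 * p.square_sum"
    using p.log_L_prime_sum(2)[OF s(1)] lo up by linarith+
qed

text \<open>A zero \<open>L(1,\<psi>) = 0\<close> for a complex \<open>\<psi>\<close> would come with the zero for the conjugate character. The two
  zeros outweigh the pole for the principal character and make the sum over the primes negative.\<close>

lemma Lv_nonzero:
  assumes j: "0 < j" "j < d" shows "Lv j \<noteq> 0"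
proof
  assume zero: "Lv j = 0"
  have ne: "2 * j \<noteq> d" using Lv_nonzero_real[OF j] zero by auto
  define j' where "j' = d - j"
  have j': "0 < j'" "j' < d" "j' \<noteq> j" using j ne by (auto simp: j'_def)
  have zero': "Lv j' = 0" using Lv_conjugate[OF j] zero by (simp add: j'_def)
  interpret a: nonprincipal "dchar j" q by (rule dchar_nonprincipal[OF j])
  interpret b: nonprincipal "dchar j'" q by (rule dchar_nonprincipal[OF j'(1,2)])
  define \<sigma> where "\<sigma> = 3 * a.square_sum"
  define K where "K = \<bar>ln (real q) + \<sigma>\<bar>"
  have K: "psum i s \<le> K" if "0 < i" "i < d" "s > 1" for i s
  proof -
    interpret i: nonprincipal "dchar i" q by (rule dchar_nonprincipal[OF that(1,2)])
    show ?thesis using i.prime_sum_upper[OF that(3)] by (simp add: K_def \<sigma>_def)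
  qed
  have lip: "a.lip > 0" using a.prime_sum_upper_if_zero(1)[of 2] zero by simp
  \<comment> \<open>The sum over all characters is at most \<open>C + ln (s - 1)\<close>, so \<open>s = 1 + \<delta>\<close> with \<open>ln \<delta> \<le> - C - 1\<close> makes it negative.\<close>
  define C where "C = ln 2 + 2 * ln a.lip + 3 * \<sigma> + real d * K"
  define \<delta> where "\<delta> = min (1 / 2) (exp (- C - 1))"
  have dl: "\<delta> > 0" "\<delta> < 1" "ln \<delta> \<le> - C - 1"
  proof -
    have "ln \<delta> \<le> ln (exp (- C - 1))" unfolding \<delta>_def by (intro ln_mono) auto
    thus "ln \<delta> \<le> - C - 1" by simp
  qed (auto simp: \<delta>_def)
  define s where "s = 1 + \<delta>"
  have s: "1 < s" "s < 2" using dl by (auto simp: s_def)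
  have pj: "psum j s \<le> ln a.lip + ln \<delta> + \<sigma>"
    using a.prime_sum_upper_if_zero(2)[OF s(1) zero] lip dl by (simp add: s_def \<sigma>_def ln_mult)
  have pj': "psum j' s \<le> ln a.lip + ln \<delta> + \<sigma>"
    using b.prime_sum_upper_if_zero(2)[OF s(1) zero'] lip dl by (simp add: s_def \<sigma>_def ln_mult)
  have p0: "psum 0 s \<le> ln 2 - ln \<delta> + \<sigma>" using principal_bounds(2)[OF s] by (simp add: s_def \<sigma>_def)
  have "(\<Sum>i<d. psum i s) = psum 0 s + psum j s + psum j' s + (\<Sum>i\<in>{..<d} - {0, j, j'}. psum i s)"
  proof -
    have "(\<Sum>i<d. psum i s) = (\<Sum>i\<in>{0, j, j'}. psum i s) + (\<Sum>i\<in>{..<d} - {0, j, j'}. psum i s)"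
      using j j' by (subst sum.subset_diff[of "{0, j, j'}" "{..<d}"]) auto
    thus ?thesis using j j' by simp
  qed
  moreover have "(\<Sum>i\<in>{..<d} - {0, j, j'}. psum i s) \<le> (\<Sum>i\<in>{..<d} - {0, j, j'}. K)"
    by (rule sum_mono) (use K s in auto)
  moreover have "(\<Sum>i\<in>{..<d} - {0, j, j'}. K) \<le> (\<Sum>i<d. K)"
    by (rule sum_mono2) (auto simp: K_def)
  ultimately have "(\<Sum>i<d. psum i s) \<le> C + ln \<delta>" using p0 pj pj' by (simp add: C_def)
  hence neg: "(\<Sum>i<d. psum i s) < 0" using dl by linarith
  have "0 \<le> (\<Sum>p. if prime p \<and> [p = 1] (mod q) then real p powr (- s) else 0)"
    by (rule suminf_nonneg[OF psum_total(2)[OF s(1)]]) simp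
  hence "0 \<le> (\<Sum>i<d. psum i s)" unfolding psum_total(1)[OF s(1)] by simp
  thus False using neg by simp
qed

text \<open>By orthogonality the sum over all characters counts the primes congruent to 1. The principal character contributes
  \<open>- ln (s - 1)\<close>, and the others are bounded below since their L-values at 1 do not vanish.\<close>

lemma prime_reciprocals_diverge: "\<not> summable (\<lambda>p. if prime p \<and> [p = 1] (mod q) then 1 / real p else 0)"
proof
  assume sm: "summable (\<lambda>p. if prime p \<and> [p = 1] (mod q) then 1 / real p else 0)"
  define T where "T = (\<Sum>p. if prime p \<and> [p = 1] (mod q) then 1 / real p else 0)"
  define \<sigma> where "\<sigma> = 3 * bounded_multiplicative.square_sum"
  have "\<exists>\<delta> K. \<delta> > 0 \<and> (\<forall>s. s > 1 \<longrightarrow> s < 1 + \<delta> \<longrightarrow> psum j s \<ge> K)" if "j \<in> {1..<d}" for j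
  proof -
    interpret a: nonprincipal "dchar j" q by (rule dchar_nonprincipal) (use that in auto)
    have "Lv j \<noteq> 0" using that by (intro Lv_nonzero) auto
    thus ?thesis using a.prime_sum_lower_if_nonzero by metis
  qed
  hence "\<exists>\<delta> K. \<forall>j\<in>{1..<d}. \<delta> j > 0 \<and> (\<forall>s. s > 1 \<longrightarrow> s < 1 + \<delta> j \<longrightarrow> psum j s \<ge> K j)"
    by metis
  then obtain \<delta> K where dK: "\<And>j. j \<in> {1..<d} \<Longrightarrow> \<delta> j > 0"
    "\<And>j s. j \<in> {1..<d} \<Longrightarrow> s > 1 \<Longrightarrow> s < 1 + \<delta> j \<Longrightarrow> psum j s \<ge> K j" by blast
  define C where "C = real d * T + \<sigma> - (\<Sum>j\<in>{1..<d}. K j)"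
  define F where "F = insert (1 / 2) (\<delta> ` {1..<d})"
  have fin: "finite F" by (simp add: F_def)
  have M0: "Min F > 0" using dK(1) fin by (subst Min_gr_iff) (auto simp: F_def)
  define e where "e = min (Min F) (exp (- C - 1)) / 2"
  have e0: "e > 0" using M0 by (simp add: e_def)
  have eF: "2 * e \<le> x" if "x \<in> F" for x
    using Min_le[OF fin that] by (simp add: e_def)
  have e1: "2 * e \<le> 1 / 2" "2 * e \<le> exp (- C - 1)" using eF[of "1 / 2"] by (auto simp: e_def F_def)
  have e2: "e < \<delta> j" if "j \<in> {1..<d}" for j
    using eF[of "\<delta> j"] that e0 by (simp add: F_def)
  define s where "s = 1 + e"
  have s: "1 < s" "s < 2" using e0 e1 by (auto simp: s_def)
  have "(\<Sum>p. if prime p \<and> [p = 1] (mod q) then real p powr (- s) else 0) \<le> T"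
    unfolding T_def
  proof (rule suminf_le[OF _ psum_total(2)[OF s(1)] sm])
    fix p show "(if prime p \<and> [p = 1] (mod q) then real p powr (- s) else 0) \<le> (if prime p \<and> [p = 1] (mod q) then 1 / real p else 0)"
    proof (cases "prime p")
      case True
      hence p1: "real p \<ge> 1" using prime_ge_1_nat by simp
      have "real p powr (- s) \<le> real p powr (- 1)" using p1 s by (intro powr_mono) auto
      thus ?thesis using p1 by (simp add: powr_minus_divide)
    qed simp
  qed
  hence up: "(\<Sum>j<d. psum j s) \<le> real d * T" unfolding psum_total(1)[OF s(1)] by (intro mult_left_mono) auto
  have "{..<d} = insert 0 {1..<d}" using d_pos by auto
  hence "(\<Sum>j<d. psum j s) = psum 0 s + (\<Sum>j\<in>{1..<d}. psum j s)" by simp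
  moreover have "(\<Sum>j\<in>{1..<d}. psum j s) \<ge> (\<Sum>j\<in>{1..<d}. K j)"
    by (rule sum_mono) (use dK(2) e2 s in \<open>auto simp: s_def\<close>)
  moreover have "psum 0 s \<ge> - ln (2 * e) - \<sigma>" using principal_bounds(1)[OF s] by (simp add: s_def \<sigma>_def)
  moreover have "ln (2 * e) \<le> ln (exp (- C - 1))" using e0 e1 by (intro ln_mono) auto
  hence "ln (2 * e) \<le> - C - 1" by simp
  ultimately show False using up by (simp add: C_def)
qed

end

theorem primes_cong_1_reciprocals_diverge:
  assumes "prime (q::nat)"
  shows "\<not> summable (\<lambda>p. if prime p \<and> [p = 1] (mod q) then 1 / real p else 0)"
proof -
  obtain g where "residue_primroot q g" using prime_primitive_root_exists[OF prime_gt_1_nat[OF assms] assms] by blast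
  then interpret prime_modulus q g using assms by unfold_locales
  show ?thesis by (rule prime_reciprocals_diverge)
qed

section \<open>Natural density\<close>

definition count :: "int set \<Rightarrow> real \<Rightarrow> nat" where
  "count A X = card {m \<in> A. \<bar>real_of_int m\<bar> \<le> X}"

lemma has_density_count: "has_density A d \<longleftrightarrow> ((\<lambda>X. real (count A X) / (2 * X)) \<longlongrightarrow> d) at_top"
  by (simp add: has_density_def count_def)

lemma finite_box: "finite {m \<in> A. \<bar>real_of_int m\<bar> \<le> X}"
proof (rule finite_subset)
  show "{m \<in> A. \<bar>real_of_int m\<bar> \<le> X} \<subseteq> {- \<lfloor>\<bar>X\<bar>\<rfloor>..\<lfloor>\<bar>X\<bar>\<rfloor>}"
  proof
    fix m assume "m \<in> {m \<in> A. \<bar>real_of_int m\<bar> \<le> X}"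
    hence "real_of_int m \<le> \<bar>X\<bar>" "real_of_int (- m) \<le> \<bar>X\<bar>" by auto
    hence "m \<le> \<lfloor>\<bar>X\<bar>\<rfloor>" "- m \<le> \<lfloor>\<bar>X\<bar>\<rfloor>" by (simp_all only: le_floor_iff)
    thus "m \<in> {- \<lfloor>\<bar>X\<bar>\<rfloor>..\<lfloor>\<bar>X\<bar>\<rfloor>}" by simp
  qed
qed simp

lemma count_mono: "A \<subseteq> B \<Longrightarrow> count A X \<le> count B X"
  unfolding count_def by (rule card_mono[OF finite_box]) auto

lemma count_Un: "count (A \<union> B) X \<le> count A X + count B X"
proof -
  have "{m \<in> A \<union> B. \<bar>real_of_int m\<bar> \<le> X} = {m \<in> A. \<bar>real_of_int m\<bar> \<le> X} \<union> {m \<in> B. \<bar>real_of_int m\<bar> \<le> X}" by auto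
  thus ?thesis unfolding count_def by (simp only: card_Un_le)
qed

lemma density_zeroI:
  assumes "\<And>\<epsilon>. \<epsilon> > 0 \<Longrightarrow> eventually (\<lambda>X. real (count A X) \<le> \<epsilon> * X) at_top"
  shows "has_density A 0"
  unfolding has_density_count
proof (rule tendstoI)
  fix e :: real assume e: "e > 0"
  have "eventually (\<lambda>X. real (count A X) \<le> e * X) at_top" by (rule assms[OF e])
  moreover have "eventually (\<lambda>X. X > (0::real)) at_top" by (rule eventually_gt_at_top)
  ultimately show "eventually (\<lambda>X. dist (real (count A X) / (2 * X)) 0 < e) at_top"
  proof eventually_elim
    case (elim X)
    have "real (count A X) < e * (2 * X)" using elim mult_pos_pos[OF e elim(2)] by linarith
    hence "real (count A X) / (2 * X) < e" using elim(2) by (simp add: pos_divide_less_eq)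
    thus ?case using elim(2) by (simp add: dist_norm)
  qed
qed

lemma density_zero_subset:
  assumes "has_density B 0" "A \<subseteq> B" shows "has_density A 0"
  unfolding has_density_count
proof (rule tendsto_sandwich[OF _ _ tendsto_const assms(1)[unfolded has_density_count]])
  show "eventually (\<lambda>X. 0 \<le> real (count A X) / (2 * X)) at_top"
    using eventually_ge_at_top[of 0] by eventually_elim simp
  show "eventually (\<lambda>X. real (count A X) / (2 * X) \<le> real (count B X) / (2 * X)) at_top"
    using eventually_ge_at_top[of 0] by eventually_elim (use count_mono[OF assms(2)] in \<open>simp add: divide_right_mono\<close>)
qed

lemma density_zero_Un:
  assumes "has_density A 0" "has_density B 0" shows "has_density (A \<union> B) 0"
  unfolding has_density_count
proof (rule tendsto_sandwich[OF _ _ tendsto_const])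
  show "((\<lambda>X. real (count A X) / (2 * X) + real (count B X) / (2 * X)) \<longlongrightarrow> 0) at_top"
    using tendsto_add[OF assms[unfolded has_density_count]] by simp
  show "eventually (\<lambda>X. 0 \<le> real (count (A \<union> B) X) / (2 * X)) at_top"
    using eventually_ge_at_top[of 0] by eventually_elim simp
  show "eventually (\<lambda>X. real (count (A \<union> B) X) / (2 * X) \<le> real (count A X) / (2 * X) + real (count B X) / (2 * X)) at_top"
    using eventually_gt_at_top[of 0]
  proof eventually_elim
    case (elim X)
    have "real (count (A \<union> B) X) \<le> real (count A X) + real (count B X)" using count_Un[of A B X] by linarith
    thus ?case unfolding add_divide_distrib[symmetric] using elim by (intro divide_right_mono) auto
  qed
qed

lemma density_zero_UN: "finite I \<Longrightarrow> (\<And>i. i \<in> I \<Longrightarrow> has_density (f i) 0) \<Longrightarrow> has_density (\<Union>i\<in>I. f i) 0"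
proof (induction I rule: finite_induct)
  case empty
  thus ?case by (simp add: has_density_def)
next
  case (insert i I)
  thus ?case using density_zero_Un[of "f i" "\<Union>i\<in>I. f i"] by simp
qed

lemma density_zero_finite: assumes "finite A" shows "has_density A 0"
proof (rule density_zeroI)
  fix e :: real assume e: "e > 0"
  have "eventually (\<lambda>X. X \<ge> real (card A) / e) at_top" by (rule eventually_ge_at_top)
  thus "eventually (\<lambda>X. real (count A X) \<le> e * X) at_top"
  proof eventually_elim
    case (elim X)
    have "count A X \<le> card A" unfolding count_def by (rule card_mono[OF assms]) auto
    thus ?case using elim e by (simp add: pos_divide_le_eq mult.commute)
  qed
qed

lemma has_density_symdiff:
  assumes A: "has_density A d" and D: "has_density ((A - B) \<union> (B - A)) 0"
  shows "has_density B d"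
  unfolding has_density_count
proof (rule Lim_transform[OF A[unfolded has_density_count]])
  show "((\<lambda>X. real (count B X) / (2 * X) - real (count A X) / (2 * X)) \<longlongrightarrow> 0) at_top"
  proof (rule Lim_null_comparison[OF _ D[unfolded has_density_count]])
    show "eventually (\<lambda>X. norm (real (count B X) / (2 * X) - real (count A X) / (2 * X))
        \<le> real (count (A - B \<union> (B - A)) X) / (2 * X)) at_top"
      using eventually_gt_at_top[of 0]
    proof eventually_elim
      case (elim X)
      let ?D = "(A - B) \<union> (B - A)"
      have "count A X \<le> count B X + count ?D X"
        using count_mono[of A "B \<union> ?D" X] count_Un[of B ?D X] by fastforce
      moreover have "count B X \<le> count A X + count ?D X"
        using count_mono[of B "A \<union> ?D" X] count_Un[of A ?D X] by fastforce
      ultimately have "\<bar>real (count B X) - real (count A X)\<bar> \<le> real (count ?D X)" by linarith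
      hence "\<bar>real (count B X) - real (count A X)\<bar> / (2 * X) \<le> real (count ?D X) / (2 * X)"
        using elim by (intro divide_right_mono) auto
      thus ?case using elim by (simp add: diff_divide_distrib[symmetric])
    qed
  qed
qed

text \<open>Every window of length \<open>L\<close> contains the same number of elements, so an interval of length \<open>2X\<close> contains that number
  times \<open>2X/L\<close> up to a bounded error.\<close>

lemma periodic_density:
  fixes P :: "int set" and L :: int
  assumes L: "L > 0" and per: "\<And>m k. m \<in> P \<longleftrightarrow> m + L * k \<in> P"
  shows "\<exists>d. has_density P d"
proof -
  define c where "c = card (P \<inter> {0..<L})"
  have window: "card (P \<inter> {b..<b + L}) = c" for b
  proof -
    have P_mod: "m mod L \<in> P \<longleftrightarrow> m \<in> P" for m
    proof -
      have "m = m mod L + L * (m div L)" by simp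
      thus ?thesis using per[of "m mod L" "m div L"] by simp
    qed
    have "bij_betw (\<lambda>m. m mod L) (P \<inter> {b..<b + L}) (P \<inter> {0..<L})"
    proof (rule bij_betw_byWitness[of _ "\<lambda>r. b + (r - b) mod L"])
      show "\<forall>m\<in>P \<inter> {b..<b + L}. b + (m mod L - b) mod L = m"
      proof
        fix m assume m: "m \<in> P \<inter> {b..<b + L}"
        have "(m mod L - b) mod L = (m - b) mod L" by (simp add: mod_diff_left_eq)
        also have "\<dots> = m - b" using m by simp
        finally show "b + (m mod L - b) mod L = m" by simp
      qed
      show "\<forall>r\<in>P \<inter> {0..<L}. (b + (r - b) mod L) mod L = r"
      proof
        fix r assume r: "r \<in> P \<inter> {0..<L}"
        have "(b + (r - b) mod L) mod L = (b + (r - b)) mod L" by (simp only: mod_add_right_eq)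
        thus "(b + (r - b) mod L) mod L = r" using r by simp
      qed
      show "(\<lambda>m. m mod L) ` (P \<inter> {b..<b + L}) \<subseteq> P \<inter> {0..<L}" using P_mod L by auto
      show "(\<lambda>r. b + (r - b) mod L) ` (P \<inter> {0..<L}) \<subseteq> P \<inter> {b..<b + L}"
      proof (rule image_subsetI)
        fix r assume r: "r \<in> P \<inter> {0..<L}"
        have "(b + (r - b) mod L) mod L = (b + (r - b)) mod L" by (simp only: mod_add_right_eq)
        hence "(b + (r - b) mod L) mod L = r" using r by simp
        hence "b + (r - b) mod L \<in> P" using P_mod[of "b + (r - b) mod L"] r by simp
        thus "b + (r - b) mod L \<in> P \<inter> {b..<b + L}" using L by simp
      qed
    qed
    thus ?thesis unfolding c_def by (rule bij_betw_same_card)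
  qed
  have windows: "card (P \<inter> {b..<b + L * int k}) = c * k" for b k
  proof (induction k)
    case (Suc k)
    have "P \<inter> {b..<b + L * int (Suc k)} = (P \<inter> {b..<b + L * int k}) \<union> (P \<inter> {b + L * int k..<(b + L * int k) + L})"
    proof -
      define z where "z = L * int k"
      have "L * int (Suc k) = z + L" "0 \<le> z" using L by (simp_all add: distrib_left z_def)
      thus ?thesis unfolding z_def[symmetric] using L by auto
    qed
    moreover have "(P \<inter> {b..<b + L * int k}) \<inter> (P \<inter> {b + L * int k..<(b + L * int k) + L}) = {}" by auto
    ultimately have "card (P \<inter> {b..<b + L * int (Suc k)}) = c * k + c"
      using Suc.IH window[of "b + L * int k"] by (simp add: card_Un_disjoint)
    thus ?case by simp
  qed simp
  have bounds: "real c * ((2 * X - 1) / real_of_int L - 1) \<le> real (count P X) \<and> real (count P X) \<le> real c * ((2 * X + 1) / real_of_int L + 1)"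
    if X: "X \<ge> 0" for X
  proof -
    define N where "N = \<lfloor>X\<rfloor>"
    have N: "N \<ge> 0" "real_of_int N \<le> X" "X < real_of_int N + 1" using X by (auto simp: N_def)
    have box: "{m \<in> P. \<bar>real_of_int m\<bar> \<le> X} = P \<inter> {- N..<- N + (2 * N + 1)}"
    proof -
      have "\<bar>real_of_int m\<bar> \<le> X \<longleftrightarrow> - N \<le> m \<and> m < - N + (2 * N + 1)" for m
      proof -
        have "\<bar>real_of_int m\<bar> \<le> X \<longleftrightarrow> real_of_int \<bar>m\<bar> \<le> X" by simp
        also have "\<dots> \<longleftrightarrow> \<bar>m\<bar> \<le> N" unfolding N_def by (rule le_floor_iff[symmetric])
        finally have "\<bar>real_of_int m\<bar> \<le> X \<longleftrightarrow> \<bar>m\<bar> \<le> N" .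
        moreover have "\<bar>m\<bar> \<le> N \<longleftrightarrow> - N \<le> m \<and> m < - N + (2 * N + 1)" by arith
        ultimately show ?thesis by (rule trans)
      qed
      note box_iff = this
      show ?thesis by (rule Set.set_eqI) (simp only: Int_iff mem_Collect_eq atLeastLessThan_iff box_iff)
    qed
    define k where "k = nat ((2 * N + 1) div L)"
    have k: "int k = (2 * N + 1) div L" using N L by (simp add: k_def pos_imp_zdiv_nonneg_iff)
    have kL: "L * int k \<le> 2 * N + 1" "2 * N + 1 < L * int (Suc k)"
    proof -
      have "2 * N + 1 = L * int k + (2 * N + 1) mod L" unfolding k by simp
      moreover have "0 \<le> (2 * N + 1) mod L" "(2 * N + 1) mod L < L" using L by auto
      ultimately show "L * int k \<le> 2 * N + 1" "2 * N + 1 < L * int (Suc k)" by (simp_all add: algebra_simps)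
    qed
    have "c * k \<le> count P X"
      unfolding count_def box windows[of "- N" k, symmetric] using kL(1) by (intro card_mono) auto
    moreover have "count P X \<le> c * Suc k"
      unfolding count_def box windows[of "- N" "Suc k", symmetric] using kL(2) by (intro card_mono) auto
    ultimately have ck: "real c * real k \<le> real (count P X)" "real (count P X) \<le> real c * (real k + 1)"
      by (metis of_nat_le_iff of_nat_mult, metis of_nat_Suc of_nat_le_iff of_nat_mult add.commute)
    have rL: "real_of_int L > 0" using L by simp
    have "real_of_int (L * int k) \<le> real_of_int (2 * N + 1)" using kL(1) by (simp only: of_int_le_iff)
    hence "real_of_int L * real k \<le> 2 * X + 1" using N by simp
    hence k1: "real k \<le> (2 * X + 1) / real_of_int L" using rL by (simp add: pos_le_divide_eq mult.commute)
    have "real_of_int (2 * N + 1) \<le> real_of_int (L * int (Suc k))" using kL(2) by (simp only: of_int_le_iff less_imp_le)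
    hence "2 * X - 1 \<le> real_of_int L * (real k + 1)" using N by (simp add: add.commute)
    hence k2: "(2 * X - 1) / real_of_int L \<le> real k + 1" using rL by (simp add: pos_divide_le_eq mult.commute)
    have "real c * ((2 * X - 1) / real_of_int L - 1) \<le> real c * real k" using k2 by (intro mult_left_mono) auto
    moreover have "real c * (real k + 1) \<le> real c * ((2 * X + 1) / real_of_int L + 1)" using k1 by (intro mult_left_mono) auto
    ultimately show ?thesis using ck by linarith
  qed
  have rL: "real_of_int L > 0" using L by simp
  have inv: "((\<lambda>X::real. 1 / X) \<longlongrightarrow> 0) at_top"
    using tendsto_inverse_0_at_top[OF filterlim_ident] by (simp add: inverse_eq_divide)
  have lo: "((\<lambda>X. real c / real_of_int L - (real c / (2 * real_of_int L) + real c / 2) * (1 / X)) \<longlongrightarrow> real c / real_of_int L - (real c / (2 * real_of_int L) + real c / 2) * 0) at_top"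
    by (intro tendsto_intros inv)
  have up: "((\<lambda>X. real c / real_of_int L + (real c / (2 * real_of_int L) + real c / 2) * (1 / X)) \<longlongrightarrow> real c / real_of_int L + (real c / (2 * real_of_int L) + real c / 2) * 0) at_top"
    by (intro tendsto_intros inv)
  have "((\<lambda>X. real (count P X) / (2 * X)) \<longlongrightarrow> real c / real_of_int L) at_top"
  proof (rule tendsto_sandwich[OF _ _ lo[simplified] up[simplified]])
    show "eventually (\<lambda>X. real c / real_of_int L - (real c / (2 * real_of_int L) + real c / 2) / X \<le> real (count P X) / (2 * X)) at_top"
      using eventually_gt_at_top[of 0]
    proof eventually_elim
      case (elim X)
      have "real c / real_of_int L - (real c / (2 * real_of_int L) + real c / 2) / X = real c * ((2 * X - 1) / real_of_int L - 1) / (2 * X)"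
        using elim rL by (simp add: field_simps)
      also have "\<dots> \<le> real (count P X) / (2 * X)" using bounds[of X] elim by (intro divide_right_mono) auto
      finally show ?case .
    qed
    show "eventually (\<lambda>X. real (count P X) / (2 * X) \<le> real c / real_of_int L + (real c / (2 * real_of_int L) + real c / 2) / X) at_top"
      using eventually_gt_at_top[of 0]
    proof eventually_elim
      case (elim X)
      have "real c / real_of_int L + (real c / (2 * real_of_int L) + real c / 2) / X = real c * ((2 * X + 1) / real_of_int L + 1) / (2 * X)"
        using elim rL by (simp add: field_simps)
      moreover have "real (count P X) / (2 * X) \<le> real c * ((2 * X + 1) / real_of_int L + 1) / (2 * X)"
        using bounds[of X] elim by (intro divide_right_mono) auto
      ultimately show ?case by simp
    qed
  qed
  thus ?thesis unfolding has_density_count by blast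
qed

text \<open>The densities of ever better approximations form a Cauchy sequence, and its limit is the density.\<close>

lemma density_by_approximation:
  assumes "\<And>e::real. e > 0 \<Longrightarrow> \<exists>P. (\<exists>d. has_density P d) \<and>
      eventually (\<lambda>X. \<bar>real (count A X) / (2 * X) - real (count P X) / (2 * X)\<bar> \<le> e) at_top"
  shows "\<exists>d. has_density A d"
proof -
  have "\<forall>k::nat. \<exists>P d. has_density P d \<and>
      eventually (\<lambda>X. \<bar>real (count A X) / (2 * X) - real (count P X) / (2 * X)\<bar> \<le> 1 / real (Suc k)) at_top"
  proof
    fix k :: nat show "\<exists>P d. has_density P d \<and>
      eventually (\<lambda>X. \<bar>real (count A X) / (2 * X) - real (count P X) / (2 * X)\<bar> \<le> 1 / real (Suc k)) at_top"
      using assms[of "1 / real (Suc k)"] by auto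
  qed
  from choice[OF this] obtain P where "\<forall>k. \<exists>d. has_density (P k) d \<and>
      eventually (\<lambda>X. \<bar>real (count A X) / (2 * X) - real (count (P k) X) / (2 * X)\<bar> \<le> 1 / real (Suc k)) at_top"
    by (elim exE) (rule that)
  from choice[OF this] obtain d where Pd: "\<forall>k. has_density (P k) (d k) \<and>
      eventually (\<lambda>X. \<bar>real (count A X) / (2 * X) - real (count (P k) X) / (2 * X)\<bar> \<le> 1 / real (Suc k)) at_top"
    by (elim exE) (rule that)
  have P: "has_density (P k) (d k)"
    "eventually (\<lambda>X. \<bar>real (count A X) / (2 * X) - real (count (P k) X) / (2 * X)\<bar> \<le> 1 / real (Suc k)) at_top" for k
    using spec[OF Pd, of k] by (rule conjunct1, rule conjunct2)
  define f where "f = (\<lambda>X. real (count A X) / (2 * X))"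
  have near: "eventually (\<lambda>X. \<bar>f X - d k\<bar> \<le> 2 / real (Suc k)) at_top" for k
  proof -
    have "eventually (\<lambda>X. dist (real (count (P k) X) / (2 * X)) (d k) < 1 / real (Suc k)) at_top"
      using P(1)[of k] unfolding has_density_count by (intro tendstoD) auto
    with P(2)[of k] show ?thesis
    proof eventually_elim
      case (elim X)
      have "1 / real (Suc k) + 1 / real (Suc k) = 2 / real (Suc k)" by simp
      thus ?case using elim unfolding f_def dist_norm real_norm_def by linarith
    qed
  qed
  have "Cauchy d"
  proof (rule metric_CauchyI)
    fix e :: real assume e: "e > 0"
    obtain M :: nat where M: "4 / e < real M" using reals_Archimedean2 by blast
    have small: "2 / real (Suc k) < e / 2" if "k \<ge> M" for k
    proof -
      have "4 / e < real (Suc k)" using M that by linarith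
      hence "4 < real (Suc k) * e" using e by (simp add: pos_divide_less_eq)
      thus ?thesis by (simp add: divide_simps mult.commute)
    qed
    show "\<exists>M. \<forall>j\<ge>M. \<forall>k\<ge>M. dist (d j) (d k) < e"
    proof (intro exI allI impI)
      fix j k assume jk: "M \<le> j" "M \<le> k"
      have "eventually (\<lambda>X. dist (d j) (d k) < e) (at_top :: real filter)"
        using near[of j] near[of k]
      proof eventually_elim
        case (elim X)
        thus ?case using small[OF jk(1)] small[OF jk(2)] unfolding dist_norm real_norm_def by linarith
      qed
      thus "dist (d j) (d k) < e" by simp
    qed
  qed
  then obtain l where l: "d \<longlonglongrightarrow> l" using Cauchy_convergent convergent_def by blast
  have "(f \<longlongrightarrow> l) at_top"
  proof (rule tendstoI)
    fix e :: real assume e: "e > 0"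
    have "eventually (\<lambda>k. dist (d k) l < e / 2) sequentially" using l e by (intro tendstoD) auto
    then obtain k0 where k0: "\<And>k. k \<ge> k0 \<Longrightarrow> dist (d k) l < e / 2" by (auto simp: eventually_sequentially)
    obtain M :: nat where M: "4 / e < real M" using reals_Archimedean2 by blast
    define k where "k = max k0 M"
    have "4 / e < real (Suc k)" using M by (simp add: k_def)
    hence "4 < real (Suc k) * e" using e by (simp add: pos_divide_less_eq)
    hence sm: "2 / real (Suc k) < e / 2" by (simp add: divide_simps mult.commute)
    have dk: "dist (d k) l < e / 2" by (rule k0) (simp add: k_def)
    show "eventually (\<lambda>X. dist (f X) l < e) at_top"
      using near[of k]
    proof eventually_elim
      case (elim X)
      thus ?case using sm dk unfolding dist_norm real_norm_def by linarith
    qed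
  qed
  thus ?thesis unfolding has_density_count f_def by blast
qed

lemma card_multiples_le:
  fixes k :: nat assumes "k > 0"
  shows "real (card {m::int. m \<noteq> 0 \<and> \<bar>m\<bar> \<le> int N \<and> int k dvd m}) \<le> 2 * real N / real k"
    "finite {m::int. m \<noteq> 0 \<and> \<bar>m\<bar> \<le> int N \<and> int k dvd m}"
proof -
  define J where "J = {- int (N div k)..int (N div k)} - {0}"
  have sub: "{m::int. m \<noteq> 0 \<and> \<bar>m\<bar> \<le> int N \<and> int k dvd m} \<subseteq> (\<lambda>j. int k * j) ` J"
  proof
    fix m :: int assume m: "m \<in> {m. m \<noteq> 0 \<and> \<bar>m\<bar> \<le> int N \<and> int k dvd m}"
    then obtain j where j: "m = int k * j" by (auto elim: dvdE)
    have "int k * \<bar>j\<bar> \<le> int N" using m by (simp add: j abs_mult)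
    hence "(int k * \<bar>j\<bar>) div int k \<le> int N div int k" using assms by (intro zdiv_mono1) auto
    hence "\<bar>j\<bar> \<le> int N div int k" using assms by simp
    hence "\<bar>j\<bar> \<le> int (N div k)" by (simp add: zdiv_int)
    moreover have "j \<noteq> 0" using m j by auto
    ultimately have "j \<in> J" unfolding J_def by auto
    thus "m \<in> (\<lambda>j. int k * j) ` J" unfolding j by (rule imageI)
  qed
  show "finite {m::int. m \<noteq> 0 \<and> \<bar>m\<bar> \<le> int N \<and> int k dvd m}"
    by (rule finite_subset[OF sub]) (simp add: J_def)
  have "card {m::int. m \<noteq> 0 \<and> \<bar>m\<bar> \<le> int N \<and> int k dvd m} \<le> card J"
    by (rule surj_card_le[OF _ sub]) (simp add: J_def)
  also have "card J = 2 * (N div k)" unfolding J_def by (subst card_Diff_singleton) (auto simp: nat_add_distrib)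
  finally have "real (card {m::int. m \<noteq> 0 \<and> \<bar>m\<bar> \<le> int N \<and> int k dvd m}) \<le> 2 * real (N div k)" by linarith
  also have "\<dots> \<le> 2 * (real N / real k)" using of_nat_div_le_of_nat[of N k, where 'a=real] by simp
  finally show "real (card {m::int. m \<noteq> 0 \<and> \<bar>m\<bar> \<le> int N \<and> int k dvd m}) \<le> 2 * real N / real k" by simp
qed

lemma sum_inverse_squares_le:
  assumes "y \<ge> 1" shows "(\<Sum>k\<in>{Suc y..N}. 1 / real k ^ 2) \<le> 1 / real y"
proof (cases "y \<le> N")
  case True
  have "(\<Sum>k\<in>{Suc y..N}. 1 / real k ^ 2) \<le> 1 / real y - 1 / real N"
    using True
  proof (induction N rule: dec_induct)
    case (step N)
    have N: "real N > 0" using step assms by simp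
    have "1 / real (Suc N) ^ 2 \<le> 1 / (real N * real (Suc N))"
      using N by (intro divide_left_mono) (auto simp: power2_eq_square)
    also have "\<dots> = 1 / real N - 1 / real (Suc N)" using N by (simp add: divide_simps)
    finally show ?case using step by simp
  qed simp
  thus ?thesis by (smt (verit) divide_nonneg_nonneg of_nat_0_le_iff)
qed simp

text \<open>Square-free numbers in residue classes: sieving by the squares of the numbers up to \<open>y\<close> leaves a
  periodic set, and the squares of larger numbers change the density by at most \<open>1/y\<close>.\<close>

lemma squarefree_residues_density:
  fixes Q :: int assumes Q: "Q > 0"
  shows "\<exists>d. has_density {m. squarefree m \<and> m mod Q \<in> G} d"
proof (rule density_by_approximation)
  fix e :: real assume e: "e > 0"
  define A where "A = {m. squarefree m \<and> m mod Q \<in> G}"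
  obtain y0 :: nat where y0: "2 / e < real y0" using reals_Archimedean2 by blast
  define y where "y = Suc y0"
  have y1: "y \<ge> 1" by (simp add: y_def)
  have "2 / e < real y" using y0 by (simp add: y_def)
  hence "2 < real y * e" using e by (simp add: pos_divide_less_eq)
  hence y2: "2 / real y \<le> e" using y1 by (simp add: pos_divide_le_eq mult.commute)
  define P where "P = {m. m mod Q \<in> G \<and> (\<forall>k\<in>{2..y}. \<not> (int k) ^ 2 dvd m)}"
  have "\<exists>d. has_density P d"
  proof (rule periodic_density[of "Q * (fact y) ^ 2"])
    show "Q * (fact y) ^ 2 > 0" using Q by simp
    fix m k
    have "(m + Q * (fact y) ^ 2 * k) mod Q = m mod Q" by (simp add: mult.assoc)
    moreover have "(int j) ^ 2 dvd (m + Q * (fact y) ^ 2 * k) \<longleftrightarrow> (int j) ^ 2 dvd m" if "j \<in> {2..y}" for j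
    proof -
      have "j dvd fact y" using that by (intro dvd_fact) auto
      hence "int j dvd int (fact y)" by (simp only: int_dvd_int_iff)
      hence "int j dvd fact y" by (simp only: of_nat_fact)
      hence "(int j) ^ 2 dvd Q * (fact y) ^ 2 * k" by (intro dvd_mult2 dvd_mult dvd_power_same)
      thus ?thesis by (rule dvd_add_left_iff)
    qed
    ultimately show "m \<in> P \<longleftrightarrow> m + Q * (fact y) ^ 2 * k \<in> P" unfolding P_def by auto
  qed
  moreover have "eventually (\<lambda>X. \<bar>real (count A X) / (2 * X) - real (count P X) / (2 * X)\<bar> \<le> e) at_top"
    using eventually_ge_at_top[of "real y"]
  proof eventually_elim
    case (elim X)
    have X0: "X > 0" using elim y1 by linarith
    define N where "N = nat \<lfloor>X\<rfloor>"
    have N: "real N \<le> X" unfolding N_def using X0 by simp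
    define E where "E = (\<lambda>k. {m::int. m \<noteq> 0 \<and> \<bar>m\<bar> \<le> int N \<and> int (k ^ 2) dvd m})"
    have AP: "A \<subseteq> P"
    proof
      fix m assume m: "m \<in> A"
      have "\<not> (int k) ^ 2 dvd m" if "k \<in> {2..y}" for k
      proof
        assume "(int k) ^ 2 dvd m"
        hence "is_unit (int k)" using m squarefreeD unfolding A_def by blast
        thus False using that by simp
      qed
      thus "m \<in> P" using m by (simp add: A_def P_def)
    qed
    have sub: "{m \<in> P. \<bar>real_of_int m\<bar> \<le> X} \<subseteq> {m \<in> A. \<bar>real_of_int m\<bar> \<le> X} \<union> ({0} \<union> (\<Union>k\<in>{Suc y..N}. E k))"
    proof
      fix m assume "m \<in> {m \<in> P. \<bar>real_of_int m\<bar> \<le> X}"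
      hence m: "m \<in> P" "\<bar>real_of_int m\<bar> \<le> X" by auto
      have "real_of_int \<bar>m\<bar> \<le> X" using m(2) by simp
      hence "\<bar>m\<bar> \<le> \<lfloor>X\<rfloor>" by (simp only: le_floor_iff)
      hence mN: "\<bar>m\<bar> \<le> int N" using X0 by (simp add: N_def)
      show "m \<in> {m \<in> A. \<bar>real_of_int m\<bar> \<le> X} \<union> ({0} \<union> (\<Union>k\<in>{Suc y..N}. E k))"
      proof (cases "m = 0 \<or> squarefree m")
        case True
        thus ?thesis using m by (auto simp: A_def P_def)
      next
        case False
        then obtain x where x: "x ^ 2 dvd m" "\<not> is_unit x" by (auto simp: squarefree_def)
        define k where "k = nat \<bar>x\<bar>"
        have x0: "x \<noteq> 0" using x(1) False by auto
        have "\<bar>x\<bar> \<noteq> 1" using x(2) by simp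
        hence k2: "k \<ge> 2" using x0 unfolding k_def by linarith
        have kd: "(int k) ^ 2 dvd m" using x(1) by (simp add: k_def)
        have "k > y" using m(1) k2 kd unfolding P_def by (auto simp: not_le)
        moreover have "k \<le> N"
        proof -
          have "k * 1 \<le> k * k" using k2 by (intro mult_le_mono) auto
          hence "int k \<le> (int k) ^ 2" by (simp add: power2_eq_square flip: of_nat_mult)
          also have "\<dots> \<le> \<bar>m\<bar>" using dvd_imp_le_int[OF _ kd] False by simp
          finally show ?thesis using mN by linarith
        qed
        ultimately show ?thesis using False kd mN by (auto simp: E_def intro!: bexI[of _ k])
      qed
    qed
    have finE: "finite (E k)" if "k \<in> {Suc y..N}" for k unfolding E_def by (rule card_multiples_le(2)) (use that in simp)
    have "real (card (\<Union>k\<in>{Suc y..N}. E k)) \<le> (\<Sum>k\<in>{Suc y..N}. real (card (E k)))"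
      using card_UN_le[of "{Suc y..N}" E] by (simp flip: of_nat_sum)
    also have "\<dots> \<le> (\<Sum>k\<in>{Suc y..N}. 2 * real N * (1 / real k ^ 2))"
    proof (rule sum_mono)
      fix k assume "k \<in> {Suc y..N}"
      hence "k ^ 2 > 0" by simp
      from card_multiples_le(1)[OF this, of N] show "real (card (E k)) \<le> 2 * real N * (1 / real k ^ 2)"
        unfolding E_def by simp
    qed
    also have "\<dots> = 2 * real N * (\<Sum>k\<in>{Suc y..N}. 1 / real k ^ 2)" by (simp add: sum_distrib_left)
    also have "\<dots> \<le> 2 * X * (1 / real y)" using N X0 by (intro mult_mono sum_inverse_squares_le y1) (auto intro: sum_nonneg)
    finally have cE: "real (card (\<Union>k\<in>{Suc y..N}. E k)) \<le> 2 * X / real y" by simp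
    have "count P X \<le> count A X + card ({0} \<union> (\<Union>k\<in>{Suc y..N}. E k))"
    proof -
      have "count P X \<le> card ({m \<in> A. \<bar>real_of_int m\<bar> \<le> X} \<union> ({0} \<union> (\<Union>k\<in>{Suc y..N}. E k)))"
        unfolding count_def by (rule card_mono[OF _ sub]) (use finite_box finE in auto)
      thus ?thesis unfolding count_def using card_Un_le order_trans by blast
    qed
    moreover have "card ({0} \<union> (\<Union>k\<in>{Suc y..N}. E k)) \<le> 1 + card (\<Union>k\<in>{Suc y..N}. E k)"
      using card_Un_le[of "{0::int}" "\<Union>k\<in>{Suc y..N}. E k"] by simp
    ultimately have "real (count P X) \<le> real (count A X) + (1 + 2 * X / real y)" using cE by linarith
    moreover have "real (count A X) \<le> real (count P X)" using count_mono[OF AP, of X] by simp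
    ultimately have "\<bar>real (count A X) - real (count P X)\<bar> \<le> 1 + 2 * X / real y" by linarith
    also have "\<dots> \<le> (2 / real y) * (2 * X)"
    proof -
      have "1 \<le> X / real y" using elim y1 by (simp add: pos_le_divide_eq)
      moreover have "(2 / real y) * (2 * X) = 2 * (X / real y) + 2 * X / real y" by simp
      ultimately show ?thesis by linarith
    qed
    finally have "\<bar>real (count A X) - real (count P X)\<bar> / (2 * X) \<le> 2 / real y" using X0 by (simp add: pos_divide_le_eq)
    thus ?case using y2 X0 by (simp add: diff_divide_distrib[symmetric])
  qed
  ultimately show "\<exists>P. (\<exists>d. has_density P d) \<and>
      eventually (\<lambda>X. \<bar>real (count {m. squarefree m \<and> m mod Q \<in> G} X) / (2 * X) - real (count P X) / (2 * X)\<bar> \<le> e) at_top"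
    unfolding A_def by blast
qed

section \<open>Numbers with few prime divisors in a large set of primes\<close>

text \<open>Split the interval into blocks of length \<open>L\<close>.\<close>

lemma card_coprime_le:
  assumes "L > 0" shows "card {k\<in>{1..N}. coprime k L} \<le> totient L * (N div L + 1)"
proof -
  have blocks: "card {k\<in>{0<..L * j}. coprime k L} \<le> totient L * j" for j
  proof (induction j)
    case (Suc j)
    have "{k\<in>{0<..L * Suc j}. coprime k L} \<subseteq> {k\<in>{0<..L * j}. coprime k L} \<union> (\<lambda>k. k + L * j) ` totatives L"
    proof
      fix k assume k: "k \<in> {k\<in>{0<..L * Suc j}. coprime k L}"
      show "k \<in> {k\<in>{0<..L * j}. coprime k L} \<union> (\<lambda>k. k + L * j) ` totatives L"
      proof (cases "k \<le> L * j")
        case False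
        have "coprime (k - L * j) L"
        proof -
          have k': "(k - L * j) + L * j = k" using False by simp
          show ?thesis
          proof (rule coprimeI)
            fix e assume e: "e dvd k - L * j" "e dvd L"
            have "e dvd (k - L * j) + L * j" using e by (intro dvd_add dvd_mult2)
            hence "e dvd k" by (simp only: k')
            thus "e dvd 1" using k e(2) coprime_common_divisor by blast
          qed
        qed
        moreover have "0 < k - L * j" "k - L * j \<le> L" using k False by auto
        ultimately have "k - L * j \<in> totatives L" by (simp add: in_totatives_iff)
        moreover have "k = (k - L * j) + L * j" using False by simp
        ultimately show ?thesis by blast
      qed (use k in simp)
    qed
    hence "card {k\<in>{0<..L * Suc j}. coprime k L} \<le> card ({k\<in>{0<..L * j}. coprime k L} \<union> (\<lambda>k. k + L * j) ` totatives L)"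
      by (rule card_mono[rotated]) auto
    also have "\<dots> \<le> card {k\<in>{0<..L * j}. coprime k L} + card ((\<lambda>k. k + L * j) ` totatives L)" by (rule card_Un_le)
    also have "card ((\<lambda>k. k + L * j) ` totatives L) \<le> totient L" unfolding totient_def by (rule card_image_le) simp
    finally show ?case using Suc.IH by simp
  qed simp
  have "N \<le> L * (N div L + 1)" using assms by (metis add.commute dividend_less_times_div less_imp_le mult_Suc_right Suc_eq_plus1)
  hence "card {k\<in>{1..N}. coprime k L} \<le> card {k\<in>{0<..L * (N div L + 1)}. coprime k L}" by (intro card_mono) auto
  thus ?thesis using blocks[of "N div L + 1"] by linarith
qed

text \<open>Since the reciprocals of \<open>S\<close> have an infinite sum beyond any \<open>Y\<close>, the product of the factors \<open>1 - 1/p \<le> exp (- 1/p)\<close> can be made small.\<close>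

lemma sieve_block:
  assumes div: "\<not> summable (\<lambda>p. if p \<in> S then 1 / real p else 0)" and S: "\<And>p. p \<in> S \<Longrightarrow> prime p" and e: "e > 0"
  obtains T where "finite T" "T \<subseteq> S" "\<And>p. p \<in> T \<Longrightarrow> p > Y" "(\<Prod>p\<in>T. 1 - 1 / real p) < e"
proof -
  define h where "h = (\<lambda>p. if p \<in> S then 1 / real p else 0)"
  have h0: "h p \<ge> 0" for p by (simp add: h_def)
  define B where "B = (\<Sum>p\<le>Y. h p) - ln e + 1"
  have "\<exists>N. (\<Sum>p<N. h p) > B"
  proof (rule ccontr)
    assume "\<not> (\<exists>N. (\<Sum>p<N. h p) > B)"
    hence "\<And>N. (\<Sum>p<N. h p) \<le> B" by (simp add: not_less)
    hence "summable h" by (intro summableI_nonneg_bounded[of h B] h0)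
    thus False using div by (simp add: h_def)
  qed
  then obtain N where N: "(\<Sum>p<N. h p) > B" by blast
  define T where "T = {p\<in>S. Y < p \<and> p < N}"
  have finT: "finite T" by (rule finite_subset[of _ "{..<N}"]) (auto simp: T_def)
  have "(\<Sum>p<N. h p) = (\<Sum>p\<in>{..<N} \<inter> ({..Y} \<union> T). h p)"
    by (rule sum.mono_neutral_right) (auto simp: T_def h_def)
  also have "\<dots> \<le> (\<Sum>p\<in>{..Y} \<union> T. h p)" by (rule sum_mono2) (use finT h0 in auto)
  also have "\<dots> = (\<Sum>p\<le>Y. h p) + (\<Sum>p\<in>T. h p)"
    by (rule sum.union_disjoint) (use finT in \<open>auto simp: T_def\<close>)
  finally have hT: "(\<Sum>p\<in>T. h p) > - ln e" using N by (simp add: B_def)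
  have "(\<Prod>p\<in>T. 1 - 1 / real p) \<le> (\<Prod>p\<in>T. exp (- h p))"
  proof (rule prod_mono)
    fix p assume p: "p \<in> T"
    hence "real p \<ge> 1" using S prime_ge_1_nat by (fastforce simp: T_def)
    moreover have "h p = 1 / real p" using p by (simp add: h_def T_def)
    ultimately show "0 \<le> 1 - 1 / real p \<and> 1 - 1 / real p \<le> exp (- h p)"
      using exp_ge_add_one_self[of "- h p"] by simp
  qed
  also have "\<dots> = exp (- (\<Sum>p\<in>T. h p))" by (simp add: exp_sum[OF finT] sum_negf[symmetric])
  also have "\<dots> < exp (ln e)" using hT by simp
  also have "\<dots> = e" using e by simp
  finally have "(\<Prod>p\<in>T. 1 - 1 / real p) < e" .
  show ?thesis
  proof (rule that)
    show "finite T" by fact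
    show "T \<subseteq> S" unfolding T_def by blast
    show "p > Y" if "p \<in> T" for p using that unfolding T_def by blast
    show "(\<Prod>p\<in>T. 1 - 1 / real p) < e" by fact
  qed
qed

text \<open>If the product of \<open>1 - 1/p\<close> over a finite part of \<open>S\<close> is small, few numbers are prime to all these \<open>p\<close>. With \<open>K\<close> disjoint parts
  of this kind, all but few numbers have a prime divisor in each part.\<close>

lemma few_prime_factors_rare:
  fixes S :: "nat set"
  assumes div: "\<not> summable (\<lambda>p. if p \<in> S then 1 / real p else 0)" and S: "\<And>p. p \<in> S \<Longrightarrow> prime p" and e: "(e::real) > 0"
  shows "\<exists>N0. \<forall>N\<ge>N0. real (card {k\<in>{1..N}. card {p\<in>S. p dvd k} < K}) \<le> e * real N"
  using e
proof (induction K arbitrary: e)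
  case 0
  thus ?case by simp
next
  case (Suc K)
  have blocks: "\<exists>T. (\<forall>i<K'. finite (T i) \<and> T i \<subseteq> S \<and> (\<Prod>p\<in>T i. 1 - 1 / real p) < \<eta>) \<and> (\<forall>i<K'. \<forall>j<i. T i \<inter> T j = {})"
    if eta: "\<eta> > 0" for K' :: nat and \<eta> :: real
  proof (induction K')
    case (Suc K')
    then obtain T where T: "\<forall>i<K'. finite (T i) \<and> T i \<subseteq> S \<and> (\<Prod>p\<in>T i. 1 - 1 / real p) < \<eta>" "\<forall>i<K'. \<forall>j<i. T i \<inter> T j = {}" by blast
    have fin: "finite (\<Union>i<K'. T i)" using T(1) by auto
    define Y where "Y = Max (insert 0 (\<Union>i<K'. T i))"
    obtain U where U: "finite U" "U \<subseteq> S" "\<And>p. p \<in> U \<Longrightarrow> p > Y" "(\<Prod>p\<in>U. 1 - 1 / real p) < \<eta>"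
      using sieve_block[OF div S eta] by metis
    have dis: "U \<inter> T i = {}" if "i < K'" for i
    proof (rule ccontr)
      assume "U \<inter> T i \<noteq> {}"
      then obtain p where p: "p \<in> U" "p \<in> T i" by blast
      have "p \<le> Y" unfolding Y_def using fin p that by (intro Max_ge) auto
      thus False using U(3)[OF p(1)] by simp
    qed
    show ?case
      by (rule exI[of _ "T(K' := U)"]) (use T U dis in \<open>auto simp: less_Suc_eq\<close>)
  qed simp
  define \<eta> where "\<eta> = e / (2 * real (Suc K))"
  have \<eta>: "\<eta> > 0" using Suc.prems by (simp add: \<eta>_def)
  obtain T where T0: "\<forall>i<Suc K. finite (T i) \<and> T i \<subseteq> S \<and> (\<Prod>p\<in>T i. 1 - 1 / real p) < \<eta>"
    "\<forall>i<Suc K. \<forall>j<i. T i \<inter> T j = {}"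
    using blocks[OF \<eta>, of "Suc K"] by (elim exE conjE) (rule that)
  have T: "finite (T i)" "T i \<subseteq> S" "(\<Prod>p\<in>T i. 1 - 1 / real p) < \<eta>" if "i < Suc K" for i
    using T0(1)[rule_format, OF that] by simp_all
  have Tdis: "T i \<inter> T j = {}" if "i < Suc K" "j < i" for i j
    using T0(2)[rule_format, OF that] .
  define L where "L = (\<lambda>i. \<Prod>p\<in>T i. p)"
  have L0: "L i > 0" if "i < Suc K" for i
    unfolding L_def using T(2)[OF that] S prime_gt_0_nat by (intro prod_pos) blast
  have tot: "real (totient (L i)) < \<eta> * real (L i)" if i: "i < Suc K" for i
  proof -
    have pf: "prime_factors (L i) = T i"
    proof -
      have "prime_factors (\<Prod>p\<in>T i. p) = (\<Union>p\<in>T i. prime_factors p)"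
      proof -
        have "0 \<notin> (\<lambda>p. p) ` T i"
        proof
          assume "0 \<in> (\<lambda>p. p) ` T i"
          hence "0 \<in> S" using T(2)[OF i] by auto
          from S[OF this] show False by simp
        qed
        from prime_factors_prod[OF T(1)[OF i] this] show ?thesis by (simp only: comp_def)
      qed
      also have "\<dots> = (\<Union>p\<in>T i. {p})" 
        by (rule SUP_cong[OF refl], rule prime_prime_factors, rule S) (use T(2)[OF i] in blast)
      finally show ?thesis by (simp add: L_def)
    qed
    have "real (totient (L i)) = real (L i) * (\<Prod>p\<in>T i. 1 - 1 / real p)"
      using totient_formula2[of "L i"] unfolding pf .
    also have "\<dots> < real (L i) * \<eta>" using L0[OF i] T(3)[OF i] by (intro mult_strict_left_mono) auto
    finally show ?thesis by (simp add: mult.commute)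
  qed
  define N0 where "N0 = Max (L ` {..K})"
  show ?case
  proof (intro exI allI impI)
    fix N assume N: "N0 \<le> N"
    have LN: "L i \<le> N" if "i < Suc K" for i
    proof -
      have "L i \<in> L ` {..K}" using that by (intro imageI) simp
      hence "L i \<le> N0" unfolding N0_def by (intro Max_ge) simp_all
      thus ?thesis using N by (rule order_trans)
    qed
    have sub: "{k\<in>{1..N}. card {p\<in>S. p dvd k} < Suc K} \<subseteq> (\<Union>i\<in>{..<Suc K}. {k\<in>{1..N}. coprime k (L i)})"
    proof
      fix k assume k: "k \<in> {k\<in>{1..N}. card {p\<in>S. p dvd k} < Suc K}"
      have fin: "finite {p\<in>S. p dvd k}" by (rule finite_subset[of _ "{..k}"]) (use k in \<open>auto dest: dvd_imp_le\<close>)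
      show "k \<in> (\<Union>i\<in>{..<Suc K}. {k\<in>{1..N}. coprime k (L i)})"
      proof (rule ccontr)
        assume "k \<notin> (\<Union>i\<in>{..<Suc K}. {k\<in>{1..N}. coprime k (L i)})"
        hence nc: "\<not> coprime k (L i)" if "i < Suc K" for i using k that by auto
        have "\<exists>p. p \<in> T i \<and> p dvd k" if i: "i < Suc K" for i
        proof (rule ccontr)
          assume "\<not> (\<exists>p. p \<in> T i \<and> p dvd k)"
          hence "coprime k p" if "p \<in> T i" for p
            using that T(2)[OF i] S by (metis coprime_commute prime_imp_coprime subsetD)
          hence "coprime k (L i)" unfolding L_def by (intro prod_coprime_right) auto
          thus False using nc[OF i] by simp
        qed
        then obtain P where P: "\<And>i. i < Suc K \<Longrightarrow> P i \<in> T i" "\<And>i. i < Suc K \<Longrightarrow> P i dvd k" by metis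
        have inj: "inj_on P {..<Suc K}"
        proof (rule inj_onI)
          fix i j assume ij: "i \<in> {..<Suc K}" "j \<in> {..<Suc K}" "P i = P j"
          show "i = j"
          proof (rule ccontr)
            assume "i \<noteq> j"
            hence "T i \<inter> T j = {}" using Tdis[of i j] Tdis[of j i] ij by (cases "j < i") auto
            thus False using P(1)[of i] P(1)[of j] ij by auto
          qed
        qed
        have "Suc K = card (P ` {..<Suc K})" using card_image[OF inj] by simp
        also have "\<dots> \<le> card {p\<in>S. p dvd k}"
          by (rule card_mono[OF fin]) (use P T(2) in blast)
        finally show False using k by simp
      qed
    qed
    have "real (card {k\<in>{1..N}. card {p\<in>S. p dvd k} < Suc K}) \<le> real (card (\<Union>i\<in>{..<Suc K}. {k\<in>{1..N}. coprime k (L i)}))"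
      by (simp only: of_nat_le_iff, rule card_mono[OF _ sub]) simp
    also have "\<dots> \<le> real (\<Sum>i\<in>{..<Suc K}. card {k\<in>{1..N}. coprime k (L i)})"
      by (simp only: of_nat_le_iff, rule card_UN_le) simp
    also have "\<dots> = (\<Sum>i\<in>{..<Suc K}. real (card {k\<in>{1..N}. coprime k (L i)}))" by simp
    also have "\<dots> \<le> (\<Sum>i\<in>{..<Suc K}. 2 * \<eta> * real N)"
    proof (rule sum_mono)
      fix i assume "i \<in> {..<Suc K}"
      hence i: "i < Suc K" by simp
      have "real (card {k\<in>{1..N}. coprime k (L i)}) \<le> real (totient (L i) * (N div L i + 1))"
        by (simp only: of_nat_le_iff, rule card_coprime_le[OF L0[OF i]])
      also have "\<dots> \<le> (\<eta> * real (L i)) * real (N div L i + 1)"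
        unfolding of_nat_mult using tot[OF i] by (intro mult_right_mono) auto
      also have "\<dots> = \<eta> * real (L i * (N div L i) + L i)" by (simp add: algebra_simps)
      also have "\<dots> \<le> \<eta> * real (N + N)"
      proof -
        have "L i * (N div L i) \<le> N" by simp
        hence "L i * (N div L i) + L i \<le> N + N" using LN[OF i] by linarith
        thus ?thesis using \<eta> by (intro mult_left_mono) (simp_all only: of_nat_le_iff less_imp_le)
      qed
      finally show "real (card {k\<in>{1..N}. coprime k (L i)}) \<le> 2 * \<eta> * real N" by simp
    qed
    also have "\<dots> = (2 * real (Suc K) * \<eta>) * real N" by simp
    also have "2 * real (Suc K) * \<eta> = e"
    proof -
      have "2 * real (Suc K) \<noteq> 0" by simp
      thus ?thesis unfolding \<eta>_def times_divide_eq_right by (rule nonzero_mult_div_cancel_left)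
    qed
    finally show "real (card {k\<in>{1..N}. card {p\<in>S. p dvd k} < Suc K}) \<le> e * real N" .
  qed
qed

text \<open>Numbers with at least \<open>K\<close> prime divisors congruent to 1 modulo \<open>q\<close> are rare among these numbers by
  \<open>card_many_prime_factors_bound\<close>, and numbers with fewer such divisors are rare altogether.\<close>

lemma power_residue_numbers_density_zero:
  assumes q: "prime (q::nat)" and c: "c = int q \<or> c = - int q"
  shows "has_density {m. nat \<bar>m\<bar> \<in> power_residue_numbers q c} 0"
proof (rule density_zeroI)
  fix e :: real assume e: "e > 0"
  define S where "S = {p. prime p \<and> [p = 1] (mod q)}"
  obtain C where C: "\<And>X K. card {k\<in>power_residue_numbers q c. k \<le> X \<and>
      K \<le> card {p. prime p \<and> p dvd k \<and> [p = 1] (mod q)}} * 2 ^ K \<le> C * X"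
    by (rule card_many_prime_factors_bound[OF q c]) (rule that)
  obtain K :: nat where K: "4 * real C / e < 2 ^ K" using real_arch_pow[of 2 "4 * real C / e"] by auto
  have "\<not> summable (\<lambda>p. if p \<in> S then 1 / real p else 0)"
    using primes_cong_1_reciprocals_diverge[OF q] by (simp add: S_def)
  from few_prime_factors_rare[OF this, of "e / 4" K] obtain N0 where
    N0: "\<And>N. N \<ge> N0 \<Longrightarrow> real (card {k\<in>{1..N}. card {p\<in>S. p dvd k} < K}) \<le> e / 4 * real N"
    using e by (auto simp: S_def)
  show "eventually (\<lambda>X. real (count {m. nat \<bar>m\<bar> \<in> power_residue_numbers q c} X) \<le> e * X) at_top"
    using eventually_ge_at_top[of "real N0 + 1"]
  proof eventually_elim
    case (elim X)
    define N where "N = nat \<lfloor>X\<rfloor>"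
    have N: "real N \<le> X" "N0 \<le> N" using elim unfolding N_def by linarith+
    define B where "B = {k\<in>power_residue_numbers q c. k \<le> N \<and> K \<le> card {p. prime p \<and> p dvd k \<and> [p = 1] (mod q)}}"
    define F where "F = {k\<in>{1..N}. card {p\<in>S. p dvd k} < K}"
    have finBF: "finite (B \<union> F)" by (rule finite_subset[of _ "{..N}"]) (auto simp: B_def F_def)
    have sub: "{m \<in> {m. nat \<bar>m\<bar> \<in> power_residue_numbers q c}. \<bar>real_of_int m\<bar> \<le> X} \<subseteq> int ` (B \<union> F) \<union> (\<lambda>k. - int k) ` (B \<union> F)"
    proof
      fix m assume "m \<in> {m \<in> {m. nat \<bar>m\<bar> \<in> power_residue_numbers q c}. \<bar>real_of_int m\<bar> \<le> X}"
      hence m: "nat \<bar>m\<bar> \<in> power_residue_numbers q c" "real_of_int \<bar>m\<bar> \<le> X" by auto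
      define k where "k = nat \<bar>m\<bar>"
      have "\<bar>m\<bar> \<le> \<lfloor>X\<rfloor>" using m(2) by (simp only: le_floor_iff)
      hence kN: "k \<le> N" by (simp add: k_def N_def)
      have k0: "k > 0" using m(1) squarefree_pos unfolding k_def power_residue_numbers_def by blast
      have eq: "{p\<in>S. p dvd k} = {p. prime p \<and> p dvd k \<and> [p = 1] (mod q)}" by (auto simp: S_def)
      have "k \<in> B \<union> F" using m(1) kN k0 eq by (auto simp: B_def F_def k_def[symmetric] not_less)
      moreover have "m = int k \<or> m = - int k" by (simp add: k_def abs_if)
      ultimately show "m \<in> int ` (B \<union> F) \<union> (\<lambda>k. - int k) ` (B \<union> F)" by blast
    qed
    have "count {m. nat \<bar>m\<bar> \<in> power_residue_numbers q c} X \<le> card (int ` (B \<union> F) \<union> (\<lambda>k. - int k) ` (B \<union> F))"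
      unfolding count_def by (rule card_mono[OF _ sub]) (use finBF in auto)
    also have "\<dots> \<le> card (int ` (B \<union> F)) + card ((\<lambda>k. - int k) ` (B \<union> F))" by (rule card_Un_le)
    also have "\<dots> \<le> card (B \<union> F) + card (B \<union> F)" by (intro add_mono card_image_le finBF)
    also have "\<dots> \<le> 2 * (card B + card F)" using card_Un_le[of B F] by simp
    finally have "real (count {m. nat \<bar>m\<bar> \<in> power_residue_numbers q c} X) \<le> real (2 * (card B + card F))" by (rule of_nat_mono)
    hence c1: "real (count {m. nat \<bar>m\<bar> \<in> power_residue_numbers q c} X) \<le> 2 * (real (card B) + real (card F))"
      by (simp only: of_nat_mult of_nat_add of_nat_numeral)
    have "card B * 2 ^ K \<le> C * N" unfolding B_def by (rule C)
    hence "real (card B * 2 ^ K) \<le> real (C * N)" by (rule of_nat_mono)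
    hence CB: "real (card B) * 2 ^ K \<le> real C * real N" by (simp only: of_nat_mult of_nat_power of_nat_numeral)
    have "4 * real C \<le> e * 2 ^ K" using K e by (simp add: pos_divide_less_eq mult.commute)
    hence CK: "4 * real C * real N \<le> e * 2 ^ K * real N" by (rule mult_right_mono) simp
    have "(4 * real (card B)) * 2 ^ K = 4 * (real (card B) * 2 ^ K)" by (rule mult.assoc)
    also have "\<dots> \<le> 4 * (real C * real N)" using CB by (rule mult_left_mono) simp
    also have "\<dots> = 4 * real C * real N" by (rule mult.assoc[symmetric])
    also note CK
    also have "e * 2 ^ K * real N = (e * real N) * 2 ^ K" by (simp only: mult.assoc mult.commute[of "2 ^ K"])
    finally have "(4 * real (card B)) * 2 ^ K \<le> (e * real N) * 2 ^ K" .
    hence cB: "4 * real (card B) \<le> e * real N" by (rule mult_right_le_imp_le) simp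
    have cF: "real (card F) \<le> e / 4 * real N" unfolding F_def by (rule N0[OF N(2)])
    have "2 * (real (card B) + real (card F)) \<le> e * real N" using cB cF by (simp add: field_simps)
    also have "\<dots> \<le> e * X" using N(1) e by (intro mult_left_mono) auto
    finally show ?case using c1 by linarith
  qed
qed

section \<open>Periodicity of alpha-monogenicity\<close>

lemma monic_division:
  fixes q :: "'a :: comm_ring_1 poly"
  assumes q: "degree q = n" "coeff q n = 1" "n > 0"
  shows "\<exists>R r. h = q * R + r \<and> degree r < n"
proof (induction h)
  case 0
  show ?case by (intro exI[of _ 0]) (simp add: q(3))
next
  case (pCons c h)
  then obtain R r where Rr: "h = q * R + r" "degree r < n" by blast
  define l where "l = coeff r (n - 1)"
  define r' where "r' = pCons c r - Polynomial.smult l q"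
  have "pCons c h = q * (pCons 0 R + [:l:]) + r'"
    by (simp add: Rr(1) r'_def distrib_left mult_pCons_right)
  moreover have "degree r' < n"
  proof -
    have "degree (pCons c r) \<le> n" using Rr(2) degree_pCons_le[of c r] by linarith
    hence le: "degree r' \<le> n" unfolding r'_def using q(1)
      by (intro degree_diff_le) (auto intro: order_trans[OF degree_smult_le])
    have "coeff r' n = 0" using q(2,3) by (cases n) (simp_all add: r'_def l_def)
    hence "degree r' \<noteq> n" using q(3) by (metis degree_0 leading_coeff_0_iff not_less_zero)
    thus ?thesis using le by simp
  qed
  ultimately show ?case by blast
qed

text \<open>Up to sign these are the elementary symmetric functions of the \<open>f i\<close>.\<close>

lemma rat_poly_fun_coeff_prod:
  assumes "finite I" "\<And>i. i \<in> I \<Longrightarrow> rat_poly_fun (f i)"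
  shows "rat_poly_fun (\<lambda>x z. coeff (\<Prod>i\<in>I. [:- f i x z, 1:]) k)"
  using assms
proof (induction I arbitrary: k rule: finite_induct)
  case empty
  show ?case using rat_poly_fun_const[of "coeff (1 :: complex poly) k"] by simp
next
  case (insert j I)
  define g where "g = (\<lambda>k x z. coeff (\<Prod>i\<in>I. [:- f i x z, 1:]) k)"
  have g: "rat_poly_fun (g k)" for k unfolding g_def using insert by blast
  have "rat_poly_fun (\<lambda>x z. (- 1) * (f j x z * g k x z) + (if k = 0 then 0 else g (k - 1) x z))"
  proof (rule rat_poly_fun.add)
    show "rat_poly_fun (\<lambda>x z. (- 1) * (f j x z * g k x z))"
      using insert.prems by (intro rat_poly_fun_mult rat_poly_fun_const g) auto
    show "rat_poly_fun (\<lambda>x z. if k = 0 then 0 else g (k - 1) x z)"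
      using g[of "k - 1"] rat_poly_fun_const[of 0] by (cases "k = 0") simp_all
  qed
  moreover have "coeff (\<Prod>i\<in>insert j I. [:- f i x z, 1:]) k
      = (- 1) * (f j x z * g k x z) + (if k = 0 then 0 else g (k - 1) x z)" for x z
    unfolding g_def using insert(1,2) by (cases k) simp_all
  ultimately show ?case by simp
qed

context pure_field
begin

lemma pure_poly_division:
  fixes h :: "int poly"
  obtains R r where "h = pure_poly n m' * R + r" "degree r < n"
proof -
  have n0: "n > 0" using n2 by simp
  have monic: "coeff (pure_poly n m' :: int poly) n = 1" using n0 by (simp add: pure_poly_def coeff_pCons split: nat.splits)
  show ?thesis using monic_division[OF degree_pure_poly[OF n0] monic n0, of h]
    by (elim exE conjE) (rule that)
qed

lemma int_eval_pure_poly: "int_eval (pure_poly n m') x = x ^ n - of_int m'"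
proof -
  have "map_poly of_int (pure_poly n m' :: int poly) = (map_poly of_rat (pure_poly n m' :: rat poly) :: complex poly)"
    by (rule poly_eqI) (simp add: pure_poly_def coeff_map_poly of_rat_diff coeff_pCons split: nat.splits)
  thus ?thesis by (simp only: rat_eval_pure_poly)
qed

text \<open>These are the coefficients of the characteristic polynomial of \<open>g(a)/p\<close>. They are integral, and rational by symmetry.\<close>

lemma conj_product_integral:
  assumes int: "algebraic_int (int_eval g a / of_int p)"
  shows "coeff (\<Prod>i<n. [:- (int_eval g (a * \<zeta> ^ i) / of_int p), 1:]) k \<in> \<int>"
proof -
  have n0: "n > 0" using n2 by simp
  define G where "G = Polynomial.smult (1 / of_int p) (map_poly of_int g :: rat poly)"
  have G: "rat_eval G x = int_eval g x / of_int p" for x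
    unfolding G_def rat_eval_smult rat_eval_of_int by (simp add: of_rat_divide)
  define f where "f = (\<lambda>x z. coeff (\<Prod>i<n. [:- rat_eval G (x * z ^ i), 1:]) k)"
  have f_eq: "f a \<zeta> = coeff (\<Prod>i<n. [:- (int_eval g (a * \<zeta> ^ i) / of_int p), 1:]) k"
    unfolding f_def G ..
  have "f a \<zeta> \<in> \<rat>"
  proof (rule rational_if_invariant[OF n0 zeta, of a f])
    show "a ^ n \<in> \<rat>" using root by simp
    show "rat_poly_fun f" unfolding f_def
      by (intro rat_poly_fun_coeff_prod rat_poly_fun_poly rat_poly_fun_var) simp
    fix s t assume t: "coprime t n"
    show "f (a * \<zeta> ^ s) (\<zeta> ^ t) = f a \<zeta>"
      unfolding f_def using prod_conj_invariant[OF t, of "\<lambda>y. [:- rat_eval G y, 1:]" s] by (rule arg_cong)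
  qed
  moreover have "algebraic_int (f a \<zeta>)"
  proof -
    have "algebraic_int (rat_eval G (a * \<zeta> ^ i))" for i
      by (rule algebraic_int_rat_eval_conj) (simp only: G int)
    hence "alg_coeffs (\<Prod>i<n. [:- rat_eval G (a * \<zeta> ^ i), 1:])"
      by (intro alg_coeffs_prod) (simp add: alg_coeffs_pCons alg_coeffs_0)
    thus ?thesis unfolding f_def alg_coeffs_def by blast
  qed
  ultimately show ?thesis unfolding f_eq[symmetric] using rational_algebraic_int_is_int by blast
qed

text \<open>Let \<open>P\<close> be the characteristic polynomial of \<open>g(a)/p\<close>. Then \<open>p\<^sup>n P(g(X)/p)\<close> has integral coefficients and the root \<open>a\<close>, hence it is
  \<open>(X\<^sup>n - m)R\<close>. At \<open>a'\<close> the factor \<open>X\<^sup>n - m\<close> is \<open>m' - m\<close>, which cancels \<open>p\<^sup>n\<close>. So \<open>P(g(a')/p)\<close> is integral, and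
  with it \<open>g(a')/p\<close>.\<close>

lemma integrality_periodic:
  assumes p: "p \<noteq> 0" and int: "algebraic_int (int_eval g a / of_int p)"
    and m': "p ^ n dvd m' - m" and a': "a' ^ n = of_int m'"
  shows "algebraic_int (int_eval g a' / of_int p)"
proof -
  have n0: "n > 0" using n2 by simp
  have pc: "(of_int p :: complex) \<noteq> 0" using p by simp
  define P where "P = (\<Prod>i<n. [:- (int_eval g (a * \<zeta> ^ i) / of_int p), 1:])"
  have degP: "degree P = n" unfolding P_def by (subst degree_prod_sum_eq) auto
  have lcP: "lead_coeff P = 1" unfolding P_def by (subst lead_coeff_prod) simp
  have "coeff P k \<in> \<int>" for k unfolding P_def by (rule conj_product_integral[OF int])
  hence "\<forall>k. \<exists>e. coeff P k = of_int e" by (metis Ints_cases)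
  then obtain e where e: "\<And>k. coeff P k = of_int (e k)" by metis
  define W where "W = (\<Sum>k\<le>n. Polynomial.smult (e k * p ^ (n - k)) (g ^ k))"
  have W: "int_eval W x = of_int (p ^ n) * poly P (int_eval g x / of_int p)" for x
  proof -
    have "int_eval W x = (\<Sum>k\<le>n. of_int (e k) * of_int p ^ (n - k) * int_eval g x ^ k)"
      unfolding W_def by (simp add: hom_distribs poly_sum)
    also have "\<dots> = (\<Sum>k\<le>n. of_int p ^ n * (of_int (e k) * (int_eval g x / of_int p) ^ k))"
    proof (rule sum.cong[OF refl])
      fix k assume "k \<in> {..n}"
      hence "(of_int p :: complex) ^ n = of_int p ^ (n - k) * of_int p ^ k" by (simp add: power_add[symmetric])
      thus "of_int (e k) * of_int p ^ (n - k) * int_eval g x ^ k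
          = of_int p ^ n * (of_int (e k) * (int_eval g x / of_int p) ^ k)"
        using pc by (simp add: power_divide)
    qed
    also have "\<dots> = of_int (p ^ n) * poly P (int_eval g x / of_int p)"
      unfolding poly_altdef degP e by (simp add: sum_distrib_left)
    finally show ?thesis .
  qed
  obtain R r where Rr: "W = pure_poly n m * R + r" "degree r < n" by (rule pure_poly_division)
  have "poly P (int_eval g a / of_int p) = 0"
    unfolding P_def poly_prod using n0 by (intro prod_zero) (auto intro!: bexI[of _ 0])
  hence "int_eval W a = 0" by (simp add: W)
  hence "int_eval r a = 0" using root by (simp add: Rr(1) int_eval_add int_eval_mult int_eval_pure_poly)
  hence "r = 0" using int_eval_conj_eq_0[OF Rr(2), of 0] by simp
  obtain t where t: "m' - m = p ^ n * t" using m' by (auto elim: dvdE)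
  have "of_int (p ^ n) * poly P (int_eval g a' / of_int p) = of_int (m' - m) * int_eval R a'"
    unfolding W[symmetric] Rr(1) \<open>r = 0\<close> by (simp add: int_eval_mult int_eval_pure_poly a')
  hence "of_int (p ^ n) * poly P (int_eval g a' / of_int p) = of_int (p ^ n) * (of_int t * int_eval R a')"
    unfolding t by (simp only: of_int_mult mult.assoc)
  moreover have "(of_int (p ^ n) :: complex) \<noteq> 0" using pc by simp
  ultimately have eq: "poly P (int_eval g a' / of_int p) = of_int t * int_eval R a'"
    by (metis mult_left_cancel)
  have "algebraic_int a'" using algebraic_int_power_root[OF n0 a'] by simp
  hence "algebraic_int (of_int t * int_eval R a')"
    by (intro algebraic_int_mult algebraic_int_int_eval) simp_all
  thus ?thesis by (rule algebraic_int_root[OF _ eq]) (use e lcP degP n0 in auto)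
qed

text \<open>An integral element outside \<open>\<int>[a]\<close> has a denominator, and a prime divisor of it gives \<open>g(a)/p\<close>. Conversely the
  representation of \<open>g(a)/p\<close> by powers of \<open>a\<close> below \<open>n\<close> is unique, and its coefficients are not all integral.\<close>

lemma not_alpha_monogenic_iff:
  "\<not> alpha_monogenic a \<longleftrightarrow> (\<exists>p g. prime p \<and> p dvd int n \<and> degree g < n \<and> (\<exists>k. \<not> p dvd coeff g k)
     \<and> algebraic_int (int_eval g a / of_int p))"
proof
  assume "\<not> alpha_monogenic a"
  then obtain \<beta> where \<beta>: "\<beta> \<in> rat_adjoin a" "algebraic_int \<beta>" "\<beta> \<notin> int_adjoin a"
    unfolding alpha_monogenic_def using int_adjoin_subset by (auto simp: ring_of_integers_def)
  obtain b0 where b0: "\<beta> = rat_eval b0 a" using \<beta>(1) unfolding rat_adjoin_eq by auto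
  obtain b where b: "degree b < n" "\<And>i. rat_eval b0 (a * \<zeta> ^ i) = rat_eval b (a * \<zeta> ^ i)"
    using rat_eval_reduce[of b0] by blast
  have \<beta>b: "\<beta> = rat_eval b a" using b(2)[of 0] b0 by simp
  obtain s g where s: "s > 0" and g: "degree g < n" "Polynomial.smult (of_int s) b = map_poly of_int g"
    and ps: "\<And>p. prime p \<Longrightarrow> p dvd s \<Longrightarrow> \<not> p dvd m \<and> p dvd int n \<and> (\<exists>k. \<not> p dvd coeff g k)
        \<and> algebraic_int (int_eval g a / of_int p)"
    using integral_denominator[OF b(1)] \<beta>(2) unfolding \<beta>b by blast
  have "s \<noteq> 1"
  proof
    assume "s = 1"
    hence "b = map_poly of_int g" using g(2) by simp
    hence "\<beta> = int_eval g a" unfolding \<beta>b by (simp only: rat_eval_of_int)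
    thus False using \<beta>(3) unfolding int_adjoin_def by blast
  qed
  hence "\<not> is_unit s" using s by auto
  moreover have "s \<noteq> 0" using s by simp
  ultimately obtain p where p: "prime p" "p dvd s" using prime_divisor_exists by blast
  show "\<exists>p g. prime p \<and> p dvd int n \<and> degree g < n \<and> (\<exists>k. \<not> p dvd coeff g k)
     \<and> algebraic_int (int_eval g a / of_int p)"
    by (intro exI[of _ p] exI[of _ g]) (use ps[OF p] p g(1) in blast)
next
  assume "\<exists>p g. prime p \<and> p dvd int n \<and> degree g < n \<and> (\<exists>k. \<not> p dvd coeff g k)
     \<and> algebraic_int (int_eval g a / of_int p)"
  then obtain p g k where p: "prime p" and g: "degree g < n" "\<not> p dvd coeff g k"
    and int: "algebraic_int (int_eval g a / of_int p)" by blast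
  have pc: "(of_int p :: complex) \<noteq> 0" using p by auto
  show "\<not> alpha_monogenic a"
  proof
    assume "alpha_monogenic a"
    have "rat_eval (Polynomial.smult (1 / of_int p) (map_poly of_int g)) a = int_eval g a / of_int p"
      unfolding rat_eval_smult rat_eval_of_int by (simp add: of_rat_divide)
    hence "int_eval g a / of_int p \<in> rat_adjoin a" unfolding rat_adjoin_eq by (metis rangeI)
    hence "int_eval g a / of_int p \<in> ring_of_integers (rat_adjoin a)"
      using int unfolding ring_of_integers_def by blast
    hence "int_eval g a / of_int p \<in> int_adjoin a"
      using \<open>alpha_monogenic a\<close> by (simp only: alpha_monogenic_def)
    then obtain h where h: "int_eval g a / of_int p = int_eval h a" unfolding int_adjoin_def by auto
    obtain R r where Rr: "h = pure_poly n m * R + r" "degree r < n" by (rule pure_poly_division)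
    have "int_eval h a = int_eval r a" using root by (simp add: Rr(1) int_eval_add int_eval_mult int_eval_pure_poly)
    hence "int_eval g a = of_int p * int_eval r a" using h pc by (metis nonzero_mult_div_cancel_left times_divide_eq_right)
    hence "int_eval (g + Polynomial.smult (- p) r) a = 0" unfolding int_eval_add by (simp add: hom_distribs)
    moreover have "degree (g + Polynomial.smult (- p) r) < n"
      using g(1) Rr(2) by (intro degree_add_less) (auto intro: le_less_trans[OF degree_smult_le])
    ultimately have "g + Polynomial.smult (- p) r = 0" using int_eval_conj_eq_0[of "g + Polynomial.smult (- p) r" 0] by simp
    hence "coeff (g + Polynomial.smult (- p) r) k = 0" by simp
    hence "coeff g k = p * coeff r k" by simp
    thus False using g(2) by simp
  qed
qed

end

lemma alpha_monogenic_periodic: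
  assumes "pure_field n m a \<zeta>" "pure_field n m' a' \<zeta>'" "m mod int n ^ n = m' mod int n ^ n"
    and "alpha_monogenic a'"
  shows "alpha_monogenic a"
proof (rule ccontr)
  assume "\<not> alpha_monogenic a"
  then obtain p g where p: "prime p" "p dvd int n" and g: "degree g < n" "\<exists>k. \<not> p dvd coeff g k"
    and int: "algebraic_int (int_eval g a / of_int p)"
    unfolding pure_field.not_alpha_monogenic_iff[OF assms(1)] by blast
  have "p ^ n dvd int n ^ n" using p(2) by (rule dvd_power_same)
  also have "int n ^ n dvd m' - m" using assms(3)[symmetric] by (simp only: mod_eq_dvd_iff)
  finally have d: "p ^ n dvd m' - m" .
  have "p \<noteq> 0" using p(1) by auto
  hence "algebraic_int (int_eval g a' / of_int p)"
    by (rule pure_field.integrality_periodic[OF assms(1) _ int d pure_field.root[OF assms(2)]])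
  hence "\<not> alpha_monogenic a'"
    unfolding pure_field.not_alpha_monogenic_iff[OF assms(2)] using p g by blast
  thus False using assms(4) by simp
qed

section \<open>Comparison of the densities\<close>

theorem theorem1p2:
  fixes n :: nat and \<alpha> :: "int \<Rightarrow> complex"
  assumes "n \<ge> 4"
    and "\<And>m. m \<in> pure_params n \<Longrightarrow> poly (pure_poly n m) (\<alpha> m) = 0"
  defines "M \<equiv> {m \<in> pure_params n. monogenic (rat_adjoin (\<alpha> m))}"
    and "A \<equiv> {m \<in> pure_params n. alpha_monogenic (\<alpha> m)}"
  shows "has_density ((M - A) \<union> (A - M)) 0 \<and> (\<exists>d. has_density M d \<and> has_density A d)"
proof -
  have n0: "n > 0" using assms(1) by simp
  define \<zeta> where "\<zeta> = exp (2 * of_real pi * \<i> / of_nat n)"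
  have \<zeta>: "primitive_root_of_unity n \<zeta>" unfolding \<zeta>_def by (rule primitive_root_of_unity_exists[OF n0])
  have field: "pure_field n m (\<alpha> m) \<zeta>" if m: "m \<in> pure_params n" "\<bar>m\<bar> \<ge> 2" for m
  proof
    show "n \<ge> 2" using assms(1) by simp
    show "\<alpha> m ^ n = of_int m" using assms(2)[OF m(1)] by (simp add: pure_poly_def poly_monom)
  qed (use m \<zeta> in \<open>auto simp: pure_params_def\<close>)
  \<comment> \<open>Below this bound, which is at least 2, the parameters are finite in number and do not affect densities. It
    absorbs \<open>m = 1\<close> and \<open>m = - 1\<close>, to which the theory of pure fields above does not apply.\<close>
  define small :: "int set" where "small = {m. \<bar>m\<bar> \<le> 2 * int n ^ (n * (2 * n))}"
  define E where "E = (\<Union>q\<in>{q. prime q \<and> q dvd n}. \<Union>c\<in>{int q, - int q}. {m. nat \<bar>m\<bar> \<in> power_residue_numbers q c})"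
  have "finite small"
    by (rule finite_subset[of _ "{- (2 * int n ^ (n * (2 * n)))..2 * int n ^ (n * (2 * n))}"])
      (auto simp: small_def abs_le_iff)
  have small1: "\<bar>m\<bar> < 2 \<Longrightarrow> m \<in> small" for m
  proof -
    have "1 \<le> int n ^ (n * (2 * n))" using n0 by (intro one_le_power) simp
    thus "\<bar>m\<bar> < 2 \<Longrightarrow> m \<in> small" by (simp add: small_def)
  qed
  have AM: "A - M \<subseteq> small"
  proof
    fix m assume "m \<in> A - M"
    hence m: "m \<in> pure_params n" "alpha_monogenic (\<alpha> m)" "\<not> monogenic (rat_adjoin (\<alpha> m))"
      by (auto simp: A_def M_def)
    show "m \<in> small"
    proof (rule ccontr)
      assume "m \<notin> small"
      have "\<bar>m\<bar> \<ge> 2" using small1[of m] \<open>m \<notin> small\<close> by (cases "\<bar>m\<bar> < 2") simp_all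
      then interpret pure_field n m "\<alpha> m" \<zeta> using field m(1) by blast
      have "int_eval (monom 1 1) (\<alpha> m) = \<alpha> m" by (simp add: poly_monom)
      hence "\<alpha> m \<in> int_adjoin (\<alpha> m)" unfolding int_adjoin_def by (metis rangeI)
      hence "\<alpha> m \<in> ring_of_integers (rat_adjoin (\<alpha> m))" using int_adjoin_subset by blast
      hence "monogenic (rat_adjoin (\<alpha> m))" using m(2) unfolding monogenic_def alpha_monogenic_def by blast
      thus False using m(3) by simp
    qed
  qed
  have MA: "M - A \<subseteq> small \<union> E"
  proof
    fix m assume "m \<in> M - A"
    hence m: "m \<in> pure_params n" "\<not> alpha_monogenic (\<alpha> m)" "monogenic (rat_adjoin (\<alpha> m))"
      by (auto simp: A_def M_def)
    show "m \<in> small \<union> E"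
    proof (rule ccontr)
      assume "m \<notin> small \<union> E"
      hence ns: "m \<notin> small" and nE: "m \<notin> E" by simp_all
      have "\<bar>m\<bar> \<ge> 2" using small1[of m] ns by (cases "\<bar>m\<bar> < 2") simp_all
      then interpret pure_field n m "\<alpha> m" \<zeta> using field m(1) by blast
      have "2 * int n ^ (n * (2 * n)) < \<bar>m\<bar>" using ns by (simp add: small_def)
      moreover have "n \<ge> 3" using assms(1) by simp
      ultimately obtain q c where q: "prime q" "q dvd n" "c \<in> {int q, - int q}"
        and c: "\<And>p. prime p \<Longrightarrow> p dvd m \<Longrightarrow> \<exists>x. [x ^ q = c] (mod p)"
        using monogenic_not_alpha_monogenic m(2,3) by blast
      have "nat \<bar>m\<bar> \<in> power_residue_numbers q c"
        unfolding power_residue_numbers_def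
      proof (intro CollectI conjI allI impI)
        have "squarefree (int (nat \<bar>m\<bar>))" using sqfree by (simp add: squarefree_def)
        thus "squarefree (nat \<bar>m\<bar>)" by (simp only: squarefree_int_iff)
        fix p :: nat assume p: "prime p" "p dvd nat \<bar>m\<bar>"
        have "int p dvd int (nat \<bar>m\<bar>)" using p(2) by (simp only: int_dvd_int_iff)
        hence "int p dvd m" by simp
        thus "\<exists>x. [x ^ q = c] (mod int p)" using c[of "int p"] p(1) by simp
      qed
      thus False using nE q by (auto simp: E_def)
    qed
  qed
  have "has_density E 0"
    unfolding E_def
  proof (intro density_zero_UN)
    show "finite {q. prime q \<and> q dvd n}" by (rule finite_subset[of _ "{..n}"]) (use n0 in \<open>auto dest: dvd_imp_le\<close>)
    fix q c assume "q \<in> {q. prime q \<and> q dvd n}" "c \<in> {int q, - int q}"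
    thus "has_density {m. nat \<bar>m\<bar> \<in> power_residue_numbers q c} 0"
      by (intro power_residue_numbers_density_zero) auto
  qed simp
  hence "has_density (small \<union> E) 0"
    using density_zero_finite[OF \<open>finite small\<close>] by (intro density_zero_Un)
  hence diff0: "has_density ((M - A) \<union> (A - M)) 0"
    by (rule density_zero_subset) (use AM MA in blast)
  \<comment> \<open>The residue classes modulo \<open>n\<^sup>n\<close> that contain a parameter of an \<open>\<alpha>\<close>-monogenic field. By periodicity they contain no others,
    apart from small ones.\<close>
  define G where "G = (\<lambda>m. m mod int n ^ n) ` {m \<in> A. \<bar>m\<bar> \<ge> 2}"
  define S where "S = {m. squarefree m \<and> m mod int n ^ n \<in> G}"
  have "int n ^ n > 0" using n0 by simp
  then obtain d where d: "has_density S d" unfolding S_def using squarefree_residues_density by blast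
  have "(S - A) \<union> (A - S) \<subseteq> small"
  proof
    fix m assume m: "m \<in> (S - A) \<union> (A - S)"
    show "m \<in> small"
    proof (rule ccontr)
      assume "m \<notin> small"
      have m2: "\<bar>m\<bar> \<ge> 2" using small1[of m] \<open>m \<notin> small\<close> by (cases "\<bar>m\<bar> < 2") simp_all
      have "m \<notin> A - S" using m2 by (auto simp: A_def S_def G_def pure_params_def)
      hence mS: "m \<in> S" "m \<notin> A" using m by auto
      then obtain m' where m': "m' \<in> A" "\<bar>m'\<bar> \<ge> 2" "m mod int n ^ n = m' mod int n ^ n"
        unfolding S_def G_def by auto
      have mp: "m \<in> pure_params n" using mS(1) irreducible_pure_poly[OF _ m2 n0]
        by (simp add: S_def pure_params_def)
      have "alpha_monogenic (\<alpha> m)"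
        by (rule alpha_monogenic_periodic[OF field[OF mp m2] field[OF _ m'(2)] m'(3)])
          (use m'(1) in \<open>simp_all add: A_def\<close>)
      thus False using mS(2) mp by (simp add: A_def)
    qed
  qed
  hence "has_density ((S - A) \<union> (A - S)) 0"
    by (rule density_zero_subset[OF density_zero_finite[OF \<open>finite small\<close>]])
  hence dA: "has_density A d" by (rule has_density_symdiff[OF d])
  have "has_density M d" by (rule has_density_symdiff[OF dA]) (use diff0 in \<open>simp add: Un_commute\<close>)
  thus ?thesis using diff0 dA by blast
qed

end
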